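(* Let $N\ge 1$, $1<p<\infty$, $0<s<1$ and $A>0$. Let $\Omega\Subset\Omega'\subset\mathbb{R}^N$ be two open and bounded sets. Let $f\in L^q(\Omega)$, where $q\ge (p^* )'$ if $p\neq N$, and $q>1$ if $p=N$. Let $g\in W^{1,p}(\Omega')\cap L^{p-1}_{sp}(\mathbb{R}^N)$. Then there is a unique weak solution $u\in W^{1,p}_g(\Omega)$ of $$\begin{cases}-\Delta_p u+A(-\Delta_p)^s u=f & \text{in }\Omega,\\ u=g & \text{in }\mathbb{R}^N\setminus\Omega.\end{cases}$$
   Context: $\Omega\Subset\Omega'$ means that $\overline\Omega$ is a compact subset of $\Omega'$. Exponent: $(p^* )'=\frac{Np}{Np-N+p}$ if $p<N$ and $(p^* )'=1$ if $p>N$. Operators: $\Delta_p u=\mathrm{div}(|\nabla u|^{p-2}\nabla u)$ and $(-\Delta_p)^s u(x)=\mathrm{P.V.}\int_{\mathbb{R}^N}\frac{|u(x)-u(y)|^{p-2}(u(x)-u(y))}{|x-y|^{N+ps}}\,dy$; solutions are understood in the weak sense below. Write $J_p(a)=|a|^{p-2}a$ for $a\in\mathbb{R}$ and $d\mu=|x-y|^{-N-sp}\,dx\,dy$. Tail space: for $m>0$, $\alpha>0$, $L^m_\alpha(\mathbb{R}^N)=\{u\in L^m_{\rm loc}(\mathbb{R}^N):\int_{\mathbb{R}^N}\frac{|u|^m}{1+|x|^{N+\alpha}}\,dx<\infty\}$; here $m=p-1$ and $\alpha=sp$. The class $W^{1,p}_g(\Omega)=\{v\in W^{1,p}(\Omega)\cap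 L^{p-1}_{sp}(\mathbb{R}^N): v-g\in W^{1,p}_0(\Omega)\}$, where each $v$ in this class is identified with its extension by $g$ outside $\Omega$ (i.e. $v=g$ in $\mathbb{R}^N\setminus\Omega$). Functions in $W^{1,p}_0(\Omega)$ are extended by zero outside $\Omega$. Weak solution of the boundary value problem: $u\in W^{1,p}_g(\Omega)$ such that for every $\phi\in W_0^{1,p}(\Omega)$, $$\int_\Omega|\nabla u|^{p-2}\nabla u\cdot\nabla\phi\,dx+A\int_{\mathbb{R}^N}\int_{\mathbb{R}^N}J_p(u(x)-u(y))(\phi(x)-\phi(y))\,d\mu=\int_\Omega f\phi\,dx.$$ *)

theory Defs
  imports "HOL-Analysis.Analysis"
begin

text \<open>
  Elements of Lebesgue and Sobolev spaces are represented by functions on the whole space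
  \<^typ>\<open>'a::euclidean_space\<close> (of dimension \<open>N = DIM('a)\<close>); values outside the set under consideration
  are irrelevant unless said otherwise, and equality of elements is equality almost everywhere.
\<close>

text \<open>\<open>L\<^sup>q(S)\<close> for \<open>0 < q \<le> \<infinity>\<close>.\<close>

definition Lp_on :: "ennreal \<Rightarrow> 'a::euclidean_space set \<Rightarrow> ('a \<Rightarrow> 'b::euclidean_space) set" where
  "Lp_on q S = {u \<in> borel_measurable (lebesgue_on S).
     if q = top then \<exists>C. AE x in lebesgue_on S. norm (u x) \<le> C
     else integrable (lebesgue_on S) (\<lambda>x. norm (u x) powr enn2real q)}"

definition Lp_loc :: "ennreal \<Rightarrow> 'a::euclidean_space set \<Rightarrow> ('a \<Rightarrow> 'b::euclidean_space) set" where
  "Lp_loc q S = {u. \<forall>K. compact K \<and> K \<subseteq> S \<longrightarrow> u \<in> Lp_on q K}"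

definition tail_space :: "real \<Rightarrow> real \<Rightarrow> ('a::euclidean_space \<Rightarrow> real) set" where
  "tail_space m \<alpha> = {u \<in> Lp_loc (ennreal m) UNIV.
     integrable lebesgue (\<lambda>x. \<bar>u x\<bar> powr m / (1 + norm x powr (real DIM('a) + \<alpha>)))}"

text \<open>\<open>k\<close> times continuously differentiable on the whole space, by recursion on partial derivatives.\<close>

fun Ck :: "nat \<Rightarrow> ('a::euclidean_space \<Rightarrow> real) \<Rightarrow> bool" where
  "Ck 0 \<phi> \<longleftrightarrow> continuous_on UNIV \<phi>"
| "Ck (Suc k) \<phi> \<longleftrightarrow> (\<forall>x. \<phi> differentiable (at x)) \<and>
     (\<forall>i\<in>Basis. Ck k (\<lambda>x. frechet_derivative \<phi> (at x) i))"

definition test_functions :: "'a::euclidean_space set \<Rightarrow> ('a \<Rightarrow> real) set" where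
  "test_functions \<Omega> = {\<phi>. (\<forall>k. Ck k \<phi>) \<and>
     compact (closure {x. \<phi> x \<noteq> 0}) \<and> closure {x. \<phi> x \<noteq> 0} \<subseteq> \<Omega>}"

definition is_weak_gradient ::
    "'a::euclidean_space set \<Rightarrow> ('a \<Rightarrow> real) \<Rightarrow> ('a \<Rightarrow> 'a) \<Rightarrow> bool" where
  "is_weak_gradient \<Omega> u G \<longleftrightarrow> u \<in> Lp_loc 1 \<Omega> \<and> G \<in> Lp_loc 1 \<Omega> \<and>
     (\<forall>\<phi>\<in>test_functions \<Omega>. \<forall>i\<in>Basis.
        (LINT x|lebesgue_on \<Omega>. u x * frechet_derivative \<phi> (at x) i)
        = - (LINT x|lebesgue_on \<Omega>. (G x \<bullet> i) * \<phi> x))"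

text \<open>A representative of the weak gradient, which is unique up to a null subset of \<open>\<Omega>\<close>.\<close>

definition weak_grad :: "'a::euclidean_space set \<Rightarrow> ('a \<Rightarrow> real) \<Rightarrow> 'a \<Rightarrow> 'a" where
  "weak_grad \<Omega> u = (SOME G. is_weak_gradient \<Omega> u G)"

definition W1p :: "real \<Rightarrow> 'a::euclidean_space set \<Rightarrow> ('a \<Rightarrow> real) set" where
  "W1p p \<Omega> = {u \<in> Lp_on (ennreal p) \<Omega>.
     \<exists>G. is_weak_gradient \<Omega> u G \<and> G \<in> Lp_on (ennreal p) \<Omega>}"

definition W1p_norm :: "real \<Rightarrow> 'a::euclidean_space set \<Rightarrow> ('a \<Rightarrow> real) \<Rightarrow> real" where
  "W1p_norm p \<Omega> u =
     ((LINT x|lebesgue_on \<Omega>. \<bar>u x\<bar> powr p)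
      + (LINT x|lebesgue_on \<Omega>. norm (weak_grad \<Omega> u x) powr p)) powr (1 / p)"

definition W1p_0 :: "real \<Rightarrow> 'a::euclidean_space set \<Rightarrow> ('a \<Rightarrow> real) set" where
  "W1p_0 p \<Omega> = {u \<in> W1p p \<Omega>. \<exists>\<phi>. (\<forall>n. \<phi> n \<in> test_functions \<Omega>) \<and>
     (\<lambda>n::nat. W1p_norm p \<Omega> (\<lambda>x. \<phi> n x - u x)) \<longlonglongrightarrow> 0}"

definition W1p_g ::
    "real \<Rightarrow> real \<Rightarrow> ('a::euclidean_space \<Rightarrow> real) \<Rightarrow> 'a set \<Rightarrow> ('a \<Rightarrow> real) set" where
  "W1p_g s p g \<Omega> = {v \<in> W1p p \<Omega> \<inter> tail_space (p - 1) (s * p).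
     (\<lambda>x. v x - g x) \<in> W1p_0 p \<Omega> \<and> (AE x in lebesgue. x \<notin> \<Omega> \<longrightarrow> v x = g x)}"

text \<open>For \<open>p < 2\<close> the value at \<open>a = 0\<close> is \<open>0\<close>, as \<open>0 powr r = 0\<close>; likewise for \<open>|\<nabla>u|\<^sup>p\<^sup>-\<^sup>2\<nabla>u\<close> below.\<close>

definition J :: "real \<Rightarrow> real \<Rightarrow> real" where
  "J p a = \<bar>a\<bar> powr (p - 2) * a"

text \<open>
  The density of \<open>\<mu>\<close> takes the value \<open>0\<close> on the diagonal (as \<open>0 powr r = 0\<close>), which is a null set.
\<close>

definition frac_measure :: "real \<Rightarrow> real \<Rightarrow> ('a::euclidean_space \<times> 'a) measure" where
  "frac_measure s p = density (lebesgue \<Otimes>\<^sub>M lebesgue)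
     (\<lambda>(x, y). ennreal (norm (x - y) powr (- real DIM('a) - s * p)))"

text \<open>
  Bochner integrals of non-integrable functions are \<open>0\<close> by convention, so the existence of the
  three integrals is part of the definition. The test functions of the weak formulation are the
  elements of \<open>W\<^sub>0\<^sup>1\<^sup>,\<^sup>p(\<Omega>)\<close> extended by zero.
\<close>

definition weak_solution ::
    "real \<Rightarrow> real \<Rightarrow> real \<Rightarrow> 'a::euclidean_space set \<Rightarrow> ('a \<Rightarrow> real) \<Rightarrow> ('a \<Rightarrow> real)
      \<Rightarrow> ('a \<Rightarrow> real) \<Rightarrow> bool" where
  "weak_solution A s p \<Omega> f g u \<longleftrightarrow> u \<in> W1p_g s p g \<Omega> \<and>
     (\<forall>\<phi>\<in>W1p_0 p \<Omega>. (\<forall>x. x \<notin> \<Omega> \<longrightarrow> \<phi> x = 0) \<longrightarrow>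
        integrable (lebesgue_on \<Omega>) (\<lambda>x. norm (weak_grad \<Omega> u x) powr (p - 2)
          * (weak_grad \<Omega> u x \<bullet> weak_grad \<Omega> \<phi> x)) \<and>
        integrable (frac_measure s p) (\<lambda>(x, y). J p (u x - u y) * (\<phi> x - \<phi> y)) \<and>
        integrable (lebesgue_on \<Omega>) (\<lambda>x. f x * \<phi> x) \<and>
        (LINT x|lebesgue_on \<Omega>. norm (weak_grad \<Omega> u x) powr (p - 2)
          * (weak_grad \<Omega> u x \<bullet> weak_grad \<Omega> \<phi> x))
        + A * (LINT (x, y)|frac_measure s p. J p (u x - u y) * (\<phi> x - \<phi> y))
        = (LINT x|lebesgue_on \<Omega>. f x * \<phi> x))"

text \<open>The exponent \<open>(p\<^sup>*)'\<close>, which is only defined for \<open>p \<noteq> N\<close>.\<close>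

definition p_star_conj :: "real \<Rightarrow> real \<Rightarrow> real" where
  "p_star_conj N p = (if p < N then N * p / (N * p - N + p) else 1)"

definition compactly_contained :: "'a::topological_space set \<Rightarrow> 'a set \<Rightarrow> bool" where
  "compactly_contained \<Omega> \<Omega>' \<longleftrightarrow> compact (closure \<Omega>) \<and> closure \<Omega> \<subseteq> \<Omega>'"

end

theory Submission
  imports Defs "HOL-Computational_Algebra.Polynomial"
begin

text \<open>
  Write \<open>\<Phi>(a) = |a|\<^sup>p / p\<close>. The equation is the Euler-Lagrange equation of a strictly convex functional. Put \<open>u = g + w\<close>,
  where \<open>w\<close> lies in \<open>W\<^sub>0\<^sup>1\<^sup>,\<^sup>p(\<Omega>)\<close> and is extended by zero. The functional of \<open>w\<close> has three terms: the integral of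
  \<open>\<Phi>(\<nabla>g + \<nabla>w) - \<Phi>(\<nabla>g)\<close> over \<open>\<Omega>\<close>, then \<open>A\<close> times the double integral of \<open>\<Phi>(a + b) - \<Phi>(a)\<close> with respect
  to \<open>\<mu>\<close>, and minus the integral of \<open>f w\<close> over \<open>\<Omega>\<close>,
  where \<open>a = g(x) - g(y)\<close> and \<open>b = w(x) - w(y)\<close>. The subtraction of \<open>\<Phi>(a)\<close> is essential: \<open>g\<close> need not have finite
  fractional energy on the whole space. The difference is integrable, since it is at most a multiple of
  \<open>|a|\<^sup>p\<^sup>-\<^sup>1 |b| + |b|\<^sup>p\<close>, and this majorant is integrable (\<open>datum_cross_term_bound\<close>): near the diagonal one uses that \<open>g\<close> has a gradient in
  \<open>L\<^sup>p\<close> on a neighbourhood of \<open>\<Omega>\<close>, and far from the diagonal that \<open>g\<close> lies in the tail space.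

  Existence and uniqueness of the critical point come from uniform convexity. For every \<open>\<epsilon>\<close>, the quantity \<open>|x - y|\<^sup>p\<close> is at most
  \<open>\<epsilon> (|x|\<^sup>p + |y|\<^sup>p)\<close> plus a multiple of the midpoint gap of \<open>\<Phi>\<close> (\<open>penergy_uniformly_convex\<close>). Hence the gradients of
  a minimising sequence form a Cauchy sequence in \<open>L\<^sup>p\<close>, and the sequence converges strongly.
  The limit is a minimiser because of the subgradient inequality there (\<open>convex_functional_critical_point\<close>). Conversely, by convexity, every critical point is a minimiser, and two minimisers
  have the same gradient.

  The linear term is bounded on \<open>W\<^sub>0\<^sup>1\<^sup>,\<^sup>p(\<Omega>)\<close> by Sobolev's inequality (\<open>sobolev_dual_bound\<close>). For \<open>p < N\<close> this is the
  inequality of Gagliardo and Nirenberg, derived from the Loomis-Whitney inequality; the case \<open>p = N\<close> is reduced to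
  a smaller exponent; for \<open>p > N\<close> it is the boundedness part of Morrey's inequality.

  Poincare's inequality, the embedding into the fractional space and the estimate of \<open>g\<close> near the diagonal have one
  common source, the translation estimate \<open>\<integral>|u(x + h) - u(x)|\<^sup>p dx \<le> |h|\<^sup>p \<integral>|\<nabla>u|\<^sup>p dx\<close>. It is proved for weak
  gradients directly: the identity \<open>u(x + h) - u(x) = \<integral>\<^sub>0\<^sup>1 \<nabla>u(x + th) \<bullet> h dt\<close> is tested against smooth functions, onto which
  the translations are moved (\<open>weak_gradient_line_integral\<close>). The passage from
  the tested identity to an identity almost everywhere is the fundamental lemma of the calculus of variations, for which products
  of flat exponentials approximate indicators of boxes.
\<close>

text \<open>Plain-text notation for the nonnegative integral, after the model of \<open>LINT\<close>.\<close>

syntax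
  "_ascii_nn_integral" :: "pttrn \<Rightarrow> 'a measure \<Rightarrow> ennreal \<Rightarrow> ennreal" ("(3NNINT (1_)/|(_)./ _)" [0,110,60] 60)
translations
  "NNINT x|M. f" == "CONST nn_integral M (\<lambda>x. f)"

section \<open>Pointwise convexity inequalities\<close>

text \<open>\<open>pflux p\<close> is the gradient of \<open>penergy p\<close>. For \<open>p < 2\<close> its value at \<open>0\<close> is \<open>0\<close>, as it must be.\<close>

definition pflux :: "real \<Rightarrow> 'b::euclidean_space \<Rightarrow> 'b" where
  "pflux p x = norm x powr (p - 2) *\<^sub>R x"

definition penergy :: "real \<Rightarrow> 'b::euclidean_space \<Rightarrow> real" where
  "penergy p x = norm x powr p / p"

lemma norm_pflux: "1 < p \<Longrightarrow> norm (pflux p x) = norm x powr (p - 1)"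
proof (cases "x = 0")
  case False
  then have "norm x powr (p - 1) = norm x powr (p - 2) * norm x powr 1"
    by (subst powr_add[symmetric]) simp
  then show ?thesis by (simp add: pflux_def)
qed (simp add: pflux_def)

lemma powr_times_le_add_powr:
  fixes a b p :: real
  assumes "1 < p" "0 \<le> a" "0 \<le> b"
  shows "a powr (p - 1) * b \<le> a powr p + b powr p"
proof -
  have *: "c powr (p - 1) * c = c powr p" if "0 \<le> c" for c :: real
    using that by (cases "c = 0") (auto simp: powr_diff)
  show ?thesis
  proof (cases "a \<le> b")
    case True
    then have "a powr (p - 1) * b \<le> b powr (p - 1) * b"
      using assms by (intro mult_right_mono powr_mono2) auto
    also have "\<dots> = b powr p" using * assms by simp
    finally show ?thesis using powr_ge_zero[of a p] by linarith
  next
    case False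
    then have "a powr (p - 1) * b \<le> a powr (p - 1) * a"
      using assms by (intro mult_left_mono) auto
    also have "\<dots> = a powr p" using * assms by simp
    finally show ?thesis using powr_ge_zero[of b p] by linarith
  qed
qed

lemma powr_add_le:
  fixes a b r :: real
  assumes "0 \<le> r" "0 \<le> a" "0 \<le> b"
  shows "(a + b) powr r \<le> 2 powr r * (a powr r + b powr r)"
proof -
  have "(a + b) powr r \<le> (2 * max a b) powr r"
    using assms by (intro powr_mono2) auto
  also have "\<dots> = 2 powr r * (max a b) powr r"
    using assms by (simp add: powr_mult)
  also have "\<dots> \<le> 2 powr r * (a powr r + b powr r)"
    by (intro mult_left_mono) (auto simp: max_def)
  finally show ?thesis .
qed

lemma norm_add_powr_le:
  fixes x y :: "'b::real_normed_vector"
  assumes "0 \<le> r"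
  shows "norm (x + y) powr r \<le> 2 powr r * (norm x powr r + norm y powr r)"
proof -
  have "norm (x + y) powr r \<le> (norm x + norm y) powr r"
    using assms by (intro powr_mono2 norm_triangle_ineq) auto
  also have "\<dots> \<le> 2 powr r * (norm x powr r + norm y powr r)"
    using assms by (intro powr_add_le) auto
  finally show ?thesis .
qed

lemma norm_diff_powr_le:
  fixes x y :: "'b::real_normed_vector"
  assumes "0 \<le> r"
  shows "norm (x - y) powr r \<le> 2 powr r * (norm x powr r + norm y powr r)"
  using norm_add_powr_le[OF assms, of x "-y"] by simp

text \<open>Young's inequality \<open>|x|\<^sup>p\<^sup>-\<^sup>1 |y| \<le> (1 - 1/p) |x|\<^sup>p + |y|\<^sup>p / p\<close> says that \<open>|.|\<^sup>p / p\<close> lies above its tangents.\<close>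

lemma penergy_subgradient:
  assumes p: "1 < p"
  shows "penergy p x + pflux p x \<bullet> (y - x) \<le> penergy p y"
proof (cases "x = 0")
  case True
  then show ?thesis using p by (simp add: penergy_def pflux_def)
next
  case False
  have np: "norm x powr (p - 2) * (norm x * norm x) = norm x powr p"
  proof -
    have "norm x powr p = norm x powr (p - 2) * norm x powr 2"
      by (subst powr_add[symmetric]) simp
    then show ?thesis using False by (simp add: power2_eq_square)
  qed
  have "pflux p x \<bullet> y \<le> norm (pflux p x) * norm y"
    by (rule norm_cauchy_schwarz)
  also have "\<dots> = norm x powr (p - 1) * norm y" using p by (simp add: norm_pflux)
  also have "\<dots> \<le> (norm x powr (p - 1)) powr (p / (p - 1)) / (p / (p - 1)) + norm y powr p / p"
    using p by (intro Youngs_inequality) (auto simp: field_simps)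
  also have "(norm x powr (p - 1)) powr (p / (p - 1)) = norm x powr p"
    using p by (simp add: powr_powr)
  finally have 1: "pflux p x \<bullet> y \<le> norm x powr p * ((p - 1) / p) + norm y powr p / p" by simp
  have 2: "pflux p x \<bullet> x = norm x powr p"
    using np by (simp add: pflux_def dot_square_norm power2_eq_square)
  have "norm x powr p * ((p - 1) / p) = norm x powr p - norm x powr p / p"
    using p by (simp add: field_simps)
  then show ?thesis using 1 2 by (simp add: inner_diff_right penergy_def)
qed

lemma penergy_diff_le_flux_norms:
  assumes p: "1 < p"
  shows "\<bar>penergy p (x + y) - penergy p x\<bar> \<le> (norm (x + y) powr (p - 1) + norm x powr (p - 1)) * norm y"
proof -
  have a: "penergy p x + pflux p x \<bullet> y \<le> penergy p (x + y)"
    using penergy_subgradient[OF p, of x "x + y"] by simp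
  have b: "penergy p (x + y) + pflux p (x + y) \<bullet> (- y) \<le> penergy p x"
    using penergy_subgradient[OF p, of "x + y" x] by simp
  have c: "\<bar>pflux p z \<bullet> y\<bar> \<le> norm z powr (p - 1) * norm y" for z :: 'a
    using Cauchy_Schwarz_ineq2[of "pflux p z" y] by (simp add: norm_pflux[OF p])
  have "0 \<le> norm x powr (p-1) * norm y" "0 \<le> norm (x+y) powr (p-1) * norm y" by auto
  then show ?thesis using a b c[of x] c[of "x + y"] by (simp add: distrib_right)
qed

lemma pflux_tendsto:
  assumes p: "1 < p" and f: "(f \<longlongrightarrow> x) F"
  shows "((\<lambda>n. pflux p (f n)) \<longlongrightarrow> pflux p x) F"
proof (cases "x = 0")
  case True
  have "((\<lambda>n. norm (f n) powr (p - 1)) \<longlongrightarrow> 0 powr (p - 1)) F"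
    using p f True by (intro tendsto_powr2 tendsto_intros) (auto simp: tendsto_norm_zero)
  then have "((\<lambda>n. norm (pflux p (f n))) \<longlongrightarrow> 0) F"
    using p by (simp add: norm_pflux)
  then have "((\<lambda>n. pflux p (f n)) \<longlongrightarrow> 0) F" by (rule tendsto_norm_zero_cancel)
  then show ?thesis using True by (simp add: pflux_def)
next
  case False
  then show ?thesis unfolding pflux_def using f by (intro tendsto_intros) auto
qed

lemma powr_midpoint_less:
  fixes a b p :: real
  assumes p: "1 < p" and ab: "0 \<le> a" "0 \<le> b" "a \<noteq> b"
  shows "((a + b) / 2) powr p < (a powr p + b powr p) / 2"
proof -
  define m where "m = (a + b) / 2"
  have m: "0 < m" using ab by (auto simp: m_def)
  \<comment> \<open>the tangent at the midpoint lies strictly below at both ends\<close>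
  have tan: "m powr p + p * m powr (p - 1) * (c - m) < c powr p" if "0 \<le> c" "c \<noteq> m" for c
  proof -
    have "\<exists>z. (m < c \<longrightarrow> m < z \<and> z < c) \<and> (c < m \<longrightarrow> c < z \<and> z < m) \<and>
        c powr p - m powr p = (c - m) * (p * z powr (p - 1))"
    proof (cases "m < c")
      case True
      have "\<exists>z>m. z < c \<and> c powr p - m powr p = (c - m) * (p * z powr (p - 1))"
        by (rule MVT2[OF True]) (use m True p in \<open>auto intro!: derivative_eq_intros\<close>)
      then show ?thesis using True by auto
    next
      case False
      then have cm: "c < m" using that by auto
      have "\<exists>z. z > c \<and> z < m \<and> m powr p - c powr p = (m - c) * (p * z powr (p - 1))"
      proof -
        have "\<exists>l z. c < z \<and> z < m \<and> DERIV (\<lambda>x. x powr p) z :> l \<and> m powr p - c powr p = (m - c) * l"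
          using cm that p m
          by (intro MVT) (auto intro!: continuous_intros derivative_eq_intros
                simp: real_differentiable_def continuous_on_powr' intro: exI)
        then obtain l z where z: "c < z" "z < m" "DERIV (\<lambda>x. x powr p) z :> l"
          "m powr p - c powr p = (m - c) * l" by blast
        have "DERIV (\<lambda>x. x powr p) z :> p * z powr (p - 1)"
          using z that by (auto intro!: derivative_eq_intros)
        then have "l = p * z powr (p - 1)" using z(3) DERIV_unique by blast
        then show ?thesis using z by auto
      qed
      then show ?thesis using cm by (auto simp: algebra_simps)
    qed
    then obtain z where z: "m < c \<Longrightarrow> m < z \<and> z < c" "c < m \<Longrightarrow> c < z \<and> z < m"
      and eq: "c powr p - m powr p = (c - m) * (p * z powr (p - 1))" by blast
    show ?thesis
    proof (cases "m < c")
      case True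
      then have "m powr (p - 1) < z powr (p - 1)" using z m p by (intro powr_less_mono2) auto
      then have "(c - m) * (p * m powr (p - 1)) < (c - m) * (p * z powr (p - 1))"
        using True p by auto
      then show ?thesis using eq by (simp add: algebra_simps)
    next
      case False
      then have cm: "c < m" using that by auto
      then have "z powr (p - 1) < m powr (p - 1)" using z that p by (intro powr_less_mono2) auto
      then have "(m - c) * (p * z powr (p - 1)) < (m - c) * (p * m powr (p - 1))"
        using cm p by auto
      then show ?thesis using eq by (simp add: algebra_simps)
    qed
  qed
  have "m powr p + p * m powr (p - 1) * (a - m) < a powr p"
    by (rule tan) (use ab in \<open>auto simp: m_def field_simps\<close>)
  moreover have "m powr p + p * m powr (p - 1) * (b - m) < b powr p"
    by (rule tan) (use ab in \<open>auto simp: m_def field_simps\<close>)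
  moreover have "p * m powr (p - 1) * (a - m) + p * m powr (p - 1) * (b - m) = 0"
    by (simp add: m_def field_simps)
  ultimately show ?thesis unfolding m_def[symmetric] by (simp add: field_simps)
qed

lemma penergy_midpoint_less:
  fixes x y :: "'b::euclidean_space"
  assumes p: "1 < p" and "x \<noteq> y"
  shows "penergy p ((1/2) *\<^sub>R (x + y)) < (penergy p x + penergy p y) / 2"
proof -
  have "(norm (x + y) / 2) powr p < (norm x powr p + norm y powr p) / 2"
  proof (cases "norm x = norm y")
    case True
    have "(norm (x + y))\<^sup>2 + (norm (x - y))\<^sup>2 = 2 * (norm x)\<^sup>2 + 2 * (norm y)\<^sup>2"
      by (simp add: power2_norm_eq_inner inner_simps inner_commute)
    then have "(norm (x + y))\<^sup>2 < (2 * norm x)\<^sup>2"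
      using True \<open>x \<noteq> y\<close> by (simp add: power2_eq_square) (metis less_add_same_cancel1 mult_pos_pos zero_less_norm_iff right_minus_eq)
    then have "norm (x + y) < 2 * norm x" by (rule power2_less_imp_less) simp
    then have "(norm (x + y) / 2) powr p < norm x powr p"
      using p by (intro powr_less_mono2) auto
    then show ?thesis using True by simp
  next
    case False
    have "(norm (x + y) / 2) powr p \<le> ((norm x + norm y) / 2) powr p"
      using p by (intro powr_mono2 divide_right_mono norm_triangle_ineq) auto
    also have "\<dots> < (norm x powr p + norm y powr p) / 2"
      by (rule powr_midpoint_less) (use p False in auto)
    finally show ?thesis .
  qed
  then have "(norm (x + y) / 2) powr p / p < (norm x powr p + norm y powr p) / 2 / p"
    using p by (intro divide_strict_right_mono) auto
  moreover have "norm ((1/2) *\<^sub>R (x + y)) = norm (x + y) / 2" by (simp only: norm_scaleR)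
  ultimately show ?thesis unfolding penergy_def by (simp only: add_divide_distrib) (simp add: mult.commute)
qed

lemma penergy_scale: "penergy p (t *\<^sub>R x) = \<bar>t\<bar> powr p * penergy p x"
  by (simp add: penergy_def powr_mult)

text \<open>
  Uniform convexity in a form that does not distinguish \<open>p < 2\<close> from \<open>p \<ge> 2\<close>: both sides are
  homogeneous of degree \<open>p\<close>, and on the compact set where \<open>|x|\<^sup>p + |y|\<^sup>p = 1\<close> and
  \<open>|x - y|\<^sup>p \<ge> \<epsilon>\<close> the midpoint gap is continuous and positive, hence bounded below.
\<close>

lemma penergy_uniformly_convex:
  fixes p \<epsilon> :: real
  assumes p: "1 < p" and e: "0 < \<epsilon>"
  shows "\<exists>C\<ge>0. \<forall>x y :: 'b::euclidean_space. norm (x - y) powr p \<le> \<epsilon> * (norm x powr p + norm y powr p)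
    + C * ((penergy p x + penergy p y) / 2 - penergy p ((1/2) *\<^sub>R (x + y)))"
proof -
  define R :: "'b \<times> 'b \<Rightarrow> real" where
    "R = (\<lambda>z. (penergy p (fst z) + penergy p (snd z)) / 2 - penergy p ((1/2) *\<^sub>R (fst z + snd z)))"
  define Q :: "'b \<times> 'b \<Rightarrow> real" where "Q = (\<lambda>z. norm (fst z) powr p + norm (snd z) powr p)"
  define S where "S = {z. Q z = 1 \<and> \<epsilon> \<le> norm (fst z - snd z) powr p}"
  have R0: "0 \<le> R z" for z
    using penergy_midpoint_less[OF p, of "fst z" "snd z"]
    by (cases "fst z = snd z") (auto simp: R_def scaleR_2[symmetric])
  have Rscale: "R (t *\<^sub>R z) = \<bar>t\<bar> powr p * R z" for t z
    using penergy_scale[of p t "(1/2) *\<^sub>R (fst z + snd z)"]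
    by (simp add: R_def penergy_scale algebra_simps)
  have Qscale: "Q (t *\<^sub>R z) = \<bar>t\<bar> powr p * Q z" for t z
    by (simp add: Q_def powr_mult algebra_simps)
  have cQ: "continuous_on UNIV Q" unfolding Q_def
    using p by (intro continuous_intros continuous_on_powr') auto
  have cR: "continuous_on UNIV R" unfolding R_def penergy_def
    using p by (intro continuous_intros continuous_on_powr') auto
  have "closed S"
  proof -
    have "closed {z. Q z = 1}" by (intro closed_Collect_eq cQ continuous_intros)
    moreover have "closed {z::'b\<times>'b. \<epsilon> \<le> norm (fst z - snd z) powr p}"
      using p by (intro closed_Collect_le continuous_intros continuous_on_powr') auto
    moreover have "S = {z. Q z = 1} \<inter> {z. \<epsilon> \<le> norm (fst z - snd z) powr p}"
      by (auto simp: S_def)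
    ultimately show ?thesis by (metis closed_Int)
  qed
  moreover have "bounded S"
  proof -
    have "S \<subseteq> cball 0 1 \<times> cball 0 1"
    proof
      fix z assume "z \<in> S"
      then have z: "norm (fst z) powr p + norm (snd z) powr p = 1" by (auto simp: S_def Q_def)
      have "a \<le> 1" if "a powr p \<le> 1" "0 \<le> a" for a :: real
      proof (rule ccontr)
        assume "\<not> a \<le> 1"
        then have "1 powr p < a powr p" using p by (intro powr_less_mono2) auto
        then show False using that by simp
      qed
      then have "norm (fst z) \<le> 1" "norm (snd z) \<le> 1"
        using z powr_ge_zero[of "norm (fst z)" p] powr_ge_zero[of "norm (snd z)" p]
        by (auto simp del: powr_ge_zero)
      then show "z \<in> cball 0 1 \<times> cball 0 1" by (cases z) auto
    qed
    then show ?thesis by (rule bounded_subset[rotated]) (intro bounded_Times bounded_cball)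
  qed
  ultimately have cS: "compact S" by (simp add: compact_eq_bounded_closed)
  have "\<exists>m>0. \<forall>z\<in>S. m \<le> R z"
  proof (cases "S = {}")
    case False
    then obtain z0 where z0: "z0 \<in> S" "\<forall>z\<in>S. R z0 \<le> R z"
      using continuous_attains_inf[OF cS False continuous_on_subset[OF cR]] by auto
    have "fst z0 \<noteq> snd z0" using z0(1) e p by (auto simp: S_def)
    then have "0 < R z0" using penergy_midpoint_less[OF p] by (auto simp: R_def)
    then show ?thesis using z0 by auto
  qed (auto intro: exI[of _ 1])
  then obtain m where m: "0 < m" "\<And>z. z \<in> S \<Longrightarrow> m \<le> R z" by blast
  define C where "C = 2 powr p / m"
  have "norm (x - y) powr p \<le> \<epsilon> * Q (x, y) + C * R (x, y)" for x y :: 'b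
  proof (cases "norm (x - y) powr p \<le> \<epsilon> * Q (x, y)")
    case True
    moreover have "0 \<le> C * R (x, y)" using m R0 by (auto simp: C_def)
    ultimately show ?thesis by linarith
  next
    case False
    have "Q (x, y) \<noteq> 0"
    proof
      assume "Q (x, y) = 0"
      then have "norm x powr p = 0" "norm y powr p = 0"
        using powr_ge_zero[of "norm x" p] powr_ge_zero[of "norm y" p] unfolding Q_def
        by (simp_all add: add_nonneg_eq_0_iff)
      then have "x = 0" "y = 0" by auto
      then show False using False p by (simp add: Q_def)
    qed
    then have Q: "0 < Q (x, y)" using powr_ge_zero[of "norm x" p] powr_ge_zero[of "norm y" p]
      by (simp add: Q_def less_le)
    define t where "t = Q (x, y) powr (- 1 / p)"
    have t: "0 < t" "t powr p = 1 / Q (x, y)"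
    proof -
      show "0 < t" using Q by (simp add: t_def)
      have "t powr p = Q (x, y) powr (-1)" using p by (simp only: t_def powr_powr) simp
      then show "t powr p = 1 / Q (x, y)" using Q by (simp add: powr_minus_divide)
    qed
    have "t *\<^sub>R (x, y) \<in> S"
    proof -
      have "Q (t *\<^sub>R (x, y)) = 1" using t Q by (simp only: Qscale) simp
      moreover have "\<epsilon> \<le> norm (t *\<^sub>R x - t *\<^sub>R y) powr p"
      proof -
        have "norm (t *\<^sub>R x - t *\<^sub>R y) = t * norm (x - y)"
          using t by (simp flip: scaleR_diff_right)
        then have "norm (t *\<^sub>R x - t *\<^sub>R y) powr p = norm (x - y) powr p / Q (x, y)"
          using t by (simp add: powr_mult)
        then show ?thesis using False Q by (simp add: pos_le_divide_eq del: divide_eq_eq)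
      qed
      ultimately show ?thesis by (simp add: S_def)
    qed
    then have "m \<le> R (t *\<^sub>R (x, y))" by (rule m)
    also have "\<dots> = R (x, y) / Q (x, y)" using t by (simp only: Rscale) simp
    finally have "m * Q (x, y) \<le> R (x, y)" using Q by (simp add: field_simps)
    then have "Q (x, y) \<le> R (x, y) / m" using m by (simp add: field_simps)
    then have "2 powr p * Q (x, y) \<le> C * R (x, y)" by (simp add: C_def mult.commute divide_right_mono) (metis mult_left_mono powr_ge_zero times_divide_eq_left times_divide_eq_right mult.commute)
    moreover have "norm (x - y) powr p \<le> 2 powr p * Q (x, y)"
      unfolding Q_def fst_conv snd_conv using p by (intro norm_diff_powr_le) auto
    moreover have "0 \<le> \<epsilon> * Q (x, y)" using Q e by auto
    ultimately show ?thesis by linarith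
  qed
  moreover have "0 \<le> C" using m by (simp add: C_def)
  ultimately show ?thesis unfolding Q_def R_def by auto
qed

lemma half_le_shift: "e \<le> (1/2) * (e + k) + y \<Longrightarrow> e \<le> k + 2 * y" for e k y :: real
  by (simp add: field_simps)

lemma average_le_shift: "a \<le> i + e \<Longrightarrow> b \<le> i + e \<Longrightarrow> i \<le> c \<Longrightarrow> (a + b) / 2 - c \<le> e"
  for a b c e i :: real
  by (simp add: field_simps)

section \<open>Critical points of uniformly convex functionals\<close>

text \<open>
  The direct method with strong convergence. Uniform convexity makes every minimising sequence
  Cauchy, and the subgradient inequality at the limit, together with boundedness of the derivative
  there, replaces lower semicontinuity. \<open>E\<close> is the \<open>p\<close>-th power of a seminorm.
\<close>

lemma convex_functional_critical_point:
  fixes V :: "('x \<Rightarrow> real) set" and E F :: "('x \<Rightarrow> real) \<Rightarrow> real"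
    and dF :: "('x \<Rightarrow> real) \<Rightarrow> ('x \<Rightarrow> real) \<Rightarrow> real" and K p :: real
  assumes p: "1 < p"
    and V0: "(\<lambda>_. 0) \<in> V"
    and Vadd: "\<And>u v. u \<in> V \<Longrightarrow> v \<in> V \<Longrightarrow> (\<lambda>x. u x + v x) \<in> V"
    and Vscale: "\<And>t u. u \<in> V \<Longrightarrow> (\<lambda>x. t * u x) \<in> V"
    and E0: "\<And>u. u \<in> V \<Longrightarrow> 0 \<le> E u"
    and Escale: "\<And>t u. u \<in> V \<Longrightarrow> E (\<lambda>x. t * u x) = \<bar>t\<bar> powr p * E u"
    and subgrad: "\<And>u v. u \<in> V \<Longrightarrow> v \<in> V \<Longrightarrow> F u + dF u (\<lambda>x. v x - u x) \<le> F v"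
    and hom: "\<And>t u v. u \<in> V \<Longrightarrow> v \<in> V \<Longrightarrow> dF u (\<lambda>x. t * v x) = t * dF u v"
    and bdd: "\<And>u. u \<in> V \<Longrightarrow> \<exists>C. \<forall>v\<in>V. E v \<le> 1 \<longrightarrow> \<bar>dF u v\<bar> \<le> C"
    and K: "0 \<le> K"
    and uc: "\<And>\<epsilon>. 0 < \<epsilon> \<Longrightarrow> \<exists>C\<ge>0. \<forall>u\<in>V. \<forall>v\<in>V. E (\<lambda>x. u x - v x) \<le> \<epsilon> * (E u + E v + K)
        + C * ((F u + F v) / 2 - F (\<lambda>x. (1/2) * (u x + v x)))"
    and complete: "\<And>u. (\<And>n. u n \<in> V) \<Longrightarrow>
        (\<And>\<epsilon>. 0 < \<epsilon> \<Longrightarrow> \<exists>n0. \<forall>m\<ge>n0. \<forall>n\<ge>n0. E (\<lambda>x. u n x - u m x) < \<epsilon>) \<Longrightarrow>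
        \<exists>w\<in>V. (\<lambda>n::nat. E (\<lambda>x. u n x - w x)) \<longlonglongrightarrow> 0"
    and hemi: "\<And>u v. u \<in> V \<Longrightarrow> v \<in> V \<Longrightarrow>
        (\<lambda>n. dF (\<lambda>x. u x + (1 / real (Suc n)) * v x) v) \<longlonglongrightarrow> dF u v"
  shows "\<exists>w\<in>V. (\<forall>v\<in>V. dF w v = 0) \<and> (\<forall>w'\<in>V. (\<forall>v\<in>V. dF w' v = 0) \<longrightarrow> E (\<lambda>x. w' x - w x) = 0)"
proof -
  have Vdiff: "(\<lambda>x. u x - v x) \<in> V" if "u \<in> V" "v \<in> V" for u v
    using Vadd[OF that(1) Vscale[OF that(2), of "-1"]] by simp
  have Vmid: "(\<lambda>x. (1/2) * (u x + v x)) \<in> V" if "u \<in> V" "v \<in> V" for u v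
    using Vscale[OF Vadd[OF that], of "1/2"] by simp
  have gap: "0 \<le> (F u + F v) / 2 - F (\<lambda>x. (1/2) * (u x + v x))" if uv: "u \<in> V" "v \<in> V" for u v
  proof -
    let ?m = "\<lambda>x. (1/2) * (u x + v x)"
    have "F ?m + dF ?m (\<lambda>x. u x - ?m x) \<le> F u" by (intro subgrad Vmid uv)
    moreover have "F ?m + dF ?m (\<lambda>x. v x - ?m x) \<le> F v" by (intro subgrad Vmid uv)
    moreover have "dF ?m (\<lambda>x. v x - ?m x) = - dF ?m (\<lambda>x. u x - ?m x)"
    proof -
      have "(\<lambda>x. v x - ?m x) = (\<lambda>x. -1 * (u x - ?m x))" by (simp add: fun_eq_iff field_simps)
      then show ?thesis using hom[OF Vmid[OF uv] Vdiff[OF uv(1) Vmid[OF uv]], of "-1"] by simp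
    qed
    ultimately show ?thesis by simp
  qed
  \<comment> \<open>by homogeneity, the bound on the unit ball becomes a bound by the \<open>p\<close>-th root of \<open>E\<close>\<close>
  have lin: "\<exists>D\<ge>0. \<forall>v\<in>V. \<bar>dF u v\<bar> \<le> D * E v powr (1/p)" if u: "u \<in> V" for u
  proof -
    obtain C where C: "\<And>v. v \<in> V \<Longrightarrow> E v \<le> 1 \<Longrightarrow> \<bar>dF u v\<bar> \<le> C" using bdd[OF u] by blast
    have C0: "0 \<le> C" using C[OF V0] Escale[OF V0, of 0] p by fastforce
    have "\<bar>dF u v\<bar> \<le> C * E v powr (1/p)" if v: "v \<in> V" for v
    proof (cases "E v = 0")
      case True
      have "\<bar>t\<bar> * \<bar>dF u v\<bar> \<le> C" for t
        using C[OF Vscale[OF v, of t]] Escale[OF v, of t] hom[OF u v, of t] True by (simp add: abs_mult)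
      from this[of "(C + 1) / \<bar>dF u v\<bar>"] have "dF u v = 0" using C0 by (auto split: if_splits)
      then show ?thesis using True by simp
    next
      case False
      then have Ev: "0 < E v" using E0[OF v] by simp
      define t where "t = E v powr (- 1 / p)"
      have t: "0 < t" using Ev by (simp add: t_def)
      have "t powr p = E v powr (-1)" using p by (simp only: t_def powr_powr) simp
      then have "E (\<lambda>x. t * v x) = 1" using Ev t by (simp add: Escale[OF v] powr_minus_divide)
      then have "t * \<bar>dF u v\<bar> \<le> C" using C[OF Vscale[OF v, of t]] hom[OF u v, of t] t
        by (simp add: abs_mult)
      moreover have "t = 1 / E v powr (1/p)" using Ev by (simp add: t_def powr_minus_divide)
      ultimately show ?thesis using Ev by (simp add: field_simps)
    qed
    then show ?thesis using C0 by blast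
  qed
  \<comment> \<open>sublevel sets are bounded and \<open>F\<close> is bounded below\<close>
  obtain A B where AB: "0 < B" "\<And>u. u \<in> V \<Longrightarrow> E u \<le> A + B * F u"
  proof -
    obtain C where C: "0 \<le> C" "\<And>u v. u \<in> V \<Longrightarrow> v \<in> V \<Longrightarrow> E (\<lambda>x. u x - v x) \<le> (1/2) * (E u + E v + K)
        + C * ((F u + F v) / 2 - F (\<lambda>x. (1/2) * (u x + v x)))"
      using uc[of "1/2"] by auto
    define z where "z = (\<lambda>_::'x. 0::real)"
    have z: "z \<in> V" using V0 by (simp add: z_def)
    have Ez: "E z = 0" using Escale[OF z, of 0] p by (simp add: z_def)
    obtain D where D: "0 \<le> D" "\<And>v. v \<in> V \<Longrightarrow> \<bar>dF z v\<bar> \<le> D * E v powr (1/p)" using lin[OF z] by blast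
    define C' where "C' = C + 1"
    have C': "0 < C'" using C by (simp add: C'_def)
    \<comment> \<open>the constant with which Young's inequality absorbs the term \<open>2 C' D (E u)\<^sup>1\<^sup>/\<^sup>p\<close> into \<open>E u / 2\<close>\<close>
    define a where "a = (2 * C' * D * 2 powr (1/p)) powr (1 / (p - 1))"
    have "E u \<le> (2 * K - 2 * C' * F z + 2 * a powr p) + (2 * C') * F u" if u: "u \<in> V" for u
    proof -
      let ?h = "\<lambda>x. (1/2) * u x"
      have h: "?h \<in> V" using u by (rule Vscale)
      have a: "E u \<le> (1/2) * (E u + K) + C * ((F u + F z) / 2 - F ?h)"
        using C(2)[OF u z] Ez by (simp add: z_def)
      have b: "C * ((F u + F z) / 2 - F ?h) \<le> C' * ((F u + F z) / 2 - F ?h)"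
        using gap[OF u z] by (intro mult_right_mono) (auto simp: C'_def z_def)
      have "F z - D * E u powr (1/p) \<le> F ?h"
      proof -
        have "F z + dF z (\<lambda>x. ?h x - z x) \<le> F ?h" by (intro subgrad z h)
        moreover have "dF z (\<lambda>x. ?h x - z x) \<ge> - (D * E ?h powr (1/p))"
          using D(2)[OF h] by (simp add: z_def)
        moreover have "E ?h \<le> E u" using p E0[OF u] by (simp only: Escale[OF u]) (intro mult_left_le_one_le powr_le1; simp)
        then have "D * E ?h powr (1/p) \<le> D * E u powr (1/p)"
          using D p E0[OF h] by (intro mult_left_mono powr_mono2) auto
        ultimately show ?thesis by linarith
      qed
      then have c: "C' * ((F u + F z) / 2 - F ?h) \<le> C' * ((F u - F z) / 2 + D * E u powr (1/p))"
        using C' by (intro mult_left_mono) (auto simp: field_simps)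
      have "E u \<le> (1/2) * (E u + K) + C' * ((F u - F z) / 2 + D * E u powr (1/p))"
        using order_trans[OF a add_left_mono[OF order_trans[OF b c]]] .
      then have 1: "E u \<le> K + 2 * (C' * ((F u - F z) / 2 + D * E u powr (1/p)))"
        by (rule half_le_shift)
      have "2 * C' * D * E u powr (1/p) \<le> a powr p + E u / 2"
      proof -
        define b where "b = (E u / 2) powr (1/p)"
        have "a powr (p - 1) = 2 * C' * D * 2 powr (1/p)"
          using p C' D by (simp add: a_def powr_powr)
        moreover have "b powr p = E u / 2" using p E0[OF u] by (simp add: b_def powr_powr)
        moreover have "2 powr (1/p) * b = E u powr (1/p)"
          using E0[OF u] unfolding b_def by (subst powr_mult[symmetric]) auto
        moreover have "a powr (p - 1) * b \<le> a powr p + b powr p"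
          using p by (intro powr_times_le_add_powr) (auto simp: a_def b_def)
        ultimately show ?thesis by (metis mult.assoc)
      qed
      then show ?thesis using 1 by (simp add: field_simps)
    qed
    then show ?thesis using that[of "2 * C'" "2 * K - 2 * C' * F z + 2 * a powr p"] C' by simp
  qed
  define I where "I = Inf (F ` V)"
  have bb: "bdd_below (F ` V)"
  proof (rule bdd_belowI2)
    fix u assume u: "u \<in> V"
    have "0 \<le> A + B * F u" using AB(2)[OF u] E0[OF u] by linarith
    then show "- A / B \<le> F u" using AB(1) by (simp add: field_simps)
  qed
  have Ile: "I \<le> F u" if "u \<in> V" for u
    unfolding I_def using bb that by (intro cInf_lower) auto
  have "\<exists>u\<in>V. F u < I + 1 / Suc n" for n
  proof -
    have "F ` V \<noteq> {}" using V0 by auto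
    then have "\<exists>y\<in>F ` V. y < I + 1 / Suc n"
      unfolding I_def using cInf_lessD[of "F ` V" "Inf (F ` V) + 1 / Suc n"] by auto
    then show ?thesis by auto
  qed
  then obtain u where u: "\<And>n. u n \<in> V" "\<And>n. F (u n) < I + 1 / Suc n" by metis
  define M where "M = A + B * (I + 1)"
  have M: "E (u n) \<le> M" for n
  proof -
    have "F (u n) \<le> I + 1" using u(2)[of n] by (smt (verit, ccfv_SIG) divide_le_eq_1 of_nat_0_less_iff of_nat_Suc of_nat_0_le_iff)
    then have "B * F (u n) \<le> B * (I + 1)" using AB by auto
    then show ?thesis using AB(2)[OF u(1)[of n]] by (simp add: M_def)
  qed
  have "\<exists>w\<in>V. (\<lambda>n. E (\<lambda>x. u n x - w x)) \<longlonglongrightarrow> 0"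
  proof (rule complete[OF u(1)])
    fix \<epsilon> :: real assume e: "0 < \<epsilon>"
    have M0: "0 \<le> M" using M[of 0] E0[OF u(1)[of 0]] by linarith
    define e1 where "e1 = \<epsilon> / (2 * (2 * M + K + 1))"
    have e1: "0 < e1" "e1 * (2 * M + K) < \<epsilon> / 2"
      using e M0 K by (auto simp: e1_def field_simps)
    obtain C where C: "0 \<le> C" "\<And>u v. u \<in> V \<Longrightarrow> v \<in> V \<Longrightarrow> E (\<lambda>x. u x - v x) \<le> e1 * (E u + E v + K)
        + C * ((F u + F v) / 2 - F (\<lambda>x. (1/2) * (u x + v x)))"
      using uc[OF e1(1)] by auto
    obtain n0 where n0: "C * (1 / real (Suc n0)) < \<epsilon> / 2"
    proof -
      have "(\<lambda>n. C * (1 / real (Suc n))) \<longlonglongrightarrow> C * 0"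
        by (intro tendsto_intros LIMSEQ_Suc[OF lim_1_over_n])
      then have "eventually (\<lambda>n. C * (1 / real (Suc n)) < \<epsilon> / 2) sequentially"
        using e by (intro order_tendstoD) auto
      then show ?thesis using that by (auto simp: eventually_sequentially)
    qed
    have "E (\<lambda>x. u n x - u m x) < \<epsilon>" if mn: "n \<ge> n0" "m \<ge> n0" for m n
    proof -
      have Fn: "F (u n) \<le> I + 1 / Suc n0" if "n \<ge> n0" for n
      proof -
        have "1 / real (Suc n) \<le> 1 / real (Suc n0)" using that by (intro divide_left_mono) auto
        then show ?thesis using u(2)[of n] by linarith
      qed
      have "(F (u n) + F (u m)) / 2 - F (\<lambda>x. (1/2) * (u n x + u m x)) \<le> 1 / Suc n0"
        by (rule average_le_shift[OF Fn[OF mn(1)] Fn[OF mn(2)] Ile[OF Vmid[OF u(1) u(1)]]])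
      then have 1: "C * ((F (u n) + F (u m)) / 2 - F (\<lambda>x. (1/2) * (u n x + u m x))) \<le> C * (1 / Suc n0)"
        using C(1) by (rule mult_left_mono)
      have 2: "e1 * (E (u n) + E (u m) + K) \<le> e1 * (2 * M + K)"
        using e1 M[of n] M[of m] by (intro mult_left_mono) auto
      have "E (\<lambda>x. u n x - u m x) \<le> e1 * (2 * M + K) + C * (1 / Suc n0)"
        by (rule order_trans[OF C(2)[OF u(1)[of n] u(1)[of m]] add_mono[OF 2 1]])
      then show ?thesis using e1(2) n0 by linarith
    qed
    then show "\<exists>n0. \<forall>m\<ge>n0. \<forall>n\<ge>n0. E (\<lambda>x. u n x - u m x) < \<epsilon>" by blast
  qed
  then obtain w where w: "w \<in> V" "(\<lambda>n. E (\<lambda>x. u n x - w x)) \<longlonglongrightarrow> 0" by blast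
  obtain D where D: "0 \<le> D" "\<And>v. v \<in> V \<Longrightarrow> \<bar>dF w v\<bar> \<le> D * E v powr (1/p)" using lin[OF w(1)] by blast
  have "F w \<le> I"
  proof (rule LIMSEQ_le)
    show "(\<lambda>n. F w - D * E (\<lambda>x. u n x - w x) powr (1/p)) \<longlonglongrightarrow> F w"
    proof -
      have "(\<lambda>n. F w - D * E (\<lambda>x. u n x - w x) powr (1/p)) \<longlonglongrightarrow> F w - D * 0 powr (1/p)"
        using p E0[OF Vdiff[OF u(1) w(1)]] w(2)
        by (intro tendsto_intros tendsto_powr2) auto
      then show ?thesis by simp
    qed
    show "(\<lambda>n. I + 1 / real (Suc n)) \<longlonglongrightarrow> I"
      using tendsto_add[OF tendsto_const[of I] LIMSEQ_Suc[OF lim_1_over_n]] by simp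
    have "F w - D * E (\<lambda>x. u n x - w x) powr (1/p) \<le> I + 1 / real (Suc n)" for n
      using subgrad[OF w(1) u(1)[of n]] D(2)[OF Vdiff[OF u(1)[of n] w(1)]] u(2)[of n] by linarith
    then show "\<exists>N. \<forall>n\<ge>N. F w - D * E (\<lambda>x. u n x - w x) powr (1/p) \<le> I + 1 / real (Suc n)" by blast
  qed
  then have wmin: "F w \<le> F v" if "v \<in> V" for v using Ile[OF that] by linarith
  \<comment> \<open>minimality gives \<open>dF z v \<ge> 0\<close> at \<open>z = w + tv\<close> for \<open>t > 0\<close>; let \<open>t\<close> tend to \<open>0\<close>\<close>
  have pos: "0 \<le> dF w v" if v: "v \<in> V" for v
  proof (rule LIMSEQ_le_const[OF hemi[OF w(1) v]])
    have "0 \<le> dF (\<lambda>x. w x + (1 / real (Suc n)) * v x) v" for n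
    proof -
      let ?t = "1 / real (Suc n)" and ?z = "\<lambda>x. w x + (1 / real (Suc n)) * v x"
      have z: "?z \<in> V" by (intro Vadd Vscale w v)
      have "F ?z + dF ?z (\<lambda>x. w x - ?z x) \<le> F w" by (intro subgrad z w)
      moreover have "dF ?z (\<lambda>x. w x - ?z x) = - ?t * dF ?z v"
        using hom[OF z v, of "- ?t"] by simp
      moreover have "F w \<le> F ?z" by (rule wmin[OF z])
      ultimately have "0 \<le> ?t * dF ?z v" by simp
      moreover have "0 < ?t" by simp
      ultimately show ?thesis by (simp only: zero_le_mult_iff) auto
    qed
    then show "\<exists>N. \<forall>n\<ge>N. 0 \<le> dF (\<lambda>x. w x + (1 / real (Suc n)) * v x) v" by blast
  qed
  have crit: "dF w v = 0" if v: "v \<in> V" for v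
    using pos[OF v] pos[OF Vscale[OF v, of "-1"]] hom[OF w(1) v, of "-1"] by simp
  have "E (\<lambda>x. w' x - w x) = 0" if w': "w' \<in> V" and z: "\<forall>v\<in>V. dF w' v = 0" for w'
  proof -
    have w'min: "F w' \<le> F v" if "v \<in> V" for v
      using subgrad[OF w' that] z Vdiff[OF that w'] by simp
    have "E (\<lambda>x. w' x - w x) \<le> 0 + e" if e: "0 < e" for e
    proof -
      define e1 where "e1 = e / (E w' + E w + K + 1)"
      have e1: "0 < e1" "e1 * (E w' + E w + K) \<le> e"
        using e K E0[OF w'] E0[OF w(1)] by (auto simp: e1_def field_simps)
      obtain C where C: "0 \<le> C" "E (\<lambda>x. w' x - w x) \<le> e1 * (E w' + E w + K)
        + C * ((F w' + F w) / 2 - F (\<lambda>x. (1/2) * (w' x + w x)))"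
        using uc[OF e1(1)] w' w(1) by blast
      have "(F w' + F w) / 2 - F (\<lambda>x. (1/2) * (w' x + w x)) \<le> 0"
        using w'min[OF Vmid[OF w' w(1)]] wmin[OF Vmid[OF w' w(1)]]
        by (intro average_le_shift[OF _ _ order_refl]) auto
      then have "C * ((F w' + F w) / 2 - F (\<lambda>x. (1/2) * (w' x + w x))) \<le> 0"
        using C(1) by (rule mult_nonneg_nonpos[rotated])
      then show ?thesis using C(2) e1 by linarith
    qed
    then have "E (\<lambda>x. w' x - w x) \<le> 0" by (rule field_le_epsilon)
    then show ?thesis using E0[OF Vdiff[OF w' w(1)]] by linarith
  qed
  then show ?thesis using w(1) crit by blast
qed

section \<open>Smooth bump functions\<close>

lemma Ck_SucI:
  assumes "\<And>x. (f has_derivative D x) (at x)" "\<And>i. i \<in> Basis \<Longrightarrow> Ck k (\<lambda>x. D x i)"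
  shows "Ck (Suc k) f"
proof -
  have "frechet_derivative f (at x) = D x" for x
    using frechet_derivative_at[OF assms(1)] by simp
  then show ?thesis using assms by (auto simp: differentiable_def)
qed

lemma Ck_Suc_has_derivative: "Ck (Suc k) f \<Longrightarrow> (f has_derivative frechet_derivative f (at x)) (at x)"
  by (simp add: frechet_derivative_works)

lemma Ck_Suc_partial: "Ck (Suc k) f \<Longrightarrow> i \<in> Basis \<Longrightarrow> Ck k (\<lambda>x. frechet_derivative f (at x) i)"
  by simp

lemma Ck_Suc_imp: "Ck (Suc k) f \<Longrightarrow> Ck k f"
proof (induction k arbitrary: f)
  case 0
  then have "continuous (at x) f" for x by (auto intro: differentiable_imp_continuous_within)
  then show ?case by (simp add: continuous_on_eq_continuous_at)
next
  case (Suc k)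
  have "Ck k (\<lambda>x. frechet_derivative f (at x) i)" if "i \<in> Basis" for i
    by (rule Suc.IH) (use Suc.prems that in simp)
  then show ?case using Suc.prems by simp
qed

lemma Ck_imp_continuous: "Ck k f \<Longrightarrow> continuous_on UNIV f"
proof (induction k)
  case (Suc k)
  then show ?case using Ck_Suc_imp by blast
qed simp

lemma Ck_const: "Ck k (\<lambda>_. c)"
proof (induction k arbitrary: c)
  case (Suc k)
  show ?case by (rule Ck_SucI[OF has_derivative_const]) (rule Suc.IH)
qed simp

lemma Ck_add: "Ck k f \<Longrightarrow> Ck k g \<Longrightarrow> Ck k (\<lambda>x. f x + g x)"
proof (induction k arbitrary: f g)
  case (Suc k)
  show ?case
    by (rule Ck_SucI[OF has_derivative_add[OF Suc.prems[THEN Ck_Suc_has_derivative]]])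
       (intro Suc.IH Suc.prems[THEN Ck_Suc_partial])
qed (auto intro: continuous_on_add)

lemma Ck_mult: "Ck k f \<Longrightarrow> Ck k g \<Longrightarrow> Ck k (\<lambda>x. f x * g x)"
proof (induction k arbitrary: f g)
  case (Suc k)
  show ?case
    by (rule Ck_SucI[OF has_derivative_mult[OF Suc.prems[THEN Ck_Suc_has_derivative]]])
       (intro Ck_add Suc.IH Suc.prems[THEN Ck_Suc_partial] Suc.prems[THEN Ck_Suc_imp])
qed (auto intro: continuous_on_mult)

lemma Ck_prod: "finite I \<Longrightarrow> (\<And>i. i \<in> I \<Longrightarrow> Ck k (f i)) \<Longrightarrow> Ck k (\<lambda>x. \<Prod>i\<in>I. f i x)"
  by (induction I rule: finite_induct) (auto intro: Ck_const Ck_mult)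

lemma Ck_translate: "Ck k f \<Longrightarrow> Ck k (\<lambda>x. f (x + c))"
proof (induction k arbitrary: f)
  case (Suc k)
  have "((\<lambda>x. f (x + c)) has_derivative frechet_derivative f (at (x + c))) (at x)" for x
  proof -
    have "((\<lambda>x. x + c) has_derivative (\<lambda>h. h)) (at x)" by (auto intro!: derivative_eq_intros)
    from has_derivative_compose[OF this Ck_Suc_has_derivative[OF Suc.prems]] show ?thesis .
  qed
  then show ?case by (rule Ck_SucI) (rule Suc.IH[OF Ck_Suc_partial[OF Suc.prems]])
next
  case 0
  then have "continuous_on UNIV f" by simp
  then have "continuous_on UNIV (\<lambda>x. f (x + c))"
    by (rule continuous_on_compose2) (auto intro!: continuous_intros)
  then show ?case by simp
qed

lemma Ck_affine_compose:
  fixes h :: "real \<Rightarrow> real" and v :: "'a::euclidean_space"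
  shows "Ck k h \<Longrightarrow> Ck k (\<lambda>x. h (x \<bullet> v + c))"
proof (induction k arbitrary: h)
  case (Suc k)
  have "((\<lambda>x. h (x \<bullet> v + c)) has_derivative
      (\<lambda>y. (y \<bullet> v) * frechet_derivative h (at (x \<bullet> v + c)) 1)) (at x)" for x
  proof -
    have "((\<lambda>x. x \<bullet> v + c) has_derivative (\<lambda>y. y \<bullet> v)) (at x)" by (auto intro!: derivative_eq_intros)
    from has_derivative_compose[OF this Ck_Suc_has_derivative[OF Suc.prems]]
    have "((\<lambda>x. h (x \<bullet> v + c)) has_derivative
      (\<lambda>y. frechet_derivative h (at (x \<bullet> v + c)) (y \<bullet> v))) (at x)" .
    moreover have "frechet_derivative h (at z) t = t * frechet_derivative h (at z) 1" for z t
      using linear_cmul[OF has_derivative_linear[OF Ck_Suc_has_derivative[OF Suc.prems]], of z t 1] by simp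
    then have "(\<lambda>y. frechet_derivative h (at (x \<bullet> v + c)) (y \<bullet> v))
        = (\<lambda>y. (y \<bullet> v) * frechet_derivative h (at (x \<bullet> v + c)) 1)" by (intro ext)
    ultimately show ?thesis by (simp only:)
  qed
  then show ?case
    by (rule Ck_SucI) (intro Ck_mult Ck_const Suc.IH Ck_Suc_partial[OF Suc.prems], simp)
next
  case 0
  then have "continuous_on UNIV h" by simp
  then have "continuous_on UNIV (\<lambda>x. h (x \<bullet> v + c))"
    by (rule continuous_on_compose2) (auto intro!: continuous_intros)
  then show ?case by simp
qed

text \<open>The functions \<open>P(1/t) e\<^sup>-\<^sup>1\<^sup>/\<^sup>t\<close>, extended by zero to \<open>t \<le> 0\<close>: a class closed under differentiation.\<close>

definition flat_exp :: "real poly \<Rightarrow> real \<Rightarrow> real" where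
  "flat_exp P t = (if 0 < t then poly P (1 / t) * exp (- (1 / t)) else 0)"

lemma poly_times_exp_tendsto_0: "((\<lambda>u::real. poly P u * exp (- u)) \<longlongrightarrow> 0) at_top"
proof -
  have "((\<lambda>u::real. \<Sum>i\<le>degree P. coeff P i * (u ^ i / exp u)) \<longlongrightarrow> (\<Sum>i\<le>degree P. coeff P i * 0)) at_top"
    by (intro tendsto_sum tendsto_mult tendsto_const tendsto_power_div_exp_0)
  moreover have "(\<lambda>u::real. \<Sum>i\<le>degree P. coeff P i * (u ^ i / exp u)) = (\<lambda>u. poly P u * exp (- u))"
    unfolding poly_altdef sum_distrib_right by (intro ext sum.cong refl) (simp add: exp_minus field_simps)
  ultimately show ?thesis by simp
qed

lemma flat_exp_has_derivative:
  "(flat_exp P has_real_derivative flat_exp ([:0, 0, 1:] * (P - pderiv P)) t) (at t)"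
proof -
  consider "t > 0" | "t < 0" | "t = 0" by linarith
  then show ?thesis
  proof cases
    case 1
    have "((\<lambda>t. poly P (1 / t) * exp (- (1 / t))) has_real_derivative
        flat_exp ([:0, 0, 1:] * (P - pderiv P)) t) (at t)"
    proof -
      have p: "((\<lambda>t. poly P (1 / t)) has_real_derivative poly (pderiv P) (1 / t) * (- (1 / t\<^sup>2))) (at t)"
      proof (rule DERIV_chain'[OF _ poly_DERIV])
        show "((\<lambda>t. 1 / t) has_real_derivative - (1 / t\<^sup>2)) (at t)"
          using 1 by (auto intro!: derivative_eq_intros simp: power2_eq_square)
      qed
      have e: "((\<lambda>t. exp (- (1 / t))) has_real_derivative exp (- (1 / t)) * (1 / t\<^sup>2)) (at t)"
        using 1 by (auto intro!: derivative_eq_intros simp: power2_eq_square)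
      have "poly (pderiv P) (1 / t) * (- (1 / t\<^sup>2)) * exp (- (1 / t))
          + exp (- (1 / t)) * (1 / t\<^sup>2) * poly P (1 / t) = flat_exp ([:0, 0, 1:] * (P - pderiv P)) t"
        using 1 by (simp add: flat_exp_def power2_eq_square algebra_simps)
      then show ?thesis by (rule DERIV_cong[OF DERIV_mult[OF p e]])
    qed
    then show ?thesis
    proof (rule has_field_derivative_transform_within_open[OF _ open_greaterThan[of 0]])
      show "t \<in> {0<..}" using 1 by simp
      show "poly P (1 / x) * exp (- (1 / x)) = flat_exp P x" if "x \<in> {0<..}" for x
        using that by (simp add: flat_exp_def)
    qed
  next
    case 2
    have "((\<lambda>t. 0) has_real_derivative flat_exp ([:0, 0, 1:] * (P - pderiv P)) t) (at t)"
      using 2 by (simp add: flat_exp_def)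
    then show ?thesis
    proof (rule has_field_derivative_transform_within_open[OF _ open_lessThan[of 0]])
      show "t \<in> {..<0}" using 2 by simp
      show "0 = flat_exp P x" if "x \<in> {..<0}" for x using that by (simp add: flat_exp_def)
    qed
  next
    case 3
    have "((\<lambda>y. flat_exp P y / y) \<longlongrightarrow> 0) (at_right 0)"
    proof -
      have "((\<lambda>y. poly ([:0, 1:] * P) (1 / y) * exp (- (1 / y))) \<longlongrightarrow> 0) (at_right 0)"
        by (rule filterlim_compose[OF poly_times_exp_tendsto_0])
           (simp add: filterlim_inverse_at_top_right flip: inverse_eq_divide)
      then show ?thesis
        by (rule Lim_transform_eventually)
           (auto simp: eventually_at_filter flat_exp_def divide_inverse)
    qed
    moreover have "((\<lambda>y. flat_exp P y / y) \<longlongrightarrow> 0) (at_left 0)"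
      by (rule Lim_transform_eventually[OF tendsto_const])
         (auto simp: eventually_at_filter flat_exp_def)
    ultimately have "((\<lambda>y. flat_exp P y / y) \<longlongrightarrow> 0) (at 0)"
      using filterlim_split_at by blast
    then show ?thesis using 3 by (simp add: has_field_derivative_iff flat_exp_def)
  qed
qed

lemma Ck_flat_exp: "Ck k (flat_exp P)"
proof (induction k arbitrary: P)
  case 0
  have "isCont (flat_exp P) t" for t using DERIV_isCont[OF flat_exp_has_derivative] .
  then show ?case by (simp add: continuous_on_eq_continuous_at)
next
  case (Suc k)
  show ?case
    by (rule Ck_SucI[OF flat_exp_has_derivative[unfolded has_field_derivative_def]])
       (use Suc in \<open>simp add: mult.commute\<close>)
qed

text \<open>Since \<open>exp (-1/(n t))\<close> increases to \<open>1\<close> for every \<open>t > 0\<close>, these bumps tend to the indicator of the open box.\<close>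

definition box_bump :: "'a::euclidean_space \<Rightarrow> 'a \<Rightarrow> nat \<Rightarrow> 'a \<Rightarrow> real" where
  "box_bump a b n x = (\<Prod>i\<in>Basis. flat_exp 1 (real (Suc n) * (x \<bullet> i - a \<bullet> i))
     * flat_exp 1 (real (Suc n) * (b \<bullet> i - x \<bullet> i)))"

lemma flat_exp_1_bounds: "0 \<le> flat_exp 1 t" "flat_exp 1 t \<le> 1"
  by (auto simp: flat_exp_def)

lemma flat_exp_1_eq_0: "flat_exp 1 t = 0 \<longleftrightarrow> t \<le> 0"
  by (auto simp: flat_exp_def)

lemma box_bump_bounds: "0 \<le> box_bump a b n x" "box_bump a b n x \<le> 1"
  unfolding box_bump_def
  by (intro prod_nonneg prod_le_1 ballI conjI mult_le_one flat_exp_1_bounds mult_nonneg_nonneg)+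

lemma box_bump_nonzero_iff: "box_bump a b n x \<noteq> 0 \<longleftrightarrow> x \<in> box a b"
proof -
  have "flat_exp 1 (real (Suc n) * t) \<noteq> 0 \<longleftrightarrow> 0 < t" for t
    by (simp only: flat_exp_1_eq_0 not_le zero_less_mult_iff) auto
  then show ?thesis by (simp only: box_bump_def prod_zero_iff[OF finite_Basis] mem_box mult_eq_0_iff) auto
qed

lemma Ck_box_bump: "Ck k (box_bump a b n)"
proof -
  have "Ck k (\<lambda>x. flat_exp 1 (real (Suc n) * (x \<bullet> i - a \<bullet> i)))" for i
    using Ck_affine_compose[OF Ck_flat_exp, of k 1 "real (Suc n) *\<^sub>R i" "- (real (Suc n) * (a \<bullet> i))"]
    by (simp add: algebra_simps)
  moreover have "Ck k (\<lambda>x. flat_exp 1 (real (Suc n) * (b \<bullet> i - x \<bullet> i)))" for i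
    using Ck_affine_compose[OF Ck_flat_exp, of k 1 "(- real (Suc n)) *\<^sub>R i" "real (Suc n) * (b \<bullet> i)"]
    by (simp add: algebra_simps)
  ultimately show ?thesis unfolding box_bump_def by (intro Ck_prod Ck_mult) auto
qed

lemma box_bump_test_function:
  assumes "cbox a b \<subseteq> U"
  shows "box_bump a b n \<in> test_functions U"
proof -
  have "{x. box_bump a b n x \<noteq> 0} \<subseteq> cbox a b" using box_bump_nonzero_iff box_subset_cbox by blast
  then have *: "closure {x. box_bump a b n x \<noteq> 0} \<subseteq> cbox a b" by (rule closure_minimal) (rule closed_cbox)
  moreover have "compact (closure {x. box_bump a b n x \<noteq> 0})"
    by (metis bounded_cbox bounded_subset closure_subset compact_closure \<open>{x. box_bump a b n x \<noteq> 0} \<subseteq> cbox a b\<close>)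
  ultimately show ?thesis using assms Ck_box_bump by (auto simp: test_functions_def)
qed

lemma box_bump_tendsto: "(\<lambda>n. box_bump a b n x) \<longlonglongrightarrow> indicator (box a b) x"
proof (cases "x \<in> box a b")
  case True
  have lim: "(\<lambda>n. flat_exp 1 (real (Suc n) * t)) \<longlonglongrightarrow> 1" if "0 < t" for t
  proof -
    have "(\<lambda>n. exp (- (1 / t * (1 / real (Suc n))))) \<longlonglongrightarrow> exp (- (1 / t * 0))"
      by (intro tendsto_intros LIMSEQ_Suc[OF lim_1_over_n])
    then show ?thesis using that by (simp add: flat_exp_def mult.commute)
  qed
  have "(\<lambda>n. box_bump a b n x) \<longlonglongrightarrow> (\<Prod>i\<in>(Basis::'a set). 1 * 1)"
    unfolding box_bump_def by (intro tendsto_prod tendsto_mult lim) (use True in \<open>auto simp: mem_box\<close>)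
  then show ?thesis using True by simp
next
  case False
  then show ?thesis using box_bump_nonzero_iff[of a b _ x] by simp
qed

section \<open>The fundamental lemma of the calculus of variations\<close>

text \<open>The positive and the negative part of \<open>h\<close> are densities of measures that agree on all open boxes,
  an intersection-stable generator of the Borel sets.\<close>

lemma AE_eq_0_of_box_integrals:
  fixes h :: "'a::euclidean_space \<Rightarrow> real"
  assumes int: "integrable lborel h"
    and z: "\<And>a b. (LINT x|lborel. indicator (box a b) x * h x) = 0"
  shows "AE x in lborel. h x = 0"
proof -
  have [measurable]: "h \<in> borel_measurable borel" using int by auto
  define hp where "hp = (\<lambda>x. ennreal (h x))"
  define hm where "hm = (\<lambda>x. ennreal (- h x))"
  have [measurable]: "hp \<in> borel_measurable borel" "hm \<in> borel_measurable borel"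
    by (auto simp: hp_def hm_def)
  have fin: "(NNINT x|lborel. hp x) < \<infinity>" "(NNINT x|lborel. hm x) < \<infinity>"
    using int by (auto simp: hp_def hm_def real_integrable_def less_top)
  have eq: "(NNINT x|lborel. hp x * indicator (box a b) x) = (NNINT x|lborel. hm x * indicator (box a b) x)" for a b
  proof -
    have i: "integrable lborel (\<lambda>x. indicator (box a b) x * h x)"
      using integrable_mult_indicator[OF _ int, of "box a b"] by simp
    have "(NNINT x|lborel. ennreal (indicator (box a b) x * h x)) = (NNINT x|lborel. ennreal (- (indicator (box a b) x * h x)))"
    proof -
      have "enn2real (NNINT x|lborel. ennreal (indicator (box a b) x * h x))
        = enn2real (NNINT x|lborel. ennreal (- (indicator (box a b) x * h x)))"
        using z[of a b] real_lebesgue_integral_def[OF i] by simp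
      moreover have "(NNINT x|lborel. ennreal (indicator (box a b) x * h x)) < top"
        "(NNINT x|lborel. ennreal (- (indicator (box a b) x * h x))) < top"
        using i by (auto simp: real_integrable_def less_top)
      ultimately show ?thesis by (metis ennreal_enn2real)
    qed
    moreover have "(\<lambda>x. ennreal (indicator (box a b) x * h x)) = (\<lambda>x. hp x * indicator (box a b) x)"
      "(\<lambda>x. ennreal (- (indicator (box a b) x * h x))) = (\<lambda>x. hm x * indicator (box a b) x)"
      by (auto simp: fun_eq_iff hp_def hm_def indicator_def)
    ultimately show ?thesis by simp
  qed
  have "density lborel hp = density lborel hm"
  proof (rule measure_eqI_generator_eq)
    let ?E = "range (\<lambda>(a, b). box a b::'a set)"
    show "Int_stable ?E" by (auto simp: Int_stable_def box_Int_box)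
    show "?E \<subseteq> Pow UNIV" "sets (density lborel hp) = sigma_sets UNIV ?E"
      "sets (density lborel hm) = sigma_sets UNIV ?E"
      by (simp_all add: borel_eq_box sets_eq_imp_space_eq)
    let ?A = "\<lambda>n::nat. box (- (real n *\<^sub>R One)) (real n *\<^sub>R One) :: 'a set"
    show "range ?A \<subseteq> ?E" "(\<Union>i. ?A i) = UNIV"
      unfolding UN_box_eq_UNIV by auto
    show "emeasure (density lborel hp) (?A i) \<noteq> \<infinity>" for i
    proof -
      have "emeasure (density lborel hp) (?A i) \<le> (NNINT x|lborel. hp x)"
        by (auto simp: emeasure_density intro!: nn_integral_mono split: split_indicator)
      then show ?thesis using fin by auto
    qed
    show "emeasure (density lborel hp) X = emeasure (density lborel hm) X" if "X \<in> ?E" for X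
      using that eq by (auto simp: emeasure_density)
  qed
  then have "AE x in lborel. hp x = hm x"
    by (subst (asm) sigma_finite_measure.density_unique_iff[OF sigma_finite_lborel]) auto
  then show ?thesis
  proof eventually_elim
    case (elim x)
    then show ?case by (cases "0 \<le> h x") (auto simp: hp_def hm_def ennreal_neg)
  qed
qed

lemma Lp_loc_1_set_integrable:
  assumes "u \<in> Lp_loc 1 U" "compact K" "K \<subseteq> U"
  shows "integrable (lebesgue_on K) u"
proof -
  have "u \<in> Lp_on 1 K" using assms by (auto simp: Lp_loc_def)
  then have "u \<in> borel_measurable (lebesgue_on K)" "integrable (lebesgue_on K) (\<lambda>x. norm (u x))"
    by (auto simp: Lp_on_def powr_one')
  then show ?thesis by (simp add: integrable_norm_iff)
qed

lemma integrable_lebesgue_on_iff: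
  fixes f :: "'a::euclidean_space \<Rightarrow> 'b::{banach, second_countable_topology}"
  assumes "S \<in> sets lebesgue"
  shows "integrable (lebesgue_on S) f \<longleftrightarrow> integrable lebesgue (\<lambda>x. indicator S x *\<^sub>R f x)"
  by (rule integrable_restrict_space) (simp add: assms)

lemma integral_lebesgue_on_eq:
  fixes f :: "'a::euclidean_space \<Rightarrow> 'b::{banach, second_countable_topology}"
  assumes "S \<in> sets lebesgue"
  shows "integral\<^sup>L (lebesgue_on S) f = (LINT x|lebesgue. indicator S x *\<^sub>R f x)"
  by (rule integral_restrict_space) (simp add: assms)

lemma lebesgue_integrable_borel_representative:
  fixes h :: "'a::euclidean_space \<Rightarrow> real"
  assumes "integrable lebesgue h"
  obtains h' where "integrable lborel h'" "AE x in lebesgue. h x = h' x"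
proof -
  obtain h' where h': "h' \<in> borel_measurable lborel" "AE x in lborel. h x = h' x"
    using completion_ex_borel_measurable_real[of h lborel] assms by auto
  have ae: "AE x in lebesgue. h x = h' x" using h'(2) by (rule AE_completion)
  have "integrable lebesgue h'"
    using assms h' ae by (subst integrable_cong_AE[of _ _ h]) (auto intro: measurable_completion)
  then show ?thesis using that h' ae integrable_completion by blast
qed

text \<open>The fundamental lemma of the calculus of variations. The bumps supported in a box inside \<open>U\<close> converge boundedly to
  its indicator, so the integrals of \<open>H\<close> over such boxes vanish; countably many boxes cover \<open>U\<close>.\<close>

lemma AE_eq_0_of_test_integrals:
  fixes H :: "'a::euclidean_space \<Rightarrow> real"
  assumes U: "open U" and H: "H \<in> Lp_loc 1 U"
    and z: "\<And>\<psi>. \<psi> \<in> test_functions U \<Longrightarrow> (LINT x|lebesgue_on U. H x * \<psi> x) = 0"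
  shows "AE x in lebesgue. x \<in> U \<longrightarrow> H x = 0"
proof -
  have Us[measurable]: "U \<in> sets lebesgue" using U by auto
  have boxes: "AE x in lebesgue. x \<in> cbox c d \<longrightarrow> H x = 0" if cd: "cbox c d \<subseteq> U" for c d
  proof -
    define h where "h = (\<lambda>x. indicator (cbox c d) x * H x)"
    have h: "integrable lebesgue h"
      using Lp_loc_1_set_integrable[OF H compact_cbox cd]
      by (simp add: h_def integrable_lebesgue_on_iff)
    have hm: "h \<in> borel_measurable lebesgue" using h by (rule borel_measurable_integrable)
    have indm: "(\<lambda>x. indicator (box a b) x * k x) \<in> borel_measurable lebesgue"
      if "k \<in> borel_measurable lebesgue" for a b and k :: "'a \<Rightarrow> real"
      using that by (intro borel_measurable_times borel_measurable_indicator sets_completionI_sets) auto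
    have zero: "(LINT x|lebesgue. indicator (box a b) x * h x) = 0" for a b
    proof -
      obtain a' b' where ab: "box a b \<inter> box c d = box a' b'" by (rule that[OF box_Int_box])
      have sub: "box a' b' \<subseteq> cbox c d" using ab box_subset_cbox by blast
      have sub': "cbox a' b' \<subseteq> cbox c d" if "box a' b' \<noteq> {}"
        using that closure_mono[OF sub] by (simp add: closure_box)
      have "(LINT x|lebesgue. indicator (box a' b') x * H x) = 0"
      proof (cases "box a' b' = {}")
        case True
        show ?thesis unfolding True by simp
      next
        case False
        note sub' = sub'[OF False]
        have lim: "(\<lambda>n. LINT x|lebesgue. box_bump a' b' n x * h x) \<longlonglongrightarrow> (LINT x|lebesgue. indicator (box a' b') x * h x)"
        proof (rule integral_dominated_convergence[where w="\<lambda>x. \<bar>h x\<bar>"])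
          have "box_bump a' b' n \<in> borel_measurable lebesgue" for n
            using Ck_imp_continuous[OF Ck_box_bump[of 0 a' b' n]]
            by (intro measurable_completion) (simp add: borel_measurable_continuous_onI)
          then show "(\<lambda>x. box_bump a' b' n x * h x) \<in> borel_measurable lebesgue" for n
            using hm by (rule borel_measurable_times)
          show "(\<lambda>x. indicator (box a' b') x * h x) \<in> borel_measurable lebesgue"
            using hm by (rule indm)
          have "(\<lambda>n. box_bump a' b' n x * h x) \<longlonglongrightarrow> indicator (box a' b') x * h x" for x
            by (rule tendsto_mult[OF box_bump_tendsto tendsto_const])
          then show "AE x in lebesgue. (\<lambda>n. box_bump a' b' n x * h x) \<longlonglongrightarrow> indicator (box a' b') x * h x"
            by simp
          have "norm (box_bump a' b' n x * h x) \<le> \<bar>h x\<bar>" for n x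
            using mult_left_le_one_le[OF abs_ge_zero[of "h x"] box_bump_bounds, of a' b' n x] box_bump_bounds(1)[of a' b' n x]
            by (simp add: abs_mult)
          then show "AE x in lebesgue. norm (box_bump a' b' n x * h x) \<le> \<bar>h x\<bar>" for n by simp
          show "integrable lebesgue (\<lambda>x. \<bar>h x\<bar>)" using h by (rule integrable_abs)
        qed
        have "(LINT x|lebesgue. box_bump a' b' n x * h x) = 0" for n
        proof -
          have "(LINT x|lebesgue_on U. H x * box_bump a' b' n x) = 0"
            by (rule z[OF box_bump_test_function]) (use sub' cd in auto)
          moreover have "indicator U x * (H x * box_bump a' b' n x) = box_bump a' b' n x * h x" for x
            using box_bump_nonzero_iff[of a' b' n x] sub cd
            by (cases "x \<in> box a' b'") (auto simp: h_def indicator_def)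
          ultimately show ?thesis by (simp add: integral_lebesgue_on_eq)
        qed
        then have "(\<lambda>n. LINT x|lebesgue. box_bump a' b' n x * h x) = (\<lambda>n. 0)" by (intro ext)
        then have "(LINT x|lebesgue. indicator (box a' b') x * h x) = 0"
          using lim by (simp only: LIMSEQ_const_iff)
        moreover have "indicator (box a' b') x * h x = indicator (box a' b') x * H x" for x
          using sub by (auto simp: h_def indicator_def)
        ultimately show ?thesis by simp
      qed
      moreover have "(LINT x|lebesgue. indicator (box a b) x * h x) = (LINT x|lebesgue. indicator (box a' b') x * H x)"
      proof (rule integral_cong_AE)
        have "AE x in lebesgue. x \<notin> cbox c d - box c d"
          using negligible_frontier_interval[of c d] by (intro AE_not_in) (simp add: negligible_iff_null_sets)
        then show "AE x in lebesgue. indicator (box a b) x * h x = indicator (box a' b') x * H x"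
        proof eventually_elim
          case (elim x)
          then show ?case using ab box_subset_cbox[of c d] by (auto simp: h_def indicator_def)
        qed
        show "(\<lambda>x. indicator (box a b) x * h x) \<in> borel_measurable lebesgue" using hm by (rule indm)
        have "(\<lambda>x. indicator (box a' b') x * h x) \<in> borel_measurable lebesgue" using hm by (rule indm)
        moreover have "indicator (box a' b') x * h x = indicator (box a' b') x * H x" for x
          using sub by (auto simp: h_def indicator_def)
        ultimately show "(\<lambda>x. indicator (box a' b') x * H x) \<in> borel_measurable lebesgue" by simp
      qed
      ultimately show ?thesis by simp
    qed
    obtain h' where h': "integrable lborel h'" "AE x in lebesgue. h x = h' x"
      using lebesgue_integrable_borel_representative[OF h] .
    have "AE x in lborel. h' x = 0"
    proof (rule AE_eq_0_of_box_integrals[OF h'(1)])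
      fix a b :: 'a
      have [measurable]: "h' \<in> borel_measurable borel" using h'(1) by auto
      have "(LINT x|lborel. indicator (box a b) x * h' x) = (LINT x|lebesgue. indicator (box a b) x * h' x)"
        by (rule integral_completion[symmetric]) measurable
      also have "\<dots> = (LINT x|lebesgue. indicator (box a b) x * h x)"
      proof (rule integral_cong_AE)
        show "(\<lambda>x. indicator (box a b) x * h' x) \<in> borel_measurable lebesgue"
          by (rule indm) (rule measurable_completion, simp)
        show "(\<lambda>x. indicator (box a b) x * h x) \<in> borel_measurable lebesgue" using hm by (rule indm)
        show "AE x in lebesgue. indicator (box a b) x * h' x = indicator (box a b) x * h x"
          using h'(2) by eventually_elim simp
      qed
      finally show "(LINT x|lborel. indicator (box a b) x * h' x) = 0" using zero by simp
    qed
    then have "AE x in lebesgue. h' x = 0" by (rule AE_completion)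
    with h'(2) show ?thesis
      by eventually_elim (auto simp: h_def)
  qed
  obtain D where D: "countable D" "D \<subseteq> Pow U" "\<And>X. X \<in> D \<Longrightarrow> \<exists>a b. X = cbox a b" "\<Union>D = U"
    by (rule open_countable_Union_open_cbox[OF U]) (rule that)
  have "AE x in lebesgue. x \<in> X \<longrightarrow> H x = 0" if X: "X \<in> D" for X
  proof -
    obtain a b where "X = cbox a b" using D(3) X by blast
    then show "AE x in lebesgue. x \<in> X \<longrightarrow> H x = 0" using boxes D(2) X by blast
  qed
  then have "AE x in lebesgue. \<forall>X\<in>D. x \<in> X \<longrightarrow> H x = 0"
    by (subst AE_ball_countable[OF D(1)]) blast
  then show ?thesis by eventually_elim (use D(4) in auto)
qed

section \<open>Functions with integrable \<open>p\<close>-th power\<close>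

text \<open>For an arbitrary measure, because the same facts are needed for Lebesgue measure on an open set and for the
  fractional measure on pairs.\<close>

definition Lpm :: "real \<Rightarrow> 'a measure \<Rightarrow> ('a \<Rightarrow> 'b::euclidean_space) set" where
  "Lpm p M = {f \<in> borel_measurable M. integrable M (\<lambda>x. norm (f x) powr p)}"

lemma Lp_on_eq_Lpm: "0 < p \<Longrightarrow> Lp_on (ennreal p) S = Lpm p (lebesgue_on S)"
  by (simp add: Lp_on_def Lpm_def)

lemma LpmD: "f \<in> Lpm p M \<Longrightarrow> f \<in> borel_measurable M" "f \<in> Lpm p M \<Longrightarrow> integrable M (\<lambda>x. norm (f x) powr p)"
  by (auto simp: Lpm_def)

lemma LpmI: "f \<in> borel_measurable M \<Longrightarrow> integrable M (\<lambda>x. norm (f x) powr p) \<Longrightarrow> f \<in> Lpm p M"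
  by (auto simp: Lpm_def)

lemma Lpm_add:
  assumes "0 \<le> p" "f \<in> Lpm p M" "g \<in> Lpm p M"
  shows "(\<lambda>x. f x + g x) \<in> Lpm p M"
proof (rule LpmI)
  note [measurable] = LpmD(1)[OF assms(2)] LpmD(1)[OF assms(3)]
  show "(\<lambda>x. f x + g x) \<in> borel_measurable M" by measurable
  show "integrable M (\<lambda>x. norm (f x + g x) powr p)"
  proof (rule Bochner_Integration.integrable_bound)
    show "integrable M (\<lambda>x. 2 powr p * (norm (f x) powr p + norm (g x) powr p))"
      using LpmD(2)[OF assms(2)] LpmD(2)[OF assms(3)] by auto
    show "AE x in M. norm (norm (f x + g x) powr p) \<le> norm (2 powr p * (norm (f x) powr p + norm (g x) powr p))"
      using norm_add_powr_le[OF assms(1)] by (intro AE_I2) (auto simp: abs_mult)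
  qed measurable
qed

lemma Lpm_scaleR:
  assumes "f \<in> Lpm p M"
  shows "(\<lambda>x. t *\<^sub>R f x) \<in> Lpm p M"
proof (rule LpmI)
  note [measurable] = LpmD(1)[OF assms]
  show "(\<lambda>x. t *\<^sub>R f x) \<in> borel_measurable M" by measurable
  have "integrable M (\<lambda>x. \<bar>t\<bar> powr p * norm (f x) powr p)"
    using LpmD(2)[OF assms] by auto
  then show "integrable M (\<lambda>x. norm (t *\<^sub>R f x) powr p)" by (simp add: powr_mult)
qed

lemma Lpm_diff:
  assumes "0 \<le> p" "f \<in> Lpm p M" "g \<in> Lpm p M"
  shows "(\<lambda>x. f x - g x) \<in> Lpm p M"
  using Lpm_add[OF assms(1,2) Lpm_scaleR[OF assms(3), of "-1"]] by simp

lemma Lpm_integral_add_le: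
  assumes "0 \<le> p" "f \<in> Lpm p M" "g \<in> Lpm p M"
  shows "(LINT x|M. norm (f x + g x) powr p)
    \<le> 2 powr p * ((LINT x|M. norm (f x) powr p) + (LINT x|M. norm (g x) powr p))"
proof -
  have "(LINT x|M. norm (f x + g x) powr p) \<le> (LINT x|M. 2 powr p * (norm (f x) powr p + norm (g x) powr p))"
    using LpmD(2)[OF Lpm_add[OF assms]] LpmD(2)[OF assms(2)] LpmD(2)[OF assms(3)] norm_add_powr_le[OF assms(1)]
    by (intro integral_mono) auto
  also have "\<dots> = 2 powr p * ((LINT x|M. norm (f x) powr p) + (LINT x|M. norm (g x) powr p))"
    using LpmD(2)[OF assms(2)] LpmD(2)[OF assms(3)] by simp
  finally show ?thesis .
qed

lemma nn_integral_norm_powr: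
  "f \<in> Lpm p M \<Longrightarrow> (NNINT x|M. ennreal (norm (f x) powr p)) = ennreal (LINT x|M. norm (f x) powr p)"
  by (intro nn_integral_eq_integral) (auto dest: LpmD)

text \<open>Completeness of \<open>L\<^sup>p\<close>: along a subsequence with \<open>\<integral>|f\<^sub>n\<^sub>+\<^sub>1 - f\<^sub>n|\<^sup>p \<le> 4\<^sup>-\<^sup>n\<^sup>p\<close> the
  increments are almost everywhere \<open>O(2\<^sup>-\<^sup>n)\<close>, and Fatou's lemma turns the pointwise limit into a limit in \<open>L\<^sup>p\<close>.\<close>

lemma Lpm_complete:
  fixes f :: "nat \<Rightarrow> 'a \<Rightarrow> 'b::euclidean_space"
  assumes p: "1 < p" and f: "\<And>n. f n \<in> Lpm p M"
    and cauchy: "\<And>\<epsilon>. 0 < \<epsilon> \<Longrightarrow> \<exists>n0. \<forall>m\<ge>n0. \<forall>n\<ge>n0. (LINT x|M. norm (f n x - f m x) powr p) < \<epsilon>"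
  shows "\<exists>g\<in>Lpm p M. (\<lambda>n. LINT x|M. norm (f n x - g x) powr p) \<longlonglongrightarrow> 0"
proof -
  have [measurable]: "f n \<in> borel_measurable M" for n using f LpmD by blast
  have "\<forall>k. \<exists>n0. \<forall>m\<ge>n0. \<forall>n\<ge>n0. (LINT x|M. norm (f n x - f m x) powr p) < (1 / 4 ^ k) powr p"
    using cauchy by simp
  then obtain N where N: "\<And>k m n. N k \<le> m \<Longrightarrow> N k \<le> n \<Longrightarrow> (LINT x|M. norm (f n x - f m x) powr p) < (1 / 4 ^ k) powr p"
    by metis
  \<comment> \<open>strictly increasing and beyond the threshold \<open>N k\<close>\<close>
  define r where "r k = (\<Sum>j\<le>k. N j) + k" for k
  have rN: "N k \<le> r k" "r k \<le> r (Suc k)" for k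
    by (auto simp: r_def intro!: trans_le_add1 member_le_sum)
  have rN': "N k \<le> r (Suc k)" for k using rN[of k] by linarith
  define d where "d k x = norm (f (r (Suc k)) x - f (r k) x)" for k x
  have [measurable]: "d k \<in> borel_measurable M" for k unfolding d_def by measurable
  have dint: "(NNINT x|M. ennreal (d k x powr p)) \<le> ennreal ((1 / 4 ^ k) powr p)" for k
    using N[OF rN(1)[of k] rN'[of k]] Lpm_diff[OF _ f f] p unfolding d_def
    by (subst nn_integral_norm_powr) (auto intro!: ennreal_leI)
  have "(NNINT x|M. (\<Sum>k. ennreal (((2::real) ^ k) powr p * d k x powr p))) = (\<Sum>k. NNINT x|M. ennreal (((2::real) ^ k) powr p * d k x powr p))"
    by (rule nn_integral_suminf) measurable
  also have "\<dots> \<le> (\<Sum>k. ennreal ((1 / 2) ^ k))"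
  proof (rule suminf_le)
    fix k
    have "(NNINT x|M. ennreal (((2::real) ^ k) powr p * d k x powr p)) = ennreal (((2::real) ^ k) powr p) * (NNINT x|M. ennreal (d k x powr p))"
      by (simp add: ennreal_mult nn_integral_cmult)
    also have "\<dots> \<le> ennreal (((2::real) ^ k) powr p) * ennreal ((1 / 4 ^ k) powr p)"
      by (intro mult_left_mono dint) auto
    also have "\<dots> = ennreal (((1 / 2) ^ k) powr p)"
    proof -
      have 4: "(4::real) ^ k = 2 ^ k * 2 ^ k" by (simp flip: power_mult_distrib)
      have "(2::real) ^ k * (1 / 4 ^ k) = (1 / 2) ^ k" unfolding 4 by (simp add: power_divide)
      then have "((2::real) ^ k) powr p * (1 / 4 ^ k) powr p = ((1 / 2) ^ k) powr p"
        by (subst powr_mult[symmetric]) simp_all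
      then show ?thesis by (subst ennreal_mult[symmetric]) simp_all
    qed
    also have "\<dots> \<le> ennreal ((1 / 2) ^ k)"
    proof -
      have "((1 / 2) ^ k) powr p \<le> ((1 / 2) ^ k) powr (1::real)"
        using p by (intro powr_mono') (auto simp: power_le_one)
      then show ?thesis by (intro ennreal_leI) simp
    qed
    finally show "(NNINT x|M. ennreal (((2::real) ^ k) powr p * d k x powr p)) \<le> ennreal ((1 / 2) ^ k)" .
  qed auto
  also have "\<dots> < \<infinity>"
  proof -
    have "(\<Sum>k. ennreal ((1 / 2) ^ k)) = ennreal (\<Sum>k. (1 / 2) ^ k)"
      by (intro suminf_ennreal2 summable_geometric) auto
    then show ?thesis by simp
  qed
  finally have "AE x in M. (\<Sum>k. ennreal (((2::real) ^ k) powr p * d k x powr p)) \<noteq> \<infinity>"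
    by (intro nn_integral_PInf_AE) auto
  then have conv: "AE x in M. convergent (\<lambda>k. f (r k) x)"
  proof eventually_elim
    case (elim x)
    define a where "a k = ennreal (((2::real) ^ k) powr p * d k x powr p)" for k
    define B where "B = enn2real (suminf a)"
    have fin: "suminf a = ennreal B" using elim by (simp add: B_def a_def[abs_def] less_top)
    have db: "d k x \<le> B powr (1/p) * (1 / 2) ^ k" for k
    proof -
      have "sum a {k} \<le> suminf a" by (rule sum_le_suminf) auto
      then have "ennreal (((2::real) ^ k) powr p * d k x powr p) \<le> ennreal B" by (simp add: fin a_def)
      moreover have "0 \<le> B" by (simp add: B_def)
      ultimately have "((2::real) ^ k) powr p * d k x powr p \<le> B" by (simp add: ennreal_le_iff)
      then have "(2 ^ k * d k x) powr p \<le> B" by (simp add: powr_mult d_def)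
      then have "((2 ^ k * d k x) powr p) powr (1/p) \<le> B powr (1/p)"
        using p by (intro powr_mono2) auto
      then have "2 ^ k * d k x \<le> B powr (1/p)" using p by (simp add: powr_powr d_def)
      then show ?thesis by (simp add: field_simps)
    qed
    have "summable (\<lambda>k. f (r (Suc k)) x - f (r k) x)"
    proof (rule summable_comparison_test)
      show "\<exists>N. \<forall>n\<ge>N. norm (f (r (Suc n)) x - f (r n) x) \<le> B powr (1/p) * (1 / 2) ^ n"
        using db unfolding d_def by blast
      show "summable (\<lambda>n. B powr (1/p) * (1 / 2) ^ n)"
        by (intro summable_mult summable_geometric) auto
    qed
    then have "convergent (\<lambda>n. \<Sum>k<n. f (r (Suc k)) x - f (r k) x)"
      by (simp add: summable_iff_convergent)
    then have "convergent (\<lambda>n. f (r n) x - f (r 0) x)" by (simp add: sum_lessThan_telescope[of "\<lambda>k. f (r k) x"])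
    then have "convergent (\<lambda>n. (f (r n) x - f (r 0) x) + f (r 0) x)"
      by (intro convergent_add convergent_const)
    then show ?case by simp
  qed
  define g where "g x = lim (\<lambda>k. f (r k) x)" for x
  have g[measurable]: "g \<in> borel_measurable M" unfolding g_def
    by (rule borel_measurable_lim_metric) measurable
  have lim: "AE x in M. (\<lambda>k. f (r k) x) \<longlonglongrightarrow> g x"
    using conv by eventually_elim (simp add: g_def convergent_LIMSEQ_iff)
  have est: "(NNINT x|M. ennreal (norm (f n x - g x) powr p)) \<le> ennreal \<epsilon>"
    if e: "0 < \<epsilon>" and n0: "\<forall>m\<ge>n0. (LINT x|M. norm (f n x - f m x) powr p) < \<epsilon>" for \<epsilon> n n0
  proof -
    have rk: "n0 \<le> r k" if "k \<ge> n0" for k using that by (simp add: r_def)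
    have "(NNINT x|M. ennreal (norm (f n x - g x) powr p))
      = (NNINT x|M. liminf (\<lambda>k. ennreal (norm (f n x - f (r k) x) powr p)))"
    proof (rule nn_integral_cong_AE)
      show "AE x in M. ennreal (norm (f n x - g x) powr p) = liminf (\<lambda>k. ennreal (norm (f n x - f (r k) x) powr p))"
        using lim
      proof eventually_elim
        case (elim x)
        have "(\<lambda>k. ennreal (norm (f n x - f (r k) x) powr p)) \<longlonglongrightarrow> ennreal (norm (f n x - g x) powr p)"
          using p elim by (intro tendsto_ennrealI tendsto_powr2 tendsto_intros) auto
        then show ?case using lim_imp_Liminf[OF sequentially_bot] by metis
      qed
    qed
    also have "\<dots> \<le> liminf (\<lambda>k. NNINT x|M. ennreal (norm (f n x - f (r k) x) powr p))"
      by (rule nn_integral_liminf) measurable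
    also have "\<dots> \<le> ennreal \<epsilon>"
    proof (rule Liminf_le)
      show "\<forall>\<^sub>F k in sequentially. (NNINT x|M. ennreal (norm (f n x - f (r k) x) powr p)) \<le> ennreal \<epsilon>"
      proof (rule eventually_sequentiallyI[of n0])
        fix k assume "n0 \<le> k"
        then have "(LINT x|M. norm (f n x - f (r k) x) powr p) < \<epsilon>" using n0 rk by blast
        then show "(NNINT x|M. ennreal (norm (f n x - f (r k) x) powr p)) \<le> ennreal \<epsilon>"
          using Lpm_diff[OF _ f f] p by (subst nn_integral_norm_powr) (auto intro!: ennreal_leI)
      qed
    qed simp
    finally show ?thesis .
  qed
  have diff: "(\<lambda>x. f n x - g x) \<in> Lpm p M \<and> (LINT x|M. norm (f n x - g x) powr p) \<le> \<epsilon>"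
    if e: "0 < \<epsilon>" and n0: "\<forall>m\<ge>n0. (LINT x|M. norm (f n x - f m x) powr p) < \<epsilon>" for \<epsilon> n n0
  proof -
    have "integrable M (\<lambda>x. norm (f n x - g x) powr p)"
      using est[OF e n0] by (intro integrableI_bounded) (auto simp: le_less_trans)
    then have L: "(\<lambda>x. f n x - g x) \<in> Lpm p M" by (intro LpmI) auto
    moreover have "(LINT x|M. norm (f n x - g x) powr p) \<le> \<epsilon>"
      using est[OF e n0] e by (subst (asm) nn_integral_norm_powr[OF L]) (simp add: ennreal_le_iff)
    ultimately show ?thesis by blast
  qed
  obtain n1 where "\<forall>m\<ge>n1. \<forall>n\<ge>n1. (LINT x|M. norm (f n x - f m x) powr p) < 1" using cauchy[of 1] by auto
  then have "(\<lambda>x. f n1 x - g x) \<in> Lpm p M" using diff[of 1 n1 n1] by simp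
  then have "(\<lambda>x. f n1 x - (f n1 x - g x)) \<in> Lpm p M" using p by (subst Lpm_diff[OF _ f]) auto
  then have "g \<in> Lpm p M" by simp
  moreover have "(\<lambda>n. LINT x|M. norm (f n x - g x) powr p) \<longlonglongrightarrow> 0"
  proof (rule LIMSEQ_I)
    fix \<epsilon> :: real assume "0 < \<epsilon>"
    then obtain n0 where n0: "\<forall>m\<ge>n0. \<forall>n\<ge>n0. (LINT x|M. norm (f n x - f m x) powr p) < \<epsilon> / 2"
      using cauchy[of "\<epsilon> / 2"] by auto
    have "norm ((LINT x|M. norm (f n x - g x) powr p) - 0) < \<epsilon>" if "n \<ge> n0" for n
    proof -
      have "(LINT x|M. norm (f n x - g x) powr p) \<le> \<epsilon> / 2" using diff[of "\<epsilon> / 2" n0 n] n0 that \<open>0 < \<epsilon>\<close> by auto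
      moreover have "0 \<le> (LINT x|M. norm (f n x - g x) powr p)" by simp
      ultimately show ?thesis using \<open>0 < \<epsilon>\<close> by auto
    qed
    then show "\<exists>no. \<forall>n\<ge>no. norm ((LINT x|M. norm (f n x - g x) powr p) - 0) < \<epsilon>" by blast
  qed
  ultimately show ?thesis by blast
qed

lemma le_add_powr:
  fixes a \<epsilon> p :: real
  assumes "1 < p" "0 \<le> a" "0 < \<epsilon>"
  shows "a \<le> \<epsilon> + \<epsilon> powr (1 - p) * a powr p"
proof (cases "a \<le> \<epsilon>")
  case True
  then show ?thesis by (simp add: add_increasing2)
next
  case False
  then have "a = a powr (1 - p) * a powr p" using assms by (simp flip: powr_add)
  also have "\<dots> \<le> \<epsilon> powr (1 - p) * a powr p"
    using False assms by (intro mult_right_mono powr_mono2') auto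
  finally show ?thesis using assms by linarith
qed

lemma Lpm_integrable_on_finite:
  fixes f :: "'a \<Rightarrow> 'b::euclidean_space"
  assumes p: "1 < p" and f: "f \<in> Lpm p M" and A: "A \<in> sets M" "emeasure M A < \<infinity>"
  shows "integrable M (\<lambda>x. indicator A x *\<^sub>R f x)"
proof (rule Bochner_Integration.integrable_bound)
  note [measurable] = LpmD(1)[OF f] A(1)
  show "integrable M (\<lambda>x. indicator A x + norm (f x) powr p)"
    using LpmD(2)[OF f] A by auto
  show "(\<lambda>x. indicator A x *\<^sub>R f x) \<in> borel_measurable M" by measurable
  show "AE x in M. norm (indicator A x *\<^sub>R f x) \<le> norm (indicat_real A x + norm (f x) powr p)"
    using le_add_powr[OF p norm_ge_zero, of 1] by (intro AE_I2) (auto simp: indicator_def)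
qed

text \<open>On a set of finite measure, convergence in \<open>L\<^sup>p\<close> implies convergence in \<open>L\<^sup>1\<close>, because
  \<open>a \<le> \<epsilon> + \<epsilon>\<^sup>1\<^sup>-\<^sup>p a\<^sup>p\<close>.\<close>

lemma Lpm_tendsto_integral_times:
  fixes f :: "nat \<Rightarrow> 'a \<Rightarrow> real"
  assumes p: "1 < p" and f: "\<And>n. f n \<in> Lpm p M"
    and lim: "(\<lambda>n. LINT x|M. norm (f n x) powr p) \<longlonglongrightarrow> 0"
    and A: "A \<in> sets M" "emeasure M A < \<infinity>"
    and k: "k \<in> borel_measurable M" "\<And>x. \<bar>k x\<bar> \<le> B * indicator A x"
  shows "(\<lambda>n. LINT x|M. f n x * k x) \<longlonglongrightarrow> 0"
proof (rule LIMSEQ_I)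
  fix \<epsilon> :: real assume e: "0 < \<epsilon>"
  define B' where "B' = \<bar>B\<bar> + 1"
  have B': "0 < B'" "\<And>x. \<bar>k x\<bar> \<le> B' * indicator A x"
  proof -
    show "0 < B'" by (simp add: B'_def)
    show "\<bar>k x\<bar> \<le> B' * indicator A x" for x
      using k(2)[of x] by (auto simp: B'_def indicator_def split: if_splits)
  qed
  define m where "m = measure M A"
  define \<delta> where "\<delta> = \<epsilon> / (2 * B' * (m + 1))"
  have d: "0 < \<delta>" "B' * (\<delta> * m) < \<epsilon> / 2"
  proof -
    have m: "0 \<le> m" by (simp add: m_def)
    then show "0 < \<delta>" using e B' by (simp add: \<delta>_def)
    have "B' * \<delta> = \<epsilon> / (2 * (m + 1))" using B' by (simp add: \<delta>_def)
    then have "B' * (\<delta> * m) = \<epsilon> / 2 * (m / (m + 1))" by (simp flip: mult.assoc)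
    also have "\<dots> < \<epsilon> / 2 * 1" using m e by (intro mult_strict_left_mono) auto
    finally show "B' * (\<delta> * m) < \<epsilon> / 2" by simp
  qed
  define c where "c = B' * \<delta> powr (1 - p)"
  have c: "0 < c" using B' d by (simp add: c_def)
  note [measurable] = LpmD(1)[OF f] A(1) k(1)
  have bnd: "\<bar>LINT x|M. f n x * k x\<bar> \<le> B' * (\<delta> * m) + c * (LINT x|M. norm (f n x) powr p)" for n
  proof -
    have pt: "\<bar>f n x * k x\<bar> \<le> B' * \<delta> * indicator A x + c * norm (f n x) powr p" for x
    proof -
      have "\<bar>f n x * k x\<bar> \<le> \<bar>f n x\<bar> * (B' * indicator A x)"
        unfolding abs_mult by (intro mult_left_mono B') auto
      also have "\<dots> \<le> (\<delta> + \<delta> powr (1 - p) * \<bar>f n x\<bar> powr p) * (B' * indicator A x)"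
        using B' le_add_powr[OF p abs_ge_zero d(1)] by (intro mult_right_mono) auto
      also have "\<dots> \<le> B' * \<delta> * indicator A x + c * norm (f n x) powr p"
        using B' d by (auto simp: indicator_def c_def algebra_simps)
      finally show ?thesis .
    qed
    have i: "integrable M (\<lambda>x. B' * \<delta> * indicator A x + c * norm (f n x) powr p)"
      using A LpmD(2)[OF f] by auto
    have "\<bar>LINT x|M. f n x * k x\<bar> \<le> (LINT x|M. \<bar>f n x * k x\<bar>)" by (rule integral_abs_bound)
    also have "\<dots> \<le> (LINT x|M. B' * \<delta> * indicator A x + c * norm (f n x) powr p)"
    proof (rule integral_mono[OF _ i pt])
      show "integrable M (\<lambda>x. \<bar>f n x * k x\<bar>)"
      proof (rule Bochner_Integration.integrable_bound[OF i])
        show "AE x in M. norm \<bar>f n x * k x\<bar> \<le> norm (B' * \<delta> * indicator A x + c * norm (f n x) powr p)"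
          using pt by (intro AE_I2) (metis abs_ge_self abs_idempotent order_trans real_norm_def)
      qed measurable
    qed
    also have "\<dots> = B' * (\<delta> * m) + c * (LINT x|M. norm (f n x) powr p)"
      using A LpmD(2)[OF f] by (simp add: m_def)
    finally show ?thesis .
  qed
  have "\<forall>\<^sub>F n in sequentially. (LINT x|M. norm (f n x) powr p) < \<epsilon> / (2 * c)"
    using lim e c by (intro order_tendstoD) auto
  then obtain N where N: "\<And>n. n \<ge> N \<Longrightarrow> (LINT x|M. norm (f n x) powr p) < \<epsilon> / (2 * c)"
    by (auto simp: eventually_sequentially)
  have "norm ((LINT x|M. f n x * k x) - 0) < \<epsilon>" if "n \<ge> N" for n
  proof -
    have "c * (LINT x|M. norm (f n x) powr p) < \<epsilon> / 2" using N[OF that] c by (simp add: field_simps)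
    then show ?thesis using bnd[of n] d by simp
  qed
  then show "\<exists>no. \<forall>n\<ge>no. norm ((LINT x|M. f n x * k x) - 0) < \<epsilon>" by blast
qed

section \<open>Classical gradients and translations\<close>

lemma lebesgue_translate:
  fixes c :: "'a::euclidean_space"
  shows measurable_lebesgue_translate: "(\<lambda>x. x + c) \<in> lebesgue \<rightarrow>\<^sub>M lebesgue"
    and distr_lebesgue_translate: "distr lebesgue lebesgue (\<lambda>x. x + c) = lebesgue"
proof -
  have T: "(\<lambda>x. c + (\<Sum>j\<in>Basis. (1 * (x \<bullet> j)) *\<^sub>R j)) = (\<lambda>x::'a. x + c)"
    by (simp add: euclidean_representation add.commute)
  show "(\<lambda>x. x + c) \<in> lebesgue \<rightarrow>\<^sub>M lebesgue"
    using lebesgue_affine_measurable[of "\<lambda>_. 1" c] by (simp add: T[simplified])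
  show "distr lebesgue lebesgue (\<lambda>x. x + c) = lebesgue"
    using lebesgue_affine_euclidean[of "\<lambda>_. 1" c] by (simp add: T[simplified] density_1)
qed

lemma integral_lebesgue_translate:
  fixes f :: "'a::euclidean_space \<Rightarrow> 'b::{banach, second_countable_topology}"
  assumes "f \<in> borel_measurable lebesgue"
  shows "(LINT x|lebesgue. f (x + c)) = (LINT x|lebesgue. f x)"
  using integral_distr[OF measurable_lebesgue_translate[of c] assms] by (simp add: distr_lebesgue_translate)

lemma integrable_lebesgue_translate:
  fixes f :: "'a::euclidean_space \<Rightarrow> 'b::{banach, second_countable_topology}"
  assumes "integrable lebesgue f"
  shows "integrable lebesgue (\<lambda>x. f (x + c))"
  using integrable_distr[OF measurable_lebesgue_translate[of c], of f] assms by (simp add: distr_lebesgue_translate)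

definition grad :: "('a::euclidean_space \<Rightarrow> real) \<Rightarrow> 'a \<Rightarrow> 'a" where
  "grad \<phi> x = (\<Sum>i\<in>Basis. frechet_derivative \<phi> (at x) i *\<^sub>R i)"

lemma grad_inner_Basis: "i \<in> Basis \<Longrightarrow> grad \<phi> x \<bullet> i = frechet_derivative \<phi> (at x) i"
  by (simp add: grad_def inner_sum_left_Basis)

lemma has_derivative_grad:
  assumes "Ck (Suc 0) \<phi>"
  shows "(\<phi> has_derivative (\<lambda>h. grad \<phi> x \<bullet> h)) (at x)"
proof -
  let ?D = "frechet_derivative \<phi> (at x)"
  have D: "(\<phi> has_derivative ?D) (at x)" by (rule Ck_Suc_has_derivative[OF assms])
  have "?D h = grad \<phi> x \<bullet> h" for h
  proof -
    have "?D h = ?D (\<Sum>i\<in>Basis. (h \<bullet> i) *\<^sub>R i)" by (simp add: euclidean_representation)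
    also have "\<dots> = (\<Sum>i\<in>Basis. (h \<bullet> i) * ?D i)"
      using has_derivative_linear[OF D] by (simp add: linear_sum linear_cmul)
    also have "\<dots> = grad \<phi> x \<bullet> h"
      unfolding grad_def inner_sum_left inner_scaleR_left
      by (intro sum.cong refl) (simp add: inner_commute)
    finally show ?thesis .
  qed
  then have "?D = (\<lambda>h. grad \<phi> x \<bullet> h)" by (intro ext)
  then show ?thesis using D by (simp only:)
qed

lemma grad_eqI:
  assumes "(\<phi> has_derivative (\<lambda>h. v \<bullet> h)) (at x)"
  shows "grad \<phi> x = v"
proof -
  have "frechet_derivative \<phi> (at x) = (\<lambda>h. v \<bullet> h)" using frechet_derivative_at[OF assms] by simp
  then show ?thesis by (simp add: grad_def euclidean_representation)
qed

lemma continuous_on_grad: "Ck (Suc 0) \<phi> \<Longrightarrow> continuous_on UNIV (grad \<phi>)"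
  unfolding grad_def by (intro continuous_on_sum continuous_on_scaleR continuous_on_const) auto

lemma grad_eq_0_off_support:
  assumes "closed K" "\<And>x. x \<notin> K \<Longrightarrow> \<phi> x = 0" "x \<notin> K"
  shows "grad \<phi> x = 0"
proof (rule grad_eqI)
  have "((\<lambda>_. 0::real) has_derivative (\<lambda>h. 0 \<bullet> h)) (at x)" by simp
  then show "(\<phi> has_derivative (\<lambda>h. 0 \<bullet> h)) (at x)"
    by (rule has_derivative_transform_within_open[of _ _ _ _ "- K"]) (use assms in auto)
qed

definition C1_supported :: "'a::euclidean_space set \<Rightarrow> ('a \<Rightarrow> real) \<Rightarrow> bool" where
  "C1_supported K \<phi> \<longleftrightarrow> Ck (Suc 0) \<phi> \<and> compact K \<and> (\<forall>x. x \<notin> K \<longrightarrow> \<phi> x = 0)"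

lemma test_function_C1_supported:
  assumes "\<phi> \<in> test_functions U"
  obtains K where "C1_supported K \<phi>" "K \<subseteq> U"
proof
  show "C1_supported (closure {x. \<phi> x \<noteq> 0}) \<phi>"
    using assms closure_subset[of "{x. \<phi> x \<noteq> 0}"] unfolding C1_supported_def test_functions_def by blast
  show "closure {x. \<phi> x \<noteq> 0} \<subseteq> U" using assms by (simp add: test_functions_def)
qed

lemma C1_supportedD:
  assumes "C1_supported K \<phi>"
  shows "Ck (Suc 0) \<phi>" "compact K" "closed K" "\<And>x. x \<notin> K \<Longrightarrow> \<phi> x = 0" "\<And>x. x \<notin> K \<Longrightarrow> grad \<phi> x = 0"
    "continuous_on UNIV \<phi>" "continuous_on UNIV (grad \<phi>)"
  using assms compact_imp_closed Ck_imp_continuous[of "Suc 0" \<phi>]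
  by (auto simp: C1_supported_def simp del: Ck.simps intro: continuous_on_grad grad_eq_0_off_support[of K])

lemma bounded_of_compact_support:
  fixes f :: "'a::euclidean_space \<Rightarrow> 'b::real_normed_vector"
  assumes "continuous_on UNIV f" "compact K" "\<And>x. x \<notin> K \<Longrightarrow> f x = 0"
  shows "\<exists>B\<ge>0. \<forall>x. norm (f x) \<le> B"
proof -
  have "bounded (f ` K)"
    using assms by (intro compact_imp_bounded compact_continuous_image continuous_on_subset[OF assms(1)]) auto
  then obtain B where B: "0 < B" "\<forall>y\<in>f ` K. norm y \<le> B" using bounded_pos by metis
  have "norm (f x) \<le> B" for x using B assms(3)[of x] by (cases "x \<in> K") auto
  then show ?thesis using B(1) by (intro exI[of _ B]) auto
qed

lemma C1_supported_bounds:
  assumes "C1_supported K \<phi>"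
  obtains B where "0 \<le> B" "\<And>x. \<bar>\<phi> x\<bar> \<le> B" "\<And>x. norm (grad \<phi> x) \<le> B"
    "\<And>x y. \<bar>\<phi> x - \<phi> y\<bar> \<le> B * norm (x - y)"
proof -
  note D = C1_supportedD[OF assms]
  obtain B1 where B1: "0 \<le> B1" "\<And>x. norm (\<phi> x) \<le> B1"
    using bounded_of_compact_support[OF D(6,2,4)] by auto
  obtain B2 where B2: "0 \<le> B2" "\<And>x. norm (grad \<phi> x) \<le> B2"
    using bounded_of_compact_support[OF D(7,2,5)] by auto
  have "norm (\<phi> x - \<phi> y) \<le> B2 * norm (x - y)" for x y
  proof (rule differentiable_bound[OF convex_UNIV])
    show "(\<phi> has_derivative (\<lambda>h. grad \<phi> z \<bullet> h)) (at z within UNIV)" for z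
      using has_derivative_grad[OF D(1)] by simp
    show "onorm (\<lambda>h. grad \<phi> z \<bullet> h) \<le> B2" for z
    proof (rule onorm_le)
      fix h
      have "norm (grad \<phi> z \<bullet> h) \<le> norm (grad \<phi> z) * norm h" by (simp add: Cauchy_Schwarz_ineq2)
      also have "\<dots> \<le> B2 * norm h" by (intro mult_right_mono B2) auto
      finally show "norm (grad \<phi> z \<bullet> h) \<le> B2 * norm h" .
    qed
  qed auto
  then have lip: "norm (\<phi> x - \<phi> y) \<le> B2 * norm (x - y)" for x y .
  show thesis
  proof (rule that[of "B1 + B2"])
    show "\<bar>\<phi> x - \<phi> y\<bar> \<le> (B1 + B2) * norm (x - y)" for x y
      using lip[of x y] mult_nonneg_nonneg[OF B1(1) norm_ge_zero[of "x - y"]]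
      unfolding distrib_right real_norm_def by linarith
    show "\<bar>\<phi> x\<bar> \<le> B1 + B2" for x using B1(2)[of x] B2(1) by simp
    show "norm (grad \<phi> x) \<le> B1 + B2" for x using B2(2)[of x] B1(1) by simp
  qed (use B1 B2 in auto)
qed

section \<open>Weak gradients\<close>

text \<open>The difference quotients of a \<open>C\<^sup>1\<close> function with compact support converge boundedly, with supports
  in one compact set, so they may be integrated against any locally integrable function.\<close>

lemma difference_quotient_integral:
  fixes u :: "'a::euclidean_space \<Rightarrow> real"
  assumes phi: "C1_supported K \<phi>" and u: "u \<in> borel_measurable lebesgue"
    and loc: "\<And>C. compact C \<Longrightarrow> integrable lebesgue (\<lambda>x. indicator C x * u x)"
  shows "((\<lambda>\<tau>. LINT x|lebesgue. u x * ((\<phi> (x + \<tau> *\<^sub>R h) - \<phi> x) / \<tau>)) \<longlongrightarrow>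
      (LINT x|lebesgue. u x * (grad \<phi> x \<bullet> h))) (at 0)"
  unfolding tendsto_at_iff_sequentially comp_def
proof (intro allI impI)
  fix T :: "nat \<Rightarrow> real"
  assume T0: "\<forall>i. T i \<in> UNIV - {0}" and T: "T \<longlonglongrightarrow> 0"
  note D = C1_supportedD[OF phi]
  obtain B where B: "0 \<le> B" "\<And>x. norm (grad \<phi> x) \<le> B" "\<And>x y. \<bar>\<phi> x - \<phi> y\<bar> \<le> B * norm (x - y)"
    by (rule C1_supported_bounds[OF phi]) (rule that)
  have "\<forall>\<^sub>F n in sequentially. norm (T n) < 1"
    using tendsto_norm_zero[OF T] by (intro order_tendstoD) auto
  then obtain n0 where n0: "\<And>n. n \<ge> n0 \<Longrightarrow> \<bar>T n\<bar> < 1" by (auto simp: eventually_sequentially)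
  define C where "C = (\<lambda>z. fst z - snd z *\<^sub>R h) ` (K \<times> {-1..1::real})"
  have C: "compact C" unfolding C_def using D(2)
    by (intro compact_continuous_image compact_Times continuous_intros) auto
  have CI: "x \<in> C" if "x + t *\<^sub>R h \<in> K" "\<bar>t\<bar> \<le> 1" for x t
    unfolding C_def by (rule image_eqI[of _ _ "(x + t *\<^sub>R h, t)"]) (use that in auto)
  have KC: "x \<in> C" if "x \<in> K" for x using CI[of x 0] that by simp
  let ?q = "\<lambda>t x. (\<phi> (x + t *\<^sub>R h) - \<phi> x) / t"
  have qb: "\<bar>?q t x\<bar> \<le> B * norm h * indicator C x" if "\<bar>t\<bar> < 1" "t \<noteq> 0" for t x
  proof (cases "x \<in> C")
    case True
    have "\<bar>?q t x\<bar> \<le> (B * norm (x + t *\<^sub>R h - x)) / \<bar>t\<bar>"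
      unfolding abs_divide by (intro divide_right_mono B) auto
    then show ?thesis using True that by simp
  next
    case False
    then have "\<phi> (x + t *\<^sub>R h) = 0" "\<phi> x = 0" using D(4) CI[of x t] KC[of x] that by force+
    then show ?thesis using B by simp
  qed
  have ctsm: "f \<in> borel_measurable lebesgue" if "continuous_on UNIV f" for f :: "'a \<Rightarrow> real"
    using that by (intro measurable_completion) (simp add: borel_measurable_continuous_onI)
  have m1: "?q t \<in> borel_measurable lebesgue" for t
  proof (rule ctsm)
    have "continuous_on UNIV (\<lambda>x. \<phi> (x + t *\<^sub>R h))"
      using D(6) by (rule continuous_on_compose2) (auto intro!: continuous_intros)
    then show "continuous_on UNIV (?q t)"
      using D(6) by (cases "t = 0") (auto intro!: continuous_on_divide continuous_on_diff continuous_on_const)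
  qed
  have m2: "(\<lambda>x. grad \<phi> x \<bullet> h) \<in> borel_measurable lebesgue"
    by (intro ctsm continuous_on_inner D(7) continuous_on_const)
  show "(\<lambda>n. LINT x|lebesgue. u x * ?q (T n) x) \<longlonglongrightarrow> (LINT x|lebesgue. u x * (grad \<phi> x \<bullet> h))"
  proof (rule LIMSEQ_offset[of _ n0], rule integral_dominated_convergence[where w="\<lambda>x. (B * norm h) * \<bar>indicator C x * u x\<bar>"])
    show "(\<lambda>x. u x * (grad \<phi> x \<bullet> h)) \<in> borel_measurable lebesgue" using u m2 by (rule borel_measurable_times)
    show "(\<lambda>x. u x * ?q (T (n + n0)) x) \<in> borel_measurable lebesgue" for n using u m1 by (rule borel_measurable_times)
    show "integrable lebesgue (\<lambda>x. (B * norm h) * \<bar>indicator C x * u x\<bar>)"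
      by (intro integrable_mult_right integrable_abs loc C)
    show "AE x in lebesgue. (\<lambda>n. u x * ?q (T (n + n0)) x) \<longlonglongrightarrow> u x * (grad \<phi> x \<bullet> h)"
    proof (rule AE_I2, rule tendsto_mult[OF tendsto_const])
      fix x
      have "((\<lambda>t. \<phi> (x + t *\<^sub>R h)) has_real_derivative grad \<phi> x \<bullet> h) (at 0)"
      proof -
        have "((\<lambda>t. x + t *\<^sub>R h) has_derivative (\<lambda>t. t *\<^sub>R h)) (at (0::real))"
          by (auto intro!: derivative_eq_intros)
        from has_derivative_compose[OF this, of \<phi> "\<lambda>k. grad \<phi> x \<bullet> k"] has_derivative_grad[OF D(1), of x]
        have "((\<lambda>t. \<phi> (x + t *\<^sub>R h)) has_derivative (\<lambda>t. grad \<phi> x \<bullet> (t *\<^sub>R h))) (at 0)" by simp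
        moreover have "(\<lambda>t. grad \<phi> x \<bullet> (t *\<^sub>R h)) = (*) (grad \<phi> x \<bullet> h)" by (simp add: fun_eq_iff mult.commute)
        ultimately show ?thesis by (simp add: has_field_derivative_def)
      qed
      then have "((\<lambda>t. ?q t x) \<longlongrightarrow> grad \<phi> x \<bullet> h) (at 0)"
        by (simp add: has_field_derivative_iff)
      then have "(\<lambda>n. ?q (T n) x) \<longlonglongrightarrow> grad \<phi> x \<bullet> h"
        unfolding tendsto_at_iff_sequentially comp_def using T0 T by blast
      then show "(\<lambda>n. ?q (T (n + n0)) x) \<longlonglongrightarrow> grad \<phi> x \<bullet> h" by (rule LIMSEQ_ignore_initial_segment)
    qed
    show "AE x in lebesgue. norm (u x * ?q (T (n + n0)) x) \<le> (B * norm h) * \<bar>indicator C x * u x\<bar>" for n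
    proof (rule AE_I2)
      fix x
      have "\<bar>?q (T (n + n0)) x\<bar> \<le> B * norm h * indicator C x"
        by (rule qb) (use n0 T0 in auto)
      then have "\<bar>u x\<bar> * \<bar>?q (T (n + n0)) x\<bar> \<le> \<bar>u x\<bar> * (B * norm h * indicator C x)"
        by (intro mult_left_mono) auto
      then show "norm (u x * ?q (T (n + n0)) x) \<le> (B * norm h) * \<bar>indicator C x * u x\<bar>"
        by (simp add: abs_mult mult.commute mult.left_commute)
    qed
  qed
qed

lemma borel_measurable_lebesgue_continuous:
  "continuous_on UNIV f \<Longrightarrow> f \<in> borel_measurable lebesgue"
  for f :: "'a::euclidean_space \<Rightarrow> 'b::euclidean_space"
  by (intro measurable_completion) (simp add: borel_measurable_continuous_onI)

lemma integrable_lebesgue_continuous_compact: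
  fixes f :: "'a::euclidean_space \<Rightarrow> 'b::euclidean_space"
  assumes "continuous_on UNIV f" "compact C"
  shows "integrable lebesgue (\<lambda>x. indicator C x *\<^sub>R f x)"
proof -
  have "integrable lborel (\<lambda>x. indicator C x *\<^sub>R f x)"
    using assms borel_integrable_compact[of C f] continuous_on_subset[of UNIV f C] by simp
  moreover have "(\<lambda>x. indicator C x *\<^sub>R f x) \<in> borel_measurable lborel"
    using calculation by (rule borel_measurable_integrable)
  ultimately show ?thesis by (simp add: integrable_completion)
qed

lemma integrable_lebesgue_compact_support:
  fixes f :: "'a::euclidean_space \<Rightarrow> 'b::euclidean_space"
  assumes "continuous_on UNIV f" "compact C" "\<And>x. x \<notin> C \<Longrightarrow> f x = 0"
  shows "integrable lebesgue f"
proof -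
  have "(\<lambda>x. indicator C x *\<^sub>R f x) = f" using assms(3) by (auto simp: indicator_def fun_eq_iff)
  then show ?thesis using integrable_lebesgue_continuous_compact[OF assms(1,2)] by simp
qed

text \<open>The derivative of the constant function \<open>t \<mapsto> \<integral> \<phi>(x + th) dx\<close>.\<close>

lemma integral_grad_eq_0:
  assumes phi: "C1_supported K \<phi>"
  shows "(LINT x|lebesgue. grad \<phi> x \<bullet> h) = 0"
proof -
  note D = C1_supportedD[OF phi]
  have i: "integrable lebesgue \<phi>" by (rule integrable_lebesgue_compact_support[OF D(6,2,4)])
  have "((\<lambda>\<tau>. LINT x|lebesgue. 1 * ((\<phi> (x + \<tau> *\<^sub>R h) - \<phi> x) / \<tau>)) \<longlongrightarrow>
      (LINT x|lebesgue. 1 * (grad \<phi> x \<bullet> h))) (at 0)"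
    by (rule difference_quotient_integral[OF phi])
       (use integrable_lebesgue_continuous_compact[of "\<lambda>_. 1::real"] in auto)
  moreover
  have "(LINT x|lebesgue. 1 * ((\<phi> (x + \<tau> *\<^sub>R h) - \<phi> x) / \<tau>)) = 0" for \<tau>
    using integrable_lebesgue_translate[OF i, of "\<tau> *\<^sub>R h"] i
      integral_lebesgue_translate[OF borel_measurable_integrable[OF i], of "\<tau> *\<^sub>R h"] by simp
  then have "(\<lambda>\<tau>. LINT x|lebesgue. 1 * ((\<phi> (x + \<tau> *\<^sub>R h) - \<phi> x) / \<tau>)) = (\<lambda>\<tau>. 0)" by (intro ext)
  ultimately have "((\<lambda>\<tau>::real. 0::real) \<longlongrightarrow> (LINT x|lebesgue. 1 * (grad \<phi> x \<bullet> h))) (at 0)" by (simp only:)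
  then show ?thesis by (simp add: tendsto_const_iff)
qed

lemma Lp_loc_1_iff:
  "u \<in> Lp_loc 1 U \<longleftrightarrow> (\<forall>K. compact K \<and> K \<subseteq> U \<longrightarrow> integrable lebesgue (\<lambda>x. indicator K x *\<^sub>R u x))"
proof -
  have "u \<in> Lp_on 1 K \<longleftrightarrow> integrable lebesgue (\<lambda>x. indicator K x *\<^sub>R u x)" if K: "compact K" for K
  proof -
    have [measurable]: "K \<in> sets lebesgue" using K by (intro sets_completionI_sets) (simp add: compact_imp_closed borel_closed)
    have "u \<in> Lp_on 1 K \<longleftrightarrow> u \<in> borel_measurable (lebesgue_on K) \<and> integrable (lebesgue_on K) (\<lambda>x. norm (u x))"
      by (simp add: Lp_on_def powr_one')
    also have "\<dots> \<longleftrightarrow> integrable (lebesgue_on K) u"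
      using integrable_norm_iff[of u "lebesgue_on K"] by auto
    finally show ?thesis by (simp add: integrable_lebesgue_on_iff)
  qed
  then show ?thesis unfolding Lp_loc_def by blast
qed

lemma Lp_loc_1_integrable_times:
  fixes u :: "'a::euclidean_space \<Rightarrow> real"
  assumes u: "u \<in> Lp_loc 1 U" and k: "continuous_on UNIV k" "compact K" "K \<subseteq> U" "\<And>x. x \<notin> K \<Longrightarrow> k x = 0"
  shows "integrable lebesgue (\<lambda>x. u x * k x)"
proof -
  obtain B where B: "\<And>x. norm (k x) \<le> B" using bounded_of_compact_support[OF k(1,2,4)] by auto
  have i: "integrable lebesgue (\<lambda>x. indicator K x * u x)" using u k(2,3) by (auto simp: Lp_loc_1_iff)
  have "integrable lebesgue (\<lambda>x. k x * (indicator K x * u x))"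
  proof (rule Bochner_Integration.integrable_bound)
    show "integrable lebesgue (\<lambda>x. B * (indicator K x * u x))" using i by (rule integrable_mult_right)
    show "(\<lambda>x. k x * (indicator K x * u x)) \<in> borel_measurable lebesgue"
      by (intro borel_measurable_times[OF borel_measurable_lebesgue_continuous[OF k(1)]] borel_measurable_integrable i)
    show "AE x in lebesgue. norm (k x * (indicator K x * u x)) \<le> norm (B * (indicator K x * u x))"
      unfolding norm_mult using B by (intro AE_I2 mult_right_mono) (auto intro: order_trans[OF _ abs_ge_self])
  qed
  moreover have "(\<lambda>x. k x * (indicator K x * u x)) = (\<lambda>x. u x * k x)"
    using k(4) by (auto simp: fun_eq_iff indicator_def)
  ultimately show ?thesis by simp
qed

lemma integral_lebesgue_on_test:
  fixes f :: "'a::euclidean_space \<Rightarrow> real"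
  assumes "open U" "\<And>x. x \<notin> U \<Longrightarrow> f x = 0"
  shows "(LINT x|lebesgue_on U. f x) = (LINT x|lebesgue. f x)"
proof -
  have "(\<lambda>x. indicator U x *\<^sub>R f x) = f" using assms(2) by (auto simp: indicator_def fun_eq_iff)
  then show ?thesis using assms(1) by (simp add: integral_lebesgue_on_eq)
qed

lemma is_weak_gradient_iff:
  assumes U: "open U"
  shows "is_weak_gradient U u G \<longleftrightarrow> u \<in> Lp_loc 1 U \<and> G \<in> Lp_loc 1 U \<and>
    (\<forall>\<psi>\<in>test_functions U. \<forall>i\<in>Basis. (LINT x|lebesgue. u x * (grad \<psi> x \<bullet> i)) = - (LINT x|lebesgue. (G x \<bullet> i) * \<psi> x))"
proof -
  have "(LINT x|lebesgue_on U. u x * frechet_derivative \<psi> (at x) i) = (LINT x|lebesgue. u x * (grad \<psi> x \<bullet> i))"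
    "(LINT x|lebesgue_on U. (G x \<bullet> i) * \<psi> x) = (LINT x|lebesgue. (G x \<bullet> i) * \<psi> x)"
    if psi: "\<psi> \<in> test_functions U" and i: "i \<in> Basis" for \<psi> i
  proof -
    obtain K where K: "C1_supported K \<psi>" "K \<subseteq> U" using test_function_C1_supported[OF psi] .
    note D = C1_supportedD[OF K(1)]
    show "(LINT x|lebesgue_on U. u x * frechet_derivative \<psi> (at x) i) = (LINT x|lebesgue. u x * (grad \<psi> x \<bullet> i))"
    proof -
      have "grad \<psi> x = 0" if "x \<notin> U" for x using D(5) K(2) that by blast
      then show ?thesis by (subst integral_lebesgue_on_test[OF U, symmetric]) (simp_all add: grad_inner_Basis[OF i])
    qed
    show "(LINT x|lebesgue_on U. (G x \<bullet> i) * \<psi> x) = (LINT x|lebesgue. (G x \<bullet> i) * \<psi> x)"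
      using D(4) K(2) by (intro integral_lebesgue_on_test[OF U]) auto
  qed
  then show ?thesis unfolding is_weak_gradient_def by auto
qed

lemma Lp_loc_1_inner: "G \<in> Lp_loc 1 U \<Longrightarrow> (\<lambda>x. G x \<bullet> c) \<in> Lp_loc 1 U"
  for G :: "'a::euclidean_space \<Rightarrow> 'b::euclidean_space"
  unfolding Lp_loc_1_iff
proof (intro allI impI)
  fix K assume G: "\<forall>K. compact K \<and> K \<subseteq> U \<longrightarrow> integrable lebesgue (\<lambda>x. indicator K x *\<^sub>R G x)" and K: "compact K \<and> K \<subseteq> U"
  then have "integrable lebesgue (\<lambda>x. (indicator K x *\<^sub>R G x) \<bullet> c)" by (intro integrable_inner_left) auto
  then show "integrable lebesgue (\<lambda>x. indicator K x *\<^sub>R (G x \<bullet> c))" by simp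
qed

lemma Lp_loc_1_add: "u \<in> Lp_loc 1 U \<Longrightarrow> v \<in> Lp_loc 1 U \<Longrightarrow> (\<lambda>x. u x + v x) \<in> Lp_loc 1 U"
  unfolding Lp_loc_1_iff scaleR_add_right by (auto intro: Bochner_Integration.integrable_add)

lemma Lp_loc_1_scaleR: "u \<in> Lp_loc 1 U \<Longrightarrow> (\<lambda>x. t *\<^sub>R u x) \<in> Lp_loc 1 U"
  for u :: "'a::euclidean_space \<Rightarrow> 'b::euclidean_space"
  unfolding Lp_loc_1_iff
proof (intro allI impI)
  fix K assume G: "\<forall>K. compact K \<and> K \<subseteq> U \<longrightarrow> integrable lebesgue (\<lambda>x. indicator K x *\<^sub>R u x)" and K: "compact K \<and> K \<subseteq> U"
  then have "integrable lebesgue (\<lambda>x. t *\<^sub>R (indicator K x *\<^sub>R u x))" by (intro integrable_scaleR_right) auto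
  then show "integrable lebesgue (\<lambda>x. indicator K x *\<^sub>R (t *\<^sub>R u x))" by (simp add: mult.commute)
qed

lemma Lp_loc_1_continuous: "continuous_on UNIV f \<Longrightarrow> f \<in> Lp_loc 1 U"
  for f :: "'a::euclidean_space \<Rightarrow> 'b::euclidean_space"
  by (simp add: Lp_loc_1_iff integrable_lebesgue_continuous_compact)

text \<open>Integration by parts: the integral of \<open>\<nabla>(\<phi>\<psi>)\<close> vanishes.\<close>

lemma weak_gradient_classical:
  assumes U: "open U" and phi: "Ck (Suc 0) \<phi>"
  shows "is_weak_gradient U \<phi> (grad \<phi>)"
  unfolding is_weak_gradient_iff[OF U]
proof (intro conjI ballI)
  have c: "continuous_on UNIV \<phi>" "continuous_on UNIV (grad \<phi>)"
    using phi Ck_imp_continuous continuous_on_grad by blast+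
  show "\<phi> \<in> Lp_loc 1 U" "grad \<phi> \<in> Lp_loc 1 U" using c by (auto intro: Lp_loc_1_continuous)
  fix \<psi> i assume psi: "\<psi> \<in> test_functions U" and i: "(i::'a) \<in> Basis"
  obtain K where K: "C1_supported K \<psi>" "K \<subseteq> U" using test_function_C1_supported[OF psi] .
  note D = C1_supportedD[OF K(1)]
  have prod: "C1_supported K (\<lambda>x. \<phi> x * \<psi> x)"
    using D(4) Ck_mult[OF phi D(1)] D(2) by (simp add: C1_supported_def del: Ck.simps)
  have g: "grad (\<lambda>x. \<phi> x * \<psi> x) x = \<phi> x *\<^sub>R grad \<psi> x + \<psi> x *\<^sub>R grad \<phi> x" for x
    by (rule grad_eqI, rule has_derivative_eq_rhs[OF has_derivative_mult[OF has_derivative_grad[OF phi] has_derivative_grad[OF D(1)]]])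
       (simp add: fun_eq_iff inner_add_left mult.commute)
  have i1: "integrable lebesgue (\<lambda>x. \<phi> x * (grad \<psi> x \<bullet> i))"
    by (rule integrable_lebesgue_compact_support[of _ K]) (use D c in \<open>auto intro!: continuous_intros\<close>)
  have i2: "integrable lebesgue (\<lambda>x. (grad \<phi> x \<bullet> i) * \<psi> x)"
    by (rule integrable_lebesgue_compact_support[of _ K]) (use D c in \<open>auto intro!: continuous_intros\<close>)
  have "(LINT x|lebesgue. \<phi> x * (grad \<psi> x \<bullet> i) + (grad \<phi> x \<bullet> i) * \<psi> x) = 0"
    using integral_grad_eq_0[OF prod, of i] by (simp add: g inner_add_left mult.commute)
  then show "(LINT x|lebesgue. \<phi> x * (grad \<psi> x \<bullet> i)) = - (LINT x|lebesgue. (grad \<phi> x \<bullet> i) * \<psi> x)"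
    using i1 i2 by simp
qed

lemma weak_gradient_unique:
  assumes U: "open U" and u: "is_weak_gradient U u G" "is_weak_gradient U u' H"
    and eq: "\<And>x. x \<in> U \<Longrightarrow> u x = u' x"
  shows "AE x in lebesgue. x \<in> U \<longrightarrow> G x = H x"
proof -
  note u = u[unfolded is_weak_gradient_iff[OF U]]
  have "AE x in lebesgue. x \<in> U \<longrightarrow> (G x - H x) \<bullet> i = 0" if i: "i \<in> Basis" for i
  proof (rule AE_eq_0_of_test_integrals[OF U])
    have G: "(\<lambda>x. G x \<bullet> i) \<in> Lp_loc 1 U" "(\<lambda>x. H x \<bullet> i) \<in> Lp_loc 1 U" using u Lp_loc_1_inner by blast+
    show "(\<lambda>x. (G x - H x) \<bullet> i) \<in> Lp_loc 1 U"
      using Lp_loc_1_add[OF G(1) Lp_loc_1_scaleR[OF G(2), of "-1"]] by (simp add: inner_diff_left)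
    fix \<psi> assume psi: "\<psi> \<in> test_functions U"
    obtain K where K: "C1_supported K \<psi>" "K \<subseteq> U" using test_function_C1_supported[OF psi] .
    note D = C1_supportedD[OF K(1)]
    have int: "integrable lebesgue (\<lambda>x. (G x \<bullet> i) * \<psi> x)" "integrable lebesgue (\<lambda>x. (H x \<bullet> i) * \<psi> x)"
      by (rule Lp_loc_1_integrable_times[OF _ D(6,2) K(2) D(4)]; use G in simp)+
    have "u x * (grad \<psi> x \<bullet> i) = u' x * (grad \<psi> x \<bullet> i)" for x
    proof (cases "x \<in> U")
      case False
      then have "grad \<psi> x = 0" using D(5) K(2) by blast
      then show ?thesis by simp
    qed (simp add: eq)
    then have "(\<lambda>x. u x * (grad \<psi> x \<bullet> i)) = (\<lambda>x. u' x * (grad \<psi> x \<bullet> i))" by (intro ext)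
    moreover have "(LINT x|lebesgue. u x * (grad \<psi> x \<bullet> i)) = - (LINT x|lebesgue. (G x \<bullet> i) * \<psi> x)"
      "(LINT x|lebesgue. u' x * (grad \<psi> x \<bullet> i)) = - (LINT x|lebesgue. (H x \<bullet> i) * \<psi> x)"
      using u psi i by blast+
    ultimately have "(LINT x|lebesgue. (G x \<bullet> i) * \<psi> x) = (LINT x|lebesgue. (H x \<bullet> i) * \<psi> x)"
      by simp
    then have "(LINT x|lebesgue. ((G x - H x) \<bullet> i) * \<psi> x) = 0"
      using int by (simp add: inner_diff_left left_diff_distrib)
    then show "(LINT x|lebesgue_on U. ((G x - H x) \<bullet> i) * \<psi> x) = 0"
      using D(4) K(2) by (subst integral_lebesgue_on_test[OF U]) auto
  qed
  then have "AE x in lebesgue. \<forall>i\<in>Basis. x \<in> U \<longrightarrow> (G x - H x) \<bullet> i = 0"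
    by (rule AE_finite_allI[OF finite_Basis])
  then show ?thesis
  proof eventually_elim
    case (elim x)
    then show ?case by (metis euclidean_eqI inner_zero_left right_minus_eq)
  qed
qed

lemma weak_gradient_add:
  assumes U: "open U" and u: "is_weak_gradient U u G" "is_weak_gradient U v H"
  shows "is_weak_gradient U (\<lambda>x. u x + v x) (\<lambda>x. G x + H x)"
  unfolding is_weak_gradient_iff[OF U]
proof (intro conjI ballI)
  note u = u[unfolded is_weak_gradient_iff[OF U]]
  show "(\<lambda>x. u x + v x) \<in> Lp_loc 1 U" "(\<lambda>x. G x + H x) \<in> Lp_loc 1 U" using u by (auto intro: Lp_loc_1_add)
  fix \<psi> i assume psi: "\<psi> \<in> test_functions U" and i: "(i::'a) \<in> Basis"
  obtain K where K: "C1_supported K \<psi>" "K \<subseteq> U" using test_function_C1_supported[OF psi] .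
  note D = C1_supportedD[OF K(1)]
  have "integrable lebesgue (\<lambda>x. (G x \<bullet> i) * \<psi> x)" "integrable lebesgue (\<lambda>x. (H x \<bullet> i) * \<psi> x)"
    by (rule Lp_loc_1_integrable_times[OF _ D(6,2) K(2) D(4)]; use u Lp_loc_1_inner in blast)+
  moreover have "integrable lebesgue (\<lambda>x. u x * (grad \<psi> x \<bullet> i))" "integrable lebesgue (\<lambda>x. v x * (grad \<psi> x \<bullet> i))"
    by (rule Lp_loc_1_integrable_times[OF _ _ D(2) K(2)]; use u D in \<open>auto intro!: continuous_intros\<close>)+
  ultimately show "(LINT x|lebesgue. (u x + v x) * (grad \<psi> x \<bullet> i)) = - (LINT x|lebesgue. ((G x + H x) \<bullet> i) * \<psi> x)"
    using u psi i by (simp add: distrib_right inner_add_left)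
qed

lemma weak_gradient_scale:
  assumes U: "open U" and u: "is_weak_gradient U u G"
  shows "is_weak_gradient U (\<lambda>x. t * u x) (\<lambda>x. t *\<^sub>R G x)"
  unfolding is_weak_gradient_iff[OF U]
proof (intro conjI ballI)
  note u = u[unfolded is_weak_gradient_iff[OF U]]
  show "(\<lambda>x. t * u x) \<in> Lp_loc 1 U" "(\<lambda>x. t *\<^sub>R G x) \<in> Lp_loc 1 U"
    using u Lp_loc_1_scaleR[of u U t] Lp_loc_1_scaleR[of G U t] by auto
  fix \<psi> i assume psi: "\<psi> \<in> test_functions U" and i: "(i::'a) \<in> Basis"
  then show "(LINT x|lebesgue. (t * u x) * (grad \<psi> x \<bullet> i)) = - (LINT x|lebesgue. ((t *\<^sub>R G x) \<bullet> i) * \<psi> x)"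
    using u by (simp add: mult.assoc)
qed

lemma weak_gradient_diff:
  assumes U: "open U" and u: "is_weak_gradient U u G" "is_weak_gradient U v H"
  shows "is_weak_gradient U (\<lambda>x. u x - v x) (\<lambda>x. G x - H x)"
  using weak_gradient_add[OF U u(1) weak_gradient_scale[OF U u(2), of "-1"]] by simp

lemma weak_gradient_cong:
  assumes U: "open U" and u: "is_weak_gradient U u G" and eq: "\<And>x. x \<in> U \<Longrightarrow> u x = u' x" "\<And>x. x \<in> U \<Longrightarrow> G x = G' x"
  shows "is_weak_gradient U u' G'"
proof -
  have L: "f' \<in> Lp_loc 1 U" if "f \<in> Lp_loc 1 U" "\<And>x. x \<in> U \<Longrightarrow> f x = f' x" for f f' :: "'a \<Rightarrow> 'b::euclidean_space"
    unfolding Lp_loc_1_iff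
  proof (intro allI impI)
    fix K assume K: "compact K \<and> K \<subseteq> U"
    then have "(\<lambda>x. indicator K x *\<^sub>R f' x) = (\<lambda>x. indicator K x *\<^sub>R f x)"
      using that(2) by (auto simp: indicator_def fun_eq_iff)
    then show "integrable lebesgue (\<lambda>x. indicator K x *\<^sub>R f' x)" using that(1) K by (simp add: Lp_loc_1_iff)
  qed
  note u = u[unfolded is_weak_gradient_iff[OF U]]
  show ?thesis unfolding is_weak_gradient_iff[OF U]
  proof (intro conjI ballI)
    show "u' \<in> Lp_loc 1 U" "G' \<in> Lp_loc 1 U" using u eq L by blast+
    fix \<psi> i assume psi: "\<psi> \<in> test_functions U" and i: "(i::'a) \<in> Basis"
    obtain K where K: "C1_supported K \<psi>" "K \<subseteq> U" using test_function_C1_supported[OF psi] .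
    note D = C1_supportedD[OF K(1)]
    have "(\<lambda>x. u' x * (grad \<psi> x \<bullet> i)) = (\<lambda>x. u x * (grad \<psi> x \<bullet> i))" "(\<lambda>x. (G' x \<bullet> i) * \<psi> x) = (\<lambda>x. (G x \<bullet> i) * \<psi> x)"
      using eq D(4,5) K(2) by (auto simp: fun_eq_iff) (metis subsetD inner_zero_left mult_zero_right)+
    then show "(LINT x|lebesgue. u' x * (grad \<psi> x \<bullet> i)) = - (LINT x|lebesgue. (G' x \<bullet> i) * \<psi> x)"
      using u psi i by simp
  qed
qed

lemma Lp_loc_1_Lpm:
  fixes f :: "'a::euclidean_space \<Rightarrow> 'b::euclidean_space"
  assumes p: "1 < p" and U: "open U" and f: "f \<in> Lpm p (lebesgue_on U)"
  shows "f \<in> Lp_loc 1 U"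
  unfolding Lp_loc_1_iff
proof (intro allI impI)
  fix K assume K: "compact K \<and> K \<subseteq> U"
  have Us: "U \<in> sets lebesgue" using U by auto
  have Ks: "K \<in> sets lebesgue" using K by (intro sets_completionI_sets) (simp add: compact_imp_closed borel_closed)
  have "emeasure lebesgue K < \<infinity>" using K emeasure_bounded_finite[of K]
    by (simp add: compact_imp_closed compact_imp_bounded borel_closed)
  then have "integrable (lebesgue_on U) (\<lambda>x. indicator K x *\<^sub>R f x)"
    using K Ks Us by (intro Lpm_integrable_on_finite[OF p f])
      (auto simp: sets_restrict_space emeasure_restrict_space Int_absorb1)
  then have "integrable lebesgue (\<lambda>x. indicator U x *\<^sub>R indicator K x *\<^sub>R f x)"
    using Us by (simp add: integrable_lebesgue_on_iff)
  moreover have "(\<lambda>x. indicator U x *\<^sub>R indicator K x *\<^sub>R f x) = (\<lambda>x. indicator K x *\<^sub>R f x)"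
    using K by (auto simp: fun_eq_iff indicator_def)
  ultimately show "integrable lebesgue (\<lambda>x. indicator K x *\<^sub>R f x)" by simp
qed

lemma tendsto_0_of_less_inverse:
  fixes a :: "nat \<Rightarrow> real"
  assumes "\<And>n. 0 \<le> a n" "\<And>n. a n < 1 / real (Suc n)"
  shows "a \<longlonglongrightarrow> 0"
proof (rule tendsto_sandwich[OF _ _ tendsto_const LIMSEQ_Suc[OF lim_1_over_n]])
  show "\<forall>\<^sub>F n in sequentially. 0 \<le> a n" using assms(1) by (intro always_eventually allI)
  show "\<forall>\<^sub>F n in sequentially. a n \<le> 1 / real (Suc n)"
    using less_imp_le[OF assms(2)] by (intro always_eventually allI)
qed

lemma sets_lebesgue_open: "open U \<Longrightarrow> U \<in> sets lebesgue"
  by (intro sets_completionI_sets) simp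

lemma AE_lebesgue_on: "open U \<Longrightarrow> (AE x in lebesgue_on U. P x) \<longleftrightarrow> (AE x in lebesgue. x \<in> U \<longrightarrow> P x)"
  by (subst AE_restrict_space_iff) (auto intro: sets_lebesgue_open)

lemma measurable_lebesgue_on_iff:
  fixes f :: "'a::euclidean_space \<Rightarrow> 'b::euclidean_space"
  assumes "open U"
  shows "f \<in> borel_measurable (lebesgue_on U) \<longleftrightarrow> (\<lambda>x. indicator U x *\<^sub>R f x) \<in> borel_measurable lebesgue"
  by (rule borel_measurable_restrict_space_iff) (simp add: sets_lebesgue_open[OF assms])

lemma Lpm_AE_cong:
  fixes f g :: "'a::euclidean_space \<Rightarrow> 'b::euclidean_space"
  assumes U: "open U" and f: "f \<in> Lpm p (lebesgue_on U)" and eq: "AE x in lebesgue. x \<in> U \<longrightarrow> f x = g x"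
  shows "g \<in> Lpm p (lebesgue_on U)"
proof (rule LpmI)
  show g: "g \<in> borel_measurable (lebesgue_on U)"
    unfolding measurable_lebesgue_on_iff[OF U]
  proof (rule borel_measurable_AE)
    show "(\<lambda>x. indicator U x *\<^sub>R f x) \<in> borel_measurable lebesgue"
      using LpmD(1)[OF f] unfolding measurable_lebesgue_on_iff[OF U] .
    show "AE x in lebesgue. indicator U x *\<^sub>R f x = indicator U x *\<^sub>R g x"
      using eq by eventually_elim (auto simp: indicator_def)
  qed
  note [measurable] = g LpmD(1)[OF f]
  have "AE x in lebesgue_on U. norm (f x) powr p = norm (g x) powr p"
    unfolding AE_lebesgue_on[OF U] using eq by eventually_elim auto
  then show "integrable (lebesgue_on U) (\<lambda>x. norm (g x) powr p)"
    using LpmD(2)[OF f] by (subst integrable_cong_AE[of _ _ "\<lambda>x. norm (f x) powr p"]) auto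
qed

lemma integral_lebesgue_on_AE_cong:
  fixes f g :: "'a::euclidean_space \<Rightarrow> 'b::euclidean_space"
  assumes U: "open U" and m: "f \<in> borel_measurable (lebesgue_on U)" "g \<in> borel_measurable (lebesgue_on U)"
    and eq: "AE x in lebesgue. x \<in> U \<longrightarrow> f x = g x"
  shows "integral\<^sup>L (lebesgue_on U) f = integral\<^sup>L (lebesgue_on U) g"
  using m eq by (intro integral_cong_AE) (auto simp: AE_lebesgue_on[OF U])

lemma weak_grad_eq:
  assumes U: "open U" and G: "is_weak_gradient U u G"
  shows "is_weak_gradient U u (weak_grad U u)" "AE x in lebesgue. x \<in> U \<longrightarrow> weak_grad U u x = G x"
proof -
  show w: "is_weak_gradient U u (weak_grad U u)" unfolding weak_grad_def using G by (rule someI[where P="is_weak_gradient U u"])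
  show "AE x in lebesgue. x \<in> U \<longrightarrow> weak_grad U u x = G x"
    by (rule weak_gradient_unique[OF U w G]) simp
qed

lemma W1p_iff:
  assumes p: "1 < p" and U: "open U"
  shows "u \<in> W1p p U \<longleftrightarrow> u \<in> Lpm p (lebesgue_on U) \<and> is_weak_gradient U u (weak_grad U u)
    \<and> weak_grad U u \<in> Lpm p (lebesgue_on U)"
proof
  assume "u \<in> W1p p U"
  then obtain G where u: "u \<in> Lpm p (lebesgue_on U)" and G: "is_weak_gradient U u G" "G \<in> Lpm p (lebesgue_on U)"
    using p by (auto simp: W1p_def Lp_on_eq_Lpm)
  have "AE x in lebesgue. x \<in> U \<longrightarrow> G x = weak_grad U u x"
    using weak_grad_eq(2)[OF U G(1)] by eventually_elim simp
  then show "u \<in> Lpm p (lebesgue_on U) \<and> is_weak_gradient U u (weak_grad U u) \<and> weak_grad U u \<in> Lpm p (lebesgue_on U)"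
    using u weak_grad_eq(1)[OF U G(1)] Lpm_AE_cong[OF U G(2)] by blast
next
  assume "u \<in> Lpm p (lebesgue_on U) \<and> is_weak_gradient U u (weak_grad U u) \<and> weak_grad U u \<in> Lpm p (lebesgue_on U)"
  then show "u \<in> W1p p U" using p by (auto simp: W1p_def Lp_on_eq_Lpm)
qed

lemma W1pI:
  assumes "1 < p" "u \<in> Lpm p (lebesgue_on U)" "is_weak_gradient U u G" "G \<in> Lpm p (lebesgue_on U)"
  shows "u \<in> W1p p U"
  using assms by (auto simp: W1p_def Lp_on_eq_Lpm)

lemma Lpm_continuous_compact_support:
  fixes f :: "'a::euclidean_space \<Rightarrow> 'b::euclidean_space"
  assumes p: "1 < p" and U: "open U" and f: "continuous_on UNIV f" "compact K" "\<And>x. x \<notin> K \<Longrightarrow> f x = 0"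
  shows "f \<in> Lpm p (lebesgue_on U)"
proof (rule LpmI)
  have fm: "f \<in> borel_measurable lebesgue" using f(1) by (rule borel_measurable_lebesgue_continuous)
  then show "f \<in> borel_measurable (lebesgue_on U)" by (rule measurable_restrict_space1)
  have "integrable lebesgue (\<lambda>x. norm (f x) powr p)"
  proof (rule integrable_lebesgue_compact_support[OF _ f(2)])
    show "continuous_on UNIV (\<lambda>x. norm (f x) powr p)"
      using p f(1) by (intro continuous_on_powr' continuous_on_norm continuous_on_const) auto
  qed (simp add: f(3))
  then have "integrable lebesgue (\<lambda>x. indicator U x *\<^sub>R norm (f x) powr p)"
    by (rule integrable_mult_indicator[OF sets_lebesgue_open[OF U]])
  then show "integrable (lebesgue_on U) (\<lambda>x. norm (f x) powr p)"
    by (simp add: integrable_lebesgue_on_iff[OF sets_lebesgue_open[OF U]])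
qed

lemma test_function_Lpm:
  assumes p: "1 < p" and U: "open U" and phi: "\<phi> \<in> test_functions U"
  shows "\<phi> \<in> Lpm p (lebesgue_on U)" "grad \<phi> \<in> Lpm p (lebesgue_on U)" "is_weak_gradient U \<phi> (grad \<phi>)"
proof -
  obtain K where K: "C1_supported K \<phi>" using test_function_C1_supported[OF phi] .
  note D = C1_supportedD[OF K]
  show "\<phi> \<in> Lpm p (lebesgue_on U)" "grad \<phi> \<in> Lpm p (lebesgue_on U)"
    using D by (auto intro!: Lpm_continuous_compact_support[OF p U])
  show "is_weak_gradient U \<phi> (grad \<phi>)" using weak_gradient_classical[OF U D(1)] .
qed

text \<open>The \<open>p\<close>-th power of the distance in \<open>W\<^sup>1\<^sup>,\<^sup>p\<close>. The gradients are arguments: the chosen weak gradient of a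
  difference is only almost everywhere the difference of the chosen ones.\<close>

definition sobolev_dist where
  "sobolev_dist p U u G v H = (LINT x|lebesgue_on U. norm (u x - v x) powr p)
    + (LINT x|lebesgue_on U. norm (G x - H x) powr p)"

text \<open>Replaces the chosen weak gradient of the difference by the difference of the gradients.\<close>

lemma W1p_norm_test_diff:
  assumes p: "1 < p" and U: "open U" and phi: "\<phi> \<in> test_functions U" and u: "u \<in> W1p p U"
  shows "W1p_norm p U (\<lambda>x. \<phi> x - u x) = sobolev_dist p U \<phi> (grad \<phi>) u (weak_grad U u) powr (1 / p)"
proof -
  note u = u[unfolded W1p_iff[OF p U]] and phi = test_function_Lpm[OF p U phi]
  have d: "is_weak_gradient U (\<lambda>x. \<phi> x - u x) (\<lambda>x. grad \<phi> x - weak_grad U u x)"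
    using u phi by (intro weak_gradient_diff[OF U]) auto
  have L: "(\<lambda>x. grad \<phi> x - weak_grad U u x) \<in> Lpm p (lebesgue_on U)"
    using u phi p by (intro Lpm_diff) auto
  have "AE x in lebesgue. x \<in> U \<longrightarrow> grad \<phi> x - weak_grad U u x = weak_grad U (\<lambda>x. \<phi> x - u x) x"
    using weak_grad_eq(2)[OF U d] by eventually_elim simp
  from this Lpm_AE_cong[OF U L this] LpmD(1)[OF L]
  have "(LINT x|lebesgue_on U. norm (weak_grad U (\<lambda>x. \<phi> x - u x) x) powr p) = (LINT x|lebesgue_on U. norm (grad \<phi> x - weak_grad U u x) powr p)"
    by (intro integral_lebesgue_on_AE_cong[OF U]) (auto dest: LpmD(1))
  then show ?thesis by (simp add: W1p_norm_def sobolev_dist_def)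
qed

lemma sobolev_dist_nonneg: "0 \<le> sobolev_dist p U u G v H"
  by (simp add: sobolev_dist_def)

lemma W1p_0_approx:
  assumes p: "1 < p" and U: "open U" and u: "u \<in> W1p_0 p U" and e: "0 < \<epsilon>"
  shows "\<exists>\<phi>\<in>test_functions U. sobolev_dist p U \<phi> (grad \<phi>) u (weak_grad U u) < \<epsilon>"
proof -
  obtain \<phi> where phi: "\<And>n. \<phi> n \<in> test_functions U" "(\<lambda>n::nat. W1p_norm p U (\<lambda>x. \<phi> n x - u x)) \<longlonglongrightarrow> 0"
    and u': "u \<in> W1p p U" using u by (auto simp: W1p_0_def)
  have "\<forall>\<^sub>F n in sequentially. W1p_norm p U (\<lambda>x. \<phi> n x - u x) < \<epsilon> powr (1 / p)"
    using phi(2) e by (intro order_tendstoD) auto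
  then obtain n where "W1p_norm p U (\<lambda>x. \<phi> n x - u x) < \<epsilon> powr (1 / p)"
    by (auto simp: eventually_sequentially)
  then have "sobolev_dist p U (\<phi> n) (grad (\<phi> n)) u (weak_grad U u) powr (1 / p) < \<epsilon> powr (1 / p)"
    by (simp add: W1p_norm_test_diff[OF p U phi(1) u'])
  then have "sobolev_dist p U (\<phi> n) (grad (\<phi> n)) u (weak_grad U u) < \<epsilon>"
    using p e powr_mono2[of "1/p" \<epsilon> "sobolev_dist p U (\<phi> n) (grad (\<phi> n)) u (weak_grad U u)"]
    by (cases "\<epsilon> \<le> sobolev_dist p U (\<phi> n) (grad (\<phi> n)) u (weak_grad U u)") auto
  then show ?thesis using phi(1) by blast
qed

lemma W1p_0I:
  assumes p: "1 < p" and U: "open U" and u: "u \<in> W1p p U"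
    and a: "\<And>\<epsilon>. 0 < \<epsilon> \<Longrightarrow> \<exists>\<phi>\<in>test_functions U. sobolev_dist p U \<phi> (grad \<phi>) u (weak_grad U u) < \<epsilon>"
  shows "u \<in> W1p_0 p U"
proof -
  have "\<forall>n. \<exists>\<phi>\<in>test_functions U. sobolev_dist p U \<phi> (grad \<phi>) u (weak_grad U u) < 1 / real (Suc n)"
    using a by simp
  then obtain \<phi> where phi: "\<And>n. \<phi> n \<in> test_functions U"
    "\<And>n. sobolev_dist p U (\<phi> n) (grad (\<phi> n)) u (weak_grad U u) < 1 / real (Suc n)" by metis
  have "(\<lambda>n. sobolev_dist p U (\<phi> n) (grad (\<phi> n)) u (weak_grad U u)) \<longlonglongrightarrow> 0"
    using sobolev_dist_nonneg phi(2) by (rule tendsto_0_of_less_inverse)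
  then have "(\<lambda>n. sobolev_dist p U (\<phi> n) (grad (\<phi> n)) u (weak_grad U u) powr (1 / p)) \<longlonglongrightarrow> 0 powr (1 / p)"
    using p by (intro tendsto_powr2 tendsto_const) (auto intro!: always_eventually sobolev_dist_nonneg)
  then have "(\<lambda>n. W1p_norm p U (\<lambda>x. \<phi> n x - u x)) \<longlonglongrightarrow> 0"
    by (simp add: W1p_norm_test_diff[OF p U phi(1) u])
  then show ?thesis using u phi(1) unfolding W1p_0_def by blast
qed

lemma sobolev_dist_triangle:
  assumes "1 < p" "u \<in> Lpm p (lebesgue_on U)" "v \<in> Lpm p (lebesgue_on U)" "w \<in> Lpm p (lebesgue_on U)"
    "G \<in> Lpm p (lebesgue_on U)" "H \<in> Lpm p (lebesgue_on U)" "L \<in> Lpm p (lebesgue_on U)"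
  shows "sobolev_dist p U u G w L \<le> 2 powr p * (sobolev_dist p U u G v H + sobolev_dist p U v H w L)"
proof -
  have t: "(LINT x|lebesgue_on U. norm (a x - c x) powr p) \<le> 2 powr p *
      ((LINT x|lebesgue_on U. norm (a x - b x) powr p) + (LINT x|lebesgue_on U. norm (b x - c x) powr p))"
    if "a \<in> Lpm p (lebesgue_on U)" "b \<in> Lpm p (lebesgue_on U)" "c \<in> Lpm p (lebesgue_on U)"
    for a b c :: "'a \<Rightarrow> 'z::euclidean_space"
    using Lpm_integral_add_le[of p "\<lambda>x. a x - b x" "lebesgue_on U" "\<lambda>x. b x - c x"] that assms(1)
      Lpm_diff[of p a "lebesgue_on U" b] Lpm_diff[of p b "lebesgue_on U" c] by simp
  show ?thesis using t[OF assms(2,3,4)] t[OF assms(5,6,7)] unfolding sobolev_dist_def distrib_left by linarith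
qed

lemma sobolev_dist_AE_cong:
  fixes u v :: "'a::euclidean_space \<Rightarrow> real"
  assumes U: "open U" and L: "G \<in> Lpm p (lebesgue_on U)" "H \<in> Lpm p (lebesgue_on U)"
    and eq: "AE x in lebesgue. x \<in> U \<longrightarrow> G x = G' x" "AE x in lebesgue. x \<in> U \<longrightarrow> H x = H' x"
  shows "sobolev_dist p U u G v H = sobolev_dist p U u G' v H'"
proof -
  note [measurable] = LpmD(1)[OF L(1)] LpmD(1)[OF L(2)] LpmD(1)[OF Lpm_AE_cong[OF U L(1) eq(1)]] LpmD(1)[OF Lpm_AE_cong[OF U L(2) eq(2)]]
  have "(LINT x|lebesgue_on U. norm (G x - H x) powr p) = (LINT x|lebesgue_on U. norm (G' x - H' x) powr p)"
  proof (rule integral_lebesgue_on_AE_cong[OF U])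
    show "AE x in lebesgue. x \<in> U \<longrightarrow> norm (G x - H x) powr p = norm (G' x - H' x) powr p"
      using eq by eventually_elim auto
  qed measurable
  then show ?thesis by (simp add: sobolev_dist_def)
qed

text \<open>A test function and its gradient are bounded with compact support, so both sides of the defining identity
  are continuous under convergence in \<open>L\<^sup>1\<close> on that support, which convergence in \<open>L\<^sup>p\<close> implies.\<close>

lemma weak_gradient_limit:
  fixes u :: "nat \<Rightarrow> 'a::euclidean_space \<Rightarrow> real"
  assumes p: "1 < p" and U: "open U" and un: "\<And>n. is_weak_gradient U (u n) (G n)"
    and L: "\<And>n. u n \<in> Lpm p (lebesgue_on U)" "\<And>n. G n \<in> Lpm p (lebesgue_on U)"
    "v \<in> Lpm p (lebesgue_on U)" "H \<in> Lpm p (lebesgue_on U)"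
    and lim: "(\<lambda>n. sobolev_dist p U (u n) (G n) v H) \<longlonglongrightarrow> 0"
  shows "is_weak_gradient U v H"
  unfolding is_weak_gradient_iff[OF U]
proof (intro conjI ballI)
  show loc: "v \<in> Lp_loc 1 U" "H \<in> Lp_loc 1 U" using Lp_loc_1_Lpm[OF p U] L by blast+
  have locn: "u n \<in> Lp_loc 1 U" "G n \<in> Lp_loc 1 U" for n using Lp_loc_1_Lpm[OF p U] L by blast+
  fix \<psi> i assume psi: "\<psi> \<in> test_functions U" and i: "(i::'a) \<in> Basis"
  obtain K where K: "C1_supported K \<psi>" "K \<subseteq> U" using test_function_C1_supported[OF psi] .
  note D = C1_supportedD[OF K(1)]
  note Us = sets_lebesgue_open[OF U]
  have Ks: "K \<in> sets lebesgue" using D(3) by (intro sets_completionI_sets) (simp add: borel_closed)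
  have Kf: "emeasure lebesgue K < \<infinity>" using emeasure_bounded_finite[of K] D(2,3)
    by (simp add: compact_imp_bounded borel_closed)
  have K': "K \<in> sets (lebesgue_on U)" "emeasure (lebesgue_on U) K < \<infinity>"
    using K(2) Ks Us Kf by (auto simp: sets_restrict_space emeasure_restrict_space Int_absorb1)
  have lims: "(\<lambda>n. LINT x|lebesgue_on U. f n x * k x) \<longlonglongrightarrow> 0"
    if f: "\<And>n. f n \<in> Lpm p (lebesgue_on U)" and b: "\<And>n. (LINT x|lebesgue_on U. norm (f n x) powr p) \<le> sobolev_dist p U (u n) (G n) v H"
      and k: "continuous_on UNIV k" "\<And>x. x \<notin> K \<Longrightarrow> k x = 0" for f and k :: "'a \<Rightarrow> real"
  proof -
    obtain B where B: "\<And>x. norm (k x) \<le> B" using bounded_of_compact_support[OF k(1) D(2) k(2)] by auto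
    have kb: "\<bar>k x\<bar> \<le> B * indicator K x" for x using B[of x] k(2)[of x] by (cases "x \<in> K") auto
    have km: "k \<in> borel_measurable (lebesgue_on U)"
      by (rule measurable_restrict_space1[OF borel_measurable_lebesgue_continuous[OF k(1)]])
    have "(\<lambda>n. LINT x|lebesgue_on U. norm (f n x) powr p) \<longlonglongrightarrow> 0"
      by (rule tendsto_sandwich[OF _ _ tendsto_const lim]) (use b in \<open>auto intro!: always_eventually simp del: real_norm_def\<close>)
    then show ?thesis by (rule Lpm_tendsto_integral_times[OF p f _ K' km kb])
  qed
  have gi: "continuous_on UNIV (\<lambda>x. grad \<psi> x \<bullet> i)" by (intro continuous_intros D(7))
  have 1: "(\<lambda>n. LINT x|lebesgue_on U. (u n x - v x) * (grad \<psi> x \<bullet> i)) \<longlonglongrightarrow> 0"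
    by (rule lims) (use L p D gi in \<open>auto intro!: Lpm_diff simp: sobolev_dist_def\<close>)
  have 2: "(\<lambda>n. LINT x|lebesgue_on U. ((G n x - H x) \<bullet> i) * \<psi> x) \<longlonglongrightarrow> 0"
  proof (rule lims[OF _ _ D(6,4)])
    have GH: "(\<lambda>x. G n x - H x) \<in> Lpm p (lebesgue_on U)" for n using L p by (intro Lpm_diff) auto
    have le: "norm ((G n x - H x) \<bullet> i) powr p \<le> norm (G n x - H x) powr p" for n x
      using p Basis_le_norm[OF i, of "G n x - H x"] by (intro powr_mono2) auto
    show in': "(\<lambda>x. (G n x - H x) \<bullet> i) \<in> Lpm p (lebesgue_on U)" for n
    proof (rule LpmI)
      note [measurable] = LpmD(1)[OF GH]
      show m: "(\<lambda>x. (G n x - H x) \<bullet> i) \<in> borel_measurable (lebesgue_on U)"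
        using LpmD(1)[OF GH] by (rule borel_measurable_inner) simp
      show "integrable (lebesgue_on U) (\<lambda>x. norm ((G n x - H x) \<bullet> i) powr p)"
      proof (rule Bochner_Integration.integrable_bound[OF LpmD(2)[OF GH[of n]]])
        show "AE x in lebesgue_on U. norm (norm ((G n x - H x) \<bullet> i) powr p) \<le> norm (norm (G n x - H x) powr p)"
          using le[of n] by (intro AE_I2) simp
      qed (use m in measurable)
    qed
    show "(LINT x|lebesgue_on U. norm ((G n x - H x) \<bullet> i) powr p) \<le> sobolev_dist p U (u n) (G n) v H" for n
      using integral_mono[OF LpmD(2)[OF in'] LpmD(2)[OF GH] le, of n]
      by (simp add: sobolev_dist_def add_increasing)
  qed
  have e1: "(LINT x|lebesgue_on U. (u n x - v x) * (grad \<psi> x \<bullet> i))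
      = (LINT x|lebesgue. u n x * (grad \<psi> x \<bullet> i)) - (LINT x|lebesgue. v x * (grad \<psi> x \<bullet> i))" for n
  proof -
    have "integrable lebesgue (\<lambda>x. w x * (grad \<psi> x \<bullet> i))" if "w \<in> Lp_loc 1 U" for w
      by (rule Lp_loc_1_integrable_times[OF that gi D(2) K(2)]) (simp add: D(5))
    moreover have "grad \<psi> x = 0" if "x \<notin> U" for x using K(2) D(5) that by blast
    ultimately show ?thesis using loc locn
      by (subst integral_lebesgue_on_test[OF U]) (simp_all add: left_diff_distrib)
  qed
  have e2: "(LINT x|lebesgue_on U. ((G n x - H x) \<bullet> i) * \<psi> x)
      = (LINT x|lebesgue. (G n x \<bullet> i) * \<psi> x) - (LINT x|lebesgue. (H x \<bullet> i) * \<psi> x)" for n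
  proof -
    have "integrable lebesgue (\<lambda>x. (w x \<bullet> i) * \<psi> x)" if "w \<in> Lp_loc 1 U" for w
      by (rule Lp_loc_1_integrable_times[OF Lp_loc_1_inner[OF that] D(6,2) K(2) D(4)])
    moreover have "\<psi> x = 0" if "x \<notin> U" for x using K(2) D(4) that by blast
    ultimately show ?thesis using loc locn
      by (subst integral_lebesgue_on_test[OF U]) (simp_all add: left_diff_distrib inner_diff_left)
  qed
  have "(\<lambda>n. (LINT x|lebesgue_on U. (u n x - v x) * (grad \<psi> x \<bullet> i)) + (LINT x|lebesgue_on U. ((G n x - H x) \<bullet> i) * \<psi> x)) \<longlonglongrightarrow> 0 + 0"
    by (intro tendsto_add 1 2)
  moreover have "(LINT x|lebesgue_on U. (u n x - v x) * (grad \<psi> x \<bullet> i)) + (LINT x|lebesgue_on U. ((G n x - H x) \<bullet> i) * \<psi> x)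
      = - (LINT x|lebesgue. v x * (grad \<psi> x \<bullet> i)) - (LINT x|lebesgue. (H x \<bullet> i) * \<psi> x)" for n
  proof -
    have "(LINT x|lebesgue. u n x * (grad \<psi> x \<bullet> i)) = - (LINT x|lebesgue. (G n x \<bullet> i) * \<psi> x)"
      using un[of n] psi i unfolding is_weak_gradient_iff[OF U] by blast
    then show ?thesis by (simp only: e1 e2)
  qed
  ultimately have "(\<lambda>n::nat. - (LINT x|lebesgue. v x * (grad \<psi> x \<bullet> i)) - (LINT x|lebesgue. (H x \<bullet> i) * \<psi> x)) \<longlonglongrightarrow> 0 + 0"
    by (simp only:)
  then show "(LINT x|lebesgue. v x * (grad \<psi> x \<bullet> i)) = - (LINT x|lebesgue. (H x \<bullet> i) * \<psi> x)"
    by (simp add: LIMSEQ_const_iff)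
qed

section \<open>The space of admissible variations\<close>

text \<open>\<open>W\<^sub>0\<^sup>1\<^sup>,\<^sup>p(\<Omega>)\<close> with the extension by zero made part of the membership, and the gradient of that extension.\<close>

definition W0z :: "real \<Rightarrow> 'a::euclidean_space set \<Rightarrow> ('a \<Rightarrow> real) set" where
  "W0z p U = {w \<in> W1p_0 p U. \<forall>x. x \<notin> U \<longrightarrow> w x = 0}"

definition zgrad :: "'a::euclidean_space set \<Rightarrow> ('a \<Rightarrow> real) \<Rightarrow> 'a \<Rightarrow> 'a" where
  "zgrad U w x = indicator U x *\<^sub>R weak_grad U w x"

lemma W0zD:
  assumes p: "1 < p" and U: "open U" and w: "w \<in> W0z p U"
  shows "w \<in> W1p_0 p U" "w \<in> W1p p U" "w \<in> Lpm p (lebesgue_on U)" "is_weak_gradient U w (weak_grad U w)"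
    "weak_grad U w \<in> Lpm p (lebesgue_on U)" "\<And>x. x \<notin> U \<Longrightarrow> w x = 0"
  using w unfolding W0z_def W1p_0_def using W1p_iff[OF p U] by auto

lemma Lpm_zero_extension:
  fixes f :: "'a::euclidean_space \<Rightarrow> 'b::euclidean_space"
  assumes U: "open U" and z: "\<And>x. x \<notin> U \<Longrightarrow> f x = 0"
  shows "f \<in> Lpm p (lebesgue_on U) \<longleftrightarrow> f \<in> Lpm p lebesgue"
proof -
  have "(\<lambda>x. indicator U x *\<^sub>R f x) = f" "(\<lambda>x. indicator U x *\<^sub>R norm (f x) powr p) = (\<lambda>x. norm (f x) powr p)"
    using z by (auto simp: indicator_def fun_eq_iff)
  then show ?thesis
    by (simp add: Lpm_def measurable_lebesgue_on_iff[OF U] integrable_lebesgue_on_iff[OF sets_lebesgue_open[OF U]])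
qed

text \<open>The zero extensions of the approximating test functions are test functions on the whole space, and
  their gradients converge in \<open>L\<^sup>p\<close> to the gradient extended by zero; weak gradients survive the limit.\<close>

lemma W0z_whole_space:
  assumes p: "1 < p" and U: "open U" and w: "w \<in> W0z p U"
  shows "w \<in> Lpm p lebesgue" "zgrad U w \<in> Lpm p lebesgue" "is_weak_gradient UNIV w (zgrad U w)"
proof -
  note D = W0zD[OF p U w]
  have z: "zgrad U w x = 0" if "x \<notin> U" for x using that by (simp add: zgrad_def)
  have zw: "AE x in lebesgue. x \<in> U \<longrightarrow> weak_grad U w x = zgrad U w x" by (simp add: zgrad_def)
  have zL: "zgrad U w \<in> Lpm p (lebesgue_on U)" by (rule Lpm_AE_cong[OF U D(5) zw])
  show wL: "w \<in> Lpm p lebesgue" and zL': "zgrad U w \<in> Lpm p lebesgue"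
    using Lpm_zero_extension[OF U, of w p] Lpm_zero_extension[OF U, of "zgrad U w" p] D(3,6) z zL by auto
  have wU: "w \<in> Lpm p (lebesgue_on UNIV)" and zU: "zgrad U w \<in> Lpm p (lebesgue_on UNIV)"
    using wL zL' by (simp_all only: lebesgue_on_UNIV_eq)
  have "\<forall>n. \<exists>\<phi>\<in>test_functions U. sobolev_dist p U \<phi> (grad \<phi>) w (weak_grad U w) < 1 / real (Suc n)"
    using W1p_0_approx[OF p U D(1)] by simp
  then obtain \<phi> where phi: "\<And>n. \<phi> n \<in> test_functions U"
    "\<And>n. sobolev_dist p U (\<phi> n) (grad (\<phi> n)) w (weak_grad U w) < 1 / real (Suc n)" by metis
  have phiU: "\<phi> n \<in> test_functions UNIV" for n using phi(1)[of n] by (simp add: test_functions_def)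
  have eq: "sobolev_dist p UNIV (\<phi> n) (grad (\<phi> n)) w (zgrad U w) = sobolev_dist p U (\<phi> n) (grad (\<phi> n)) w (weak_grad U w)" for n
  proof -
    obtain K where K: "C1_supported K (\<phi> n)" "K \<subseteq> U" using test_function_C1_supported[OF phi(1)] .
    have "\<phi> n x = 0" "grad (\<phi> n) x = 0" if "x \<notin> U" for x using C1_supportedD(4,5)[OF K(1)] K(2) that by blast+
    then have "sobolev_dist p UNIV (\<phi> n) (grad (\<phi> n)) w (zgrad U w) = sobolev_dist p U (\<phi> n) (grad (\<phi> n)) w (zgrad U w)"
      using D(6) z by (simp add: sobolev_dist_def integral_lebesgue_on_test[OF U] lebesgue_on_UNIV_eq)
    also have "\<dots> = sobolev_dist p U (\<phi> n) (grad (\<phi> n)) w (weak_grad U w)"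
      by (rule sobolev_dist_AE_cong[OF U test_function_Lpm(2)[OF p U phi(1)] zL]) (auto simp: zgrad_def)
    finally show ?thesis .
  qed
  have "(\<lambda>n. sobolev_dist p UNIV (\<phi> n) (grad (\<phi> n)) w (zgrad U w)) \<longlonglongrightarrow> 0"
    unfolding eq using sobolev_dist_nonneg phi(2) by (rule tendsto_0_of_less_inverse)
  then show "is_weak_gradient UNIV w (zgrad U w)"
    by (rule weak_gradient_limit[OF p open_UNIV test_function_Lpm(3)[OF p open_UNIV phiU]
          test_function_Lpm(1)[OF p open_UNIV phiU] test_function_Lpm(2)[OF p open_UNIV phiU]
          wU zU])
qed

lemma W0z_zgrad_eq:
  assumes U: "open U" and G: "is_weak_gradient U w G"
  shows "AE x in lebesgue. zgrad U w x = indicator U x *\<^sub>R G x"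
  using weak_grad_eq(2)[OF U G] by eventually_elim (auto simp: zgrad_def indicator_def)

lemma W0z_linear:
  assumes p: "1 < p" and U: "open U" and u: "u \<in> W0z p U" and v: "v \<in> W0z p U"
  shows "(\<lambda>x. a * u x + b * v x) \<in> W0z p U"
    "AE x in lebesgue. zgrad U (\<lambda>x. a * u x + b * v x) x = a *\<^sub>R zgrad U u x + b *\<^sub>R zgrad U v x"
proof -
  note Du = W0zD[OF p U u] and Dv = W0zD[OF p U v]
  let ?w = "\<lambda>x. a * u x + b * v x" and ?G = "\<lambda>x. a *\<^sub>R weak_grad U u x + b *\<^sub>R weak_grad U v x"
  have wk: "is_weak_gradient U ?w ?G" by (intro weak_gradient_add weak_gradient_scale U Du Dv)
  show "AE x in lebesgue. zgrad U ?w x = a *\<^sub>R zgrad U u x + b *\<^sub>R zgrad U v x"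
    using W0z_zgrad_eq[OF U wk] by eventually_elim (simp add: zgrad_def algebra_simps)
  have wL: "?w \<in> Lpm p (lebesgue_on U)"
    using p Lpm_add[OF _ Lpm_scaleR[OF Du(3), of a] Lpm_scaleR[OF Dv(3), of b]] by simp
  have GL: "?G \<in> Lpm p (lebesgue_on U)" using p by (intro Lpm_add Lpm_scaleR Du Dv) auto
  have W: "?w \<in> W1p p U" by (rule W1pI[OF p wL wk GL])
  have "?w \<in> W1p_0 p U"
  proof (rule W1p_0I[OF p U W])
    fix \<epsilon> :: real assume e: "0 < \<epsilon>"
    define c where "c = 2 powr p * (\<bar>a\<bar> powr p + \<bar>b\<bar> powr p + 1)"
    have c: "0 < c" unfolding c_def by (intro mult_pos_pos add_nonneg_pos) auto
    have c': "2 powr p * \<bar>a\<bar> powr p \<le> c" "2 powr p * \<bar>b\<bar> powr p \<le> c"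
      unfolding c_def by (auto intro!: mult_left_mono)
    obtain \<phi> where phi: "\<phi> \<in> test_functions U" "sobolev_dist p U \<phi> (grad \<phi>) u (weak_grad U u) < \<epsilon> / (2 * c)"
      using W1p_0_approx[OF p U Du(1), of "\<epsilon> / (2 * c)"] e c by auto
    obtain \<psi> where psi: "\<psi> \<in> test_functions U" "sobolev_dist p U \<psi> (grad \<psi>) v (weak_grad U v) < \<epsilon> / (2 * c)"
      using W1p_0_approx[OF p U Dv(1), of "\<epsilon> / (2 * c)"] e c by auto
    let ?\<xi> = "\<lambda>x. a * \<phi> x + b * \<psi> x"
    have k: "Ck k \<phi>" "Ck k \<psi>" for k using phi(1) psi(1) by (auto simp: test_functions_def)
    have xi: "?\<xi> \<in> test_functions U"
    proof -
      have "{x. ?\<xi> x \<noteq> 0} \<subseteq> {x. \<phi> x \<noteq> 0} \<union> {x. \<psi> x \<noteq> 0}" by auto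
      then have sub: "closure {x. ?\<xi> x \<noteq> 0} \<subseteq> closure {x. \<phi> x \<noteq> 0} \<union> closure {x. \<psi> x \<noteq> 0}"
        unfolding closure_Un[symmetric] by (rule closure_mono)
      have "compact (closure {x. \<phi> x \<noteq> 0} \<union> closure {x. \<psi> x \<noteq> 0})"
        using phi(1) psi(1) by (intro compact_Un) (auto simp: test_functions_def)
      then have "compact (closure {x. ?\<xi> x \<noteq> 0})"
        using bounded_subset[OF compact_imp_bounded sub] by (simp add: compact_eq_bounded_closed)
      moreover have "Ck k ?\<xi>" for k by (rule Ck_add[OF Ck_mult[OF Ck_const k(1)] Ck_mult[OF Ck_const k(2)]])
      ultimately show ?thesis using sub phi(1) psi(1) by (auto simp: test_functions_def)
    qed
    have gxi: "grad ?\<xi> x = a *\<^sub>R grad \<phi> x + b *\<^sub>R grad \<psi> x" for x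
      by (rule grad_eqI, rule has_derivative_eq_rhs[OF has_derivative_add[OF
            has_derivative_mult_right[OF has_derivative_grad[OF k(1)]] has_derivative_mult_right[OF has_derivative_grad[OF k(2)]]]])
         (simp add: inner_add_left)
    have est: "(LINT x|lebesgue_on U. norm ((a *\<^sub>R f x + b *\<^sub>R g x) - (a *\<^sub>R f' x + b *\<^sub>R g' x)) powr p)
        \<le> c * ((LINT x|lebesgue_on U. norm (f x - f' x) powr p) + (LINT x|lebesgue_on U. norm (g x - g' x) powr p))"
      if L: "f \<in> Lpm p (lebesgue_on U)" "f' \<in> Lpm p (lebesgue_on U)" "g \<in> Lpm p (lebesgue_on U)" "g' \<in> Lpm p (lebesgue_on U)"
      for f g f' g' :: "'a \<Rightarrow> 'z::euclidean_space"
    proof -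
      have p0: "0 \<le> p" using p by simp
      let ?I = "\<lambda>h. LINT x|lebesgue_on U. norm (h x) powr p"
      have "?I (\<lambda>x. a *\<^sub>R (f x - f' x) + b *\<^sub>R (g x - g' x))
        \<le> 2 powr p * (?I (\<lambda>x. a *\<^sub>R (f x - f' x)) + ?I (\<lambda>x. b *\<^sub>R (g x - g' x)))"
        by (rule Lpm_integral_add_le[OF p0 Lpm_scaleR[OF Lpm_diff[OF p0 L(1,2)]] Lpm_scaleR[OF Lpm_diff[OF p0 L(3,4)]]])
      also have "\<dots> = (2 powr p * \<bar>a\<bar> powr p) * ?I (\<lambda>x. f x - f' x) + (2 powr p * \<bar>b\<bar> powr p) * ?I (\<lambda>x. g x - g' x)"
        by (simp add: powr_mult distrib_left)
      also have "\<dots> \<le> c * ?I (\<lambda>x. f x - f' x) + c * ?I (\<lambda>x. g x - g' x)"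
        by (intro add_mono mult_right_mono c') auto
      finally show ?thesis by (simp add: algebra_simps)
    qed
    note Lphi = test_function_Lpm[OF p U phi(1)] and Lpsi = test_function_Lpm[OF p U psi(1)]
    have "sobolev_dist p U ?\<xi> (grad ?\<xi>) ?w ?G
      \<le> c * (sobolev_dist p U \<phi> (grad \<phi>) u (weak_grad U u) + sobolev_dist p U \<psi> (grad \<psi>) v (weak_grad U v))"
      using est[OF Lphi(1) Du(3) Lpsi(1) Dv(3)] est[OF Lphi(2) Du(5) Lpsi(2) Dv(5)]
      by (simp add: sobolev_dist_def gxi distrib_left)
    also have "\<dots> < c * (\<epsilon> / (2 * c) + \<epsilon> / (2 * c))"
      using phi(2) psi(2) c by (intro mult_strict_left_mono add_strict_mono) auto
    also have "\<dots> = \<epsilon>" using c by simp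
    finally have "sobolev_dist p U ?\<xi> (grad ?\<xi>) ?w ?G < \<epsilon>" .
    moreover have "sobolev_dist p U ?\<xi> (grad ?\<xi>) ?w ?G = sobolev_dist p U ?\<xi> (grad ?\<xi>) ?w (weak_grad U ?w)"
    proof (rule sobolev_dist_AE_cong[OF U test_function_Lpm(2)[OF p U xi] GL])
      show "AE x in lebesgue. x \<in> U \<longrightarrow> ?G x = weak_grad U ?w x"
        using weak_grad_eq(2)[OF U wk] by eventually_elim simp
    qed simp
    ultimately show "\<exists>\<phi>\<in>test_functions U. sobolev_dist p U \<phi> (grad \<phi>) ?w (weak_grad U ?w) < \<epsilon>"
      using xi by auto
  qed
  then show "?w \<in> W0z p U" using Du(6) Dv(6) by (simp add: W0z_def)
qed

text \<open>The functions and their gradients converge separately in \<open>L\<^sup>p\<close>, the limit of the gradients is the gradient of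
  the limit, and a diagonal choice of test functions approximates the limit.\<close>

lemma W0z_complete:
  assumes p: "1 < p" and U: "open U" and w: "\<And>n. w n \<in> W0z p U"
    and cauchy: "\<And>\<epsilon>. 0 < \<epsilon> \<Longrightarrow> \<exists>n0. \<forall>m\<ge>n0. \<forall>n\<ge>n0.
      sobolev_dist p U (w n) (weak_grad U (w n)) (w m) (weak_grad U (w m)) < \<epsilon>"
  shows "\<exists>v\<in>W0z p U. (\<lambda>n. sobolev_dist p U (w n) (weak_grad U (w n)) v (weak_grad U v)) \<longlonglongrightarrow> 0"
proof -
  let ?d = "\<lambda>n m. sobolev_dist p U (w n) (weak_grad U (w n)) (w m) (weak_grad U (w m))"
  note D = W0zD[OF p U w]
  let ?M = "lebesgue_on U"
  have le: "(LINT x|?M. norm (w n x - w m x) powr p) \<le> ?d n m"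
    "(LINT x|?M. norm (weak_grad U (w n) x - weak_grad U (w m) x) powr p) \<le> ?d n m" for m n
    by (simp_all add: sobolev_dist_def)
  have c: "\<exists>n0. \<forall>m\<ge>n0. \<forall>n\<ge>n0. I n m < \<epsilon>"
    if I: "\<And>m n. I n m \<le> ?d n m" and e: "0 < \<epsilon>" for I \<epsilon>
  proof -
    obtain n0 where n0: "\<And>m n. m \<ge> n0 \<Longrightarrow> n \<ge> n0 \<Longrightarrow>
        ?d n m < \<epsilon>"
      using cauchy[OF e] by blast
    show ?thesis by (intro exI[of _ n0] allI impI le_less_trans[OF I n0])
  qed
  obtain f where f: "f \<in> Lpm p ?M" "(\<lambda>n. LINT x|?M. norm (w n x - f x) powr p) \<longlonglongrightarrow> 0"
    using Lpm_complete[OF p D(3) c[OF le(1)]] by blast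
  obtain H where H: "H \<in> Lpm p ?M" "(\<lambda>n. LINT x|?M. norm (weak_grad U (w n) x - H x) powr p) \<longlonglongrightarrow> 0"
    using Lpm_complete[OF p D(5) c[OF le(2)]] by blast
  define v where "v x = indicator U x * f x" for x
  have vf: "v x = f x" if "x \<in> U" for x using that by (simp add: v_def)
  have vL: "v \<in> Lpm p ?M" by (rule Lpm_AE_cong[OF U f(1)]) (simp add: vf)
  have "(LINT x|?M. norm (w n x - v x) powr p) = (LINT x|?M. norm (w n x - f x) powr p)" for n
    by (rule Bochner_Integration.integral_cong) (auto simp: space_restrict_space vf)
  then have lim: "(\<lambda>n. sobolev_dist p U (w n) (weak_grad U (w n)) v H) \<longlonglongrightarrow> 0"
    using tendsto_add[OF f(2) H(2)] by (simp add: sobolev_dist_def)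
  have wk: "is_weak_gradient U v H" by (rule weak_gradient_limit[OF p U D(4) D(3) D(5) vL H(1) lim])
  have W: "v \<in> W1p p U" by (rule W1pI[OF p vL wk H(1)])
  have eqH: "AE x in lebesgue. x \<in> U \<longrightarrow> H x = weak_grad U v x"
    using weak_grad_eq(2)[OF U wk] by eventually_elim simp
  have sd: "sobolev_dist p U a G v H = sobolev_dist p U a G v (weak_grad U v)" if "G \<in> Lpm p ?M" for a G
    by (rule sobolev_dist_AE_cong[OF U that H(1) _ eqH]) simp
  have "v \<in> W1p_0 p U"
  proof (rule W1p_0I[OF p U W])
    fix \<epsilon> :: real assume e: "0 < \<epsilon>"
    define \<delta> where "\<delta> = \<epsilon> / (2 * 2 powr p)"
    have d: "0 < \<delta>" "2 powr p * (\<delta> + \<delta>) = \<epsilon>" using e by (auto simp: \<delta>_def)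
    have "\<forall>\<^sub>F n in sequentially. sobolev_dist p U (w n) (weak_grad U (w n)) v H < \<delta>"
      using lim d by (intro order_tendstoD) auto
    then obtain n where n: "sobolev_dist p U (w n) (weak_grad U (w n)) v H < \<delta>" by (auto simp: eventually_sequentially)
    obtain \<phi> where phi: "\<phi> \<in> test_functions U" "sobolev_dist p U \<phi> (grad \<phi>) (w n) (weak_grad U (w n)) < \<delta>"
      using W1p_0_approx[OF p U D(1) d(1)] by blast
    note L = test_function_Lpm[OF p U phi(1)]
    have "sobolev_dist p U \<phi> (grad \<phi>) v H \<le> 2 powr p * (sobolev_dist p U \<phi> (grad \<phi>) (w n) (weak_grad U (w n)) + sobolev_dist p U (w n) (weak_grad U (w n)) v H)"
      by (rule sobolev_dist_triangle[OF p L(1) D(3) vL L(2) D(5) H(1)])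
    also have "\<dots> < 2 powr p * (\<delta> + \<delta>)" using n phi(2) by (intro mult_strict_left_mono add_strict_mono) auto
    finally show "\<exists>\<phi>\<in>test_functions U. sobolev_dist p U \<phi> (grad \<phi>) v (weak_grad U v) < \<epsilon>"
      using phi(1) sd[OF L(2)] d(2) by auto
  qed
  then have "v \<in> W0z p U" by (simp add: W0z_def v_def)
  moreover have "(\<lambda>n. sobolev_dist p U (w n) (weak_grad U (w n)) v (weak_grad U v)) \<longlonglongrightarrow> 0"
    using lim by (simp add: sd[OF D(5)])
  ultimately show ?thesis by blast
qed

section \<open>The translation estimate\<close>

text \<open>Integrate the tangent of \<open>|.|\<^sup>p / p\<close> at the mean value. If \<open>f\<close> is not integrable, the left-hand side is \<open>0\<close>.\<close>

lemma jensen_powr: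
  fixes f :: "'a \<Rightarrow> 'b::euclidean_space"
  assumes p: "1 < p" and M: "emeasure M (space M) = 1" and f: "f \<in> borel_measurable M"
  shows "ennreal (norm (integral\<^sup>L M f) powr p) \<le> (NNINT x|M. ennreal (norm (f x) powr p))"
proof (cases "integrable M f \<and> (NNINT x|M. ennreal (norm (f x) powr p)) < \<infinity>")
  case False
  then show ?thesis using not_integrable_integral_eq[of M f] by (auto simp: not_less top_unique)
next
  case True
  then have int: "integrable M f" by simp
  have ip: "integrable M (\<lambda>x. norm (f x) powr p)"
    using True f by (intro integrableI_bounded) auto
  have M1: "measure M (space M) = 1" using M by (simp add: measure_def)
  have cst: "integrable M (\<lambda>x. c)" for c :: real 
  proof -
    interpret finite_measure M by standard (simp add: M)
    show ?thesis by simp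
  qed
  define m where "m = integral\<^sup>L M f"
  have "penergy p m = (LINT x|M. penergy p m + pflux p m \<bullet> f x - pflux p m \<bullet> m)"
    using int cst M1 by (simp add: m_def)
  also have "\<dots> \<le> (LINT x|M. penergy p (f x))"
  proof (rule integral_mono)
    show "integrable M (\<lambda>x. penergy p m + pflux p m \<bullet> f x - pflux p m \<bullet> m)" using int cst by auto
    show "integrable M (\<lambda>x. penergy p (f x))" using ip by (simp add: penergy_def)
    show "penergy p m + pflux p m \<bullet> f x - pflux p m \<bullet> m \<le> penergy p (f x)" for x
      using penergy_subgradient[OF p, of m "f x"] by (simp add: inner_diff_right)
  qed
  also have "\<dots> = (LINT x|M. norm (f x) powr p) / p" by (simp add: penergy_def)
  finally have "norm m powr p \<le> (LINT x|M. norm (f x) powr p)" using p by (simp add: penergy_def divide_le_cancel)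
  then show ?thesis using ip by (subst nn_integral_eq_integral) (auto simp: m_def intro: ennreal_leI)
qed

lemma nn_integral_lborel_translate:
  fixes f :: "'a::euclidean_space \<Rightarrow> ennreal"
  assumes [measurable]: "f \<in> borel_measurable borel"
  shows "(NNINT x|lborel. f (x + c)) = (NNINT x|lborel. f x)"
proof -
  have "(NNINT x|distr lborel borel ((+) c). f x) = (NNINT x|lborel. f (c + x))"
    by (rule nn_integral_distr) measurable
  then show ?thesis by (simp add: lborel_distr_plus add.commute)
qed

lemma weak_gradient_direction:
  assumes U: "open U" and u: "is_weak_gradient U u G" and psi: "\<psi> \<in> test_functions U"
  shows "(LINT x|lebesgue. u x * (grad \<psi> x \<bullet> h)) = - (LINT x|lebesgue. (G x \<bullet> h) * \<psi> x)"
proof -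
  note u = u[unfolded is_weak_gradient_iff[OF U]]
  obtain K where K: "C1_supported K \<psi>" "K \<subseteq> U" using test_function_C1_supported[OF psi] .
  note D = C1_supportedD[OF K(1)]
  have e: "v \<bullet> h = (\<Sum>i\<in>Basis. (h \<bullet> i) * (v \<bullet> i))" for v
    using euclidean_inner[of v h] by (simp add: mult.commute)
  have i1: "integrable lebesgue (\<lambda>x. u x * (grad \<psi> x \<bullet> i))" for i
    by (rule Lp_loc_1_integrable_times[OF _ _ D(2) K(2)]) (use u D in \<open>auto intro!: continuous_intros\<close>)
  have i2: "integrable lebesgue (\<lambda>x. (G x \<bullet> i) * \<psi> x)" for i
    by (rule Lp_loc_1_integrable_times[OF _ D(6,2) K(2) D(4)]) (use u Lp_loc_1_inner in blast)
  have "(LINT x|lebesgue. u x * (grad \<psi> x \<bullet> h)) = (LINT x|lebesgue. (\<Sum>i\<in>Basis. (h \<bullet> i) * (u x * (grad \<psi> x \<bullet> i))))"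
    by (subst e) (simp add: sum_distrib_left mult.left_commute)
  also have "\<dots> = (\<Sum>i\<in>Basis. (h \<bullet> i) * (LINT x|lebesgue. u x * (grad \<psi> x \<bullet> i)))"
    using i1 by (simp add: Bochner_Integration.integral_sum)
  also have "\<dots> = (\<Sum>i\<in>Basis. (h \<bullet> i) * - (LINT x|lebesgue. (G x \<bullet> i) * \<psi> x))"
    using u psi by (intro sum.cong refl) auto
  also have "\<dots> = - (LINT x|lebesgue. (\<Sum>i\<in>Basis. (h \<bullet> i) * ((G x \<bullet> i) * \<psi> x)))"
    using i2 by (simp add: Bochner_Integration.integral_sum sum_negf)
  also have "(\<lambda>x. \<Sum>i\<in>Basis. (h \<bullet> i) * ((G x \<bullet> i) * \<psi> x)) = (\<lambda>x. (G x \<bullet> h) * \<psi> x)"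
    by (subst e) (simp add: sum_distrib_right mult.assoc)
  finally show ?thesis .
qed

lemma C1_supported_translate:
  assumes "C1_supported K \<phi>"
  shows "C1_supported ((\<lambda>x. x + c) ` K) (\<lambda>x. \<phi> (x - c))" "grad (\<lambda>x. \<phi> (x - c)) x = grad \<phi> (x - c)"
proof -
  note D = C1_supportedD[OF assms]
  have "compact ((\<lambda>x. x + c) ` K)" using D(2) by (intro compact_continuous_image continuous_intros)
  moreover have "\<phi> (x - c) = 0" if "x \<notin> (\<lambda>x. x + c) ` K" for x
    using D(4)[of "x - c"] that by (metis diff_add_cancel image_eqI)
  ultimately show "C1_supported ((\<lambda>x. x + c) ` K) (\<lambda>x. \<phi> (x - c))"
    using Ck_translate[OF D(1), of "- c"] by (simp add: C1_supported_def del: Ck.simps)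
  have "((\<lambda>x. x - c) has_derivative (\<lambda>h. h)) (at x)" by (auto intro!: derivative_eq_intros)
  from has_derivative_compose[OF this has_derivative_grad[OF D(1)]]
  show "grad (\<lambda>x. \<phi> (x - c)) x = grad \<phi> (x - c)" by (intro grad_eqI)
qed

lemma test_function_translate:
  assumes psi: "\<psi> \<in> test_functions K" and sub: "\<And>x. x \<in> K \<Longrightarrow> x + c \<in> U"
  shows "(\<lambda>x. \<psi> (x - c)) \<in> test_functions U"
proof -
  define S where "S = (\<lambda>x. x + c) ` closure {x. \<psi> x \<noteq> 0}"
  have cS: "compact S" unfolding S_def using psi
    by (intro compact_continuous_image continuous_intros) (auto simp: test_functions_def)
  have "{x. \<psi> (x - c) \<noteq> 0} \<subseteq> S"
  proof
    fix x assume "x \<in> {x. \<psi> (x - c) \<noteq> 0}"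
    then have "x - c \<in> {x. \<psi> x \<noteq> 0}" by simp
    then have "x - c \<in> closure {x. \<psi> x \<noteq> 0}" by (rule subsetD[OF closure_subset])
    then show "x \<in> S" unfolding S_def by (rule image_eqI[rotated]) simp
  qed
  then have cl: "closure {x. \<psi> (x - c) \<noteq> 0} \<subseteq> S" using cS by (intro closure_minimal compact_imp_closed)
  have "S \<subseteq> U" using psi sub by (auto simp: S_def test_functions_def)
  moreover have "compact (closure {x. \<psi> (x - c) \<noteq> 0})"
    using bounded_subset[OF compact_imp_bounded[OF cS] cl] by (simp add: compact_eq_bounded_closed)
  moreover have "Ck k (\<lambda>x. \<psi> (x - c))" for k
    using Ck_translate[of k \<psi> "- c"] psi by (simp add: test_functions_def)
  ultimately show ?thesis using cl by (auto simp: test_functions_def)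
qed

lemma integrable_lebesgue_iff_lborel:
  fixes f :: "'a::euclidean_space \<Rightarrow> 'b::{banach, second_countable_topology}"
  shows "f \<in> borel_measurable borel \<Longrightarrow> integrable lebesgue f \<longleftrightarrow> integrable lborel f"
  by (rule integrable_completion) simp

text \<open>The fundamental theorem of calculus for weak gradients. Tested against \<open>\<psi>\<close>, the function
  \<open>t \<mapsto> \<integral> g(x + th) \<psi>(x) dx\<close> is differentiable with derivative \<open>\<integral> \<nabla>g(x + th) \<bullet> h \<psi>(x) dx\<close>, because the
  translation can be moved to \<open>\<psi>\<close>, and a translate of \<open>\<psi>\<close> is again a test function.\<close>

lemma weak_gradient_line_integral:
  fixes g :: "'a::euclidean_space \<Rightarrow> real"
  assumes U: "open U" and wk: "is_weak_gradient U g G"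
    and gm[measurable]: "g \<in> borel_measurable borel" and Gm[measurable]: "G \<in> borel_measurable borel"
    and gl: "\<And>C. compact C \<Longrightarrow> integrable lborel (\<lambda>x. indicator C x * g x)"
    and Gl: "\<And>C. compact C \<Longrightarrow> integrable lborel (\<lambda>x. indicator C x *\<^sub>R G x)"
    and K: "open K" and seg: "\<And>x t. x \<in> K \<Longrightarrow> 0 \<le> t \<Longrightarrow> t \<le> 1 \<Longrightarrow> x + t *\<^sub>R h \<in> U"
  shows "AE x in lborel. x \<in> K \<longrightarrow> g (x + h) - g x = (LINT t|lborel. indicator {0..1} t * (G (x + t *\<^sub>R h) \<bullet> h))"
proof -
  define F where "F x t = indicator {0..1} t * (G (x + t *\<^sub>R h) \<bullet> h)" for x t
  have F[measurable]: "(\<lambda>z. F (fst z) (snd z)) \<in> borel_measurable (lborel \<Otimes>\<^sub>M lborel)"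
    unfolding F_def by measurable
  define I where "I x = (LINT t|lborel. F x t)" for x
  have I[measurable]: "I \<in> borel_measurable borel" unfolding I_def F_def by measurable
  \<comment> \<open>the segments that start in a compact set sweep out a compact set, on which \<open>G\<close> is integrable\<close>
  have Fint: "integrable (lborel \<Otimes>\<^sub>M lborel) (\<lambda>(x, t). k x * F x t)"
    if k[measurable]: "k \<in> borel_measurable borel" and C: "compact C" and kb: "\<And>x. \<bar>k x\<bar> \<le> B * indicator C x" for k B C
  proof (rule integrableI_bounded)
    define C' where "C' = (\<lambda>z. fst z + snd z *\<^sub>R h) ` (C \<times> {0..1::real})"
    have C': "compact C'" unfolding C'_def using C
      by (intro compact_continuous_image compact_Times continuous_intros) auto
    have [measurable]: "C \<in> sets borel" "C' \<in> sets borel" using C C' compact_imp_closed borel_closed by blast+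
    show "(\<lambda>(x, t). k x * F x t) \<in> borel_measurable (lborel \<Otimes>\<^sub>M lborel)" unfolding F_def by measurable
    let ?c = "\<bar>B\<bar> * norm h" and ?n = "\<lambda>x. norm (indicator C' x *\<^sub>R G x)"
    let ?b = "\<lambda>x t. indicator {0..1} t * (?c * ?n (x + t *\<^sub>R h))"
    have B: "0 \<le> ?c" by simp
    have pt: "norm (k x * F x t) \<le> ?b x t" for x t
    proof (cases "x \<in> C \<and> t \<in> {0..1}")
      case True
      then have c: "x + t *\<^sub>R h \<in> C'" unfolding C'_def by (intro image_eqI[of _ _ "(x, t)"]) auto
      have "\<bar>k x\<bar> \<le> \<bar>B\<bar>" using kb[of x] True by auto
      moreover have "\<bar>G (x + t *\<^sub>R h) \<bullet> h\<bar> \<le> norm (G (x + t *\<^sub>R h)) * norm h" by (rule Cauchy_Schwarz_ineq2)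
      ultimately have "\<bar>k x\<bar> * \<bar>G (x + t *\<^sub>R h) \<bullet> h\<bar> \<le> \<bar>B\<bar> * (norm (G (x + t *\<^sub>R h)) * norm h)"
        by (intro mult_mono) auto
      then show ?thesis using True c by (simp add: F_def abs_mult mult.assoc mult.commute[of "norm h"])
    next
      case False
      then have "k x * F x t = 0" using kb[of x] by (auto simp: F_def)
      then have "norm (k x * F x t) = 0" by (simp only: norm_zero)
      moreover have "0 \<le> ?b x t" by simp
      ultimately show ?thesis by linarith
    qed
    have "(NNINT z|(lborel \<Otimes>\<^sub>M lborel). ennreal (norm (case z of (x, t) \<Rightarrow> k x * F x t)))
      \<le> (NNINT z|(lborel \<Otimes>\<^sub>M lborel). ennreal (?b (fst z) (snd z)))"
      using pt by (intro nn_integral_mono) (auto intro!: ennreal_leI simp del: norm_scaleR)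
    also have "\<dots> = (NNINT t|lborel. (NNINT x|lborel. ennreal (?b x t)))"
      by (subst lborel_pair.nn_integral_snd[symmetric]) (auto simp del: norm_scaleR)
    also have "\<dots> = (NNINT t|lborel. indicator {0..1} (t::real) * (ennreal ?c * (NNINT x|lborel. ennreal (?n x))))"
    proof (rule nn_integral_cong)
      fix t :: real
      have "(NNINT x|lborel. ennreal (?b x t))
        = (NNINT x|lborel. ennreal (indicator {0..1} t * (?c * ?n x)))"
        by (rule nn_integral_lborel_translate[of "\<lambda>x. ennreal (indicator {0..1} t * (?c * ?n x))"]) measurable
      also have "\<dots> = (NNINT x|lborel. indicator {0..1} t * (ennreal ?c * ennreal (?n x)))"
        using B by (intro nn_integral_cong) (simp add: ennreal_mult ennreal_indicator del: norm_scaleR)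
      also have "\<dots> = indicator {0..1} t * (ennreal ?c * (NNINT x|lborel. ennreal (?n x)))"
        by (subst nn_integral_cmult, measurable, subst nn_integral_cmult) auto
      finally show "(NNINT x|lborel. ennreal (?b x t))
        = indicator {0..1} t * (ennreal ?c * (NNINT x|lborel. ennreal (?n x)))" .
    qed
    also have "\<dots> = ennreal ?c * (NNINT x|lborel. ennreal (?n x))"
      by (subst nn_integral_multc) auto
    also have "\<dots> < \<infinity>"
      using Gl[OF C'] unfolding infinity_ennreal_def ennreal_mult_less_top integrable_iff_bounded by auto
    finally show "(NNINT z|(lborel \<Otimes>\<^sub>M lborel). ennreal (norm (case z of (x, t) \<Rightarrow> k x * F x t))) < \<infinity>" .
  qed
  have gloc: "g \<in> Lp_loc 1 UNIV"
    unfolding Lp_loc_1_iff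
  proof (intro allI impI)
    fix C :: "'a set" assume C: "compact C \<and> C \<subseteq> UNIV"
    have [measurable]: "C \<in> sets borel" using C compact_imp_closed borel_closed by blast
    have "(\<lambda>x. indicator C x *\<^sub>R g x) \<in> borel_measurable borel" by measurable
    then show "integrable lebesgue (\<lambda>x. indicator C x *\<^sub>R g x)"
      using gl C by (simp add: integrable_lebesgue_iff_lborel)
  qed
  define H where "H x = g (x + h) - g x - I x" for x
  have [measurable]: "H \<in> borel_measurable borel" unfolding H_def by measurable
  have Hloc: "H \<in> Lp_loc 1 K"
    unfolding Lp_loc_1_iff
  proof (intro allI impI)
    fix C assume C: "compact C \<and> C \<subseteq> K"
    have Cm[measurable]: "C \<in> sets borel" using C compact_imp_closed borel_closed by blast
    have "compact ((\<lambda>x. x + h) ` C)" using C by (intro compact_continuous_image continuous_intros) auto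
    then have "integrable lebesgue (\<lambda>x. indicator ((\<lambda>x. x + h) ` C) x *\<^sub>R g x)" using gloc by (simp add: Lp_loc_1_iff)
    then have "integrable lebesgue (\<lambda>x. indicator ((\<lambda>x. x + h) ` C) (x + h) *\<^sub>R g (x + h))"
      by (rule integrable_lebesgue_translate)
    moreover have "indicator ((\<lambda>x. x + h) ` C) (x + h) = (indicator C x :: real)" for x
      by (auto simp: indicator_def)
    ultimately have 1: "integrable lebesgue (\<lambda>x. indicator C x * g (x + h))" by simp
    have 2: "integrable lebesgue (\<lambda>x. indicator C x * g x)" using gloc C by (simp add: Lp_loc_1_iff)
    have "integrable (lborel \<Otimes>\<^sub>M lborel) (\<lambda>(x, t). indicator C x * F x t)"
      by (rule Fint[of _ C 1]) (use C in auto)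
    then have "integrable lborel (\<lambda>x. LINT t|lborel. indicator C x * F x t)"
      using lborel_pair.integrable_fst'[of "\<lambda>(x, t). indicator C x * F x t"] by simp
    then have "integrable lborel (\<lambda>x. indicator C x * I x)" by (simp add: I_def)
    moreover have "(\<lambda>x. indicator C x * I x) \<in> borel_measurable borel" by measurable
    ultimately have 3: "integrable lebesgue (\<lambda>x. indicator C x * I x)" by (simp add: integrable_lebesgue_iff_lborel)
    show "integrable lebesgue (\<lambda>x. indicator C x *\<^sub>R H x)"
      using Bochner_Integration.integrable_diff[OF Bochner_Integration.integrable_diff[OF 1 2] 3]
      by (simp add: H_def right_diff_distrib)
  qed
  have "(LINT x|lebesgue_on K. H x * \<psi> x) = 0" if psi: "\<psi> \<in> test_functions K" for \<psi>
  proof -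
    obtain S where S: "C1_supported S \<psi>" "S \<subseteq> K" using test_function_C1_supported[OF psi] .
    note D = C1_supportedD[OF S(1)]
    obtain B where B: "\<And>x. norm (\<psi> x) \<le> B" using bounded_of_compact_support[OF D(6,2,4)] by auto
    have [measurable]: "\<psi> \<in> borel_measurable borel" using D(6) by (rule borel_measurable_continuous_onI)
    \<comment> \<open>the integral of \<open>g(x + th) \<psi>(x)\<close>, with the translation on \<open>\<psi>\<close>, and its derivative in \<open>t\<close>\<close>
    define m where "m t = (LINT x|lebesgue. g x * \<psi> (x - t *\<^sub>R h))" for t
    define m' where "m' t = (LINT x|lebesgue. (G (x + t *\<^sub>R h) \<bullet> h) * \<psi> x)" for t
    have gint: "integrable lebesgue (\<lambda>x. g x * \<psi> (x - c))" for c
    proof -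
      note T = C1_supportedD[OF C1_supported_translate(1)[OF S(1), of c]]
      show ?thesis by (rule Lp_loc_1_integrable_times[OF gloc T(6,2) subset_UNIV T(4)])
    qed
    have der: "(m has_real_derivative m' t) (at t)" if t: "0 \<le> t" "t \<le> 1" for t
    proof -
      let ?\<phi> = "\<lambda>x. \<psi> (x - t *\<^sub>R h)"
      note T = C1_supported_translate(1)[OF S(1), of "t *\<^sub>R h"]
      have tf: "?\<phi> \<in> test_functions U" by (rule test_function_translate[OF psi]) (use seg t in auto)
      have "((\<lambda>\<tau>. LINT x|lebesgue. g x * ((?\<phi> (x + \<tau> *\<^sub>R (- h)) - ?\<phi> x) / \<tau>)) \<longlongrightarrow>
          (LINT x|lebesgue. g x * (grad ?\<phi> x \<bullet> (- h)))) (at 0)"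
      proof (rule difference_quotient_integral[OF T])
        show "g \<in> borel_measurable lebesgue" by (rule measurable_completion) simp
        show "integrable lebesgue (\<lambda>x. indicator C x * g x)" if "compact C" for C
          using gloc that by (simp add: Lp_loc_1_iff)
      qed
      moreover have "(LINT x|lebesgue. g x * ((?\<phi> (x + \<tau> *\<^sub>R (- h)) - ?\<phi> x) / \<tau>)) = (m (t + \<tau>) - m t) / \<tau>" for \<tau>
      proof -
        have "(LINT x|lebesgue. g x * ((?\<phi> (x + \<tau> *\<^sub>R (- h)) - ?\<phi> x) / \<tau>))
          = (LINT x|lebesgue. (g x * \<psi> (x - (t + \<tau>) *\<^sub>R h) - g x * \<psi> (x - t *\<^sub>R h)) / \<tau>)"
          by (rule Bochner_Integration.integral_cong) (simp_all add: algebra_simps)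
        also have "\<dots> = (m (t + \<tau>) - m t) / \<tau>"
          using gint by (simp add: m_def)
        finally show ?thesis .
      qed
      moreover have "(LINT x|lebesgue. g x * (grad ?\<phi> x \<bullet> (- h))) = m' t"
      proof -
        have "(LINT x|lebesgue. g x * (grad ?\<phi> x \<bullet> (- h))) = - (LINT x|lebesgue. (G x \<bullet> (- h)) * ?\<phi> x)"
          by (rule weak_gradient_direction[OF U wk tf])
        also have "\<dots> = (LINT x|lebesgue. (G x \<bullet> h) * \<psi> (x - t *\<^sub>R h))" by simp
        also have "\<dots> = (LINT x|lebesgue. (G (x + t *\<^sub>R h) \<bullet> h) * \<psi> (x + t *\<^sub>R h - t *\<^sub>R h))"
          by (rule integral_lebesgue_translate[symmetric]) (rule measurable_completion, simp)
        finally show ?thesis by (simp add: m'_def)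
      qed
      ultimately show ?thesis unfolding DERIV_def by (simp only:)
    qed
    have ftc: "(m' has_integral m 1 - m 0) {0..1}"
    proof (rule fundamental_theorem_of_calculus)
      show "(m has_vector_derivative m' t) (at t within {0..1})" if "t \<in> {0..1}" for t
        using der[of t] that has_vector_derivative_at_within[of m "m' t" t "{0..1}"]
        by (simp add: has_real_derivative_iff_has_vector_derivative)
    qed simp
    have PF: "integrable (lborel \<Otimes>\<^sub>M lborel) (\<lambda>(x, t). \<psi> x * F x t)"
    proof (rule Fint[OF _ D(2)])
      show "\<bar>\<psi> x\<bar> \<le> B * indicator S x" for x
        using B[of x] D(4)[of x] by (cases "x \<in> S") simp_all
    qed simp
    have inner: "(LINT x|lborel. \<psi> x * F x t) = indicator {0..1} t * m' t" for t
    proof -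
      have "(LINT x|lborel. \<psi> x * F x t) = (LINT x|lborel. indicator {0..1} t * ((G (x + t *\<^sub>R h) \<bullet> h) * \<psi> x))"
        by (rule Bochner_Integration.integral_cong) (simp_all add: F_def mult_ac)
      also have "\<dots> = indicator {0..1} t * (LINT x|lborel. (G (x + t *\<^sub>R h) \<bullet> h) * \<psi> x)" by simp
      also have "(LINT x|lborel. (G (x + t *\<^sub>R h) \<bullet> h) * \<psi> x) = m' t"
        unfolding m'_def by (rule integral_completion[symmetric]) measurable
      finally show ?thesis .
    qed
    have "integrable lborel (\<lambda>t. LINT x|lborel. \<psi> x * F x t)"
      using lborel_pair.integrable_snd[of "\<lambda>x t. \<psi> x * F x t"] PF by simp
    then have si: "set_integrable lborel {0..1} m'" by (simp add: inner set_integrable_def)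
    have "(LINT x|lborel. \<psi> x * I x) = (LINT x|lborel. (LINT t|lborel. \<psi> x * F x t))"
      by (simp add: I_def)
    also have "\<dots> = (LINT t|lborel. (LINT x|lborel. \<psi> x * F x t))"
      using lborel_pair.Fubini_integral[of "\<lambda>x t. \<psi> x * F x t"] PF by simp
    also have "\<dots> = (LINT t:{0..1}|lborel. m' t)" by (simp add: inner set_lebesgue_integral_def)
    also have "\<dots> = integral {0..1} m'" using set_borel_integral_eq_integral(2)[OF si] .
    also have "\<dots> = m 1 - m 0" using ftc by (rule integral_unique)
    finally have key: "(LINT x|lborel. \<psi> x * I x) = m 1 - m 0" .
    have m1: "m 1 = (LINT x|lebesgue. g (x + h) * \<psi> x)"
      using integral_lebesgue_translate[of "\<lambda>x. g x * \<psi> (x - h)" h, OF borel_measurable_integrable[OF gint]]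
      by (simp add: m_def)
    have m1i: "integrable lebesgue (\<lambda>x. g (x + h) * \<psi> x)"
      using integrable_lebesgue_translate[OF gint, of h h] by simp
    have Ii: "integrable lebesgue (\<lambda>x. \<psi> x * I x)"
    proof -
      have "integrable lborel (\<lambda>x. LINT t|lborel. \<psi> x * F x t)"
        using lborel_pair.integrable_fst'[of "\<lambda>(x, t). \<psi> x * F x t"] PF by simp
      then have "integrable lborel (\<lambda>x. \<psi> x * I x)" by (simp add: I_def)
      moreover have "(\<lambda>x. \<psi> x * I x) \<in> borel_measurable borel" by measurable
      ultimately show ?thesis by (simp add: integrable_lebesgue_iff_lborel)
    qed
    have key': "(LINT x|lebesgue. \<psi> x * I x) = m 1 - m 0"
      unfolding key[symmetric] by (rule integral_completion) measurable
    have "(LINT x|lebesgue. H x * \<psi> x) = (LINT x|lebesgue. (g (x + h) * \<psi> x - g x * \<psi> (x - 0)) - \<psi> x * I x)"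
      by (rule Bochner_Integration.integral_cong) (simp_all add: H_def algebra_simps)
    also have "\<dots> = ((LINT x|lebesgue. g (x + h) * \<psi> x) - (LINT x|lebesgue. g x * \<psi> (x - 0))) - (LINT x|lebesgue. \<psi> x * I x)"
      using m1i gint[of 0] Ii by (simp del: diff_zero)
    also have "\<dots> = 0" unfolding key' m1 by (simp add: m_def)
    finally have "(LINT x|lebesgue. H x * \<psi> x) = 0" .
    moreover have "\<psi> x = 0" if "x \<notin> K" for x using D(4) S(2) that by blast
    ultimately show ?thesis by (subst integral_lebesgue_on_test[OF K]) simp_all
  qed
  then have "AE x in lebesgue. x \<in> K \<longrightarrow> H x = 0" by (rule AE_eq_0_of_test_integrals[OF K Hloc])
  then have "AE x in lborel. x \<in> K \<longrightarrow> H x = 0" by (simp add: AE_completion_iff)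
  then show ?thesis by eventually_elim (simp add: H_def I_def F_def)
qed

text \<open>Jensen's inequality for the line integral \<open>\<integral>\<^sub>0\<^sup>1 G(x + th) \<bullet> h dt\<close>, then Fubini's theorem; the segments from \<open>K\<close> in
  direction \<open>h\<close> stay in \<open>U\<close>.\<close>

lemma translation_estimate:
  fixes g :: "'a::euclidean_space \<Rightarrow> real"
  assumes p: "1 < p" and U: "open U" and wk: "is_weak_gradient U g G"
    and gm[measurable]: "g \<in> borel_measurable borel" and Gm[measurable]: "G \<in> borel_measurable borel"
    and gl: "\<And>C. compact C \<Longrightarrow> integrable lborel (\<lambda>x. indicator C x * g x)"
    and Gl: "\<And>C. compact C \<Longrightarrow> integrable lborel (\<lambda>x. indicator C x *\<^sub>R G x)"
    and K: "open K" and seg: "\<And>x t. x \<in> K \<Longrightarrow> 0 \<le> t \<Longrightarrow> t \<le> 1 \<Longrightarrow> x + t *\<^sub>R h \<in> U"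
  shows "(NNINT x|lborel. ennreal (\<bar>g (x + h) - g x\<bar> powr p) * indicator K x)
    \<le> ennreal (norm h powr p) * (NNINT x|lborel. ennreal (norm (G x) powr p) * indicator U x)"
proof -
  have [measurable]: "K \<in> sets borel" "U \<in> sets borel" using K U by auto
  define N where "N x = ennreal (norm (G x) powr p)" for x
  have [measurable]: "N \<in> borel_measurable borel" unfolding N_def by measurable
  let ?N = "\<lambda>x t. ennreal (norm h powr p) * (N (x + t *\<^sub>R h) * indicator {0..1} t)"
  have bound: "ennreal (\<bar>LINT t|lborel. indicator {0..1} t * (G (x + t *\<^sub>R h) \<bullet> h)\<bar> powr p)
    \<le> (NNINT t|lborel. ?N x t)" for x
  proof -
    let ?M = "restrict_space lborel {0..1::real}"
    have M1: "emeasure ?M (space ?M) = 1" by (simp add: emeasure_restrict_space space_restrict_space)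
    have "ennreal (norm (LINT t|?M. G (x + t *\<^sub>R h) \<bullet> h) powr p) \<le> (NNINT t|?M. ennreal (norm (G (x + t *\<^sub>R h) \<bullet> h) powr p))"
      by (rule jensen_powr[OF p M1]) (intro measurable_restrict_space1, measurable)
    also have "\<dots> = (NNINT t|lborel. ennreal (norm (G (x + t *\<^sub>R h) \<bullet> h) powr p) * indicator {0..1} t)"
      by (rule nn_integral_restrict_space) simp
    also have "\<dots> \<le> (NNINT t|lborel. ?N x t)"
    proof (rule nn_integral_mono)
      fix t :: real
      have "norm (G (x + t *\<^sub>R h) \<bullet> h) powr p \<le> (norm h * norm (G (x + t *\<^sub>R h))) powr p"
        using p Cauchy_Schwarz_ineq2[of "G (x + t *\<^sub>R h)" h] by (intro powr_mono2) (auto simp: mult.commute)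
      then have "norm (G (x + t *\<^sub>R h) \<bullet> h) powr p \<le> norm h powr p * norm (G (x + t *\<^sub>R h)) powr p"
        by (simp add: powr_mult)
      then show "ennreal (norm (G (x + t *\<^sub>R h) \<bullet> h) powr p) * indicator {0..1} t
          \<le> ?N x t"
        by (auto simp: N_def indicator_def simp flip: ennreal_mult intro!: ennreal_leI)
    qed
    finally show ?thesis
      by (subst (asm) integral_restrict_space) (auto simp: set_lebesgue_integral_def)
  qed
  have "(NNINT x|lborel. ennreal (\<bar>g (x + h) - g x\<bar> powr p) * indicator K x)
    \<le> (NNINT x|lborel. (NNINT t|lborel. ?N x t) * indicator K x)"
  proof (rule nn_integral_mono_AE)
    have "AE x in lborel. x \<in> K \<longrightarrow> g (x + h) - g x = (LINT t|lborel. indicator {0..1} t * (G (x + t *\<^sub>R h) \<bullet> h))"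
      by (rule weak_gradient_line_integral[OF U wk gm Gm gl Gl K seg])
    then show "AE x in lborel. ennreal (\<bar>g (x + h) - g x\<bar> powr p) * indicator K x
      \<le> (NNINT t|lborel. ?N x t) * indicator K x"
    proof eventually_elim
      case (elim x)
      then show ?case using bound[of x] by (cases "x \<in> K") simp_all
    qed
  qed
  also have "\<dots> = (NNINT x|lborel. (NNINT t|lborel. ?N x t * indicator K x))"
    by (intro nn_integral_cong nn_integral_multc[symmetric]) measurable
  also have "\<dots> = (NNINT t|lborel. (NNINT x|lborel. ?N x t * indicator K x))"
    by (rule lborel_pair.Fubini'[symmetric]) measurable
  also have "\<dots> \<le> (NNINT t|lborel. ennreal (norm h powr p) * (NNINT x|lborel. N x * indicator U x) * indicator {0..1} (t::real))"
  proof (rule nn_integral_mono)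
    fix t :: real
    have "(NNINT x|lborel. ?N x t * indicator K x)
      \<le> (NNINT x|lborel. (ennreal (norm h powr p) * indicator {0..1} t) * (N (x + t *\<^sub>R h) * indicator U (x + t *\<^sub>R h)))"
      by (rule nn_integral_mono) (use seg in \<open>auto simp: indicator_def\<close>)
    also have "\<dots> = (ennreal (norm h powr p) * indicator {0..1} t) * (NNINT x|lborel. N (x + t *\<^sub>R h) * indicator U (x + t *\<^sub>R h))"
      by (rule nn_integral_cmult) measurable
    also have "(NNINT x|lborel. N (x + t *\<^sub>R h) * indicator U (x + t *\<^sub>R h)) = (NNINT x|lborel. N x * indicator U x)"
      by (rule nn_integral_lborel_translate[of "\<lambda>x. N x * indicator U x"]) measurable
    finally show "(NNINT x|lborel. ?N x t * indicator K x)
      \<le> ennreal (norm h powr p) * (NNINT x|lborel. N x * indicator U x) * indicator {0..1} t" by (simp add: mult_ac)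
  qed
  also have "\<dots> = ennreal (norm h powr p) * (NNINT x|lborel. N x * indicator U x)"
    by (subst nn_integral_cmult) auto
  finally show ?thesis by (simp add: N_def)
qed

section \<open>Integrability of powers of the norm\<close>

text \<open>On each shell \<open>r\<^sub>k / 2 \<le> |h| < r\<^sub>k\<close> the power \<open>|h|\<^sup>\<gamma>\<close> is comparable to \<open>r\<^sub>k\<^sup>\<gamma>\<close>, and the ball of radius \<open>r\<^sub>k\<close> has
  volume proportional to \<open>r\<^sub>k\<^sup>N\<close>.\<close>

lemma nn_integral_powr_norm_dyadic:
  fixes S :: "'a::euclidean_space set" and r :: "nat \<Rightarrow> real"
  assumes S: "\<And>h. h \<in> S \<Longrightarrow> \<exists>k. r k / 2 \<le> norm h \<and> norm h < r k" and r: "\<And>k. 0 < r k"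
    and sm: "summable (\<lambda>k. r k powr (\<gamma> + real DIM('a)))"
  shows "(NNINT h|lborel. ennreal (norm h powr \<gamma>) * indicator S h) < \<infinity>"
proof -
  let ?b = "\<lambda>k. 2 powr \<bar>\<gamma>\<bar> * r k powr \<gamma>" and ?B = "\<lambda>k. indicator (ball 0 (r k)) :: 'a \<Rightarrow> ennreal"
  define c where "c = unit_ball_vol (real DIM('a))"
  have c: "0 \<le> c" by (simp add: c_def)
  have "(NNINT h|lborel. ennreal (norm h powr \<gamma>) * indicator S h)
    \<le> (NNINT h|(lborel :: 'a measure). (\<Sum>k. ennreal (?b k) * ?B k h))"
  proof (rule nn_integral_mono)
    fix h :: 'a
    show "ennreal (norm h powr \<gamma>) * indicator S h \<le> (\<Sum>k. ennreal (?b k) * ?B k h)"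
    proof (cases "h \<in> S")
      case True
      then obtain k where k: "r k / 2 \<le> norm h" "norm h < r k" using S by blast
      define q where "q = norm h / r k"
      have q: "1 / 2 \<le> q" "q \<le> 1" using k r[of k] by (auto simp: q_def field_simps)
      have "q powr \<gamma> \<le> 2 powr \<bar>\<gamma>\<bar>"
      proof (cases "0 \<le> \<gamma>")
        case True
        then have "q powr \<gamma> \<le> 1" using q by (intro powr_le1) auto
        also have "1 \<le> 2 powr \<bar>\<gamma>\<bar>" by (rule ge_one_powr_ge_zero) auto
        finally show ?thesis .
      next
        case False
        then have "q powr \<gamma> \<le> (1 / 2) powr \<gamma>" using q by (intro powr_mono2') auto
        also have "\<dots> = 2 powr \<bar>\<gamma>\<bar>" using False by (simp add: powr_divide powr_minus_divide)
        finally show ?thesis .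
      qed
      moreover have "norm h powr \<gamma> = q powr \<gamma> * r k powr \<gamma>"
        using r[of k] by (subst powr_mult[symmetric]) (auto simp: q_def)
      ultimately have "norm h powr \<gamma> \<le> ?b k"
        by (simp add: mult_right_mono)
      then have "ennreal (norm h powr \<gamma>) * indicator S h \<le> (\<Sum>k\<in>{k}. ennreal (?b k) * ?B k h)"
        using True k by (simp add: ennreal_leI)
      also have "\<dots> \<le> (\<Sum>k. ennreal (?b k) * ?B k h)"
        by (rule sum_le_suminf) auto
      finally show ?thesis .
    qed simp
  qed
  also have "\<dots> = (\<Sum>k. NNINT h|(lborel :: 'a measure). ennreal (?b k) * ?B k h)"
    by (rule nn_integral_suminf) (intro borel_measurable_times_ennreal borel_measurable_const borel_measurable_indicator, simp)
  also have "\<dots> = (\<Sum>k. ennreal ((2 powr \<bar>\<gamma>\<bar> * c) * r k powr (\<gamma> + real DIM('a))))"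
  proof (rule suminf_cong)
    fix k
    have "(NNINT h|(lborel :: 'a measure). ennreal (?b k) * ?B k h)
      = ennreal (?b k) * emeasure (lborel :: 'a measure) (ball 0 (r k))"
      by (rule nn_integral_cmult_indicator) simp
    also have "\<dots> = ennreal (?b k) * ennreal (c * r k ^ DIM('a))"
      using r[of k] by (subst emeasure_ball) (auto simp: c_def)
    also have "\<dots> = ennreal ((2 powr \<bar>\<gamma>\<bar> * c) * r k powr (\<gamma> + real DIM('a)))"
      using r[of k] c by (subst ennreal_mult[symmetric]) (auto simp: powr_add powr_realpow mult_ac)
    finally show "(NNINT h|(lborel :: 'a measure). ennreal (?b k) * ?B k h)
      = ennreal ((2 powr \<bar>\<gamma>\<bar> * c) * r k powr (\<gamma> + real DIM('a)))" .
  qed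
  also have "\<dots> = ennreal (\<Sum>k. (2 powr \<bar>\<gamma>\<bar> * c) * r k powr (\<gamma> + real DIM('a)))"
    using c by (intro suminf_ennreal2 summable_mult sm) auto
  also have "\<dots> < \<infinity>" by simp
  finally show ?thesis .
qed

lemma nn_integral_powr_norm_ball:
  assumes "0 < \<beta>" "0 < \<delta>"
  shows "(NNINT h|(lborel :: 'a::euclidean_space measure). ennreal (norm h powr (\<beta> - real DIM('a))) * indicator (ball 0 \<delta> - {0}) h) < \<infinity>"
proof (rule nn_integral_powr_norm_dyadic[where r = "\<lambda>k. \<delta> * (1 / 2) ^ k"])
  fix h :: 'a assume "h \<in> ball 0 \<delta> - {0}"
  then have h: "0 < norm h / \<delta>" "norm h / \<delta> < 1" using assms by auto
  define n where "n = (LEAST n. (1 / 2) ^ Suc n \<le> norm h / \<delta>)"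
  obtain m where m0: "(1 / 2) ^ m < norm h / \<delta>" using real_arch_pow_inv[OF h(1), of "1/2"] by auto
  have "(1 / 2 :: real) ^ Suc m \<le> (1 / 2) ^ m" by (rule power_decreasing) auto
  then have m: "(1 / 2 :: real) ^ Suc m \<le> norm h / \<delta>" using m0 by linarith
  have n1: "(1 / 2) ^ Suc n \<le> norm h / \<delta>" unfolding n_def by (rule LeastI[of _ m]) (rule m)
  have n2: "norm h / \<delta> < (1 / 2) ^ n"
  proof (cases n)
    case (Suc k)
    then have "\<not> (1 / 2) ^ Suc k \<le> norm h / \<delta>" using not_less_Least[of k "\<lambda>n. (1 / 2) ^ Suc n \<le> norm h / \<delta>"]
      unfolding n_def by simp
    then show ?thesis using Suc by simp
  qed (use h in simp)
  show "\<exists>k. \<delta> * (1 / 2) ^ k / 2 \<le> norm h \<and> norm h < \<delta> * (1 / 2) ^ k"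
    using n1 n2 assms by (intro exI[of _ n]) (simp add: field_simps)
next
  have "(1 / 2 :: real) powr \<beta> < 1" using powr_less_mono2[of \<beta> "1 / 2" 1] assms by simp
  then have "summable (\<lambda>k. \<delta> powr \<beta> * ((1 / 2) powr \<beta>) ^ k)" by (intro summable_mult summable_geometric) auto
  moreover have "\<delta> powr \<beta> * ((1 / 2) powr \<beta>) ^ k = (\<delta> * (1 / 2) ^ k) powr \<beta>" for k
    using assms by (simp add: powr_mult powr_power powr_realpow[symmetric] powr_powr mult.commute)
  ultimately show "summable (\<lambda>k. (\<delta> * (1 / 2) ^ k) powr (\<beta> - real DIM('a) + real DIM('a)))" by simp
qed (use assms in auto)

lemma nn_integral_powr_norm_outside_ball:
  assumes "0 < \<alpha>" "0 < \<delta>"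
  shows "(NNINT h|(lborel :: 'a::euclidean_space measure). ennreal (norm h powr (- real DIM('a) - \<alpha>)) * indicator (- ball 0 \<delta>) h) < \<infinity>"
proof (rule nn_integral_powr_norm_dyadic[where r = "\<lambda>k. \<delta> * 2 ^ Suc k"])
  fix h :: 'a assume "h \<in> - ball 0 \<delta>"
  then have h: "1 \<le> norm h / \<delta>" using assms by auto
  define n where "n = (LEAST n. norm h / \<delta> < 2 ^ Suc n)"
  obtain m where m0: "norm h / \<delta> < 2 ^ m" using real_arch_pow[of 2 "norm h / \<delta>"] by auto
  have "(2 :: real) ^ m \<le> 2 ^ Suc m" by (rule power_increasing) auto
  then have m: "norm h / \<delta> < 2 ^ Suc m" using m0 by linarith
  have n1: "norm h / \<delta> < 2 ^ Suc n" unfolding n_def by (rule LeastI[of _ m]) (rule m)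
  have n2: "2 ^ n \<le> norm h / \<delta>"
  proof (cases n)
    case (Suc k)
    then have "\<not> norm h / \<delta> < 2 ^ Suc k" using not_less_Least[of k "\<lambda>n. norm h / \<delta> < 2 ^ Suc n"]
      unfolding n_def by simp
    then show ?thesis using Suc by simp
  qed (use h in simp)
  show "\<exists>k. \<delta> * 2 ^ Suc k / 2 \<le> norm h \<and> norm h < \<delta> * 2 ^ Suc k"
    using n1 n2 assms by (intro exI[of _ n]) (simp add: field_simps)
next
  have "(2 :: real) powr (- \<alpha>) < 1" using assms by (simp add: powr_less_one)
  then have "summable (\<lambda>k. (2 * \<delta>) powr (- \<alpha>) * (2 powr (- \<alpha>)) ^ k)" by (intro summable_mult summable_geometric) auto
  moreover have "(2 * \<delta>) powr (- \<alpha>) * (2 powr (- \<alpha>)) ^ k = (\<delta> * 2 ^ Suc k) powr (- \<alpha>)" for k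
    using assms by (simp add: powr_mult powr_power powr_realpow[symmetric] powr_powr mult.commute)
  ultimately show "summable (\<lambda>k. (\<delta> * 2 ^ Suc k) powr (- real DIM('a) - \<alpha> + real DIM('a)))" by simp
qed (use assms in auto)

section \<open>Borel representatives\<close>

lemma lebesgue_ex_borel_measurable:
  fixes f :: "'a::euclidean_space \<Rightarrow> 'b::euclidean_space"
  assumes f: "f \<in> borel_measurable lebesgue"
  obtains f' where "f' \<in> borel_measurable borel" "AE x in lebesgue. f x = f' x"
proof -
  have "\<forall>i\<in>Basis. \<exists>f'\<in>borel_measurable lborel. AE x in lborel. f x \<bullet> i = f' x"
    using f by (intro ballI completion_ex_borel_measurable_real borel_measurable_inner) auto
  then obtain F where F: "\<And>i. i \<in> Basis \<Longrightarrow> F i \<in> borel_measurable lborel"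
    "\<And>i. i \<in> Basis \<Longrightarrow> AE x in lborel. f x \<bullet> i = F i x" by metis
  define f' where "f' x = (\<Sum>i\<in>Basis. F i x *\<^sub>R i)" for x
  have "f' \<in> borel_measurable borel"
    unfolding f'_def using F(1) by (intro borel_measurable_sum borel_measurable_scaleR) auto
  moreover have "AE x in lborel. \<forall>i\<in>Basis. f x \<bullet> i = F i x" using F(2) by (rule AE_finite_allI[OF finite_Basis])
  then have "AE x in lborel. f x = f' x"
  proof eventually_elim
    case (elim x)
    have "f x = (\<Sum>i\<in>Basis. (f x \<bullet> i) *\<^sub>R i)" by (simp add: euclidean_representation)
    also have "\<dots> = f' x" unfolding f'_def using elim by (intro sum.cong) auto
    finally show ?case .
  qed
  then have "AE x in lebesgue. f x = f' x" by (rule AE_completion)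
  ultimately show thesis by (rule that)
qed

lemma Lpm_borel_version:
  fixes f :: "'a::euclidean_space \<Rightarrow> 'b::euclidean_space"
  assumes U: "open U" and f: "f \<in> Lpm p (lebesgue_on U)"
  obtains f' where "f' \<in> borel_measurable borel" "AE x in lebesgue. x \<in> U \<longrightarrow> f x = f' x"
    "\<And>x. x \<notin> U \<Longrightarrow> f' x = 0" "f' \<in> Lpm p lborel"
    "(NNINT x|lborel. ennreal (norm (f' x) powr p) * indicator U x) = ennreal (LINT x|lebesgue_on U. norm (f x) powr p)"
proof -
  have "(\<lambda>x. indicator U x *\<^sub>R f x) \<in> borel_measurable lebesgue"
    using LpmD(1)[OF f] unfolding measurable_lebesgue_on_iff[OF U] .
  then obtain h where h: "h \<in> borel_measurable borel" "AE x in lebesgue. indicator U x *\<^sub>R f x = h x"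
    by (rule lebesgue_ex_borel_measurable)
  have Ub: "U \<in> sets borel" using U by simp
  define f' where "f' x = indicator U x *\<^sub>R h x" for x
  have m: "f' \<in> borel_measurable borel" unfolding f'_def using h(1) Ub by measurable
  have ae: "AE x in lebesgue. x \<in> U \<longrightarrow> f x = f' x" using h(2) by eventually_elim (auto simp: f'_def)
  have z: "f' x = 0" if "x \<notin> U" for x using that by (simp add: f'_def)
  have L: "f' \<in> Lpm p (lebesgue_on U)" by (rule Lpm_AE_cong[OF U f ae])
  then have L': "f' \<in> Lpm p lebesgue" using Lpm_zero_extension[OF U, of f' p] z by simp
  have "integrable lborel (\<lambda>x. norm (f' x) powr p)"
  proof -
    have "(\<lambda>x. norm (f' x) powr p) \<in> borel_measurable borel" using m by measurable
    then show ?thesis using LpmD(2)[OF L'] by (simp add: integrable_lebesgue_iff_lborel)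
  qed
  then have L'': "f' \<in> Lpm p lborel" using m by (simp add: Lpm_def)
  have "ennreal (LINT x|lebesgue_on U. norm (f x) powr p) = ennreal (LINT x|lebesgue_on U. norm (f' x) powr p)"
  proof -
    have "(LINT x|lebesgue_on U. norm (f x) powr p) = (LINT x|lebesgue_on U. norm (f' x) powr p)"
    proof (rule integral_lebesgue_on_AE_cong[OF U])
      show "AE x in lebesgue. x \<in> U \<longrightarrow> norm (f x) powr p = norm (f' x) powr p" using ae by eventually_elim auto
      show "(\<lambda>x. norm (f x) powr p) \<in> borel_measurable (lebesgue_on U)" using LpmD(1)[OF f] by measurable
      show "(\<lambda>x. norm (f' x) powr p) \<in> borel_measurable (lebesgue_on U)" using LpmD(1)[OF L] by measurable
    qed
    then show ?thesis by simp
  qed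
  also have "\<dots> = (NNINT x|lebesgue_on U. ennreal (norm (f' x) powr p))" using nn_integral_norm_powr[OF L] by simp
  also have "\<dots> = (NNINT x|lebesgue. ennreal (norm (f' x) powr p) * indicator U x)"
    by (rule nn_integral_restrict_space) (simp add: sets_lebesgue_open[OF U])
  also have "\<dots> = (NNINT x|lborel. ennreal (norm (f' x) powr p) * indicator U x)"
    by (rule nn_integral_completion)
  finally show thesis using that[OF m ae z L''] by simp
qed

lemma weak_gradient_AE_cong:
  fixes u u' :: "'a::euclidean_space \<Rightarrow> real"
  assumes U: "open U" and u: "is_weak_gradient U u G"
    and eq: "AE x in lebesgue. x \<in> U \<longrightarrow> u x = u' x" "AE x in lebesgue. x \<in> U \<longrightarrow> G x = G' x"
    and loc: "u' \<in> Lp_loc 1 U" "G' \<in> Lp_loc 1 U"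
  shows "is_weak_gradient U u' G'"
  unfolding is_weak_gradient_iff[OF U]
proof (intro conjI ballI loc)
  note u = u[unfolded is_weak_gradient_iff[OF U]]
  fix \<psi> i assume psi: "\<psi> \<in> test_functions U" and i: "(i::'a) \<in> Basis"
  obtain K where K: "C1_supported K \<psi>" "K \<subseteq> U" using test_function_C1_supported[OF psi] .
  note D = C1_supportedD[OF K(1)]
  have z: "\<psi> x = 0" "grad \<psi> x = 0" if "x \<notin> U" for x using D(4,5) K(2) that by blast+
  have gi: "continuous_on UNIV (\<lambda>x. grad \<psi> x \<bullet> i)" by (intro continuous_intros D(7))
  have m1: "(\<lambda>x. v x * (grad \<psi> x \<bullet> i)) \<in> borel_measurable lebesgue" if "v \<in> Lp_loc 1 U" for v
    by (rule borel_measurable_integrable[OF Lp_loc_1_integrable_times[OF that gi D(2) K(2)]]) (simp add: D(5))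
  have m2: "(\<lambda>x. (v x \<bullet> i) * \<psi> x) \<in> borel_measurable lebesgue" if "v \<in> Lp_loc 1 U" for v
    by (rule borel_measurable_integrable[OF Lp_loc_1_integrable_times[OF Lp_loc_1_inner[OF that] D(6,2) K(2) D(4)]])
  have "(LINT x|lebesgue. u' x * (grad \<psi> x \<bullet> i)) = (LINT x|lebesgue. u x * (grad \<psi> x \<bullet> i))"
  proof (rule integral_cong_AE[OF m1[OF loc(1)] m1])
    show "AE x in lebesgue. u' x * (grad \<psi> x \<bullet> i) = u x * (grad \<psi> x \<bullet> i)"
      using eq(1) by eventually_elim (use z in force)
  qed (use u in blast)
  also have "\<dots> = - (LINT x|lebesgue. (G x \<bullet> i) * \<psi> x)" using u psi i by blast
  also have "(LINT x|lebesgue. (G x \<bullet> i) * \<psi> x) = (LINT x|lebesgue. (G' x \<bullet> i) * \<psi> x)"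
  proof (rule integral_cong_AE[OF m2 m2[OF loc(2)]])
    show "AE x in lebesgue. (G x \<bullet> i) * \<psi> x = (G' x \<bullet> i) * \<psi> x"
      using eq(2) by eventually_elim (use z in force)
  qed (use u in blast)
  finally show "(LINT x|lebesgue. u' x * (grad \<psi> x \<bullet> i)) = - (LINT x|lebesgue. (G' x \<bullet> i) * \<psi> x)" .
qed

text \<open>The pointwise estimates need Borel functions, and the Fubini arguments below need one representative that
  serves all increments \<open>h\<close> at once.\<close>

lemma translation_estimate_representative:
  fixes u :: "'a::euclidean_space \<Rightarrow> real"
  assumes p: "1 < p" and U: "open U" and wk: "is_weak_gradient U u G"
    and u: "u \<in> Lpm p (lebesgue_on U)" and G: "G \<in> Lpm p (lebesgue_on U)"
  obtains u' where "u' \<in> borel_measurable borel" "AE x in lebesgue. x \<in> U \<longrightarrow> u x = u' x"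
    "\<And>x. x \<notin> U \<Longrightarrow> u' x = 0" "u' \<in> Lpm p lborel"
    "(NNINT x|lborel. ennreal (\<bar>u' x\<bar> powr p)) = ennreal (LINT x|lebesgue_on U. \<bar>u x\<bar> powr p)"
    "\<And>K h. open K \<Longrightarrow> (\<And>x t. x \<in> K \<Longrightarrow> 0 \<le> t \<Longrightarrow> t \<le> 1 \<Longrightarrow> x + t *\<^sub>R h \<in> U) \<Longrightarrow>
      (NNINT x|lborel. ennreal (\<bar>u' (x + h) - u' x\<bar> powr p) * indicator K x)
        \<le> ennreal (norm h powr p) * ennreal (LINT x|lebesgue_on U. norm (G x) powr p)"
proof -
  obtain u' where u': "u' \<in> borel_measurable borel" "AE x in lebesgue. x \<in> U \<longrightarrow> u x = u' x"
    "\<And>x. x \<notin> U \<Longrightarrow> u' x = 0" "u' \<in> Lpm p lborel"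
    "(NNINT x|lborel. ennreal (norm (u' x) powr p) * indicator U x) = ennreal (LINT x|lebesgue_on U. norm (u x) powr p)"
    by (rule Lpm_borel_version[OF U u]) (rule that)
  obtain G' where G': "G' \<in> borel_measurable borel" "AE x in lebesgue. x \<in> U \<longrightarrow> G x = G' x"
    "\<And>x. x \<notin> U \<Longrightarrow> G' x = 0" "G' \<in> Lpm p lborel"
    "(NNINT x|lborel. ennreal (norm (G' x) powr p) * indicator U x) = ennreal (LINT x|lebesgue_on U. norm (G x) powr p)"
    by (rule Lpm_borel_version[OF U G]) (rule that)
  have wk': "is_weak_gradient U u' G'"
    by (rule weak_gradient_AE_cong[OF U wk u'(2) G'(2) Lp_loc_1_Lpm[OF p U Lpm_AE_cong[OF U u u'(2)]] Lp_loc_1_Lpm[OF p U Lpm_AE_cong[OF U G G'(2)]]])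
  have loc: "integrable lborel (\<lambda>x. indicator C x *\<^sub>R f x)" if "f \<in> Lpm p lborel" "compact C" for C :: "'a set" and f :: "'a \<Rightarrow> 'b::euclidean_space"
    using that emeasure_bounded_finite[OF compact_imp_bounded[OF that(2)]]
    by (intro Lpm_integrable_on_finite[OF p]) (auto simp: compact_imp_closed borel_closed)
  have up: "ennreal (\<bar>u' x\<bar> powr p) = ennreal (norm (u' x) powr p) * indicator U x" for x
    using u'(3)[of x] by (cases "x \<in> U") auto
  show thesis
  proof (rule that[OF u'(1-4)])
    show "(NNINT x|lborel. ennreal (\<bar>u' x\<bar> powr p)) = ennreal (LINT x|lebesgue_on U. \<bar>u x\<bar> powr p)"
      unfolding up u'(5) by simp
    fix K h assume K: "open K" "\<And>x t. x \<in> K \<Longrightarrow> 0 \<le> t \<Longrightarrow> t \<le> 1 \<Longrightarrow> x + t *\<^sub>R h \<in> U"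
    have l1: "integrable lborel (\<lambda>x. indicator C x * u' x)" if "compact C" for C using loc[OF u'(4) that] by simp
    have l2: "integrable lborel (\<lambda>x. indicator C x *\<^sub>R G' x)" if "compact C" for C using loc[OF G'(4) that] .
    show "(NNINT x|lborel. ennreal (\<bar>u' (x + h) - u' x\<bar> powr p) * indicator K x)
        \<le> ennreal (norm h powr p) * ennreal (LINT x|lebesgue_on U. norm (G x) powr p)"
      unfolding G'(5)[symmetric] by (rule translation_estimate[OF p U wk' u'(1) G'(1) l1 l2 K])
  qed
qed

section \<open>Loomis-Whitney and the Gagliardo-Nirenberg-Sobolev inequality\<close>

text \<open>The \<open>m\<close>-th root on \<open>[0, \<infinity>]\<close>; marginals of functions need not be finite everywhere.\<close>

definition eroot :: "nat \<Rightarrow> ennreal \<Rightarrow> ennreal" where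
  "eroot m a = (if a = top then top else ennreal (root m (enn2real a)))"

lemma eroot_ennreal: "0 \<le> x \<Longrightarrow> eroot m (ennreal x) = ennreal (root m x)"
  by (simp add: eroot_def)

lemma eroot_top: "eroot m top = top"
  by (simp add: eroot_def)

lemma eroot_0: "eroot m 0 = 0"
  by (simp add: eroot_def)

lemma eroot_mono:
  assumes "0 < m" "a \<le> b"
  shows "eroot m a \<le> eroot m b"
proof (cases "b = top")
  case False
  then have "a \<noteq> top" using assms(2) by (auto simp: top_unique)
  moreover have "enn2real a \<le> enn2real b" using assms(2) False by (intro enn2real_mono) (auto simp: less_top)
  ultimately show ?thesis using assms False by (auto simp: eroot_def intro!: ennreal_leI real_root_le_mono)
qed (simp add: eroot_def)

lemma measurable_eroot[measurable]: "eroot m \<in> borel_measurable borel"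
proof -
  have "root m \<in> borel_measurable borel" by (intro borel_measurable_continuous_onI continuous_intros)
  then show ?thesis unfolding eroot_def[abs_def] by measurable
qed

lemma root_prod:
  fixes x :: "'i \<Rightarrow> real"
  assumes "finite I" "0 < m"
  shows "root m (\<Prod>i\<in>I. x i) = (\<Prod>i\<in>I. root m (x i))"
  using assms by (induction I rule: finite_induct) (simp_all add: real_root_mult)

lemma prod_ennreal_top:
  fixes a :: "'i \<Rightarrow> ennreal"
  assumes "finite I" "\<And>i. i \<in> I \<Longrightarrow> a i \<noteq> 0" "j \<in> I" "a j = top"
  shows "(\<Prod>i\<in>I. a i) = top"
proof -
  have "(\<Prod>i\<in>I. a i) = a j * (\<Prod>i\<in>I - {j}. a i)" using assms by (simp add: prod.remove)
  moreover have "(\<Prod>i\<in>I - {j}. a i) \<noteq> 0" using assms by simp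
  ultimately show ?thesis using assms(4) by (simp add: ennreal_top_mult)
qed

lemma eroot_prod_finite:
  fixes a :: "'i \<Rightarrow> real"
  assumes "finite I" "0 < m" "\<And>i. i \<in> I \<Longrightarrow> 0 \<le> a i"
  shows "(\<Prod>i\<in>I. eroot m (ennreal (a i))) = ennreal (root m (\<Prod>i\<in>I. a i))"
proof -
  have "(\<Prod>i\<in>I. eroot m (ennreal (a i))) = (\<Prod>i\<in>I. ennreal (root m (a i)))"
    using assms by (intro prod.cong refl) (simp add: eroot_ennreal)
  also have "\<dots> = ennreal (\<Prod>i\<in>I. root m (a i))" using assms by (intro prod_ennreal) auto
  finally show ?thesis using assms by (simp add: root_prod)
qed

text \<open>Hoelder's inequality for \<open>m\<close> functions with equal exponents: normalise every integral to \<open>1\<close>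
  and apply the inequality of arithmetic and geometric means.\<close>

lemma nn_integral_prod_eroot_le:
  fixes h :: "'i \<Rightarrow> 'a \<Rightarrow> ennreal"
  assumes I: "finite I" "I \<noteq> {}" and h[measurable]: "\<And>i. i \<in> I \<Longrightarrow> h i \<in> borel_measurable M"
  shows "(NNINT x|M. (\<Prod>i\<in>I. eroot (card I) (h i x))) \<le> (\<Prod>i\<in>I. eroot (card I) (NNINT x|M. h i x))"
proof -
  define m where "m = card I"
  have m: "0 < m" using I by (simp add: m_def card_gt_0_iff)
  define a where "a i = (NNINT x|M. h i x)" for i
  consider (zero) j where "j \<in> I" "a j = 0" | (top) j where "\<And>i. i \<in> I \<Longrightarrow> a i \<noteq> 0" "j \<in> I" "a j = top"
    | (fin) "\<And>i. i \<in> I \<Longrightarrow> a i \<noteq> 0 \<and> a i \<noteq> top" by blast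
  then have "(NNINT x|M. (\<Prod>i\<in>I. eroot m (h i x))) \<le> (\<Prod>i\<in>I. eroot m (a i))"
  proof cases
    case zero
    then have "AE x in M. h j x = 0" using nn_integral_0_iff_AE[of "h j" M] h by (simp add: a_def)
    then have "AE x in M. (\<Prod>i\<in>I. eroot m (h i x)) = 0"
    proof eventually_elim
      case (elim x)
      then show ?case using zero I by (intro prod_zero) (auto simp: eroot_0 intro!: bexI[of _ j])
    qed
    then have "(NNINT x|M. (\<Prod>i\<in>I. eroot m (h i x))) = (NNINT x|M. 0)" by (rule nn_integral_cong_AE)
    then show ?thesis by simp
  next
    case top
    have "eroot m (a i) \<noteq> 0" if "i \<in> I" for i
      using top(1)[OF that] m by (auto simp: eroot_def enn2real_eq_0_iff)
    then have "(\<Prod>i\<in>I. eroot m (a i)) = top"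
      by (rule prod_ennreal_top[OF I(1) _ top(2)]) (simp_all add: top(3) eroot_top)
    then show ?thesis by simp
  next
    case fin
    define c where "c i = enn2real (a i)" for i
    have c: "0 < c i" "ennreal (c i) = a i" if "i \<in> I" for i
      using fin[OF that] by (auto simp: c_def enn2real_positive_iff less_top zero_less_iff_neq_zero)
    have ae: "AE x in M. \<forall>i\<in>I. h i x \<noteq> top"
    proof (rule AE_finite_allI[OF I(1)])
      fix i assume i: "i \<in> I"
      show "AE x in M. h i x \<noteq> top"
        using nn_integral_PInf_AE[of "h i" M] h[OF i] fin[OF i] by (simp add: a_def)
    qed
    define P where "P = root m (\<Prod>i\<in>I. c i)"
    have P0: "0 \<le> P" by (auto simp: P_def intro!: real_root_ge_zero prod_nonneg less_imp_le[OF c(1)])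
    have "(NNINT x|M. (\<Prod>i\<in>I. eroot m (h i x))) \<le> (NNINT x|M. ennreal P * (\<Sum>i\<in>I. ennreal (1 / (real m * c i)) * h i x))"
    proof (rule nn_integral_mono_AE)
      show "AE x in M. (\<Prod>i\<in>I. eroot m (h i x)) \<le> ennreal P * (\<Sum>i\<in>I. ennreal (1 / (real m * c i)) * h i x)"
        using ae
      proof eventually_elim
        case (elim x)
        define y where "y i = enn2real (h i x)" for i
        have y: "0 \<le> y i" "ennreal (y i) = h i x" if "i \<in> I" for i using elim that by (auto simp: y_def less_top)
        have "(\<Prod>i\<in>I. eroot m (h i x)) = (\<Prod>i\<in>I. eroot m (ennreal (y i)))" using y by simp
        also have "\<dots> = ennreal (root m (\<Prod>i\<in>I. y i))" by (rule eroot_prod_finite[OF I(1) m y(1)])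
        also have "root m (\<Prod>i\<in>I. y i) = P * root m (\<Prod>i\<in>I. y i / c i)"
        proof -
          have "(\<Prod>i\<in>I. c i) * (\<Prod>i\<in>I. y i / c i) = (\<Prod>i\<in>I. y i)"
          proof (subst prod.distrib[symmetric], rule prod.cong[OF refl])
            fix i assume "i \<in> I"
            then show "c i * (y i / c i) = y i" using c(1)[of i] by simp
          qed
          then show ?thesis unfolding P_def by (simp flip: real_root_mult)
        qed
        also have "ennreal (P * root m (\<Prod>i\<in>I. y i / c i)) \<le> ennreal (P * (\<Sum>i\<in>I. (1 / (real m * c i)) * y i))"
        proof (intro ennreal_leI mult_left_mono P0)
          have yc: "0 \<le> y i / c i" if "i \<in> I" for i using y(1)[OF that] c(1)[OF that] by simp
          have "root m z = z powr (1 / real m)" if "0 \<le> z" for z :: real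
            using that m by (cases "z = 0") (simp_all add: root_powr_inverse)
          then have "root m (\<Prod>i\<in>I. y i / c i) = (\<Prod>i\<in>I. y i / c i) powr (1 / real (card I))"
            using prod_nonneg[of I "\<lambda>i. y i / c i"] yc by (simp add: m_def)
          also have "\<dots> \<le> (\<Sum>i\<in>I. y i / c i / real (card I))"
            by (rule arith_geom_mean[OF I yc])
          finally have "root m (\<Prod>i\<in>I. y i / c i) \<le> (\<Sum>i\<in>I. y i / c i / real (card I))" .
          then show "root m (\<Prod>i\<in>I. y i / c i) \<le> (\<Sum>i\<in>I. (1 / (real m * c i)) * y i)"
            by (simp add: m_def mult.commute)
        qed
        also have "\<dots> = ennreal P * (\<Sum>i\<in>I. ennreal ((1 / (real m * c i)) * y i))"
          using P0 y(1) c(1) by (subst ennreal_mult) (auto intro!: sum_nonneg mult_nonneg_nonneg simp: less_imp_le simp flip: sum_ennreal)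
        also have "(\<Sum>i\<in>I. ennreal ((1 / (real m * c i)) * y i)) = (\<Sum>i\<in>I. ennreal (1 / (real m * c i)) * h i x)"
        proof (rule sum.cong[OF refl])
          fix i assume i: "i \<in> I"
          have "ennreal ((1 / (real m * c i)) * y i) = ennreal (1 / (real m * c i)) * ennreal (y i)"
            using y(1)[OF i] c(1)[OF i] by (intro ennreal_mult) auto
          then show "ennreal ((1 / (real m * c i)) * y i) = ennreal (1 / (real m * c i)) * h i x" using y(2)[OF i] by simp
        qed
        finally show ?case .
      qed
    qed
    also have "\<dots> = ennreal P * (\<Sum>i\<in>I. ennreal (1 / (real m * c i)) * a i)"
      using h by (simp add: nn_integral_cmult nn_integral_sum a_def)
    also have "(\<Sum>i\<in>I. ennreal (1 / (real m * c i)) * a i) = (\<Sum>i\<in>I. ennreal (1 / real m))"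
    proof (rule sum.cong[OF refl])
      fix i assume i: "i \<in> I"
      have "ennreal (1 / (real m * c i)) * a i = ennreal (1 / (real m * c i) * c i)"
        using c[OF i] by (subst ennreal_mult) auto
      then show "ennreal (1 / (real m * c i)) * a i = ennreal (1 / real m)" using c(1)[OF i] by simp
    qed
    also have "\<dots> = ennreal (real m * (1 / real m))" using m by (simp add: m_def ennreal_of_nat_eq_real_of_nat flip: ennreal_mult)
    also have "ennreal P * \<dots> = ennreal P" using m by simp
    also have "ennreal P = (\<Prod>i\<in>I. eroot m (ennreal (c i)))"
      unfolding P_def by (rule eroot_prod_finite[symmetric, OF I(1) m]) (use c(1) less_imp_le in blast)
    also have "\<dots> = (\<Prod>i\<in>I. eroot m (a i))" using c(2) by simp
    finally show ?thesis .
  qed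
  then show ?thesis by (simp add: m_def a_def)
qed

text \<open>The integral of \<open>h\<close> over the coordinate subspace through \<open>x\<close> that is spanned by \<open>S \<subseteq> Basis\<close>.\<close>

definition marginal :: "'a::euclidean_space set \<Rightarrow> ('a \<Rightarrow> ennreal) \<Rightarrow> 'a \<Rightarrow> ennreal" where
  "marginal S h x = (NNINT f|(\<Pi>\<^sub>M b\<in>S. lborel). h (x + (\<Sum>b\<in>S. f b *\<^sub>R b)))"

lemma marginal_empty: "marginal {} h x = h x"
  by (simp add: marginal_def PiM_empty nn_integral_count_space_finite)

lemma marginal_insert:
  fixes h :: "'a::euclidean_space \<Rightarrow> ennreal"
  assumes S: "finite S" "j \<notin> S" and h[measurable]: "h \<in> borel_measurable borel"
  shows "marginal (insert j S) h x = (NNINT t|lborel. marginal S h (x + t *\<^sub>R j))"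
proof -
  interpret product_sigma_finite "\<lambda>_::'a. lborel :: real measure" ..
  have "marginal (insert j S) h x
    = (NNINT t|lborel. (NNINT f|(\<Pi>\<^sub>M b\<in>S. lborel). h (x + (\<Sum>b\<in>insert j S. (f(j := t)) b *\<^sub>R b))))"
    unfolding marginal_def by (rule product_nn_integral_insert_rev[OF S]) measurable
  also have "\<dots> = (NNINT t|lborel. marginal S h (x + t *\<^sub>R j))"
  proof (intro nn_integral_cong)
    fix t :: real
    have "(\<Sum>b\<in>insert j S. (f(j := t)) b *\<^sub>R b) = t *\<^sub>R j + (\<Sum>b\<in>S. f b *\<^sub>R b)" for f :: "'a \<Rightarrow> real"
    proof -
      have "(\<Sum>b\<in>S. (f(j := t)) b *\<^sub>R b) = (\<Sum>b\<in>S. f b *\<^sub>R b)" using S(2) by (intro sum.cong) auto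
      then show ?thesis using S by simp
    qed
    then show "(NNINT f|(\<Pi>\<^sub>M b\<in>S. lborel). h (x + (\<Sum>b\<in>insert j S. (f(j := t)) b *\<^sub>R b))) = marginal S h (x + t *\<^sub>R j)"
      by (simp add: marginal_def add.assoc)
  qed
  finally show ?thesis .
qed

lemma measurable_marginal[measurable]:
  fixes h :: "'a::euclidean_space \<Rightarrow> ennreal"
  assumes S: "finite S" and h[measurable]: "h \<in> borel_measurable borel"
  shows "marginal S h \<in> borel_measurable borel"
  using S
proof (induction S rule: finite_induct)
  case empty
  have "marginal {} h = h" by (simp add: fun_eq_iff marginal_empty)
  then show ?case using h by simp
next
  case (insert j S)
  note [measurable] = insert.IH
  have "marginal (insert j S) h = (\<lambda>x. NNINT t|lborel. marginal S h (x + t *\<^sub>R j))"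
    using marginal_insert[OF insert.hyps h] by (intro ext)
  then show ?case by simp
qed

lemma marginal_Basis:
  fixes h :: "'a::euclidean_space \<Rightarrow> ennreal"
  assumes h[measurable]: "h \<in> borel_measurable borel"
  shows "marginal Basis h x = (NNINT y|lborel. h y)"
proof -
  have "(NNINT y|lborel. h (y + x)) = (NNINT f|(\<Pi>\<^sub>M b\<in>(Basis::'a set). lborel). h ((\<Sum>b\<in>Basis. f b *\<^sub>R b) + x))"
    by (subst lborel_eq, subst nn_integral_distr) measurable
  then show ?thesis using nn_integral_lborel_translate[OF h, of x] by (simp add: marginal_def add.commute)
qed

lemma marginal_translate:
  fixes h :: "'a::euclidean_space \<Rightarrow> ennreal"
  assumes S: "finite S" "j \<in> S" and h[measurable]: "h \<in> borel_measurable borel"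
  shows "marginal S h (x + t *\<^sub>R j) = marginal S h x"
proof -
  obtain S' where S': "S = insert j S'" "j \<notin> S'" using S(2) by (metis mk_disjoint_insert)
  have fin: "finite S'" using S S' by simp
  note [measurable] = measurable_marginal[OF fin h]
  have "marginal S h (x + t *\<^sub>R j) = (NNINT \<tau>|lborel. marginal S' h (x + (\<tau> + t) *\<^sub>R j))"
    unfolding S'(1) marginal_insert[OF fin S'(2) h] by (simp add: algebra_simps)
  also have "\<dots> = (NNINT \<tau>|lborel. marginal S' h (x + \<tau> *\<^sub>R j))"
    by (rule nn_integral_lborel_translate[of "\<lambda>\<tau>. marginal S' h (x + \<tau> *\<^sub>R j)"]) measurable
  also have "\<dots> = marginal S h x" unfolding S'(1) marginal_insert[OF fin S'(2) h] ..
  finally show ?thesis .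
qed

lemma marginal_mono: "(\<And>y. h y \<le> k y) \<Longrightarrow> marginal S h x \<le> marginal S k x"
  unfolding marginal_def by (intro nn_integral_mono)

text \<open>The Loomis-Whitney inequality, integrating out one coordinate \<open>j\<close> at a time: one of the \<open>N\<close> factors does
  not depend on that coordinate, and Hoelder's inequality applies to the other \<open>N - 1\<close>.\<close>

lemma marginal_prod_le:
  fixes g :: "'a::euclidean_space \<Rightarrow> ennreal"
  assumes g[measurable]: "g \<in> borel_measurable borel" and N: "2 \<le> DIM('a)" and T: "T \<subseteq> Basis"
  shows "marginal T (\<lambda>x. \<Prod>i\<in>Basis. eroot (DIM('a) - 1) (marginal {i} g x)) x
    \<le> (\<Prod>i\<in>Basis. eroot (DIM('a) - 1) (marginal (insert i T) g x))"
proof -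
  let ?m = "DIM('a) - 1"
  define h where "h x = (\<Prod>i\<in>(Basis::'a set). eroot ?m (marginal {i} g x))" for x
  have mm[measurable]: "marginal S g \<in> borel_measurable borel" if "S \<subseteq> Basis" for S
    using that finite_subset[OF that finite_Basis] by (intro measurable_marginal) auto
  have [measurable]: "marginal {i} g \<in> borel_measurable borel" for i by (rule measurable_marginal) auto
  have h[measurable]: "h \<in> borel_measurable borel"
    unfolding h_def by (intro borel_measurable_prod_ennreal measurable_compose[OF _ measurable_eroot]) auto
  have "finite T" using T finite_subset finite_Basis by blast
  then have "\<forall>x. marginal T h x \<le> (\<Prod>i\<in>Basis. eroot ?m (marginal (insert i T) g x))"
    using T
  proof (induction T rule: finite_induct)
    case empty
    then show ?case by (simp add: marginal_empty h_def)
  next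
    case (insert j T)
    then have jB: "j \<in> Basis" and JB: "T \<subseteq> Basis" by auto
    show ?case
    proof
      fix x
      let ?I = "Basis - {j}"
      have cI: "card ?I = ?m" using jB by simp
      have Ine: "?I \<noteq> {}" 
      proof
        assume "?I = {}"
        then have "?m = 0" using cI by (simp only: card.empty)
        then show False using N by linarith
      qed
      have fI: "finite (insert i T)" for i using insert.hyps by simp
      have mt: "(\<lambda>t. marginal (insert i T) g (x + t *\<^sub>R j)) \<in> borel_measurable lborel" for i
      proof -
        have "(\<lambda>t. x + t *\<^sub>R j) \<in> borel_measurable (borel :: real measure)" by simp
        from measurable_compose[OF this measurable_marginal[OF fI g]] show ?thesis by simp
      qed
      have "marginal (insert j T) h x = (NNINT t|lborel. marginal T h (x + t *\<^sub>R j))"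
        by (rule marginal_insert[OF insert.hyps h])
      also have "\<dots> \<le> (NNINT t|lborel. (\<Prod>i\<in>Basis. eroot ?m (marginal (insert i T) g (x + t *\<^sub>R j))))"
        using insert.IH[OF JB] by (intro nn_integral_mono) blast
      also have "\<dots> = (NNINT t|lborel. eroot ?m (marginal (insert j T) g x) * (\<Prod>i\<in>?I. eroot ?m (marginal (insert i T) g (x + t *\<^sub>R j))))"
      proof (rule nn_integral_cong)
        fix t :: real
        have "marginal (insert j T) g (x + t *\<^sub>R j) = marginal (insert j T) g x"
          by (rule marginal_translate[OF fI _ g]) simp
        then show "(\<Prod>i\<in>Basis. eroot ?m (marginal (insert i T) g (x + t *\<^sub>R j)))
          = eroot ?m (marginal (insert j T) g x) * (\<Prod>i\<in>?I. eroot ?m (marginal (insert i T) g (x + t *\<^sub>R j)))"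
          using jB by (subst prod.remove[of _ j]) auto
      qed
      also have "\<dots> = eroot ?m (marginal (insert j T) g x) * (NNINT t|lborel. (\<Prod>i\<in>?I. eroot ?m (marginal (insert i T) g (x + t *\<^sub>R j))))"
        by (intro nn_integral_cmult borel_measurable_prod_ennreal measurable_compose[OF mt measurable_eroot])
      also have "\<dots> \<le> eroot ?m (marginal (insert j T) g x) * (\<Prod>i\<in>?I. eroot ?m (NNINT t|lborel. marginal (insert i T) g (x + t *\<^sub>R j)))"
        using nn_integral_prod_eroot_le[of ?I "\<lambda>i t. marginal (insert i T) g (x + t *\<^sub>R j)" lborel] Ine mt
        by (intro mult_left_mono) (auto simp: cI)
      also have "(\<Prod>i\<in>?I. eroot ?m (NNINT t|lborel. marginal (insert i T) g (x + t *\<^sub>R j)))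
        = (\<Prod>i\<in>?I. eroot ?m (marginal (insert i (insert j T)) g x))"
      proof (rule prod.cong[OF refl])
        fix i assume i: "i \<in> ?I"
        then have "j \<notin> insert i T" using insert.hyps by auto
        then have "marginal (insert j (insert i T)) g x = (NNINT t|lborel. marginal (insert i T) g (x + t *\<^sub>R j))"
          by (rule marginal_insert[OF fI _ g])
        then show "eroot ?m (NNINT t|lborel. marginal (insert i T) g (x + t *\<^sub>R j)) = eroot ?m (marginal (insert i (insert j T)) g x)"
          by (simp add: insert_commute)
      qed
      also have "eroot ?m (marginal (insert j T) g x) * \<dots> = (\<Prod>i\<in>Basis. eroot ?m (marginal (insert i (insert j T)) g x))"
        using jB by (subst prod.remove[of Basis j]) auto
      finally show "marginal (insert j T) h x \<le> (\<Prod>i\<in>Basis. eroot ?m (marginal (insert i (insert j T)) g x))" .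
    qed
  qed
  then show ?thesis unfolding h_def[abs_def] by blast
qed

lemma has_derivative_abs_powr:
  fixes s \<gamma> :: real
  assumes g: "1 < \<gamma>"
  shows "((\<lambda>s. \<bar>s\<bar> powr \<gamma>) has_real_derivative \<gamma> * pflux \<gamma> s) (at s)"
proof -
  consider "s > 0" | "s < 0" | "s = 0" by linarith
  then show ?thesis
  proof cases
    case 1
    have "((\<lambda>s. s powr \<gamma>) has_real_derivative \<gamma> * s powr (\<gamma> - 1)) (at s)"
      using 1 by (rule has_real_derivative_powr)
    also have "\<gamma> * s powr (\<gamma> - 1) = \<gamma> * pflux \<gamma> s"
      using 1 powr_add[of s "\<gamma> - 2" 1] by (simp add: pflux_def)
    finally show ?thesis
      by (rule has_field_derivative_transform_within_open[OF _ open_greaterThan[of 0]]) (use 1 in auto)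
  next
    case 2
    have "((\<lambda>s. (- s) powr \<gamma>) has_real_derivative (\<gamma> * (- s) powr (\<gamma> - 1)) * (- 1)) (at s)"
      by (rule DERIV_chain'[OF _ has_real_derivative_powr]) (use 2 in \<open>auto intro!: derivative_eq_intros\<close>)
    also have "(\<gamma> * (- s) powr (\<gamma> - 1)) * (- 1) = \<gamma> * pflux \<gamma> s"
      using 2 powr_add[of "- s" "\<gamma> - 2" 1] by (simp add: pflux_def)
    finally show ?thesis
      by (rule has_field_derivative_transform_within_open[OF _ open_lessThan[of 0]]) (use 2 in auto)
  next
    case 3
    have "((\<lambda>h::real. \<bar>h\<bar> powr (\<gamma> - 1)) \<longlongrightarrow> 0 powr (\<gamma> - 1)) (at 0)"
      using g by (intro tendsto_powr2 tendsto_const tendsto_rabs_zero tendsto_ident_at) auto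
    then have "((\<lambda>h::real. \<bar>h\<bar> powr (\<gamma> - 1)) \<longlongrightarrow> 0) (at 0)" by simp
    moreover have "\<bar>\<bar>h\<bar> powr \<gamma> / h\<bar> = \<bar>h\<bar> powr (\<gamma> - 1)" for h :: real
      by (cases "h = 0") (simp_all add: powr_diff abs_divide)
    ultimately have "((\<lambda>h::real. \<bar>\<bar>h\<bar> powr \<gamma> / h\<bar>) \<longlongrightarrow> 0) (at 0)" by simp
    then have "((\<lambda>h::real. \<bar>h\<bar> powr \<gamma> / h) \<longlongrightarrow> 0) (at 0)" by (rule tendsto_rabs_zero_cancel)
    then show ?thesis using 3 g by (simp add: DERIV_def pflux_def)
  qed
qed

lemma has_real_derivative_along_line:
  assumes "Ck (Suc 0) \<phi>"
  shows "((\<lambda>t. \<phi> (x + t *\<^sub>R b)) has_real_derivative grad \<phi> (x + t *\<^sub>R b) \<bullet> b) (at t)"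
proof -
  have "((\<lambda>t. x + t *\<^sub>R b) has_derivative (\<lambda>t. t *\<^sub>R b)) (at t)" by (auto intro!: derivative_eq_intros)
  from has_derivative_compose[OF this has_derivative_grad[OF assms]]
  have "((\<lambda>t. \<phi> (x + t *\<^sub>R b)) has_derivative (\<lambda>s. grad \<phi> (x + t *\<^sub>R b) \<bullet> (s *\<^sub>R b))) (at t)" .
  moreover have "(\<lambda>s. grad \<phi> (x + t *\<^sub>R b) \<bullet> (s *\<^sub>R b)) = (*) (grad \<phi> (x + t *\<^sub>R b) \<bullet> b)"
    by (simp add: fun_eq_iff mult.commute)
  ultimately show ?thesis by (simp add: has_field_derivative_def)
qed

lemma diff_le_nn_integral_derivative:
  fixes F :: "real \<Rightarrow> real"
  assumes "a \<le> b" and F: "\<And>t. (F has_real_derivative F' t) (at t)" and F'b: "\<And>t. \<bar>F' t\<bar> \<le> k t"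
    and F'm: "F' \<in> borel_measurable borel" and km: "k \<in> borel_measurable borel"
  shows "ennreal (\<bar>F b - F a\<bar>) \<le> (NNINT t|lborel. ennreal (k t) * indicator {a..b} t)"
proof (cases "(NNINT t|lborel. ennreal (k t) * indicator {a..b} t) = top")
  case False
  note [measurable] = F'm km
  have k0: "0 \<le> k t" for t using F'b[of t] by linarith
  have eq: "ennreal (indicator {a..b} t * k t) = ennreal (k t) * indicator {a..b} t" for t
    by (auto simp: indicator_def)
  have ik: "integrable lborel (\<lambda>t. indicator {a..b} t * k t)"
  proof (rule integrableI_bounded)
    have "ennreal (norm (indicator {a..b} t * k t)) = ennreal (k t) * indicator {a..b} t" for t
      using k0 by (auto simp: indicator_def)
    then show "(NNINT t|lborel. ennreal (norm (indicator {a..b} t * k t))) < \<infinity>" using False by (simp add: less_top)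
  qed measurable
  have iF: "integrable lborel (\<lambda>t. indicator {a..b} t * F' t)"
  proof (rule Bochner_Integration.integrable_bound[OF ik])
    show "AE t in lborel. norm (indicator {a..b} t * F' t) \<le> norm (indicator {a..b} t * k t)"
      using F'b k0 by (intro AE_I2) (auto simp: indicator_def)
  qed measurable
  then have si: "set_integrable lborel {a..b} F'" by (simp add: set_integrable_def)
  have "(F' has_integral F b - F a) {a..b}"
    using F has_vector_derivative_at_within[of F _ _ "{a..b}"]
    by (intro fundamental_theorem_of_calculus assms) (auto simp: has_real_derivative_iff_has_vector_derivative)
  then have "F b - F a = integral {a..b} F'" by (simp add: integral_unique)
  also have "\<dots> = (LINT t:{a..b}|lborel. F' t)" using set_borel_integral_eq_integral(2)[OF si] by simp
  finally have "\<bar>F b - F a\<bar> = \<bar>LINT t|lborel. indicator {a..b} t * F' t\<bar>" by (simp add: set_lebesgue_integral_def)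
  also have "\<dots> \<le> (LINT t|lborel. \<bar>indicator {a..b} t * F' t\<bar>)" by (rule integral_abs_bound)
  also have "\<dots> \<le> (LINT t|lborel. indicator {a..b} t * k t)"
    using iF ik F'b by (intro integral_mono) (auto simp: indicator_def)
  finally have "ennreal \<bar>F b - F a\<bar> \<le> ennreal (LINT t|lborel. indicator {a..b} t * k t)" by (rule ennreal_leI)
  also have "\<dots> = (NNINT t|lborel. ennreal (indicator {a..b} t * k t))"
    using ik k0 by (intro nn_integral_eq_integral[symmetric]) auto
  finally show ?thesis by (simp only: eq)
qed simp

lemma prod_mono_ennreal:
  fixes f g :: "'i \<Rightarrow> ennreal"
  assumes "finite I" "\<And>i. i \<in> I \<Longrightarrow> f i \<le> g i"
  shows "(\<Prod>i\<in>I. f i) \<le> (\<Prod>i\<in>I. g i)"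
  using assms by (induction I rule: finite_induct) (auto intro!: mult_mono)

lemma borel_measurable_C1:
  assumes "C1_supported K \<phi>"
  shows "\<phi> \<in> borel_measurable borel" "grad \<phi> \<in> borel_measurable borel"
  using C1_supportedD(6,7)[OF assms] by (auto intro: borel_measurable_continuous_onI)

text \<open>Along the line through \<open>x\<close> in direction \<open>b\<close>, the function \<open>|\<phi>|\<^sup>\<gamma>\<close> starts from \<open>0\<close>, so the integral of its
  derivative bounds its value at \<open>x\<close>.\<close>

lemma abs_powr_le_marginal:
  assumes phi: "C1_supported K \<phi>" and g: "1 < \<gamma>" and b: "b \<in> Basis"
  shows "ennreal (\<bar>\<phi> x\<bar> powr \<gamma>) \<le> marginal {b} (\<lambda>y. ennreal (\<gamma> * \<bar>\<phi> y\<bar> powr (\<gamma> - 1) * norm (grad \<phi> y))) x"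
proof -
  note D = C1_supportedD[OF phi] and [measurable] = borel_measurable_C1[OF phi]
  let ?g = "\<lambda>y. ennreal (\<gamma> * \<bar>\<phi> y\<bar> powr (\<gamma> - 1) * norm (grad \<phi> y))"
  have gm: "?g \<in> borel_measurable borel" by measurable
  obtain R where R: "0 < R" "\<And>y. y \<in> K \<Longrightarrow> norm y \<le> R"
    using D(2) compact_imp_bounded bounded_pos by metis
  define T where "T = R + norm x + 1"
  have T: "0 \<le> T" using R(1) by (simp add: T_def)
  have "x + (- T) *\<^sub>R b \<notin> K"
  proof
    assume "x + (- T) *\<^sub>R b \<in> K"
    then have "norm (x + (- T) *\<^sub>R b) \<le> R" by (rule R(2))
    moreover have "norm (T *\<^sub>R b) \<le> norm (x + (- T) *\<^sub>R b) + norm x"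
      using norm_triangle_ineq4[of x "x + (- T) *\<^sub>R b"] by simp
    ultimately show False using b T by (simp add: T_def)
  qed
  then have z: "\<phi> (x + (- T) *\<^sub>R b) = 0" by (rule D(4))
  define F where "F t = \<bar>\<phi> (x + t *\<^sub>R b)\<bar> powr \<gamma>" for t
  define F' where "F' t = \<gamma> * pflux \<gamma> (\<phi> (x + t *\<^sub>R b)) * (grad \<phi> (x + t *\<^sub>R b) \<bullet> b)" for t
  define k where "k t = \<gamma> * \<bar>\<phi> (x + t *\<^sub>R b)\<bar> powr (\<gamma> - 1) * norm (grad \<phi> (x + t *\<^sub>R b))" for t
  have der: "(F has_real_derivative F' t) (at t)" for t
    unfolding F_def F'_def
    by (rule DERIV_chain'[OF has_real_derivative_along_line[OF D(1)] has_derivative_abs_powr[OF g]])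
  have bnd: "\<bar>F' t\<bar> \<le> k t" for t
  proof -
    have "\<bar>grad \<phi> (x + t *\<^sub>R b) \<bullet> b\<bar> \<le> norm (grad \<phi> (x + t *\<^sub>R b))" using Basis_le_norm[OF b] .
    moreover have "\<bar>pflux \<gamma> (\<phi> (x + t *\<^sub>R b))\<bar> = \<bar>\<phi> (x + t *\<^sub>R b)\<bar> powr (\<gamma> - 1)"
      using norm_pflux[OF g, of "\<phi> (x + t *\<^sub>R b)"] by simp
    ultimately show ?thesis using g unfolding F'_def k_def abs_mult by (intro mult_mono) auto
  qed
  have F'm: "F' \<in> borel_measurable borel" unfolding F'_def pflux_def by measurable
  have km: "k \<in> borel_measurable borel" unfolding k_def by measurable
  have "ennreal (\<bar>\<phi> x\<bar> powr \<gamma>) = ennreal \<bar>F 0 - F (- T)\<bar>" using z g by (simp add: F_def)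
  also have "\<dots> \<le> (NNINT t|lborel. ennreal (k t) * indicator {- T..0} t)"
    by (rule diff_le_nn_integral_derivative[OF _ der bnd F'm km]) (use T in simp)
  also have "\<dots> \<le> (NNINT t|lborel. ennreal (k t))"
    by (rule nn_integral_mono) (auto simp: indicator_def)
  also have "\<dots> = marginal (insert b {}) ?g x"
    by (subst marginal_insert[OF finite.emptyI _ gm]) (simp_all add: marginal_empty k_def)
  finally show ?thesis .
qed

text \<open>Each of the \<open>N\<close> coordinate lines through \<open>x\<close> bounds \<open>|\<phi>(x)|\<^sup>\<gamma>\<close> by an integral over that line. The product of
  the \<open>(N-1)\<close>-th roots of these \<open>N\<close> bounds is integrated with the Loomis-Whitney inequality.\<close>

lemma gagliardo_nirenberg:
  fixes \<phi> :: "'a::euclidean_space \<Rightarrow> real"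
  assumes phi: "C1_supported K \<phi>" and g: "1 < \<gamma>" and N: "2 \<le> DIM('a)"
  defines "n \<equiv> real DIM('a)"
  shows "(LINT x|lborel. \<bar>\<phi> x\<bar> powr (\<gamma> * (n / (n - 1))))
    \<le> (LINT x|lborel. \<gamma> * \<bar>\<phi> x\<bar> powr (\<gamma> - 1) * norm (grad \<phi> x)) powr (n / (n - 1))"
proof -
  note D = C1_supportedD[OF phi] and [measurable] = borel_measurable_C1[OF phi]
  let ?m = "DIM('a) - 1"
  have m: "0 < ?m" "real ?m = n - 1" using N by (auto simp: n_def)
  have n1: "1 < n" using N by (simp add: n_def)
  define g where "g y = \<gamma> * \<bar>\<phi> y\<bar> powr (\<gamma> - 1) * norm (grad \<phi> y)" for y
  define Y where "Y = (LINT x|lborel. g x)"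
  have g0: "0 \<le> g y" for y using g by (simp add: g_def)
  have cg: "continuous_on UNIV g" unfolding g_def
    using D(6,7) \<open>1 < \<gamma>\<close> by (intro continuous_intros continuous_on_powr') auto
  have gm: "g \<in> borel_measurable borel" using cg by (rule borel_measurable_continuous_onI)
  have ig: "integrable lborel g"
  proof -
    have "integrable lebesgue g"
      by (rule integrable_lebesgue_compact_support[OF cg D(2)]) (simp add: g_def D(5))
    then show ?thesis using integrable_lebesgue_iff_lborel[OF gm] by simp
  qed
  have Y0: "0 \<le> Y" unfolding Y_def using g0 by simp
  have Yn: "(NNINT x|lborel. ennreal (g x)) = ennreal Y"
    unfolding Y_def using ig g0 by (intro nn_integral_eq_integral) auto
  have gem: "(\<lambda>y. ennreal (g y)) \<in> borel_measurable borel" using gm by measurable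
  have pow: "root ?m t ^ DIM('a) = t powr (n / (n - 1))" if "0 \<le> t" for t
  proof (cases "t = 0")
    case True
    then show ?thesis using n1 N by simp
  next
    case False
    then have "root ?m t = t powr (1 / (n - 1))" using that m by (simp add: root_powr_inverse)
    then have "root ?m t ^ DIM('a) = (t powr (1 / (n - 1))) powr n"
      using False that by (simp add: powr_realpow n_def)
    then show ?thesis by (simp add: powr_powr)
  qed
  have "(NNINT x|lborel. ennreal (\<bar>\<phi> x\<bar> powr (\<gamma> * (n / (n - 1)))))
    = marginal Basis (\<lambda>x. ennreal (\<bar>\<phi> x\<bar> powr (\<gamma> * (n / (n - 1))))) 0"
    by (rule marginal_Basis[symmetric]) measurable
  also have "\<dots> \<le> marginal Basis (\<lambda>x. \<Prod>i\<in>Basis. eroot ?m (marginal {i} (\<lambda>y. ennreal (g y)) x)) (0::'a)"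
  proof (rule marginal_mono)
    fix x
    have "ennreal (\<bar>\<phi> x\<bar> powr (\<gamma> * (n / (n - 1)))) = ennreal (root ?m (\<bar>\<phi> x\<bar> powr \<gamma>) ^ DIM('a))"
      by (simp only: pow[OF powr_ge_zero] powr_powr)
    also have "\<dots> = (\<Prod>i\<in>(Basis::'a set). eroot ?m (ennreal (\<bar>\<phi> x\<bar> powr \<gamma>)))"
      by (simp add: eroot_ennreal ennreal_power real_root_ge_zero)
    also have "\<dots> \<le> (\<Prod>i\<in>Basis. eroot ?m (marginal {i} (\<lambda>y. ennreal (g y)) x))"
      unfolding g_def using abs_powr_le_marginal[OF phi \<open>1 < \<gamma>\<close>]
      by (intro prod_mono_ennreal eroot_mono m(1) finite_Basis)
    finally show "ennreal (\<bar>\<phi> x\<bar> powr (\<gamma> * (n / (n - 1)))) \<le> (\<Prod>i\<in>Basis. eroot ?m (marginal {i} (\<lambda>y. ennreal (g y)) x))" .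
  qed
  also have "\<dots> \<le> (\<Prod>i\<in>(Basis::'a set). eroot ?m (marginal (insert i Basis) (\<lambda>y. ennreal (g y)) 0))"
    by (rule marginal_prod_le[OF gem N order_refl])
  also have "\<dots> = (\<Prod>i\<in>(Basis::'a set). eroot ?m (ennreal Y))"
  proof (rule prod.cong[OF refl])
    fix i :: 'a assume "i \<in> Basis"
    then have "insert i Basis = Basis" by (rule insert_absorb)
    then show "eroot ?m (marginal (insert i Basis) (\<lambda>y. ennreal (g y)) 0) = eroot ?m (ennreal Y)"
      by (simp add: marginal_Basis[OF gem] Yn)
  qed
  also have "\<dots> = ennreal (root ?m Y ^ DIM('a))" using Y0 by (simp add: eroot_ennreal ennreal_power real_root_ge_zero)
  also have "\<dots> = ennreal (Y powr (n / (n - 1)))" using pow[OF Y0] by simp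
  finally have le: "(NNINT x|lborel. ennreal (\<bar>\<phi> x\<bar> powr (\<gamma> * (n / (n - 1))))) \<le> ennreal (Y powr (n / (n - 1)))" .
  have "integrable lborel (\<lambda>x. \<bar>\<phi> x\<bar> powr (\<gamma> * (n / (n - 1))))"
    using le by (intro integrableI_bounded) (measurable, auto simp: le_less_trans)
  then have "(NNINT x|lborel. ennreal (\<bar>\<phi> x\<bar> powr (\<gamma> * (n / (n - 1))))) = ennreal (LINT x|lborel. \<bar>\<phi> x\<bar> powr (\<gamma> * (n / (n - 1))))"
    by (intro nn_integral_eq_integral) auto
  then show ?thesis using le by (simp add: ennreal_le_iff Y_def g_def)
qed

text \<open>The choice \<open>\<gamma> = p(N-1)/(N-p)\<close> makes the exponents of \<open>\<phi>\<close> on both sides of the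
  Gagliardo-Nirenberg inequality, after Young's inequality, equal to \<open>p\<^sup>* = Np/(N-p)\<close>; the power of
  \<open>\<integral>|\<phi>|\<^sup>p\<^sup>*\<close> on the right is then smaller than one and can be absorbed.\<close>

lemma sobolev_subcritical:
  fixes p M :: real
  defines "n \<equiv> real DIM('a::euclidean_space)"
  assumes p: "1 < p" "p < n" and M: "0 \<le> M"
  shows "\<exists>C. \<forall>(\<phi> :: 'a \<Rightarrow> real) K. C1_supported K \<phi> \<longrightarrow> (LINT x|lborel. norm (grad \<phi> x) powr p) \<le> M \<longrightarrow>
    (LINT x|lborel. \<bar>\<phi> x\<bar> powr (n * p / (n - p))) \<le> C"
proof -
  have N: "2 \<le> DIM('a)" using p by (simp add: n_def)
  define \<gamma> where "\<gamma> = p * (n - 1) / (n - p)"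
  have n1: "1 < n" using p by simp
  have g: "1 < \<gamma>" using p n1 by (simp add: \<gamma>_def field_simps)
  define P where "P = n * p / (n - p)"
  have e1: "\<gamma> * (n / (n - 1)) = P" using n1 p by (simp add: \<gamma>_def P_def)
  define a where "a = n / (n - p)"
  have e2: "a * (p - 1) = \<gamma> - 1" "a * p = P" using p by (simp_all add: a_def \<gamma>_def P_def field_simps)
  \<comment> \<open>the exponent of \<open>X = \<integral>|\<phi>|\<^sup>P\<close> on the right-hand side; it is less than \<open>1\<close>\<close>
  define e where "e = (p - 1) / p * (n / (n - 1))"
  have e: "0 < e" "e < 1"
  proof -
    show "0 < e" using p n1 by (simp add: e_def)
    have "(p - 1) * n < p * (n - 1)" using p by (simp add: algebra_simps)
    then show "e < 1" using p n1 by (simp add: e_def field_simps)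
  qed
  define c where "c = (\<gamma> * (1 + M)) powr (n / (n - 1))"
  have c0: "0 \<le> c" by (simp add: c_def)
  have "(LINT x|lborel. \<bar>\<phi> x\<bar> powr P) \<le> c powr (1 / (1 - e))"
    if phi: "C1_supported K \<phi>" and le: "(LINT x|lborel. norm (grad \<phi> x) powr p) \<le> M" for \<phi> :: "'a \<Rightarrow> real" and K
  proof -
    note D = C1_supportedD[OF phi]
    define X where "X = (LINT x|lborel. \<bar>\<phi> x\<bar> powr P)"
    define Y where "Y = (LINT x|lborel. \<gamma> * \<bar>\<phi> x\<bar> powr (\<gamma> - 1) * norm (grad \<phi> x))"
    have P0: "0 < P" using p n1 by (simp add: P_def)
    have int: "integrable lborel f" if "continuous_on UNIV f" "\<And>x. x \<notin> K \<Longrightarrow> f x = 0" for f :: "'a \<Rightarrow> real"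
      using integrable_lebesgue_compact_support[OF that(1) D(2) that(2)] borel_measurable_continuous_onI[OF that(1)]
      by (simp add: integrable_lebesgue_iff_lborel)
    have iX: "integrable lborel (\<lambda>x. \<bar>\<phi> x\<bar> powr P)"
      using P0 D(4,6) by (intro int continuous_on_powr' continuous_intros) auto
    have iG: "integrable lborel (\<lambda>x. norm (grad \<phi> x) powr p)"
      using p D(5,7) by (intro int continuous_on_powr' continuous_intros) auto
    have iY: "integrable lborel (\<lambda>x. \<gamma> * \<bar>\<phi> x\<bar> powr (\<gamma> - 1) * norm (grad \<phi> x))"
      using g D(5,6,7) by (intro int continuous_on_powr' continuous_intros) auto
    have X0: "0 \<le> X" by (simp add: X_def)
    have Y0: "0 \<le> Y" unfolding Y_def using g by simp
    have XY: "X \<le> Y powr (n / (n - 1))"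
      using gagliardo_nirenberg[OF phi g N, folded n_def, unfolded e1] by (simp only: X_def Y_def)
    show ?thesis
    proof (cases "X = 0")
      case True
      then show ?thesis by (simp add: X_def)
    next
      case False
      then have Xp: "0 < X" using X0 by simp
      \<comment> \<open>this weight in Young's inequality normalises the integral of \<open>|\<phi>|\<^sup>P\<close> to \<open>1\<close>\<close>
      define l where "l = X powr (- 1 / p)"
      have l: "0 < l" "l powr p * X = 1"
      proof -
        show "0 < l" using Xp by (simp add: l_def)
        have "l powr p = X powr (- 1)" using p by (simp add: l_def powr_powr)
        then show "l powr p * X = 1" using Xp by (simp add: powr_minus_divide)
      qed
      have "l powr (p - 1) * Y \<le> (LINT x|lborel. \<gamma> * (l powr p * \<bar>\<phi> x\<bar> powr P + norm (grad \<phi> x) powr p))"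
      proof -
        have "(LINT x|lborel. l powr (p - 1) * (\<gamma> * \<bar>\<phi> x\<bar> powr (\<gamma> - 1) * norm (grad \<phi> x)))
          \<le> (LINT x|lborel. \<gamma> * (l powr p * \<bar>\<phi> x\<bar> powr P + norm (grad \<phi> x) powr p))"
        proof (rule integral_mono)
          show "integrable lborel (\<lambda>x. l powr (p - 1) * (\<gamma> * \<bar>\<phi> x\<bar> powr (\<gamma> - 1) * norm (grad \<phi> x)))"
            using iY by (rule integrable_mult_right)
          show "integrable lborel (\<lambda>x. \<gamma> * (l powr p * \<bar>\<phi> x\<bar> powr P + norm (grad \<phi> x) powr p))"
            using iX iG by auto
          fix x
          have "(l * \<bar>\<phi> x\<bar> powr a) powr (p - 1) * norm (grad \<phi> x) \<le> (l * \<bar>\<phi> x\<bar> powr a) powr p + norm (grad \<phi> x) powr p"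
            using l by (intro powr_times_le_add_powr p) auto
          then have "l powr (p - 1) * \<bar>\<phi> x\<bar> powr (\<gamma> - 1) * norm (grad \<phi> x) \<le> l powr p * \<bar>\<phi> x\<bar> powr P + norm (grad \<phi> x) powr p"
            using l by (simp add: powr_mult powr_powr e2)
          then have "\<gamma> * (l powr (p - 1) * \<bar>\<phi> x\<bar> powr (\<gamma> - 1) * norm (grad \<phi> x)) \<le> \<gamma> * (l powr p * \<bar>\<phi> x\<bar> powr P + norm (grad \<phi> x) powr p)"
            using g by (intro mult_left_mono) auto
          then show "l powr (p - 1) * (\<gamma> * \<bar>\<phi> x\<bar> powr (\<gamma> - 1) * norm (grad \<phi> x)) \<le> \<gamma> * (l powr p * \<bar>\<phi> x\<bar> powr P + norm (grad \<phi> x) powr p)"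
            by (simp add: mult_ac)
        qed
        then show ?thesis by (simp add: Y_def)
      qed
      also have "\<dots> = \<gamma> * (l powr p * X + (LINT x|lborel. norm (grad \<phi> x) powr p))"
        using iX iG by (simp add: X_def)
      also have "\<dots> \<le> \<gamma> * (1 + M)" using le l g by (intro mult_left_mono) auto
      finally have lY: "l powr (p - 1) * Y \<le> \<gamma> * (1 + M)" .
      have "Y \<le> \<gamma> * (1 + M) * X powr ((p - 1) / p)"
      proof -
        have "l powr (p - 1) = X powr (- ((p - 1) / p))" by (simp add: l_def powr_powr)
        then have "X powr ((p - 1) / p) * l powr (p - 1) = 1" using Xp by (simp flip: powr_add)
        then have "Y = X powr ((p - 1) / p) * (l powr (p - 1) * Y)" by (simp flip: mult.assoc)
        also have "\<dots> \<le> X powr ((p - 1) / p) * (\<gamma> * (1 + M))" using lY by (intro mult_left_mono) auto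
        finally show ?thesis by (simp add: mult.commute)
      qed
      then have "Y powr (n / (n - 1)) \<le> (\<gamma> * (1 + M) * X powr ((p - 1) / p)) powr (n / (n - 1))"
        using Y0 n1 by (intro powr_mono2) auto
      also have "\<dots> = c * X powr e"
        using g M by (simp add: powr_mult powr_powr c_def e_def)
      finally have "X \<le> c * X powr e" using XY by linarith
      then have "X powr (- e) * X \<le> X powr (- e) * (c * X powr e)" by (intro mult_left_mono) auto
      moreover have "X powr (- e) * (c * X powr e) = c"
        using Xp by (simp add: powr_minus_divide)
      moreover have "X powr (- e) * X = X powr (1 - e)"
        using Xp powr_add[of X "- e" 1] by simp
      ultimately have "X powr (1 - e) \<le> c" by simp
      then have "(X powr (1 - e)) powr (1 / (1 - e)) \<le> c powr (1 / (1 - e))"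
        using e by (intro powr_mono2) auto
      then show ?thesis using e X0 by (simp add: powr_powr X_def)
    qed
  qed
  then show ?thesis unfolding P_def by blast
qed

lemma nn_integral_lborel_scale:
  fixes F :: "'a::euclidean_space \<Rightarrow> ennreal"
  assumes F[measurable]: "F \<in> borel_measurable borel" and t: "0 < t"
  shows "ennreal (t ^ DIM('a)) * (NNINT h|lborel. F (x + t *\<^sub>R h)) = (NNINT y|lborel. F y)"
proof -
  have "(NNINT y|lborel. F y) = (NNINT y|density (distr lborel borel (\<lambda>h. x + t *\<^sub>R h)) (\<lambda>_. ennreal (\<bar>t\<bar> ^ DIM('a))). F y)"
    using lborel_affine[of t x] t by simp
  also have "\<dots> = (NNINT y|distr lborel borel (\<lambda>h. x + t *\<^sub>R h). ennreal (\<bar>t\<bar> ^ DIM('a)) * F y)"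
    by (rule nn_integral_density) measurable
  also have "\<dots> = (NNINT h|lborel. ennreal (\<bar>t\<bar> ^ DIM('a)) * F (x + t *\<^sub>R h))"
    by (rule nn_integral_distr) measurable
  also have "\<dots> = ennreal (t ^ DIM('a)) * (NNINT h|lborel. F (x + t *\<^sub>R h))"
    using t by (simp add: nn_integral_cmult)
  finally show ?thesis ..
qed

text \<open>For \<open>p > N\<close>, average the line integral of the gradient from \<open>x\<close> to \<open>x + h\<close> over a ball of vectors \<open>h\<close>
  for which \<open>x + h\<close> lies outside the support; the dilation by \<open>t\<close> costs the factor \<open>t\<^sup>-\<^sup>N\<^sup>/\<^sup>p\<close>, which is integrable.\<close>

lemma morrey_bound:
  fixes p R :: real
  assumes p: "real DIM('a::euclidean_space) < p" and R: "0 < R"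
  shows "\<exists>C. \<forall>(\<phi> :: 'a \<Rightarrow> real) K. C1_supported K \<phi> \<longrightarrow> K \<subseteq> ball 0 R \<longrightarrow> (LINT x|lborel. norm (grad \<phi> x) powr p) \<le> 1 \<longrightarrow>
    (\<forall>x. \<bar>\<phi> x\<bar> \<le> C)"
proof -
  define n where "n = real DIM('a)"
  have n1: "1 \<le> n" using DIM_positive[where 'a='a] unfolding n_def by linarith
  have p1: "1 < p" using p n1 unfolding n_def by linarith
  obtain b :: 'a where b: "b \<in> Basis" using nonempty_Basis by blast
  \<comment> \<open>if \<open>|x| < R\<close> and \<open>h \<in> B\<close>, then \<open>|x + h| > R\<close>\<close>
  define B where "B = ball ((3 * R) *\<^sub>R b) R"
  have Bm[measurable]: "B \<in> sets borel" by (simp add: B_def)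
  define v where "v = measure lborel B"
  have vB: "emeasure lborel B = ennreal v"
    unfolding v_def by (rule emeasure_eq_ennreal_measure) (use emeasure_bounded_finite[of B] in \<open>simp add: B_def top.not_eq_extremum\<close>)
  have v: "0 < v"
    unfolding v_def B_def using R by (simp add: content_ball_pos)
  have hB: "norm h \<le> 4 * R" if "h \<in> B" for h
  proof -
    have "norm h \<le> norm ((3 * R) *\<^sub>R b) + norm (h - (3 * R) *\<^sub>R b)" using norm_triangle_ineq[of "(3 * R) *\<^sub>R b" "h - (3 * R) *\<^sub>R b"] by simp
    then show ?thesis using that b R by (simp add: B_def dist_norm norm_minus_commute)
  qed
  define c where "c = (NNINT t|lborel. ennreal (\<bar>t\<bar> powr (- n / p)) * indicator {0<..1} (t::real))"
  have c: "c < \<infinity>"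
  proof -
    have "c \<le> (NNINT t|lborel. ennreal (norm t powr ((1 - n / p) - real DIM(real))) * indicator (ball 0 2 - {0}) (t::real))"
      unfolding c_def by (rule nn_integral_mono) (auto simp: indicator_def)
    also have "\<dots> < \<infinity>" by (rule nn_integral_powr_norm_ball) (use p p1 in \<open>auto simp: n_def\<close>)
    finally show ?thesis .
  qed
  define C where "C = enn2real (ennreal (4 * R * (v + 1)) * c) / v"
  have "\<bar>\<phi> x\<bar> \<le> C" if phi: "C1_supported K \<phi>" and KR: "K \<subseteq> ball 0 R" and le: "(LINT x|lborel. norm (grad \<phi> x) powr p) \<le> 1"
    for \<phi> :: "'a \<Rightarrow> real" and K x
  proof (cases "x \<in> K")
    case False
    then have "\<phi> x = 0" by (rule C1_supportedD(4)[OF phi])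
    then show ?thesis using v by (simp add: C_def)
  next
    case True
    note D = C1_supportedD[OF phi] and [measurable] = borel_measurable_C1[OF phi]
    have xR: "norm x < R" using True KR by auto
    have iG: "integrable lborel (\<lambda>x. norm (grad \<phi> x) powr p)"
    proof -
      have cc: "continuous_on UNIV (\<lambda>x. norm (grad \<phi> x) powr p)"
        using p1 D(7) by (intro continuous_on_powr' continuous_intros) auto
      show ?thesis
        using integrable_lebesgue_compact_support[OF cc D(2)] borel_measurable_continuous_onI[OF cc] D(5)
        by (simp add: integrable_lebesgue_iff_lborel)
    qed
    have nG: "(NNINT x|lborel. ennreal (norm (grad \<phi> x) powr p)) \<le> 1"
      using iG le by (subst nn_integral_eq_integral) (auto simp: ennreal_le_1)
    define G where "G t h = ennreal (4 * R) * ennreal (norm (grad \<phi> (x + t *\<^sub>R h)))" for t h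
    have Gm[measurable]: "(\<lambda>z. G (fst z) (snd z)) \<in> borel_measurable (lborel \<Otimes>\<^sub>M lborel)"
      unfolding G_def by measurable
    have Gm1[measurable]: "(\<lambda>h. G t h) \<in> borel_measurable borel" for t unfolding G_def by measurable
    have line: "ennreal \<bar>\<phi> x\<bar> \<le> (NNINT t|lborel. G t h * indicator {0..1} t)" if h: "h \<in> B" for h
    proof -
      have "x + h \<notin> K"
      proof
        assume "x + h \<in> K"
        then have 1: "norm (x + h) < R" using KR by auto
        have "norm ((3 * R) *\<^sub>R b) \<le> norm (x + h) + norm x + norm ((3 * R) *\<^sub>R b - h)"
          using norm_triangle_ineq[of "x + h - x" "(3 * R) *\<^sub>R b - h"] norm_triangle_ineq4[of "x + h" x] by simp
        then show False using 1 xR h b R by (simp add: B_def dist_norm)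
      qed
      then have z: "\<phi> (x + h) = 0" by (rule D(4))
      have "ennreal \<bar>\<phi> (x + 1 *\<^sub>R h) - \<phi> (x + 0 *\<^sub>R h)\<bar> \<le> (NNINT t|lborel. ennreal (4 * R * norm (grad \<phi> (x + t *\<^sub>R h))) * indicator {0..1} t)"
      proof (rule diff_le_nn_integral_derivative[OF _ has_real_derivative_along_line[OF D(1)]])
        show "\<bar>grad \<phi> (x + t *\<^sub>R h) \<bullet> h\<bar> \<le> 4 * R * norm (grad \<phi> (x + t *\<^sub>R h))" for t
        proof -
          have "\<bar>grad \<phi> (x + t *\<^sub>R h) \<bullet> h\<bar> \<le> norm (grad \<phi> (x + t *\<^sub>R h)) * norm h" by (rule Cauchy_Schwarz_ineq2)
          also have "\<dots> \<le> norm (grad \<phi> (x + t *\<^sub>R h)) * (4 * R)" by (intro mult_left_mono hB h) auto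
          finally show ?thesis by (simp add: mult.commute)
        qed
      qed (simp, measurable)
      then show ?thesis using z R by (simp add: G_def ennreal_mult)
    qed
    have "ennreal v * ennreal \<bar>\<phi> x\<bar> = (NNINT h|lborel. ennreal \<bar>\<phi> x\<bar> * indicator B h)"
      by (subst nn_integral_cmult_indicator) (simp_all add: vB mult.commute)
    also have "\<dots> \<le> (NNINT h|lborel. (NNINT t|lborel. G t h * indicator {0..1} t * indicator B h))"
    proof (rule nn_integral_mono)
      fix h
      show "ennreal \<bar>\<phi> x\<bar> * indicator B h \<le> (NNINT t|lborel. G t h * indicator {0..1} t * indicator B h)"
        using line[of h] by (cases "h \<in> B") simp_all
    qed
    also have "\<dots> = (NNINT t|lborel. (NNINT h|lborel. G t h * indicator {0..1} t * indicator B h))"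
      by (rule lborel_pair.Fubini') measurable
    also have "\<dots> \<le> (NNINT t|lborel. ennreal (4 * R * (v + 1)) * (ennreal (\<bar>t\<bar> powr (- n / p)) * indicator {0<..1} t))"
    proof (rule nn_integral_mono_AE)
      have "AE t in lborel. t \<noteq> (0::real)" by (rule AE_lborel_singleton)
      then show "AE t in lborel. (NNINT h|lborel. G t h * indicator {0..1} t * indicator B h)
        \<le> ennreal (4 * R * (v + 1)) * (ennreal (\<bar>t\<bar> powr (- n / p)) * indicator {0<..1} t)"
      proof eventually_elim
        case (elim t)
        show ?case
        proof (cases "t \<in> {0<..1}")
          case False
          then have "t \<notin> {0..1}" using elim by auto
          then show ?thesis by simp
        next
          case True
          then have t: "0 < t" by simp
          \<comment> \<open>the value for which both terms of \<open>|\<nabla>\<phi>| \<le> \<mu> + \<mu>\<^sup>1\<^sup>-\<^sup>p |\<nabla>\<phi>|\<^sup>p\<close> contribute the same order, \<open>\<mu>\<^sup>1\<^sup>-\<^sup>p t\<^sup>-\<^sup>N = \<mu>\<close>\<close>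
          define \<mu> where "\<mu> = t powr (- n / p)"
          have mu: "0 < \<mu>" using t by (simp add: \<mu>_def)
          let ?F = "\<lambda>y. ennreal (norm (grad \<phi> y) powr p)"
          have e: "\<mu> powr (1 - p) / t ^ DIM('a) = \<mu>"
          proof -
            have "- n / p * (1 - p) = n - n / p" using p1 by (simp add: field_simps)
            then have "\<mu> powr (1 - p) = t powr (n - n / p)" by (simp only: \<mu>_def powr_powr)
            moreover have "t ^ DIM('a) = t powr n" using t by (simp add: n_def powr_realpow)
            moreover have "t powr (n - n / p) / t powr n = t powr (n - n / p - n)" by (rule powr_diff[symmetric])
            ultimately show ?thesis by (simp add: \<mu>_def)
          qed
          have sc: "(NNINT h|lborel. ?F (x + t *\<^sub>R h)) \<le> ennreal (1 / t ^ DIM('a))"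
          proof -
            have "ennreal (t ^ DIM('a)) * (NNINT h|lborel. ?F (x + t *\<^sub>R h)) \<le> 1"
              using nn_integral_lborel_scale[of ?F t x] t nG by simp
            then have "ennreal (1 / t ^ DIM('a)) * (ennreal (t ^ DIM('a)) * (NNINT h|lborel. ?F (x + t *\<^sub>R h))) \<le> ennreal (1 / t ^ DIM('a)) * 1"
              by (intro mult_left_mono) auto
            moreover have "ennreal (1 / t ^ DIM('a)) * ennreal (t ^ DIM('a)) = 1"
              using t by (subst ennreal_mult[symmetric]) auto
            ultimately show ?thesis by (simp flip: mult.assoc)
          qed
          have "(NNINT h|lborel. G t h * indicator {0..1} t * indicator B h)
            \<le> (NNINT h|lborel. ennreal (4 * R) * (ennreal \<mu> * indicator B h + ennreal (\<mu> powr (1 - p)) * ?F (x + t *\<^sub>R h)))"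
          proof (rule nn_integral_mono)
            fix h
            have "ennreal (norm (grad \<phi> (x + t *\<^sub>R h))) \<le> ennreal (\<mu> + \<mu> powr (1 - p) * norm (grad \<phi> (x + t *\<^sub>R h)) powr p)"
              using le_add_powr[OF p1 norm_ge_zero mu] by (intro ennreal_leI)
            also have "\<dots> = ennreal \<mu> + ennreal (\<mu> powr (1 - p)) * ?F (x + t *\<^sub>R h)"
              using mu by (simp add: ennreal_mult)
            finally show "G t h * indicator {0..1} t * indicator B h
              \<le> ennreal (4 * R) * (ennreal \<mu> * indicator B h + ennreal (\<mu> powr (1 - p)) * ?F (x + t *\<^sub>R h))"
              using True by (cases "h \<in> B") (auto simp: G_def intro!: mult_left_mono)
          qed
          also have "\<dots> = ennreal (4 * R) * (ennreal \<mu> * ennreal v + ennreal (\<mu> powr (1 - p)) * (NNINT h|lborel. ?F (x + t *\<^sub>R h)))"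
            by (simp add: nn_integral_cmult nn_integral_add vB)
          also have "\<dots> \<le> ennreal (4 * R) * (ennreal \<mu> * ennreal v + ennreal (\<mu> powr (1 - p)) * ennreal (1 / t ^ DIM('a)))"
            by (intro mult_left_mono add_left_mono sc) auto
          also have "\<dots> = ennreal (4 * R * (\<mu> * v + \<mu> powr (1 - p) / t ^ DIM('a)))"
            using mu v R t by (simp flip: ennreal_mult ennreal_plus)
          also have "\<dots> = ennreal (4 * R * (v + 1)) * ennreal \<mu>"
            unfolding e using mu v R by (subst ennreal_mult[symmetric]) (auto simp: algebra_simps)
          finally show ?thesis using True t by (simp add: \<mu>_def)
        qed
      qed
    qed
    also have "\<dots> = ennreal (4 * R * (v + 1)) * c" unfolding c_def by (rule nn_integral_cmult) measurable
    finally have fin: "ennreal (v * \<bar>\<phi> x\<bar>) \<le> ennreal (4 * R * (v + 1)) * c" using v by (simp add: ennreal_mult)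
    have "ennreal (4 * R * (v + 1)) * c < top" using c by (simp add: ennreal_mult_less_top)
    then have "v * \<bar>\<phi> x\<bar> \<le> enn2real (ennreal (4 * R * (v + 1)) * c)"
      using fin v enn2real_mono[OF fin] by simp
    then show ?thesis using v by (simp add: C_def field_simps)
  qed
  then show ?thesis by blast
qed

section \<open>Pairing with the right-hand side\<close>

lemma finite_measure_bounded_open:
  fixes U :: "'a::euclidean_space set"
  assumes "open U" "bounded U"
  shows "emeasure lebesgue U < \<infinity>" "emeasure (lebesgue_on U) (space (lebesgue_on U)) < \<infinity>"
proof -
  show *: "emeasure lebesgue U < \<infinity>" using emeasure_bounded_finite[OF assms(2)] assms(1) by simp
  then show "emeasure (lebesgue_on U) (space (lebesgue_on U)) < \<infinity>"
    using sets_lebesgue_open[OF assms(1)] by (simp add: emeasure_restrict_space space_restrict_space)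
qed

lemma integrable_const_bounded_open:
  assumes "open U" "bounded U"
  shows "integrable (lebesgue_on U) (\<lambda>_. c :: real)"
proof -
  interpret finite_measure "lebesgue_on U"
    by standard (use finite_measure_bounded_open(2)[OF assms] in auto)
  show ?thesis by simp
qed

lemma Lp_on_integrable_powr:
  fixes f :: "'a::euclidean_space \<Rightarrow> real"
  assumes U: "open U" "bounded U" and f: "f \<in> Lp_on q U" and r: "0 < r" "ennreal r \<le> q"
  shows "integrable (lebesgue_on U) (\<lambda>x. \<bar>f x\<bar> powr r)"
proof -
  have fm[measurable]: "f \<in> borel_measurable (lebesgue_on U)" using f by (simp add: Lp_on_def)
  show ?thesis
  proof (cases "q = top")
    case True
    then obtain C where C: "AE x in lebesgue_on U. norm (f x) \<le> C" using f by (auto simp: Lp_on_def)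
    show ?thesis
    proof (rule Bochner_Integration.integrable_bound[OF integrable_const_bounded_open[OF U, of "\<bar>C\<bar> powr r"]])
      show "AE x in lebesgue_on U. norm (\<bar>f x\<bar> powr r) \<le> norm (\<bar>C\<bar> powr r)"
        using C by eventually_elim (use r in \<open>auto intro!: powr_mono2\<close>)
    qed measurable
  next
    case False
    define q' where "q' = enn2real q"
    have q': "q = ennreal q'" using False by (simp add: q'_def less_top)
    have rq: "r \<le> q'" using r unfolding q' by (simp add: ennreal_le_iff2)
    have i: "integrable (lebesgue_on U) (\<lambda>x. norm (f x) powr q')" using f False by (simp add: Lp_on_def q'_def)
    show ?thesis
    proof (rule Bochner_Integration.integrable_bound[OF Bochner_Integration.integrable_add[OF integrable_const_bounded_open[OF U, of 1] i]])
      have "a powr r \<le> 1 + a powr q'" if "0 \<le> a" for a :: real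
      proof (cases "a \<le> 1")
        case True
        then have "a powr r \<le> 1" using that r by (intro powr_le1) auto
        then show ?thesis using powr_ge_zero[of a q'] by linarith
      next
        case False
        then have "a powr r \<le> a powr q'" using rq by (intro powr_mono) auto
        then show ?thesis by linarith
      qed
      then show "AE x in lebesgue_on U. norm (\<bar>f x\<bar> powr r) \<le> norm (1 + norm (f x) powr q')"
        by (intro AE_I2) (simp add: abs_of_nonneg)
    qed measurable
  qed
qed

text \<open>Young's inequality for \<open>|f|\<^sup>1\<^sup>/\<^sup>(\<^sup>P\<^sup>-\<^sup>1\<^sup>)\<close> and \<open>|\<phi>|\<close>.\<close>

lemma dual_bound_of_power_bound:
  fixes f \<phi> :: "'a::euclidean_space \<Rightarrow> real"
  assumes P: "1 < P" and f: "integrable (lebesgue_on U) (\<lambda>x. \<bar>f x\<bar> powr (P / (P - 1)))" and U: "open U"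
    and phi: "C1_supported K \<phi>" and le: "(LINT x|lborel. \<bar>\<phi> x\<bar> powr P) \<le> C"
  shows "(NNINT x|lebesgue_on U. ennreal \<bar>f x * \<phi> x\<bar>) \<le> ennreal ((LINT x|lebesgue_on U. \<bar>f x\<bar> powr (P / (P - 1))) + C)"
proof -
  note D = C1_supportedD[OF phi]
  have cc: "continuous_on UNIV (\<lambda>x. \<bar>\<phi> x\<bar> powr P)" using P D(6) by (intro continuous_on_powr' continuous_intros) auto
  have i: "integrable lebesgue (\<lambda>x. \<bar>\<phi> x\<bar> powr P)"
    by (rule integrable_lebesgue_compact_support[OF cc D(2)]) (simp add: D(4))
  have "(NNINT x|lebesgue_on U. ennreal \<bar>f x * \<phi> x\<bar>) \<le> (NNINT x|lebesgue_on U. ennreal (\<bar>f x\<bar> powr (P / (P - 1))) + ennreal (\<bar>\<phi> x\<bar> powr P))"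
  proof (rule nn_integral_mono)
    fix x
    define a where "a = \<bar>f x\<bar> powr (1 / (P - 1))"
    have "a powr (P - 1) * \<bar>\<phi> x\<bar> \<le> a powr P + \<bar>\<phi> x\<bar> powr P"
      by (rule powr_times_le_add_powr[OF P]) (auto simp: a_def)
    then have "\<bar>f x * \<phi> x\<bar> \<le> \<bar>f x\<bar> powr (P / (P - 1)) + \<bar>\<phi> x\<bar> powr P"
      using P by (simp add: a_def powr_powr abs_mult)
    then show "ennreal \<bar>f x * \<phi> x\<bar> \<le> ennreal (\<bar>f x\<bar> powr (P / (P - 1))) + ennreal (\<bar>\<phi> x\<bar> powr P)"
      by (simp flip: ennreal_plus add: ennreal_leI)
  qed
  also have "\<dots> = (NNINT x|lebesgue_on U. ennreal (\<bar>f x\<bar> powr (P / (P - 1)))) + (NNINT x|lebesgue_on U. ennreal (\<bar>\<phi> x\<bar> powr P))"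
  proof (rule nn_integral_add)
    show "(\<lambda>x. ennreal (\<bar>f x\<bar> powr (P / (P - 1)))) \<in> borel_measurable (lebesgue_on U)" using f by measurable
    show "(\<lambda>x. ennreal (\<bar>\<phi> x\<bar> powr P)) \<in> borel_measurable (lebesgue_on U)"
      using measurable_restrict_space1[OF borel_measurable_integrable[OF i]] by measurable
  qed
  also have "(NNINT x|lebesgue_on U. ennreal (\<bar>\<phi> x\<bar> powr P)) \<le> (NNINT x|lebesgue. ennreal (\<bar>\<phi> x\<bar> powr P))"
    by (subst nn_integral_restrict_space) (auto simp: sets_lebesgue_open[OF U] indicator_def intro!: nn_integral_mono)
  also have "(NNINT x|lebesgue. ennreal (\<bar>\<phi> x\<bar> powr P)) = ennreal (LINT x|lebesgue. \<bar>\<phi> x\<bar> powr P)"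
    using i by (intro nn_integral_eq_integral) auto
  also have "(LINT x|lebesgue. \<bar>\<phi> x\<bar> powr P) = (LINT x|lborel. \<bar>\<phi> x\<bar> powr P)"
    by (rule integral_completion) (simp add: borel_measurable_continuous_onI[OF cc])
  also have "(NNINT x|lebesgue_on U. ennreal (\<bar>f x\<bar> powr (P / (P - 1)))) = ennreal (LINT x|lebesgue_on U. \<bar>f x\<bar> powr (P / (P - 1)))"
    using f by (intro nn_integral_eq_integral) auto
  also have "ennreal (LINT x|lebesgue_on U. \<bar>f x\<bar> powr (P / (P - 1))) + ennreal (LINT x|lborel. \<bar>\<phi> x\<bar> powr P)
    \<le> ennreal ((LINT x|lebesgue_on U. \<bar>f x\<bar> powr (P / (P - 1))) + C)"
    using le by (simp flip: ennreal_plus add: ennreal_leI)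
  finally show ?thesis by (simp add: add_left_mono)
qed

text \<open>For \<open>p < N\<close> the exponent \<open>(p\<^sup>*)'\<close> is dual to the Sobolev exponent, and for \<open>p > N\<close> test functions are bounded. For
  \<open>p = N\<close> the subcritical inequality with an exponent slightly below \<open>N\<close> suffices, because \<open>q > 1\<close>.\<close>

lemma sobolev_dual_bound:
  fixes f :: "'a::euclidean_space \<Rightarrow> real" and q :: ennreal
  defines "n \<equiv> real DIM('a)"
  assumes p: "1 < p" and U: "open U" "bounded U"
    and q1: "p \<noteq> n \<Longrightarrow> q \<ge> ennreal (p_star_conj n p)" and q2: "p = n \<Longrightarrow> q > 1"
    and f: "f \<in> Lp_on q U"
  shows "\<exists>C. \<forall>\<phi>\<in>test_functions U. (LINT x|lborel. norm (grad \<phi> x) powr p) \<le> 1 \<longrightarrow>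
    (NNINT x|lebesgue_on U. ennreal \<bar>f x * \<phi> x\<bar>) \<le> ennreal C"
proof -
  \<comment> \<open>the subcritical inequality with an exponent \<open>p'\<close> whose conjugate Sobolev exponent is at most \<open>q\<close>\<close>
  have sub: ?thesis if p': "1 < p'" "p' < n" and r: "ennreal (p_star_conj n p') \<le> q" and M: "0 \<le> M"
    and grM: "\<And>\<phi>. \<phi> \<in> test_functions U \<Longrightarrow> (LINT x|lborel. norm (grad \<phi> x) powr p) \<le> 1 \<Longrightarrow>
        (LINT x|lborel. norm (grad \<phi> x) powr p') \<le> M" for p' M
  proof -
    define P where "P = n * p' / (n - p')"
    have np: "0 < n" "n < n * p'" using p' by auto
    have "n - p' < n * p'" using p' np by linarith
    then have P: "1 < P" using p' by (simp add: P_def pos_less_divide_eq)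
    have e: "P / (P - 1) = p_star_conj n p'"
    proof -
      have "P - 1 = (n * p' - n + p') / (n - p')" using p' by (simp add: P_def field_simps)
      then have "P / (P - 1) = n * p' / (n * p' - n + p')" using p' by (simp add: P_def)
      then show ?thesis using p' by (simp add: p_star_conj_def)
    qed
    have e0: "0 < p_star_conj n p'" unfolding e[symmetric] using P by simp
    have fi: "integrable (lebesgue_on U) (\<lambda>x. \<bar>f x\<bar> powr (P / (P - 1)))"
      unfolding e by (rule Lp_on_integrable_powr[OF U f e0 r])
    obtain C where C0: "\<forall>(\<phi> :: 'a \<Rightarrow> real) K. C1_supported K \<phi> \<longrightarrow> (LINT x|lborel. norm (grad \<phi> x) powr p') \<le> M \<longrightarrow>
        (LINT x|lborel. \<bar>\<phi> x\<bar> powr P) \<le> C"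
      unfolding P_def n_def by (rule exE[OF sobolev_subcritical[where 'a='a, OF p'(1) p'(2)[unfolded n_def] M]])
    note C = C0[rule_format]
    show ?thesis
    proof (intro exI[of _ "(LINT x|lebesgue_on U. \<bar>f x\<bar> powr (P / (P - 1))) + C"] ballI impI)
      fix \<phi> assume phi: "\<phi> \<in> test_functions U" and le: "(LINT x|lborel. norm (grad \<phi> x) powr p) \<le> 1"
      obtain K where K: "C1_supported K \<phi>" using test_function_C1_supported[OF phi] .
      show "(NNINT x|lebesgue_on U. ennreal \<bar>f x * \<phi> x\<bar>) \<le> ennreal ((LINT x|lebesgue_on U. \<bar>f x\<bar> powr (P / (P - 1))) + C)"
        by (rule dual_bound_of_power_bound[OF P fi U(1) K C[OF K grM[OF phi le]]])
    qed
  qed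
  consider "p < n" | "p > n" | "p = n" by linarith
  then show ?thesis
  proof cases
    case 1
    show ?thesis by (rule sub[OF p 1 _ zero_le_one]) (use q1 1 in auto)
  next
    case 2
    then have "ennreal 1 \<le> q" using q1 by (simp add: p_star_conj_def)
    then have fi: "integrable (lebesgue_on U) (\<lambda>x. \<bar>f x\<bar>)"
      using Lp_on_integrable_powr[OF U f, of 1] by simp
    obtain R where R: "0 < R" "U \<subseteq> ball 0 R" using U(2) by (metis bounded_subset_ballD)
    obtain C where C0: "\<forall>(\<phi> :: 'a \<Rightarrow> real) K. C1_supported K \<phi> \<longrightarrow> K \<subseteq> ball 0 R \<longrightarrow>
        (LINT x|lborel. norm (grad \<phi> x) powr p) \<le> 1 \<longrightarrow> (\<forall>x. \<bar>\<phi> x\<bar> \<le> C)"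
      by (rule exE[OF morrey_bound[where 'a='a, OF 2[unfolded n_def] R(1)]])
    note C = C0[rule_format]
    show ?thesis
    proof (intro exI[of _ "\<bar>C\<bar> * (LINT x|lebesgue_on U. \<bar>f x\<bar>)"] ballI impI)
      fix \<phi> assume phi: "\<phi> \<in> test_functions U" and le: "(LINT x|lborel. norm (grad \<phi> x) powr p) \<le> 1"
      obtain K where K: "C1_supported K \<phi>" "K \<subseteq> U" using test_function_C1_supported[OF phi] .
      have b: "\<bar>\<phi> x\<bar> \<le> \<bar>C\<bar>" for x
        using C[OF K(1) subset_trans[OF K(2) R(2)] le, of x] by linarith
      have "(NNINT x|lebesgue_on U. ennreal \<bar>f x * \<phi> x\<bar>) \<le> (NNINT x|lebesgue_on U. ennreal (\<bar>C\<bar> * \<bar>f x\<bar>))"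
        using b by (intro nn_integral_mono ennreal_leI) (simp add: abs_mult mult.commute mult_right_mono)
      also have "\<dots> = ennreal (LINT x|lebesgue_on U. \<bar>C\<bar> * \<bar>f x\<bar>)"
        using fi by (intro nn_integral_eq_integral) auto
      finally show "(NNINT x|lebesgue_on U. ennreal \<bar>f x * \<phi> x\<bar>) \<le> ennreal (\<bar>C\<bar> * (LINT x|lebesgue_on U. \<bar>f x\<bar>))" by simp
    qed
  next
    case 3
    then have q: "1 < q" by (rule q2)
    have n1: "1 < n" using p 3 by simp
    obtain q0 where q0: "1 < q0" "ennreal q0 \<le> q"
    proof (cases "q = top")
      case True
      then show ?thesis using that[of 2] by simp
    next
      case False
      then have e: "q = ennreal (enn2real q)" by (simp add: less_top)
      then have "1 < enn2real q" using q by (metis ennreal_1 ennreal_less_iff zero_le_one)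
      then show ?thesis using that[of "enn2real q"] e by simp
    qed
    \<comment> \<open>the reciprocal of the auxiliary exponent, larger than \<open>1/N\<close> but so close that the conjugate Sobolev exponent is at most \<open>q\<^sub>0\<close>\<close>
    define \<kappa> where "\<kappa> = min (1 - 1 / q0 + 1 / n) ((1 + 1 / n) / 2)"
    have k: "1 / n < \<kappa>" "\<kappa> < 1" "\<kappa> \<le> 1 - 1 / q0 + 1 / n" 
    proof -
      have "1 / n < 1" "1 / q0 < 1" using q0 n1 by simp_all
      then show "1 / n < \<kappa>" "\<kappa> < 1" "\<kappa> \<le> 1 - 1 / q0 + 1 / n" by (auto simp: \<kappa>_def min_less_iff_disj)
    qed
    define p' where "p' = 1 / \<kappa>"
    have kp: "0 < \<kappa>" using k(1) n1 by (meson less_trans zero_less_divide_1_iff zero_less_one)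
    have p': "1 < p'" "p' < n" using k kp n1 by (auto simp: p'_def field_simps)
    have "p_star_conj n p' \<le> q0"
    proof -
      have "p_star_conj n p' = n * p' / (n * p' - n + p')" using p' by (simp add: p_star_conj_def)
      also have "\<dots> = 1 / (1 - \<kappa> + 1 / n)" using kp n1 k by (simp add: p'_def field_simps)
      also have "\<dots> \<le> 1 / (1 / q0)"
      proof -
        have "0 < 1 / q0" "1 / q0 \<le> 1 - \<kappa> + 1 / n" using k q0 by auto
        then show ?thesis by (intro frac_le) simp_all
      qed
      finally show ?thesis by simp
    qed
    then have r: "ennreal (p_star_conj n p') \<le> q" using q0(2) by (meson ennreal_leI order_trans)
    have mU: "emeasure lborel U < \<infinity>" using emeasure_bounded_finite[OF U(2)] by simp
    show ?thesis
    proof (rule sub[OF p' r])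
      show "0 \<le> measure lborel U + 1" by simp
      fix \<phi> assume phi: "\<phi> \<in> test_functions U" and le: "(LINT x|lborel. norm (grad \<phi> x) powr p) \<le> 1"
      obtain K where K: "C1_supported K \<phi>" "K \<subseteq> U" using test_function_C1_supported[OF phi] .
      note D = C1_supportedD[OF K(1)]
      have int: "integrable lborel (\<lambda>x. norm (grad \<phi> x) powr r)" if "0 < r" for r
      proof -
        have cc: "continuous_on UNIV (\<lambda>x. norm (grad \<phi> x) powr r)"
          using that D(7) by (intro continuous_on_powr' continuous_intros) auto
        show ?thesis
          using integrable_lebesgue_compact_support[OF cc D(2)] borel_measurable_continuous_onI[OF cc] D(5)
          by (simp add: integrable_lebesgue_iff_lborel)
      qed
      have iU: "integrable lborel (indicator U :: 'a \<Rightarrow> real)" using U(1) mU by simp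
      have "(LINT x|lborel. norm (grad \<phi> x) powr p') \<le> (LINT x|lborel. indicator U x + norm (grad \<phi> x) powr p)"
      proof (rule integral_mono)
        show "integrable lborel (\<lambda>x. norm (grad \<phi> x) powr p')" using p' by (intro int) simp
        show "integrable lborel (\<lambda>x. indicator U x + norm (grad \<phi> x) powr p)" using p iU int by auto
        fix x
        show "norm (grad \<phi> x) powr p' \<le> indicator U x + norm (grad \<phi> x) powr p"
        proof (cases "x \<in> U")
          case True
          show ?thesis
          proof (cases "norm (grad \<phi> x) \<le> 1")
            case le1: True
            then have "norm (grad \<phi> x) powr p' \<le> 1" using p' by (intro powr_le1) auto
            then show ?thesis using True by (simp add: add_increasing2)
          next
            case False
            then have "norm (grad \<phi> x) powr p' \<le> norm (grad \<phi> x) powr p" using p' 3 by (intro powr_mono) auto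
            then show ?thesis using True by simp
          qed
        next
          case False
          then have "grad \<phi> x = 0" using K(2) D(5) by blast
          then show ?thesis by simp
        qed
      qed
      also have "\<dots> = measure lborel U + (LINT x|lborel. norm (grad \<phi> x) powr p)" using p iU int U(1) by simp
      finally show "(LINT x|lborel. norm (grad \<phi> x) powr p') \<le> measure lborel U + 1" using le by simp
    qed
  qed
qed

text \<open>Elements of \<open>W\<^sub>0\<^sup>1\<^sup>,\<^sup>p\<close> are almost everywhere limits of test functions whose gradients are bounded in \<open>L\<^sup>p\<close>, so Fatou's
  lemma carries the bound over.\<close>

lemma W0z_dual_bound:
  fixes f :: "'a::euclidean_space \<Rightarrow> real"
  assumes p: "1 < p" and U: "open U" "bounded U" and fm: "f \<in> borel_measurable (lebesgue_on U)"
    and C: "\<And>\<phi>. \<phi> \<in> test_functions U \<Longrightarrow> (LINT x|lborel. norm (grad \<phi> x) powr p) \<le> 1 \<Longrightarrow>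
      (NNINT x|lebesgue_on U. ennreal \<bar>f x * \<phi> x\<bar>) \<le> ennreal C"
  shows "\<exists>C'. \<forall>w\<in>W0z p U. (LINT x|lebesgue_on U. norm (weak_grad U w x) powr p) \<le> 1 \<longrightarrow>
    (NNINT x|lebesgue_on U. ennreal \<bar>f x * w x\<bar>) \<le> ennreal C'"
proof -
  let ?I = "\<lambda>w. NNINT x|lebesgue_on U. ennreal \<bar>f x * w x\<bar>"
  \<comment> \<open>test functions close to the unit ball have energy at most \<open>2\<^sup>p (1 + 1)\<close>; dividing by \<open>c\<close> normalises them\<close>
  define c where "c = (2 powr p * 2) powr (1 / p)"
  have c: "0 < c" "c powr p = 2 powr p * 2" using p by (simp_all add: c_def powr_powr)
  have test: "?I \<phi> \<le> ennreal (c * C)"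
    if phi: "\<phi> \<in> test_functions U" and le: "(LINT x|lborel. norm (grad \<phi> x) powr p) \<le> 2 powr p * 2" for \<phi>
  proof -
    let ?\<psi> = "\<lambda>x. (1 / c) * \<phi> x"
    have k: "Ck k \<phi>" for k using phi by (simp add: test_functions_def)
    have supp: "{x. ?\<psi> x \<noteq> 0} = {x. \<phi> x \<noteq> 0}" using c by auto
    have "Ck k ?\<psi>" for k by (rule Ck_mult[OF Ck_const k])
    then have psi: "?\<psi> \<in> test_functions U" using phi unfolding test_functions_def mem_Collect_eq supp by blast
    have g: "grad ?\<psi> x = (1 / c) *\<^sub>R grad \<phi> x" for x
      by (rule grad_eqI, rule has_derivative_eq_rhs[OF has_derivative_mult_right[OF has_derivative_grad[OF k]]]) simp
    have "norm (grad ?\<psi> x) powr p = norm (grad \<phi> x) powr p / (c powr p)" for x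
      unfolding g using c(1) by (simp add: powr_divide)
    then have "(LINT x|lborel. norm (grad ?\<psi> x) powr p) = (LINT x|lborel. norm (grad \<phi> x) powr p / (c powr p))"
      by (simp only:)
    also have "\<dots> = (LINT x|lborel. norm (grad \<phi> x) powr p) / (c powr p)" by simp
    also have "\<dots> \<le> 1" using le unfolding c(2) by (simp add: divide_le_eq_1)
    finally have "?I ?\<psi> \<le> ennreal C" by (rule C[OF psi])
    then have "ennreal c * ?I ?\<psi> \<le> ennreal c * ennreal C" by (intro mult_left_mono) auto
    moreover have "ennreal c * ?I ?\<psi> = ?I \<phi>"
    proof -
      have pm: "?\<psi> \<in> borel_measurable (lebesgue_on U)" by (rule LpmD(1)[OF test_function_Lpm(1)[OF p U(1) psi]])
      have "(\<lambda>x. ennreal \<bar>f x * ?\<psi> x\<bar>) \<in> borel_measurable (lebesgue_on U)" using fm pm by measurable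
      from nn_integral_cmult[OF this, of "ennreal c"] show ?thesis
        using c by (simp add: abs_mult flip: ennreal_mult)
    qed
    ultimately show ?thesis using c by (simp add: ennreal_mult')
  qed
  have "?I w \<le> ennreal (c * C)"
    if w: "w \<in> W0z p U" and le: "(LINT x|lebesgue_on U. norm (weak_grad U w x) powr p) \<le> 1" for w
  proof -
    note D = W0zD[OF p U(1) w]
    have "\<forall>n. \<exists>\<phi>\<in>test_functions U. sobolev_dist p U \<phi> (grad \<phi>) w (weak_grad U w) < 1 / real (Suc n)"
      using W1p_0_approx[OF p U(1) D(1)] by simp
    then obtain \<phi> where phi: "\<And>n. \<phi> n \<in> test_functions U"
      "\<And>n. sobolev_dist p U (\<phi> n) (grad (\<phi> n)) w (weak_grad U w) < 1 / real (Suc n)" by metis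
    note L = test_function_Lpm[OF p U(1) phi(1)]
    have "(\<lambda>n. sobolev_dist p U (\<phi> n) (grad (\<phi> n)) w (weak_grad U w)) \<longlonglongrightarrow> 0"
      using sobolev_dist_nonneg phi(2) by (rule tendsto_0_of_less_inverse)
    then have l0: "(\<lambda>n. LINT x|lebesgue_on U. norm (\<phi> n x - w x) powr p) \<longlonglongrightarrow> 0"
      by (rule tendsto_sandwich[OF _ _ tendsto_const, rotated 2]) (simp_all add: sobolev_dist_def)
    have Ld: "(\<lambda>x. \<phi> n x - w x) \<in> Lpm p (lebesgue_on U)" for n using p by (intro Lpm_diff L D) auto
    have "\<exists>r::nat \<Rightarrow> nat. strict_mono r \<and> (AE x in lebesgue_on U. (\<lambda>n. norm (\<phi> (r n) x - w x) powr p) \<longlonglongrightarrow> 0)"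
      by (rule tendsto_L1_AE_subseq) (use LpmD(2)[OF Ld] l0 in simp_all)
    then obtain r where r: "strict_mono r" "AE x in lebesgue_on U. (\<lambda>n. norm (\<phi> (r n) x - w x) powr p) \<longlonglongrightarrow> 0"
      by blast
    have gb: "(LINT x|lborel. norm (grad (\<phi> n) x) powr p) \<le> 2 powr p * 2" for n
    proof -
      obtain K where K: "C1_supported K (\<phi> n)" "K \<subseteq> U" using test_function_C1_supported[OF phi(1)] .
      note DK = C1_supportedD[OF K(1)]
      have z: "grad (\<phi> n) x = 0" if "x \<notin> U" for x using DK(5) K(2) that by blast
      have "(\<lambda>x. norm (grad (\<phi> n) x) powr p) \<in> borel_measurable borel" using borel_measurable_C1(2)[OF K(1)] by measurable
      then have "(LINT x|lborel. norm (grad (\<phi> n) x) powr p) = (LINT x|lebesgue. norm (grad (\<phi> n) x) powr p)"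
        by (intro integral_completion[symmetric]) simp
      also have "\<dots> = (LINT x|lebesgue_on U. norm (grad (\<phi> n) x) powr p)"
        using z by (intro integral_lebesgue_on_test[OF U(1), symmetric]) simp
      also have "\<dots> \<le> 2 powr p * ((LINT x|lebesgue_on U. norm (grad (\<phi> n) x - weak_grad U w x) powr p) + (LINT x|lebesgue_on U. norm (weak_grad U w x) powr p))"
        using Lpm_integral_add_le[of p "\<lambda>x. grad (\<phi> n) x - weak_grad U w x" "lebesgue_on U" "weak_grad U w"] p
          Lpm_diff[OF _ L(2) D(5), of n] D(5) by simp
      also have "\<dots> \<le> 2 powr p * (1 + 1)"
      proof (intro mult_left_mono add_mono le)
        have "(LINT x|lebesgue_on U. norm (grad (\<phi> n) x - weak_grad U w x) powr p) \<le> sobolev_dist p U (\<phi> n) (grad (\<phi> n)) w (weak_grad U w)"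
          by (simp add: sobolev_dist_def)
        also have "\<dots> \<le> 1 / real (Suc n)" using phi(2)[of n] by simp
        also have "\<dots> \<le> 1" by simp
        finally show "(LINT x|lebesgue_on U. norm (grad (\<phi> n) x - weak_grad U w x) powr p) \<le> 1" .
      qed simp
      finally show ?thesis by simp
    qed
    have "?I w = (NNINT x|lebesgue_on U. liminf (\<lambda>n. ennreal \<bar>f x * \<phi> (r n) x\<bar>))"
    proof (rule nn_integral_cong_AE)
      show "AE x in lebesgue_on U. ennreal \<bar>f x * w x\<bar> = liminf (\<lambda>n. ennreal \<bar>f x * \<phi> (r n) x\<bar>)"
        using r(2)
      proof eventually_elim
        case (elim x)
        then have "(\<lambda>n. (norm (\<phi> (r n) x - w x) powr p) powr (1 / p)) \<longlonglongrightarrow> 0 powr (1 / p)"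
          using p by (intro tendsto_powr2 tendsto_const) auto
        then have "(\<lambda>n. norm (\<phi> (r n) x - w x)) \<longlonglongrightarrow> 0" using p by (simp add: powr_powr)
        then have "(\<lambda>n. \<phi> (r n) x) \<longlonglongrightarrow> w x" by (rule LIM_zero_cancel[OF tendsto_norm_zero_cancel])
        then have "(\<lambda>n. ennreal \<bar>f x * \<phi> (r n) x\<bar>) \<longlonglongrightarrow> ennreal \<bar>f x * w x\<bar>"
          by (intro tendsto_ennrealI tendsto_rabs tendsto_mult tendsto_const)
        then show ?case using lim_imp_Liminf[OF sequentially_bot] by metis
      qed
    qed
    also have "\<dots> \<le> liminf (\<lambda>n. NNINT x|lebesgue_on U. ennreal \<bar>f x * \<phi> (r n) x\<bar>)"
    proof (rule nn_integral_liminf)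
      show "(\<lambda>x. ennreal \<bar>f x * \<phi> (r n) x\<bar>) \<in> borel_measurable (lebesgue_on U)" for n
        using fm LpmD(1)[OF L(1)] by measurable
    qed
    also have "\<dots> \<le> ennreal (c * C)"
      by (rule Liminf_le) (use test[OF phi(1) gb] in \<open>auto intro: always_eventually\<close>)
    finally show ?thesis .
  qed
  then show ?thesis by blast
qed

section \<open>Integration with respect to the fractional measure\<close>

definition frac_kernel :: "real \<Rightarrow> real \<Rightarrow> 'a::euclidean_space \<Rightarrow> real" where
  "frac_kernel s p z = norm z powr (- real DIM('a) - s * p)"

lemma frac_kernel_minus: "frac_kernel s p (x - y) = frac_kernel s p (y - x)"
  by (simp add: frac_kernel_def norm_minus_commute)

lemma measurable_frac_kernel[measurable]: "frac_kernel s p \<in> borel_measurable borel"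
  unfolding frac_kernel_def[abs_def] by measurable

lemma sigma_finite_lebesgue: "sigma_finite_measure (lebesgue :: 'a::euclidean_space measure)"
proof
  obtain A :: "'a set set" where A: "countable A" "A \<subseteq> sets lborel" "\<Union>A = space lborel" "\<forall>a\<in>A. emeasure lborel a \<noteq> \<infinity>"
    using sigma_finite_measure.sigma_finite_countable[OF sigma_finite_lborel] by blast
  then show "\<exists>A. countable A \<and> A \<subseteq> sets (lebesgue :: 'a measure) \<and> \<Union>A = space lebesgue \<and> (\<forall>a\<in>A. emeasure lebesgue a \<noteq> \<infinity>)"
    by (intro exI[of _ A]) (auto intro!: sets_completionI_sets)
qed

lemma measurable_lebesgue_pair_id:
  "(\<lambda>z :: 'a::euclidean_space \<times> 'a. z) \<in> measurable (lebesgue \<Otimes>\<^sub>M lebesgue) (borel \<Otimes>\<^sub>M borel)"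
proof -
  have 1: "fst \<in> measurable (lebesgue \<Otimes>\<^sub>M (lebesgue :: 'a measure)) (borel :: 'a measure)"
    by (rule measurable_compose[OF measurable_fst]) (rule measurable_completion, simp)
  have 2: "snd \<in> measurable ((lebesgue :: 'a measure) \<Otimes>\<^sub>M lebesgue) (borel :: 'a measure)"
    by (rule measurable_compose[OF measurable_snd]) (rule measurable_completion, simp)
  from measurable_Pair[OF 1 2] show ?thesis by simp
qed

lemma sets_frac_measure: "sets (frac_measure s p) = sets (lebesgue \<Otimes>\<^sub>M lebesgue)"
  by (simp add: frac_measure_def)

lemma measurable_frac_measure_iff: "measurable (frac_measure s p) N = measurable (lebesgue \<Otimes>\<^sub>M lebesgue) N"
  by (rule measurable_cong_sets[OF sets_frac_measure refl])

lemma measurable_frac_borel: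
  assumes "F \<in> borel_measurable (borel \<Otimes>\<^sub>M borel)"
  shows "F \<in> borel_measurable (frac_measure s p)"
  unfolding measurable_frac_measure_iff by (rule measurable_compose[OF measurable_lebesgue_pair_id assms])

lemma measurable_frac_fst_snd:
  assumes "u \<in> borel_measurable lebesgue"
  shows "(\<lambda>z. u (fst z)) \<in> borel_measurable (frac_measure s p)" "(\<lambda>z. u (snd z)) \<in> borel_measurable (frac_measure s p)"
  unfolding measurable_frac_measure_iff
  by (rule measurable_compose[OF measurable_fst assms], rule measurable_compose[OF measurable_snd assms])

lemma frac_density_measurable:
  "(\<lambda>(x, y). ennreal (norm (x - y) powr (- real DIM('a) - s * p))) \<in> borel_measurable ((lebesgue :: 'a::euclidean_space measure) \<Otimes>\<^sub>M lebesgue)"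
proof -
  have "(\<lambda>(x :: 'a, y). ennreal (norm (x - y) powr (- real DIM('a) - s * p))) \<in> borel_measurable (borel \<Otimes>\<^sub>M borel)"
    by measurable
  from measurable_compose[OF measurable_lebesgue_pair_id this] show ?thesis .
qed

text \<open>A null set times the space is null for the product measure, hence for every measure with a density.\<close>

lemma AE_frac_measure:
  fixes P Q :: "'a::euclidean_space \<Rightarrow> bool"
  assumes P: "AE x in lebesgue. P x"
  shows "AE z in (frac_measure s p :: ('a \<times> 'a) measure). P (fst z) \<and> P (snd z)"
proof -
  interpret L: sigma_finite_measure "lebesgue :: 'a measure" by (rule sigma_finite_lebesgue)
  let ?L = "lebesgue :: 'a measure"
  obtain N where N: "{x \<in> space ?L. \<not> P x} \<subseteq> N" "emeasure ?L N = 0" "N \<in> sets ?L" using AE_E[OF P] .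
  have "emeasure (?L \<Otimes>\<^sub>M ?L) (N \<times> UNIV) = 0" "emeasure (?L \<Otimes>\<^sub>M ?L) (UNIV \<times> N) = 0"
  proof -
    have U: "UNIV \<in> sets ?L" by simp
    show "emeasure (?L \<Otimes>\<^sub>M ?L) (N \<times> UNIV) = 0" "emeasure (?L \<Otimes>\<^sub>M ?L) (UNIV \<times> N) = 0"
      using L.emeasure_pair_measure_Times[OF N(3) U] L.emeasure_pair_measure_Times[OF U N(3)] N(2) by simp_all
  qed
  moreover have "N \<times> UNIV \<in> sets (?L \<Otimes>\<^sub>M ?L)" "UNIV \<times> N \<in> sets (?L \<Otimes>\<^sub>M ?L)"
    by (rule pair_measureI[OF N(3)], simp, rule pair_measureI[OF _ N(3)], simp)
  ultimately have "N \<times> UNIV \<in> null_sets (?L \<Otimes>\<^sub>M ?L)" "UNIV \<times> N \<in> null_sets (?L \<Otimes>\<^sub>M ?L)"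
    by (simp_all add: null_setsI)
  then have "(N \<times> UNIV) \<union> (UNIV \<times> N) \<in> null_sets (?L \<Otimes>\<^sub>M ?L)" by (rule null_sets.Un)
  then have "AE z in ?L \<Otimes>\<^sub>M ?L. P (fst z) \<and> P (snd z)"
  proof (rule AE_I')
    show "{z \<in> space (?L \<Otimes>\<^sub>M ?L). \<not> (P (fst z) \<and> P (snd z))} \<subseteq> (N \<times> UNIV) \<union> (UNIV \<times> N)"
    proof
      fix z assume "z \<in> {z \<in> space (?L \<Otimes>\<^sub>M ?L). \<not> (P (fst z) \<and> P (snd z))}"
      then have "fst z \<in> N \<or> snd z \<in> N" using N(1) by auto
      then show "z \<in> (N \<times> UNIV) \<union> (UNIV \<times> N)" by (cases z) auto
    qed
  qed
  then show ?thesis unfolding frac_measure_def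
    by (subst AE_density[OF frac_density_measurable]) auto
qed

lemma nn_integral_frac_borel:
  fixes F :: "'a::euclidean_space \<times> 'a \<Rightarrow> ennreal"
  assumes F[measurable]: "F \<in> borel_measurable (borel \<Otimes>\<^sub>M borel)"
  shows "(NNINT z|frac_measure s p. F z) = (NNINT x|lborel. (NNINT y|lborel. ennreal (frac_kernel s p (x - y)) * F (x, y)))"
proof -
  interpret L: sigma_finite_measure "lebesgue :: 'a measure" by (rule sigma_finite_lebesgue)
  have Fm: "F \<in> borel_measurable (lebesgue \<Otimes>\<^sub>M lebesgue)" by (rule measurable_compose[OF measurable_lebesgue_pair_id F])
  have KF: "(\<lambda>z. ennreal (frac_kernel s p (fst z - snd z)) * F z) \<in> borel_measurable (borel \<Otimes>\<^sub>M borel)" by measurable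
  have "(NNINT z|frac_measure s p. F z) = (NNINT z|(lebesgue \<Otimes>\<^sub>M lebesgue). ennreal (frac_kernel s p (fst z - snd z)) * F z)"
    unfolding frac_measure_def by (subst nn_integral_density[OF frac_density_measurable Fm]) (simp add: frac_kernel_def case_prod_beta)
  also have "\<dots> = (NNINT x|lebesgue. (NNINT y|lebesgue. ennreal (frac_kernel s p (x - y)) * F (x, y)))"
    by (subst L.nn_integral_fst[symmetric]) (use measurable_compose[OF measurable_lebesgue_pair_id KF] in simp_all)
  finally show ?thesis by (simp add: nn_integral_completion)
qed

text \<open>Fubini's theorem in the coordinates \<open>x\<close> and \<open>h = y - x\<close>, which separate the singularity of the kernel from the increment.\<close>

lemma nn_integral_increment_coordinates:
  fixes F :: "'a::euclidean_space \<times> 'a \<Rightarrow> ennreal"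
  assumes F[measurable]: "F \<in> borel_measurable (borel \<Otimes>\<^sub>M borel)"
  shows "(NNINT x|lborel. (NNINT y|lborel. ennreal (frac_kernel s p (x - y)) * F (x, y)))
    = (NNINT h|lborel. ennreal (frac_kernel s p h) * (NNINT x|lborel. F (x, x + h)))"
proof -
  have "(NNINT y|lborel. ennreal (frac_kernel s p (x - y)) * F (x, y)) = (NNINT h|lborel. ennreal (frac_kernel s p h) * F (x, x + h))" for x
  proof -
    have "(\<lambda>y. ennreal (frac_kernel s p (x - y)) * F (x, y)) \<in> borel_measurable borel" by measurable
    from nn_integral_lborel_translate[OF this, of x]
    have "(NNINT y|lborel. ennreal (frac_kernel s p (x - y)) * F (x, y))
      = (NNINT h|lborel. ennreal (frac_kernel s p (x - (h + x))) * F (x, h + x))" by (rule sym)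
    also have "\<dots> = (NNINT h|lborel. ennreal (frac_kernel s p h) * F (x, x + h))"
      by (rule nn_integral_cong) (simp add: frac_kernel_def add.commute)
    finally show ?thesis .
  qed
  then have "(NNINT x|lborel. (NNINT y|lborel. ennreal (frac_kernel s p (x - y)) * F (x, y)))
    = (NNINT x|lborel. (NNINT h|lborel. ennreal (frac_kernel s p h) * F (x, x + h)))" by simp
  also have "\<dots> = (NNINT h|lborel. (NNINT x|lborel. ennreal (frac_kernel s p h) * F (x, x + h)))"
    by (rule lborel_pair.Fubini') measurable
  also have "\<dots> = (NNINT h|lborel. ennreal (frac_kernel s p h) * (NNINT x|lborel. F (x, x + h)))"
    by (intro nn_integral_cong nn_integral_cmult) measurable
  finally show ?thesis .
qed

text \<open>The masses of the kernel near and away from the diagonal; near the diagonal it is first multiplied by \<open>|h|\<^sup>p\<close>.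
  The dimension enters through a type argument.\<close>

definition near_const :: "'a::euclidean_space itself \<Rightarrow> real \<Rightarrow> real \<Rightarrow> real \<Rightarrow> ennreal" where
  "near_const _ s p \<delta> = (NNINT h|(lborel :: 'a measure). ennreal (norm h powr (p * (1 - s) - real DIM('a))) * indicator (ball 0 \<delta> - {0}) h)"

definition far_const :: "'a::euclidean_space itself \<Rightarrow> real \<Rightarrow> real \<Rightarrow> real \<Rightarrow> ennreal" where
  "far_const _ s p \<delta> = (NNINT h|(lborel :: 'a measure). ennreal (frac_kernel s p h) * indicator (- ball 0 \<delta>) h)"

lemma near_const_finite: "1 < p \<Longrightarrow> s < 1 \<Longrightarrow> 0 < \<delta> \<Longrightarrow> near_const TYPE('a::euclidean_space) s p \<delta> < \<infinity>"
  unfolding near_const_def by (intro nn_integral_powr_norm_ball) auto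

lemma far_const_finite: "1 < p \<Longrightarrow> 0 < s \<Longrightarrow> 0 < \<delta> \<Longrightarrow> far_const TYPE('a::euclidean_space) s p \<delta> < \<infinity>"
  unfolding far_const_def frac_kernel_def by (intro nn_integral_powr_norm_outside_ball) auto

lemma far_integral_eq:
  fixes x :: "'a::euclidean_space"
  shows "(NNINT y|lborel. ennreal (frac_kernel s p (x - y)) * indicator (- ball 0 \<delta>) (x - y)) = far_const TYPE('a) s p \<delta>"
proof -
  have m: "(\<lambda>h::'a. ennreal (frac_kernel s p h) * indicator (- ball 0 \<delta>) h) \<in> borel_measurable borel"
    by (intro borel_measurable_times_ennreal borel_measurable_indicator) (measurable, auto)
  have "(NNINT y|lborel. ennreal (frac_kernel s p (x - y)) * indicator (- ball 0 \<delta>) (x - y))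
    = (NNINT y|lborel. ennreal (frac_kernel s p (y + - x)) * indicator (- ball 0 \<delta>) (y + - x))"
    by (rule nn_integral_cong) (simp add: frac_kernel_def norm_minus_commute indicator_def dist_norm)
  also have "\<dots> = far_const TYPE('a) s p \<delta>"
    unfolding far_const_def by (rule nn_integral_lborel_translate[OF m])
  finally show ?thesis .
qed

text \<open>By translation invariance, the mass of the kernel in \<open>y\<close> at distance at least \<open>\<delta>\<close> from \<open>x\<close> is the same for all \<open>x\<close>.\<close>

lemma nn_integral_frac_far:
  fixes F :: "'a::euclidean_space \<Rightarrow> ennreal"
  assumes F[measurable]: "F \<in> borel_measurable borel"
  shows "(NNINT z|frac_measure s p. F (fst z) * indicator (- ball 0 \<delta>) (fst z - snd z))
    = far_const TYPE('a) s p \<delta> * (NNINT x|lborel. F x)"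
proof -
  have B[measurable]: "- ball (0 :: 'a) \<delta> \<in> sets borel" by simp
  have "(NNINT z|frac_measure s p. F (fst z) * indicator (- ball 0 \<delta>) (fst z - snd z))
    = (NNINT x|lborel. (NNINT y|lborel. F x * (ennreal (frac_kernel s p (x - y)) * indicator (- ball 0 \<delta>) (x - y))))"
    by (subst nn_integral_frac_borel) (measurable, simp add: mult_ac)
  also have "\<dots> = (NNINT x|lborel. F x * far_const TYPE('a) s p \<delta>)"
  proof (rule nn_integral_cong)
    fix x :: 'a
    show "(NNINT y|lborel. F x * (ennreal (frac_kernel s p (x - y)) * indicator (- ball 0 \<delta>) (x - y))) = F x * far_const TYPE('a) s p \<delta>"
      unfolding far_integral_eq[of s p x \<delta>, symmetric] by (rule nn_integral_cmult) measurable
  qed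
  also have "\<dots> = far_const TYPE('a) s p \<delta> * (NNINT x|lborel. F x)"
    by (subst nn_integral_multc) (simp_all add: mult.commute)
  finally show ?thesis .
qed

lemma nn_integral_frac_swap:
  fixes F :: "'a::euclidean_space \<times> 'a \<Rightarrow> ennreal"
  assumes F[measurable]: "F \<in> borel_measurable (borel \<Otimes>\<^sub>M borel)"
  shows "(NNINT z|frac_measure s p. F (snd z, fst z)) = (NNINT z|frac_measure s p. F z)"
proof -
  have "(NNINT z|frac_measure s p. F (snd z, fst z)) = (NNINT x|lborel. (NNINT y|lborel. ennreal (frac_kernel s p (y - x)) * F (y, x)))"
    by (subst nn_integral_frac_borel) (measurable, simp add: frac_kernel_minus[of s p])
  also have "\<dots> = (NNINT y|lborel. (NNINT x|lborel. ennreal (frac_kernel s p (y - x)) * F (y, x)))"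
    by (rule lborel_pair.Fubini') measurable
  finally show ?thesis by (simp only: nn_integral_frac_borel[OF F])
qed

text \<open>If increments by \<open>h\<close> are \<open>O(|h|)\<close> in \<open>L\<^sup>p\<close>, the kernel \<open>|h|\<^sup>-\<^sup>N\<^sup>-\<^sup>s\<^sup>p\<close> is reduced to \<open>|h|\<^sup>p\<^sup>(\<^sup>1\<^sup>-\<^sup>s\<^sup>)\<^sup>-\<^sup>N\<close>, which is integrable at \<open>0\<close>.\<close>

lemma near_diagonal_bound:
  fixes u :: "'a::euclidean_space \<Rightarrow> real"
  assumes u[measurable]: "u \<in> borel_measurable borel" and K[measurable]: "K \<in> sets borel"
    and tr: "\<And>h. norm h < \<delta> \<Longrightarrow> (NNINT x|lborel. ennreal (\<bar>u (x + h) - u x\<bar> powr p) * indicator K x) \<le> ennreal (norm h powr p) * G"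
  shows "(NNINT z|frac_measure s p. ennreal (\<bar>u (fst z) - u (snd z)\<bar> powr p) * indicator K (fst z) * indicator (ball 0 \<delta>) (fst z - snd z))
    \<le> near_const TYPE('a) s p \<delta> * G"
proof -
  let ?F = "\<lambda>z. ennreal (\<bar>u (fst z) - u (snd z)\<bar> powr p) * indicator K (fst z) * indicator (ball 0 \<delta>) (fst z - snd z)"
  have [measurable]: "ball (0 :: 'a) \<delta> \<in> sets borel" by simp
  have Fm: "?F \<in> borel_measurable (borel \<Otimes>\<^sub>M borel)" by measurable
  have "(NNINT z|frac_measure s p. ?F z) = (NNINT h|lborel. ennreal (frac_kernel s p h) * (NNINT x|lborel. ?F (x, x + h)))"
    unfolding nn_integral_frac_borel[OF Fm] by (rule nn_integral_increment_coordinates[OF Fm])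
  also have "\<dots> \<le> (NNINT h|(lborel :: 'a measure). ennreal (norm h powr (p * (1 - s) - real DIM('a))) * indicator (ball 0 \<delta> - {0}) h * G)"
  proof (rule nn_integral_mono)
    fix h :: 'a
    show "ennreal (frac_kernel s p h) * (NNINT x|lborel. ?F (x, x + h)) \<le> ennreal (norm h powr (p * (1 - s) - real DIM('a))) * indicator (ball 0 \<delta> - {0}) h * G"
    proof (cases "h = 0 \<or> \<delta> \<le> norm h")
      case True
      then have "ennreal (frac_kernel s p h) * (NNINT x|lborel. ?F (x, x + h)) = 0"
        by (auto simp: frac_kernel_def)
      then show ?thesis by (simp only: zero_le)
    next
      case False
      then have h: "h \<noteq> 0" "norm h < \<delta>" by auto
      have "(NNINT x|lborel. ?F (x, x + h)) = (NNINT x|lborel. ennreal (\<bar>u (x + h) - u x\<bar> powr p) * indicator K x)"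
        using h by (simp add: abs_minus_commute)
      also have "\<dots> \<le> ennreal (norm h powr p) * G" by (rule tr[OF h(2)])
      finally have "ennreal (frac_kernel s p h) * (NNINT x|lborel. ?F (x, x + h)) \<le> ennreal (frac_kernel s p h) * (ennreal (norm h powr p) * G)"
        by (rule mult_left_mono) simp
      also have "\<dots> = ennreal (frac_kernel s p h * norm h powr p) * G" by (simp add: ennreal_mult mult.assoc frac_kernel_def)
      also have "frac_kernel s p h * norm h powr p = norm h powr (p * (1 - s) - real DIM('a))"
        by (simp add: frac_kernel_def algebra_simps flip: powr_add)
      finally show ?thesis using h by simp
    qed
  qed
  also have "\<dots> = near_const TYPE('a) s p \<delta> * G"
    unfolding near_const_def
    by (intro nn_integral_multc borel_measurable_times_ennreal borel_measurable_indicator) (measurable, auto)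
  finally show ?thesis .
qed

section \<open>Estimates in the space of admissible variations\<close>

definition grad_energy :: "real \<Rightarrow> 'a::euclidean_space set \<Rightarrow> ('a \<Rightarrow> real) \<Rightarrow> real" where
  "grad_energy p U w = (LINT x|lebesgue_on U. norm (weak_grad U w x) powr p)"

lemma grad_energy_nonneg: "0 \<le> grad_energy p U w"
  by (simp add: grad_energy_def)

lemma W0z_representative:
  fixes w :: "'a::euclidean_space \<Rightarrow> real"
  assumes p: "1 < p" and U: "open U" and w: "w \<in> W0z p U"
  obtains w' where "w' \<in> borel_measurable borel" "AE x in lebesgue. w x = w' x"
    "(NNINT x|lborel. ennreal (\<bar>w' x\<bar> powr p)) = ennreal (LINT x|lebesgue_on U. \<bar>w x\<bar> powr p)"
    "\<And>h. (NNINT x|lborel. ennreal (\<bar>w' (x + h) - w' x\<bar> powr p)) \<le> ennreal (norm h powr p) * ennreal (grad_energy p U w)"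
proof -
  note W = W0z_whole_space[OF p U w] and D = W0zD[OF p U w]
  have L: "w \<in> Lpm p (lebesgue_on UNIV)" "zgrad U w \<in> Lpm p (lebesgue_on UNIV)"
    using W by (simp_all only: lebesgue_on_UNIV_eq)
  have e: "(LINT x|lebesgue_on UNIV. norm (zgrad U w x) powr p) = grad_energy p U w"
  proof -
    have "(LINT x|lebesgue_on UNIV. norm (zgrad U w x) powr p) = (LINT x|lebesgue. norm (zgrad U w x) powr p)"
      by (simp only: lebesgue_on_UNIV_eq)
    also have "\<dots> = (LINT x|lebesgue_on U. norm (zgrad U w x) powr p)"
      by (rule integral_lebesgue_on_test[OF U, symmetric]) (simp add: zgrad_def)
    also have "\<dots> = grad_energy p U w" unfolding grad_energy_def
      by (rule Bochner_Integration.integral_cong) (auto simp: space_restrict_space zgrad_def)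
    finally show ?thesis .
  qed
  have e2: "(LINT x|lebesgue_on UNIV. \<bar>w x\<bar> powr p) = (LINT x|lebesgue_on U. \<bar>w x\<bar> powr p)"
  proof -
    have "(LINT x|lebesgue_on UNIV. \<bar>w x\<bar> powr p) = (LINT x|lebesgue. \<bar>w x\<bar> powr p)" by (simp only: lebesgue_on_UNIV_eq)
    also have "\<dots> = (LINT x|lebesgue_on U. \<bar>w x\<bar> powr p)"
      by (rule integral_lebesgue_on_test[OF U, symmetric]) (simp add: D(6))
    finally show ?thesis .
  qed
  obtain w' where w': "w' \<in> borel_measurable borel" "AE x in lebesgue. x \<in> UNIV \<longrightarrow> w x = w' x"
    "\<And>x. x \<notin> UNIV \<Longrightarrow> w' x = 0" "w' \<in> Lpm p lborel"
    "(NNINT x|lborel. ennreal (\<bar>w' x\<bar> powr p)) = ennreal (LINT x|lebesgue_on UNIV. \<bar>w x\<bar> powr p)"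
    "\<And>K h. open K \<Longrightarrow> (\<And>x t. x \<in> K \<Longrightarrow> 0 \<le> t \<Longrightarrow> t \<le> 1 \<Longrightarrow> x + t *\<^sub>R h \<in> UNIV) \<Longrightarrow>
      (NNINT x|lborel. ennreal (\<bar>w' (x + h) - w' x\<bar> powr p) * indicator K x)
        \<le> ennreal (norm h powr p) * ennreal (LINT x|lebesgue_on UNIV. norm (zgrad U w x) powr p)"
  proof (rule translation_estimate_representative[OF p open_UNIV W(3) L])
    fix u' :: "'a \<Rightarrow> real"
    assume 1: "u' \<in> borel_measurable borel" and 2: "AE x in lebesgue. x \<in> UNIV \<longrightarrow> w x = u' x"
      and 3: "\<And>x. x \<notin> UNIV \<Longrightarrow> u' x = 0" and 4: "u' \<in> Lpm p lborel"
      and 5: "(NNINT x|lborel. ennreal (\<bar>u' x\<bar> powr p)) = ennreal (LINT x|lebesgue_on UNIV. \<bar>w x\<bar> powr p)"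
      and 6: "\<And>K h. open K \<Longrightarrow> (\<And>x t. x \<in> K \<Longrightarrow> 0 \<le> t \<Longrightarrow> t \<le> 1 \<Longrightarrow> x + t *\<^sub>R h \<in> UNIV) \<Longrightarrow>
        (NNINT x|lborel. ennreal (\<bar>u' (x + h) - u' x\<bar> powr p) * indicator K x)
          \<le> ennreal (norm h powr p) * ennreal (LINT x|lebesgue_on UNIV. norm (zgrad U w x) powr p)"
    show thesis by (rule that[OF 1 2 3 4 5 6])
  qed
  have "(NNINT x|lborel. ennreal (\<bar>w' (x + h) - w' x\<bar> powr p)) \<le> ennreal (norm h powr p) * ennreal (grad_energy p U w)" for h
    using w'(6)[OF open_UNIV, of h] by (simp add: e)
  then show thesis using that[OF w'(1) _ w'(5)[unfolded e2]] w'(2) by simp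
qed

text \<open>Poincare's inequality: translate by a vector longer than the diameter of \<open>U\<close>.\<close>

lemma W0z_poincare:
  fixes U :: "'a::euclidean_space set"
  assumes p: "1 < p" and U: "open U" "bounded U"
  shows "\<exists>C\<ge>0. \<forall>w\<in>W0z p U. (LINT x|lebesgue_on U. \<bar>w x\<bar> powr p) \<le> C * grad_energy p U w"
proof -
  obtain R where R: "0 < R" "U \<subseteq> ball 0 R" using U(2) by (metis bounded_subset_ballD)
  obtain b :: 'a where b: "b \<in> Basis" using nonempty_Basis by blast
  \<comment> \<open>the translate of \<open>U\<close> by \<open>h\<close> is disjoint from \<open>U\<close>\<close>
  define h where "h = (2 * R) *\<^sub>R b"
  have nh: "norm h = 2 * R" using b R by (simp add: h_def)
  have out: "x + h \<notin> U" if "x \<in> U" for x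
  proof
    assume "x + h \<in> U"
    then have "norm (x + h) < R" "norm x < R" using that R(2) by auto
    moreover have "norm h \<le> norm (x + h) + norm x" using norm_triangle_ineq4[of "x + h" x] by simp
    ultimately show False using nh by simp
  qed
  have "(LINT x|lebesgue_on U. \<bar>w x\<bar> powr p) \<le> (2 * R) powr p * grad_energy p U w" if w: "w \<in> W0z p U" for w
  proof -
    note D = W0zD[OF p U(1) w]
    obtain w' where w': "w' \<in> borel_measurable borel" "AE x in lebesgue. w x = w' x"
      "(NNINT x|lborel. ennreal (\<bar>w' x\<bar> powr p)) = ennreal (LINT x|lebesgue_on U. \<bar>w x\<bar> powr p)"
      "\<And>h. (NNINT x|lborel. ennreal (\<bar>w' (x + h) - w' x\<bar> powr p)) \<le> ennreal (norm h powr p) * ennreal (grad_energy p U w)"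
      by (rule W0z_representative[OF p U(1) w]) (rule that)
    have a1: "AE x in lborel. w x = w' x" using w'(2) by (simp add: AE_completion_iff)
    have a2: "AE x in lborel. w (x + h) = w' (x + h)"
    proof -
      have "AE x in distr lebesgue lebesgue (\<lambda>x. x + h). w x = w' x"
        using w'(2) by (subst distr_lebesgue_translate)
      then have "AE x in lebesgue. w (x + h) = w' (x + h)"
        by (rule AE_distrD[OF measurable_lebesgue_translate])
      then show ?thesis by (simp add: AE_completion_iff)
    qed
    have "ennreal (LINT x|lebesgue_on U. \<bar>w x\<bar> powr p) \<le> (NNINT x|lborel. ennreal (\<bar>w' (x + h) - w' x\<bar> powr p))"
      unfolding w'(3)[symmetric]
    proof (rule nn_integral_mono_AE)
      show "AE x in lborel. ennreal (\<bar>w' x\<bar> powr p) \<le> ennreal (\<bar>w' (x + h) - w' x\<bar> powr p)"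
        using a1 a2
      proof eventually_elim
        case (elim x)
        show ?case
        proof (cases "x \<in> U")
          case True
          then show ?thesis using elim D(6)[OF out[OF True]] by simp
        next
          case False
          then have "w' x = 0" using elim D(6)[OF False] by simp
          then show ?thesis by simp
        qed
      qed
    qed
    also have "\<dots> \<le> ennreal (norm h powr p) * ennreal (grad_energy p U w)" by (rule w'(4))
    also have "\<dots> = ennreal ((2 * R) powr p * grad_energy p U w)" by (simp add: nh ennreal_mult grad_energy_nonneg)
    finally show ?thesis by (simp add: ennreal_le_iff grad_energy_nonneg)
  qed
  then show ?thesis by (intro exI[of _ "(2 * R) powr p"]) auto
qed

text \<open>The embedding of \<open>W\<^sup>1\<^sup>,\<^sup>p\<close> into the fractional space: increments shorter than \<open>1\<close> are controlled by the gradient,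
  longer ones by the function itself.\<close>

lemma W0z_fractional_bound:
  fixes U :: "'a::euclidean_space set"
  assumes p: "1 < p" and s: "0 < s" "s < 1" and U: "open U" "bounded U"
  shows "\<exists>C\<ge>0. \<forall>w\<in>W0z p U. (NNINT z|frac_measure s p. ennreal (\<bar>w (fst z) - w (snd z)\<bar> powr p)) \<le> ennreal (C * grad_energy p U w)"
proof -
  obtain Cp where Cp: "0 \<le> Cp" "\<And>w. w \<in> W0z p U \<Longrightarrow> (LINT x|lebesgue_on U. \<bar>w x\<bar> powr p) \<le> Cp * grad_energy p U w"
    using W0z_poincare[OF p U] by blast
  define kn where "kn = enn2real (near_const TYPE('a) s p 1)"
  define kf where "kf = enn2real (far_const TYPE('a) s p 1)"
  have kn: "near_const TYPE('a) s p 1 = ennreal kn" "0 \<le> kn"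
    using near_const_finite[where 'a = 'a, OF p s(2), of 1] by (auto simp: kn_def less_top)
  have kf: "far_const TYPE('a) s p 1 = ennreal kf" "0 \<le> kf"
    using far_const_finite[where 'a = 'a, OF p s(1), of 1] by (auto simp: kf_def less_top)
  define C where "C = kn + kf * (2 powr p * Cp) + kf * (2 powr p * Cp)"
  have C0: "0 \<le> C" using kn kf Cp by (simp add: C_def)
  have "(NNINT z|frac_measure s p. ennreal (\<bar>w (fst z) - w (snd z)\<bar> powr p)) \<le> ennreal (C * grad_energy p U w)"
    if w: "w \<in> W0z p U" for w
  proof -
    define E where "E = grad_energy p U w"
    have E0: "0 \<le> E" by (simp add: E_def grad_energy_nonneg)
    obtain w' where w': "w' \<in> borel_measurable borel" "AE x in lebesgue. w x = w' x"
      "(NNINT x|lborel. ennreal (\<bar>w' x\<bar> powr p)) = ennreal (LINT x|lebesgue_on U. \<bar>w x\<bar> powr p)"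
      "\<And>h. (NNINT x|lborel. ennreal (\<bar>w' (x + h) - w' x\<bar> powr p)) \<le> ennreal (norm h powr p) * ennreal (grad_energy p U w)"
      by (rule W0z_representative[OF p U(1) w]) (rule that)
    note [measurable] = w'(1)
    have [measurable]: "ball (0 :: 'a) 1 \<in> sets borel" "- ball (0 :: 'a) 1 \<in> sets borel" by simp_all
    let ?N = "\<lambda>z. ennreal (\<bar>w' (fst z) - w' (snd z)\<bar> powr p) * indicator UNIV (fst z) * indicator (ball 0 1) (fst z - snd z)"
    let ?F = "\<lambda>z. ennreal (2 powr p * \<bar>w' (fst z)\<bar> powr p) * indicator (- ball 0 1) (fst z - snd z)"
    have m: "?N \<in> borel_measurable (borel \<Otimes>\<^sub>M borel)" "?F \<in> borel_measurable (borel \<Otimes>\<^sub>M borel)"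
      "(\<lambda>z. ?F (snd z, fst z)) \<in> borel_measurable (borel \<Otimes>\<^sub>M borel)" by measurable
    have near: "(NNINT z|frac_measure s p. ?N z) \<le> ennreal kn * ennreal E"
      unfolding kn(1)[symmetric] E_def by (rule near_diagonal_bound) (simp_all add: w')
    have far: "(NNINT z|frac_measure s p. ?F z) \<le> ennreal (kf * (2 powr p * (Cp * E)))"
    proof -
      have "(NNINT z|frac_measure s p. ?F z) = ennreal kf * (NNINT x|lborel. ennreal (2 powr p) * ennreal (\<bar>w' x\<bar> powr p))"
        unfolding kf(1)[symmetric] by (subst nn_integral_frac_far) (measurable, simp add: ennreal_mult)
      also have "\<dots> = ennreal kf * (ennreal (2 powr p) * ennreal (LINT x|lebesgue_on U. \<bar>w x\<bar> powr p))"
        by (subst nn_integral_cmult) (simp_all add: w'(3))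
      also have "\<dots> \<le> ennreal kf * (ennreal (2 powr p) * ennreal (Cp * E))"
        unfolding E_def by (intro mult_left_mono ennreal_leI Cp(2) w) auto
      also have "\<dots> = ennreal (kf * (2 powr p * (Cp * E)))" using kf(2) Cp(1) E0 by (simp add: ennreal_mult)
      finally show ?thesis .
    qed
    have "(NNINT z|frac_measure s p. ennreal (\<bar>w (fst z) - w (snd z)\<bar> powr p))
      \<le> (NNINT z|frac_measure s p. ?N z + ?F z + ?F (snd z, fst z))"
    proof (rule nn_integral_mono_AE, rule eventually_mono[OF AE_frac_measure[OF w'(2)]])
      fix z assume z: "w (fst z) = w' (fst z) \<and> w (snd z) = w' (snd z)"
      show "ennreal (\<bar>w (fst z) - w (snd z)\<bar> powr p) \<le> ?N z + ?F z + ?F (snd z, fst z)"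
      proof (cases "norm (fst z - snd z) < 1")
        case True
        then show ?thesis using z by simp
      next
        case False
        have "\<bar>w' (fst z) - w' (snd z)\<bar> powr p \<le> 2 powr p * \<bar>w' (fst z)\<bar> powr p + 2 powr p * \<bar>w' (snd z)\<bar> powr p"
          using norm_diff_powr_le[of p "w' (fst z)" "w' (snd z)"] p by (simp add: distrib_left)
        then show ?thesis using z False
          by (simp add: dist_norm norm_minus_commute ennreal_leI flip: ennreal_plus)
      qed
    qed
    also have "\<dots> = (NNINT z|frac_measure s p. ?N z) + (NNINT z|frac_measure s p. ?F z) + (NNINT z|frac_measure s p. ?F (snd z, fst z))"
      using m[THEN measurable_frac_borel, of s p] by (simp only: nn_integral_add borel_measurable_add)
    also have "\<dots> \<le> ennreal kn * ennreal E + ennreal (kf * (2 powr p * (Cp * E))) + ennreal (kf * (2 powr p * (Cp * E)))"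
      unfolding nn_integral_frac_swap[OF m(2)] by (intro add_mono near far)
    also have "\<dots> = ennreal (C * E)"
      using kn(2) kf(2) Cp(1) E0 by (simp add: C_def algebra_simps flip: ennreal_plus ennreal_mult)
    finally show ?thesis by (simp add: E_def)
  qed
  then show ?thesis using C0 by blast
qed

section \<open>The boundary datum and the nonlocal term\<close>

lemma tail_space_measurable:
  fixes g :: "'a::euclidean_space \<Rightarrow> real"
  assumes "g \<in> tail_space m \<alpha>"
  shows "g \<in> borel_measurable lebesgue"
proof (rule borel_measurable_LIMSEQ_real)
  fix x :: 'a
  show "(\<lambda>n. indicator (cball 0 (real n)) x * g x) \<longlonglongrightarrow> g x"
  proof (rule tendsto_eventually, rule eventually_sequentiallyI[of "nat \<lceil>norm x\<rceil>"])
    fix n assume "nat \<lceil>norm x\<rceil> \<le> n"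
    then have "norm x \<le> real n" by linarith
    then show "indicator (cball 0 (real n)) x * g x = g x" by simp
  qed
next
  fix n :: nat
  have "g \<in> borel_measurable (lebesgue_on (cball 0 (real n)))"
    using assms by (auto simp: tail_space_def Lp_loc_def Lp_on_def)
  then have "(\<lambda>x. indicator (cball 0 (real n)) x *\<^sub>R g x) \<in> borel_measurable lebesgue"
    by (subst (asm) borel_measurable_restrict_space_iff) auto
  then show "(\<lambda>x. indicator (cball 0 (real n)) x * g x) \<in> borel_measurable lebesgue" by simp
qed

text \<open>For \<open>x\<close> in a bounded set and \<open>y\<close> away from \<open>x\<close>, both \<open>1\<close> and \<open>|y|\<close> are at most a multiple of \<open>|x - y|\<close>. This is where
  the weight of the tail space comes from.\<close>

lemma frac_kernel_le_weight:
  fixes x y :: "'a::euclidean_space"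
  assumes p: "1 < p" and s: "0 < s" and d: "0 < \<delta>" "\<delta> \<le> norm (x - y)" and R: "norm x < R"
  shows "frac_kernel s p (x - y) \<le> ((1 / \<delta>) powr (real DIM('a) + s * p) + (R / \<delta> + 1) powr (real DIM('a) + s * p))
    / (1 + norm y powr (real DIM('a) + s * p))"
proof -
  define m where "m = real DIM('a) + s * p"
  have m: "0 < m" using p s by (simp add: m_def add_pos_pos)
  define r where "r = norm (x - y)"
  have r: "0 < r" using d unfolding r_def by linarith
  have R0: "0 < R" using R norm_ge_zero[of x] by linarith
  have "1 \<le> r / \<delta>" using d by (simp add: r_def)
  then have "1 powr m \<le> (r / \<delta>) powr m" using m by (intro powr_mono2) auto
  then have 1: "1 \<le> (1 / \<delta>) powr m * r powr m" using d r by (simp add: powr_divide)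
  have "norm y \<le> norm x + r" using norm_triangle_ineq4[of x "x - y"] by (simp add: r_def)
  also have "\<dots> \<le> R * (r / \<delta>) + r"
  proof -
    have "R * 1 \<le> R * (r / \<delta>)" using \<open>1 \<le> r / \<delta>\<close> R0 by (intro mult_left_mono) auto
    then show ?thesis using R by linarith
  qed
  also have "\<dots> = (R / \<delta> + 1) * r" by (simp add: algebra_simps)
  finally have "norm y powr m \<le> ((R / \<delta> + 1) * r) powr m" using m by (intro powr_mono2) auto
  then have 2: "norm y powr m \<le> (R / \<delta> + 1) powr m * r powr m" using r R0 d by (simp add: powr_mult)
  have "1 + norm y powr m \<le> ((1 / \<delta>) powr m + (R / \<delta> + 1) powr m) * r powr m"
    using 1 2 by (simp add: distrib_right)
  moreover have "frac_kernel s p (x - y) = 1 / r powr m"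
  proof -
    have "- real DIM('a) - s * p = - m" by (simp add: m_def)
    then show ?thesis by (simp add: frac_kernel_def r_def powr_minus_divide)
  qed
  moreover have "0 < 1 + norm y powr m" by (simp add: add_pos_nonneg)
  moreover have "1 / a \<le> C / D" if "D \<le> C * a" "0 < a" "0 < D" for a C D :: real
    using that by (simp add: field_simps)
  ultimately show ?thesis using r unfolding m_def[symmetric] by simp
qed

text \<open>The part of the cross term with \<open>|x - y| \<ge> \<delta>\<close> that contains \<open>w(x)\<close>. The summand with \<open>g(x)\<close> is controlled by the
  mass of the kernel, the one with \<open>g(y)\<close> by the tail of \<open>g\<close>, using \<open>|w| \<le> 1 + |w|\<^sup>p\<close>.\<close>

lemma datum_cross_term_far_bound:
  fixes g w :: "'a::euclidean_space \<Rightarrow> real"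
  assumes p: "1 < p" and s: "0 < s" and d: "0 < \<delta>" and R: "U \<subseteq> ball 0 R" and Um[measurable]: "U \<in> sets borel"
    and gm[measurable]: "g \<in> borel_measurable borel" and wm[measurable]: "w \<in> borel_measurable borel"
    and w0: "\<And>x. x \<notin> U \<Longrightarrow> w x = 0"
    and cR: "cR = (1 / \<delta>) powr (real DIM('a) + s * p) + (R / \<delta> + 1) powr (real DIM('a) + s * p)"
    and T: "T = (NNINT y|lborel. ennreal (\<bar>g y\<bar> powr (p - 1) / (1 + norm y powr (real DIM('a) + s * p))))"
    and Iw: "Iw = (NNINT x|lborel. ennreal (\<bar>w x\<bar> powr p))"
  shows "(NNINT z|frac_measure s p. ennreal (\<bar>g (fst z) - g (snd z)\<bar> powr (p - 1) * \<bar>w (fst z)\<bar>) * indicator (- ball 0 \<delta>) (fst z - snd z))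
    \<le> far_const TYPE('a) s p \<delta> * (ennreal (2 powr (p - 1)) * ((NNINT x|lborel. ennreal (\<bar>g x\<bar> powr p) * indicator U x) + Iw))
      + ennreal (2 powr (p - 1) * cR) * (emeasure lborel U + Iw) * T"
proof -
  define wt where "wt y = \<bar>g y\<bar> powr (p - 1) / (1 + norm y powr (real DIM('a) + s * p))" for y
  have wtm[measurable]: "wt \<in> borel_measurable borel" unfolding wt_def by measurable
  have cR0: "0 \<le> cR" by (simp add: cR)
  define c where "c = 2 powr (p - 1)"
  have c0: "0 \<le> c" by (simp add: c_def)
  define a where "a x = ennreal c * (ennreal (\<bar>g x\<bar> powr p) * indicator U x + ennreal (\<bar>w x\<bar> powr p))" for x
  define b where "b x = ennreal (c * cR) * (indicator U x + ennreal (\<bar>w x\<bar> powr p))" for x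
  have [measurable]: "a \<in> borel_measurable borel" "b \<in> borel_measurable borel" unfolding a_def b_def by measurable
  have B[measurable]: "- ball (0 :: 'a) \<delta> \<in> sets borel" by simp
  let ?far = "\<lambda>x y. indicator (- ball 0 \<delta>) (x - y) :: ennreal" and ?k = "\<lambda>x y :: 'a. frac_kernel s p (x - y)"
  let ?F = "\<lambda>z. ennreal (\<bar>g (fst z) - g (snd z)\<bar> powr (p - 1) * \<bar>w (fst z)\<bar>) * ?far (fst z) (snd z)"
  have pt: "ennreal (?k x y) * ?F (x, y) \<le> ennreal (?k x y) * (a x * ?far x y) + b x * ennreal (wt y)" for x y
  proof (cases "x \<in> U \<and> \<delta> \<le> norm (x - y)")
    case False
    then have "?F (x, y) = 0" using w0[of x] by auto
    then show ?thesis by (simp only: mult_zero_right zero_le)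
  next
    case True
    then have far: "\<delta> \<le> norm (x - y)" and xR: "norm x < R" using R by auto
    have k0: "0 \<le> ?k x y" by (simp add: frac_kernel_def)
    have kb: "?k x y * \<bar>g y\<bar> powr (p - 1) \<le> cR * wt y"
      using mult_right_mono[OF frac_kernel_le_weight[OF p s d far xR], of "\<bar>g y\<bar> powr (p - 1)"] by (simp add: cR wt_def)
    have gw: "\<bar>g x\<bar> powr (p - 1) * \<bar>w x\<bar> \<le> \<bar>g x\<bar> powr p + \<bar>w x\<bar> powr p" by (intro powr_times_le_add_powr p) auto
    have w1: "\<bar>w x\<bar> \<le> 1 + \<bar>w x\<bar> powr p" using le_add_powr[OF p abs_ge_zero, of 1 "w x"] by simp
    have wt0: "0 \<le> wt y" by (simp add: wt_def add_pos_nonneg)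
    have "\<bar>g x - g y\<bar> powr (p - 1) \<le> c * (\<bar>g x\<bar> powr (p - 1) + \<bar>g y\<bar> powr (p - 1))"
      using norm_diff_powr_le[of "p - 1" "g x" "g y"] p by (simp add: c_def)
    then have "?k x y * (\<bar>g x - g y\<bar> powr (p - 1) * \<bar>w x\<bar>) \<le> ?k x y * (c * (\<bar>g x\<bar> powr (p - 1) + \<bar>g y\<bar> powr (p - 1)) * \<bar>w x\<bar>)"
      using k0 by (intro mult_left_mono mult_right_mono) auto
    also have "\<dots> = ?k x y * (c * (\<bar>g x\<bar> powr (p - 1) * \<bar>w x\<bar>)) + c * \<bar>w x\<bar> * (?k x y * \<bar>g y\<bar> powr (p - 1))"
      by (simp add: algebra_simps)
    also have "\<dots> \<le> ?k x y * (c * (\<bar>g x\<bar> powr p + \<bar>w x\<bar> powr p)) + c * (1 + \<bar>w x\<bar> powr p) * (cR * wt y)"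
      using k0 c0 w1 cR0 wt0 by (intro add_mono mult_mono[OF _ kb] mult_left_mono gw) auto
    finally have "ennreal (?k x y * (\<bar>g x - g y\<bar> powr (p - 1) * \<bar>w x\<bar>))
      \<le> ennreal (?k x y * (c * (\<bar>g x\<bar> powr p + \<bar>w x\<bar> powr p)) + c * cR * (1 + \<bar>w x\<bar> powr p) * wt y)"
      by (intro ennreal_leI) (simp add: mult_ac)
    then show ?thesis using True far k0 c0 cR0 wt0 by (simp add: a_def b_def ennreal_mult ennreal_plus)
  qed
  have Fm: "?F \<in> borel_measurable (borel \<Otimes>\<^sub>M borel)" and am: "(\<lambda>z. a (fst z) * ?far (fst z) (snd z)) \<in> borel_measurable (borel \<Otimes>\<^sub>M borel)"
    by measurable
  have "(NNINT z|frac_measure s p. ?F z)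
    \<le> (NNINT x|lborel. (NNINT y|lborel. ennreal (?k x y) * (a x * ?far x y) + b x * ennreal (wt y)))"
    unfolding nn_integral_frac_borel[OF Fm] by (intro nn_integral_mono pt)
  also have "\<dots> = (NNINT x|lborel. (NNINT y|lborel. ennreal (?k x y) * (a x * ?far x y))) + (NNINT x|lborel. (NNINT y|lborel. b x * ennreal (wt y)))"
    by (subst nn_integral_add[symmetric]) (measurable, intro nn_integral_cong nn_integral_add, measurable)
  also have "(NNINT x|lborel. (NNINT y|lborel. ennreal (?k x y) * (a x * ?far x y))) = far_const TYPE('a) s p \<delta> * (NNINT x|lborel. a x)"
    using nn_integral_frac_far[of a s p \<delta>] by (simp add: nn_integral_frac_borel[OF am])
  also have "(NNINT x|lborel. a x) = ennreal c * ((NNINT x|lborel. ennreal (\<bar>g x\<bar> powr p) * indicator U x) + Iw)"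
    unfolding a_def Iw by (simp add: nn_integral_cmult nn_integral_add)
  also have "(NNINT x|lborel. (NNINT y|lborel. b x * ennreal (wt y))) = (NNINT x|lborel. b x) * T"
    unfolding T wt_def[symmetric] by (simp add: nn_integral_cmult nn_integral_multc)
  also have "(NNINT x|lborel. b x) = ennreal (c * cR) * (emeasure lborel U + Iw)"
    unfolding b_def Iw by (simp add: nn_integral_cmult nn_integral_add)
  finally show ?thesis unfolding c_def .
qed

text \<open>The datum may have infinite fractional energy, so its increments enter only through
  \<open>|g(x) - g(y)|\<^sup>p\<^sup>-\<^sup>1 |w(x) - w(y)|\<close>, which vanishes unless \<open>x\<close> or \<open>y\<close> lies in \<open>U\<close>. Near the diagonal both points then lie
  in \<open>U'\<close>, where \<open>g\<close> has a gradient in \<open>L\<^sup>p\<close>; this is what the compact inclusion of \<open>U\<close> in \<open>U'\<close> is for.\<close>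

lemma datum_cross_term_bound:
  fixes g :: "'a::euclidean_space \<Rightarrow> real" and U U' :: "'a set"
  assumes p: "1 < p" and s: "0 < s" "s < 1" and U: "open U" "bounded U" and U': "open U'"
    and cc: "compactly_contained U U'" and g: "g \<in> W1p p U'" "g \<in> tail_space (p - 1) (s * p)"
  shows "\<exists>C. \<forall>w\<in>W0z p U. grad_energy p U w \<le> 1 \<longrightarrow>
    (NNINT z|frac_measure s p. ennreal (\<bar>g (fst z) - g (snd z)\<bar> powr (p - 1) * \<bar>w (fst z) - w (snd z)\<bar>)) \<le> ennreal C"
proof -
  obtain R where R: "0 < R" "U \<subseteq> ball 0 R" using U(2) by (metis bounded_subset_ballD)
  have [measurable]: "U \<in> sets borel" "U' \<in> sets borel" using U U' by auto
  obtain e where e: "0 < e" "(\<Union>x\<in>closure U. ball x e) \<subseteq> U'"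
    using compact_subset_open_imp_ball_epsilon_subset[of "closure U" U'] cc U' by (auto simp: compactly_contained_def)
  \<comment> \<open>points at distance less than \<open>2 \<delta>\<close> from \<open>U\<close> lie in \<open>U'\<close>, so segments of length less than \<open>\<delta>\<close> that start in \<open>K\<close> stay in \<open>U'\<close>\<close>
  define \<delta> where "\<delta> = e / 2"
  have d: "0 < \<delta>" using e by (simp add: \<delta>_def)
  have ball2: "z \<in> U'" if "y \<in> U" "dist y z < 2 * \<delta>" for y z
    using e(2) that closure_subset[of U] by (fastforce simp: \<delta>_def subset_iff)
  define K where "K = (\<Union>y\<in>U. ball y \<delta>)"
  have Ko: "open K" by (auto simp: K_def)
  then have [measurable]: "K \<in> sets borel" by simp
  have KU: "U \<subseteq> K" using d by (auto simp: K_def)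
  have Kseg: "x + t *\<^sub>R h \<in> U'" if xK: "x \<in> K" and that: "0 \<le> t" "t \<le> 1" "norm h < \<delta>" for x t h
  proof -
    obtain y where y: "y \<in> U" "dist y x < \<delta>" using xK unfolding K_def by auto
    have "norm (t *\<^sub>R h) \<le> 1 * norm h" using that by (simp add: mult_left_le_one_le)
    then have "dist y (x + t *\<^sub>R h) < 2 * \<delta>"
      using y(2) that(3) dist_triangle[of y "x + t *\<^sub>R h" x] by (simp add: dist_norm)
    then show ?thesis by (rule ball2[OF y(1)])
  qed
  have KU': "K \<subseteq> U'" using Kseg[of _ 0 0] d by auto
  note gW = g(1)[unfolded W1p_iff[OF p U']]
  define G where "G = (LINT x|lebesgue_on U'. norm (weak_grad U' g x) powr p)"
  define gp where "gp = (LINT x|lebesgue_on U'. \<bar>g x\<bar> powr p)"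
  obtain u' where u'm[measurable]: "u' \<in> borel_measurable borel" and u'eq: "AE x in lebesgue. x \<in> U' \<longrightarrow> g x = u' x"
    and u'p: "(NNINT x|lborel. ennreal (\<bar>u' x\<bar> powr p)) = ennreal gp"
    and u't: "\<And>K h. open K \<Longrightarrow> (\<And>x t. x \<in> K \<Longrightarrow> 0 \<le> t \<Longrightarrow> t \<le> 1 \<Longrightarrow> x + t *\<^sub>R h \<in> U') \<Longrightarrow>
      (NNINT x|lborel. ennreal (\<bar>u' (x + h) - u' x\<bar> powr p) * indicator K x) \<le> ennreal (norm h powr p) * ennreal G"
  proof (rule translation_estimate_representative[OF p U' conjunct1[OF conjunct2[OF gW]] conjunct1[OF gW] conjunct2[OF conjunct2[OF gW]]])
    fix u' :: "'a \<Rightarrow> real"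
    assume 1: "u' \<in> borel_measurable borel" and 2: "AE x in lebesgue. x \<in> U' \<longrightarrow> g x = u' x"
      and 5: "(NNINT x|lborel. ennreal (\<bar>u' x\<bar> powr p)) = ennreal (LINT x|lebesgue_on U'. \<bar>g x\<bar> powr p)"
      and 6: "\<And>K h. open K \<Longrightarrow> (\<And>x t. x \<in> K \<Longrightarrow> 0 \<le> t \<Longrightarrow> t \<le> 1 \<Longrightarrow> x + t *\<^sub>R h \<in> U') \<Longrightarrow>
        (NNINT x|lborel. ennreal (\<bar>u' (x + h) - u' x\<bar> powr p) * indicator K x)
          \<le> ennreal (norm h powr p) * ennreal (LINT x|lebesgue_on U'. norm (weak_grad U' g x) powr p)"
    show thesis by (rule that[OF 1 2 5[folded gp_def] 6[folded G_def]])
  qed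
  have gm: "g \<in> borel_measurable lebesgue" by (rule tail_space_measurable[OF g(2)])
  obtain g1 where g1: "g1 \<in> borel_measurable borel" "AE x in lebesgue. g x = g1 x"
    by (rule lebesgue_ex_borel_measurable[OF gm]) (rule that)
  \<comment> \<open>one Borel function that equals \<open>g\<close> almost everywhere and satisfies the translation estimate inside \<open>U'\<close>\<close>
  define g' where "g' x = (if x \<in> U' then u' x else g1 x)" for x
  have g'm[measurable]: "g' \<in> borel_measurable borel" unfolding g'_def using g1(1) by measurable
  have g'eq: "AE x in lebesgue. g x = g' x" using u'eq g1(2) by eventually_elim (auto simp: g'_def)
  have g'U: "g' x = u' x" if "x \<in> U'" for x using that by (simp add: g'_def)
  define T where "T = (NNINT y|lborel. ennreal (\<bar>g' y\<bar> powr (p - 1) / (1 + norm y powr (real DIM('a) + s * p))))"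
  have T: "T < \<infinity>"
  proof -
    have i: "integrable lebesgue (\<lambda>x. \<bar>g x\<bar> powr (p - 1) / (1 + norm x powr (real DIM('a) + s * p)))"
      using g(2) by (simp add: tail_space_def)
    have "T = (NNINT y|lebesgue. ennreal (\<bar>g' y\<bar> powr (p - 1) / (1 + norm y powr (real DIM('a) + s * p))))"
      unfolding T_def by (rule nn_integral_completion[symmetric])
    also have "\<dots> = (NNINT y|lebesgue. ennreal (\<bar>g y\<bar> powr (p - 1) / (1 + norm y powr (real DIM('a) + s * p))))"
      by (rule nn_integral_cong_AE) (use g'eq in \<open>eventually_elim, simp\<close>)
    also have "\<dots> < \<infinity>" using i by (subst nn_integral_eq_integral) (auto simp: add_pos_nonneg)
    finally show ?thesis .
  qed
  obtain Cp where Cp: "0 \<le> Cp" "\<And>w. w \<in> W0z p U \<Longrightarrow> (LINT x|lebesgue_on U. \<bar>w x\<bar> powr p) \<le> Cp * grad_energy p U w"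
    using W0z_poincare[OF p U] by blast
  obtain Cf where Cf: "0 \<le> Cf" "\<And>w. w \<in> W0z p U \<Longrightarrow>
      (NNINT z|frac_measure s p. ennreal (\<bar>w (fst z) - w (snd z)\<bar> powr p)) \<le> ennreal (Cf * grad_energy p U w)"
    using W0z_fractional_bound[OF p s U] by blast
  define cR where "cR = (1 / \<delta>) powr (real DIM('a) + s * p) + (R / \<delta> + 1) powr (real DIM('a) + s * p)"
  define c1 where "c1 = near_const TYPE('a) s p \<delta> * ennreal G"
  define c3 where "c3 = far_const TYPE('a) s p \<delta> * (ennreal (2 powr (p - 1)) * (ennreal gp + ennreal Cp))
      + ennreal (2 powr (p - 1) * cR) * (emeasure lborel U + ennreal Cp) * T"
  define c where "c = c1 + ennreal Cf + c3 + c3"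
  have cfin: "c < \<infinity>"
  proof -
    have mU: "emeasure lborel U < top" using emeasure_bounded_finite[OF U(2)] by simp
    have "c1 < top" using near_const_finite[where 'a = 'a, OF p s(2) d] by (simp add: c1_def ennreal_mult_less_top)
    moreover have "c3 < top"
      using far_const_finite[where 'a = 'a, OF p s(1) d] T mU by (simp add: c3_def ennreal_mult_less_top)
    ultimately show ?thesis by (simp add: c_def)
  qed
  have "(NNINT z|frac_measure s p. ennreal (\<bar>g (fst z) - g (snd z)\<bar> powr (p - 1) * \<bar>w (fst z) - w (snd z)\<bar>)) \<le> c"
    if w: "w \<in> W0z p U" and E1: "grad_energy p U w \<le> 1" for w
  proof -
    note D = W0zD[OF p U(1) w]
    obtain w' where w'm[measurable]: "w' \<in> borel_measurable borel" and w'eq: "AE x in lebesgue. x \<in> U \<longrightarrow> w x = w' x"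
      and w'0: "\<And>x. x \<notin> U \<Longrightarrow> w' x = 0"
      and w'p: "(NNINT x|lborel. ennreal (norm (w' x) powr p) * indicator U x) = ennreal (LINT x|lebesgue_on U. norm (w x) powr p)"
      by (rule Lpm_borel_version[OF U(1) D(3)]) (rule that)
    have w'eq': "AE x in lebesgue. w x = w' x" using w'eq
    proof eventually_elim
      case (elim x)
      then show ?case using D(6)[of x] w'0[of x] by (cases "x \<in> U") auto
    qed
    have w'pow: "(NNINT x|lborel. ennreal (\<bar>w' x\<bar> powr p)) \<le> ennreal Cp"
    proof -
      have "ennreal (\<bar>w' x\<bar> powr p) = ennreal (norm (w' x) powr p) * indicator U x" for x
        using w'0[of x] by (cases "x \<in> U") auto
      then have "(NNINT x|lborel. ennreal (\<bar>w' x\<bar> powr p)) = ennreal (LINT x|lebesgue_on U. \<bar>w x\<bar> powr p)"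
        using w'p by simp
      also have "\<dots> \<le> ennreal (Cp * grad_energy p U w)" using Cp(2)[OF w] by (rule ennreal_leI)
      also have "\<dots> \<le> ennreal Cp" using Cp(1) E1 by (intro ennreal_leI mult_left_le) auto
      finally show ?thesis .
    qed
    let ?N1 = "\<lambda>z. ennreal (\<bar>u' (fst z) - u' (snd z)\<bar> powr p) * indicator K (fst z) * indicator (ball 0 \<delta>) (fst z - snd z)"
    let ?N2 = "\<lambda>z. ennreal (\<bar>w' (fst z) - w' (snd z)\<bar> powr p)"
    let ?N3 = "\<lambda>z. ennreal (\<bar>g' (fst z) - g' (snd z)\<bar> powr (p - 1) * \<bar>w' (fst z)\<bar>) * indicator (- ball 0 \<delta>) (fst z - snd z)"
    let ?N4 = "\<lambda>z. ?N3 (snd z, fst z)"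
    have [measurable]: "ball (0 :: 'a) \<delta> \<in> sets borel" "- ball (0 :: 'a) \<delta> \<in> sets borel" by simp_all
    have N: "?N1 \<in> borel_measurable (borel \<Otimes>\<^sub>M borel)" "?N2 \<in> borel_measurable (borel \<Otimes>\<^sub>M borel)"
      "?N3 \<in> borel_measurable (borel \<Otimes>\<^sub>M borel)" "?N4 \<in> borel_measurable (borel \<Otimes>\<^sub>M borel)" by measurable
    \<comment> \<open>near the diagonal Young's inequality separates \<open>g\<close> from \<open>w\<close>; far from it \<open>w(x)\<close> and \<open>w(y)\<close> are treated separately\<close>
    have pt: "ennreal (\<bar>g' x - g' y\<bar> powr (p - 1) * \<bar>w' x - w' y\<bar>) \<le> ?N1 (x, y) + ?N2 (x, y) + ?N3 (x, y) + ?N4 (x, y)" for x y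
    proof (cases "norm (x - y) < \<delta>")
      case True
      show ?thesis
      proof (cases "x \<in> U \<or> y \<in> U")
        case False
        then show ?thesis by (simp add: w'0)
      next
        case inU: True
        have xK: "x \<in> K"
        proof (cases "x \<in> U")
          case False
          then have "y \<in> U" using inU by simp
          then show ?thesis using True by (auto simp: K_def dist_norm norm_minus_commute)
        qed (use KU in auto)
        have yU': "y \<in> U'" using Kseg[OF xK, of 1 "y - x"] True by (simp add: norm_minus_commute)
        have xU': "x \<in> U'" using KU' xK by auto
        have "\<bar>g' x - g' y\<bar> powr (p - 1) * \<bar>w' x - w' y\<bar> \<le> \<bar>g' x - g' y\<bar> powr p + \<bar>w' x - w' y\<bar> powr p"
          by (rule powr_times_le_add_powr[OF p]) auto
        then have "ennreal (\<bar>g' x - g' y\<bar> powr (p - 1) * \<bar>w' x - w' y\<bar>) \<le> ennreal (\<bar>u' x - u' y\<bar> powr p) + ennreal (\<bar>w' x - w' y\<bar> powr p)"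
          by (simp add: g'U[OF xU'] g'U[OF yU'] ennreal_leI flip: ennreal_plus)
        also have "\<dots> = ?N1 (x, y) + ?N2 (x, y)" using True xK by simp
        also have "\<dots> \<le> ?N1 (x, y) + ?N2 (x, y) + ?N3 (x, y) + ?N4 (x, y)" by (simp add: add.assoc)
        finally show ?thesis .
      qed
    next
      case False
      have "\<bar>g' x - g' y\<bar> powr (p - 1) * \<bar>w' x - w' y\<bar> \<le> \<bar>g' x - g' y\<bar> powr (p - 1) * (\<bar>w' x\<bar> + \<bar>w' y\<bar>)"
        by (intro mult_left_mono abs_triangle_ineq4) auto
      then have "ennreal (\<bar>g' x - g' y\<bar> powr (p - 1) * \<bar>w' x - w' y\<bar>) \<le> ennreal (\<bar>g' x - g' y\<bar> powr (p - 1) * \<bar>w' x\<bar>) + ennreal (\<bar>g' x - g' y\<bar> powr (p - 1) * \<bar>w' y\<bar>)"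
        by (simp add: distrib_left ennreal_leI flip: ennreal_plus)
      also have "\<dots> = ?N3 (x, y) + ?N4 (x, y)" using False by (simp add: dist_norm norm_minus_commute abs_minus_commute)
      also have "\<dots> \<le> (?N1 (x, y) + ?N2 (x, y)) + (?N3 (x, y) + ?N4 (x, y))" by (rule add_increasing[OF zero_le order_refl])
      finally show ?thesis by (simp only: add.assoc)
    qed
    have "(NNINT z|frac_measure s p. ennreal (\<bar>g (fst z) - g (snd z)\<bar> powr (p - 1) * \<bar>w (fst z) - w (snd z)\<bar>))
      \<le> (NNINT z|frac_measure s p. ?N1 z + ?N2 z + ?N3 z + ?N4 z)"
    proof (rule nn_integral_mono_AE)
      show "AE z in frac_measure s p. ennreal (\<bar>g (fst z) - g (snd z)\<bar> powr (p - 1) * \<bar>w (fst z) - w (snd z)\<bar>) \<le> ?N1 z + ?N2 z + ?N3 z + ?N4 z"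
        using AE_frac_measure[OF g'eq, of s p] AE_frac_measure[OF w'eq', of s p]
      proof eventually_elim
        case (elim z)
        then show ?case using pt[of "fst z" "snd z"] by (simp only: prod.collapse)
      qed
    qed
    also have "\<dots> = (NNINT z|frac_measure s p. ?N1 z) + (NNINT z|frac_measure s p. ?N2 z) + (NNINT z|frac_measure s p. ?N3 z) + (NNINT z|frac_measure s p. ?N4 z)"
      using measurable_frac_borel[OF N(1), of s p] measurable_frac_borel[OF N(2), of s p]
        measurable_frac_borel[OF N(3), of s p] measurable_frac_borel[OF N(4), of s p]
      by (simp only: nn_integral_add borel_measurable_add)
    also have "\<dots> \<le> c1 + ennreal Cf + c3 + c3"
    proof (intro add_mono)
      have tr: "(NNINT x|lborel. ennreal (\<bar>u' (x + h) - u' x\<bar> powr p) * indicator K x) \<le> ennreal (norm h powr p) * ennreal G"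
        if "norm h < \<delta>" for h by (rule u't[OF Ko]) (rule Kseg[OF _ _ _ that])
      show "(NNINT z|frac_measure s p. ?N1 z) \<le> c1"
        unfolding c1_def by (rule near_diagonal_bound[OF u'm _ tr]) simp_all
      have "(NNINT z|frac_measure s p. ?N2 z) = (NNINT z|frac_measure s p. ennreal (\<bar>w (fst z) - w (snd z)\<bar> powr p))"
        by (rule nn_integral_cong_AE, rule eventually_mono[OF AE_frac_measure[OF w'eq']]) simp
      also have "\<dots> \<le> ennreal (Cf * grad_energy p U w)" by (rule Cf(2)[OF w])
      also have "\<dots> \<le> ennreal Cf" using Cf(1) E1 by (intro ennreal_leI mult_left_le) auto
      finally show "(NNINT z|frac_measure s p. ?N2 z) \<le> ennreal Cf" .
      show N3: "(NNINT z|frac_measure s p. ?N3 z) \<le> c3"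
      proof -
        have gU: "(NNINT x|lborel. ennreal (\<bar>g' x\<bar> powr p) * indicator U x) \<le> ennreal gp"
          unfolding u'p[symmetric] using KU KU' by (intro nn_integral_mono) (auto simp: indicator_def g'U subset_iff)
        have [measurable]: "U \<in> sets borel" using U(1) by simp
        note far = datum_cross_term_far_bound[OF p s(1) d R(2) this g'm w'm w'0 cR_def T_def refl]
        show ?thesis unfolding c3_def
          by (rule order_trans[OF far], assumption) (intro mult_left_mono mult_right_mono add_mono gU w'pow order_refl zero_le)
      qed
      show "(NNINT z|frac_measure s p. ?N4 z) \<le> c3" unfolding nn_integral_frac_swap[OF N(3)] by (rule N3)
    qed
    finally show ?thesis by (simp add: c_def)
  qed
  moreover have "c = ennreal (enn2real c)" using cfin by (simp add: less_top)
  ultimately show ?thesis by (intro exI[of _ "enn2real c"]) simp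
qed

section \<open>Convex energies along linear families\<close>

lemma inner_pflux_le:
  fixes x y z :: "'e::euclidean_space"
  assumes p: "1 < p"
  shows "\<bar>pflux p (x + y) \<bullet> z\<bar> \<le> 2 powr (p - 1) * (norm x powr (p - 1) * norm z + (norm y powr p + norm z powr p))"
proof -
  have "\<bar>pflux p (x + y) \<bullet> z\<bar> \<le> norm (x + y) powr (p - 1) * norm z"
    using Cauchy_Schwarz_ineq2[of "pflux p (x + y)" z] norm_pflux[OF p, of "x + y"] by simp
  also have "\<dots> \<le> 2 powr (p - 1) * (norm x powr (p - 1) + norm y powr (p - 1)) * norm z"
    using p by (intro mult_right_mono norm_add_powr_le) auto
  also have "\<dots> = 2 powr (p - 1) * (norm x powr (p - 1) * norm z + norm y powr (p - 1) * norm z)"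
    by (simp add: algebra_simps)
  also have "\<dots> \<le> 2 powr (p - 1) * (norm x powr (p - 1) * norm z + (norm y powr p + norm z powr p))"
    by (intro mult_left_mono add_left_mono powr_times_le_add_powr p) auto
  finally show ?thesis .
qed

text \<open>
  The derivative of \<open>\<Phi>(x) = |x|\<^sup>p / p\<close> is the flux, so \<open>|\<Phi>(x + y) - \<Phi>(x)|\<close> is controlled by the fluxes at both ends.
\<close>

lemma penergy_increment_le:
  fixes x y :: "'e::euclidean_space"
  assumes p: "1 < p"
  shows "\<bar>penergy p (x + y) - penergy p x\<bar> \<le> (2 powr (p - 1) + 1) * (norm x powr (p - 1) * norm y + (norm y powr p + norm y powr p))"
proof -
  have a: "norm (x + y) powr (p - 1) * norm y \<le> 2 powr (p - 1) * (norm x powr (p - 1) * norm y + (norm y powr p + norm y powr p))"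
  proof -
    have "norm (x + y) powr (p - 1) * norm y \<le> 2 powr (p - 1) * (norm x powr (p - 1) + norm y powr (p - 1)) * norm y"
      using p by (intro mult_right_mono norm_add_powr_le) auto
    also have "\<dots> = 2 powr (p - 1) * (norm x powr (p - 1) * norm y + norm y powr (p - 1) * norm y)"
      by (simp add: algebra_simps)
    also have "\<dots> \<le> 2 powr (p - 1) * (norm x powr (p - 1) * norm y + (norm y powr p + norm y powr p))"
      by (intro mult_left_mono add_left_mono powr_times_le_add_powr p) auto
    finally show ?thesis .
  qed
  have "\<bar>penergy p (x + y) - penergy p x\<bar> \<le> norm (x + y) powr (p - 1) * norm y + norm x powr (p - 1) * norm y"
    using penergy_diff_le_flux_norms[OF p, of x y] by (simp add: distrib_right)
  also have "\<dots> \<le> 2 powr (p - 1) * (norm x powr (p - 1) * norm y + (norm y powr p + norm y powr p))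
      + 1 * (norm x powr (p - 1) * norm y + (norm y powr p + norm y powr p))"
    using a by (intro add_mono) auto
  finally show ?thesis by (simp only: distrib_right)
qed

lemma penergy_midpoint_le:
  fixes x y :: "'e::euclidean_space"
  assumes p: "1 < p"
  shows "0 \<le> (penergy p x + penergy p y) / 2 - penergy p ((1/2) *\<^sub>R (x + y))"
proof (cases "x = y")
  case True
  then have "(1/2) *\<^sub>R (x + y) = x" by (simp flip: scaleR_2)
  then show ?thesis using True by simp
qed (use penergy_midpoint_less[OF p] in fastforce)

lemma borel_measurable_pflux[measurable]: "pflux p \<in> borel_measurable borel"
  unfolding pflux_def by measurable

lemma borel_measurable_penergy[measurable]: "penergy p \<in> borel_measurable borel"
  unfolding penergy_def by measurable

text \<open>Common form of the two terms of the functional. For the local one, \<open>M\<close> is Lebesgue measure on \<open>\<Omega>\<close>, \<open>a\<close> the gradient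
  of the datum and \<open>B\<close> the gradient of the variation; for the nonlocal one, \<open>M\<close> is the fractional measure, and \<open>a\<close> and \<open>B\<close>
  are increments. Integrability is assumed of \<open>|a|\<^sup>p\<^sup>-\<^sup>1 |B u|\<close>, because the
  integral of \<open>|a|\<^sup>p\<close> may diverge in the nonlocal case. Linearity holds only almost everywhere, since weak gradients
  are chosen representatives.\<close>

locale convex_energy =
  fixes p :: real and M :: "'m measure" and a :: "'m \<Rightarrow> 'e::euclidean_space"
    and V :: "('x \<Rightarrow> real) set" and B :: "('x \<Rightarrow> real) \<Rightarrow> 'm \<Rightarrow> 'e"
  assumes p: "1 < p"
    and a_measurable[measurable]: "a \<in> borel_measurable M"
    and V: "\<And>u v \<sigma> \<tau>. u \<in> V \<Longrightarrow> v \<in> V \<Longrightarrow> (\<lambda>x. \<sigma> * u x + \<tau> * v x) \<in> V"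
    and B: "\<And>u. u \<in> V \<Longrightarrow> B u \<in> Lpm p M"
    and cross: "\<And>u. u \<in> V \<Longrightarrow> integrable M (\<lambda>z. norm (a z) powr (p - 1) * norm (B u z))"
    and lin: "\<And>u v \<sigma> \<tau>. u \<in> V \<Longrightarrow> v \<in> V \<Longrightarrow>
      AE z in M. B (\<lambda>x. \<sigma> * u x + \<tau> * v x) z = \<sigma> *\<^sub>R B u z + \<tau> *\<^sub>R B v z"
begin

text \<open>The integral of the difference, since the integrals of the two terms may diverge.\<close>

definition energy :: "('x \<Rightarrow> real) \<Rightarrow> real" where
  "energy u = (LINT z|M. penergy p (a z + B u z) - penergy p (a z))"

text \<open>The derivative of the energy at \<open>u\<close> in direction \<open>v\<close>.\<close>

definition pairing :: "('x \<Rightarrow> real) \<Rightarrow> ('x \<Rightarrow> real) \<Rightarrow> real" where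
  "pairing u v = (LINT z|M. pflux p (a z + B u z) \<bullet> B v z)"

lemma B_measurable[measurable]: "u \<in> V \<Longrightarrow> B u \<in> borel_measurable M"
  using LpmD(1)[OF B] .

lemma B_powr_integrable: "u \<in> V \<Longrightarrow> integrable M (\<lambda>z. norm (B u z) powr p)"
  using LpmD(2)[OF B] .

lemma V_scale: "u \<in> V \<Longrightarrow> (\<lambda>x. \<tau> * u x) \<in> V"
  using V[of u u \<tau> 0] by simp

lemma lin_scale: "u \<in> V \<Longrightarrow> AE z in M. B (\<lambda>x. \<tau> * u x) z = \<tau> *\<^sub>R B u z"
  using lin[of u u \<tau> 0] by simp

lemma V_diff: "u \<in> V \<Longrightarrow> v \<in> V \<Longrightarrow> (\<lambda>x. u x - v x) \<in> V"
  using V[of u v 1 "-1"] by simp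

lemma lin_diff: "u \<in> V \<Longrightarrow> v \<in> V \<Longrightarrow> AE z in M. B (\<lambda>x. u x - v x) z = B u z - B v z"
  using lin[of u v 1 "-1"] by simp

lemma flux_integrable:
  assumes "u \<in> V" "v \<in> V"
  shows "integrable M (\<lambda>z. pflux p (a z + B u z) \<bullet> B v z)"
proof (rule Bochner_Integration.integrable_bound)
  note [measurable] = B_measurable[OF assms(1)] B_measurable[OF assms(2)]
  show "integrable M (\<lambda>z. 2 powr (p - 1) * (norm (a z) powr (p - 1) * norm (B v z) + (norm (B u z) powr p + norm (B v z) powr p)))"
    using cross[OF assms(2)] B_powr_integrable[OF assms(1)] B_powr_integrable[OF assms(2)] by simp
  show "(\<lambda>z. pflux p (a z + B u z) \<bullet> B v z) \<in> borel_measurable M" by measurable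
  show "AE z in M. norm (pflux p (a z + B u z) \<bullet> B v z)
    \<le> norm (2 powr (p - 1) * (norm (a z) powr (p - 1) * norm (B v z) + (norm (B u z) powr p + norm (B v z) powr p)))"
    using inner_pflux_le[OF p] by (intro AE_I2) (simp add: order_trans[OF _ abs_ge_self])
qed

lemma pairing_bound:
  assumes "u \<in> V" "v \<in> V"
  shows "\<bar>pairing u v\<bar> \<le> 2 powr (p - 1) * ((LINT z|M. norm (a z) powr (p - 1) * norm (B v z))
    + ((LINT z|M. norm (B u z) powr p) + (LINT z|M. norm (B v z) powr p)))"
proof -
  have "\<bar>pairing u v\<bar> \<le> (LINT z|M. \<bar>pflux p (a z + B u z) \<bullet> B v z\<bar>)"
    unfolding pairing_def by (rule integral_abs_bound)
  also have "\<dots> \<le> (LINT z|M. 2 powr (p - 1) * (norm (a z) powr (p - 1) * norm (B v z) + (norm (B u z) powr p + norm (B v z) powr p)))"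
    using cross[OF assms(2)] B_powr_integrable[OF assms(1)] B_powr_integrable[OF assms(2)] flux_integrable[OF assms]
    by (intro integral_mono inner_pflux_le p) simp_all
  also have "\<dots> = 2 powr (p - 1) * ((LINT z|M. norm (a z) powr (p - 1) * norm (B v z))
    + ((LINT z|M. norm (B u z) powr p) + (LINT z|M. norm (B v z) powr p)))"
    using cross[OF assms(2)] B_powr_integrable[OF assms(1)] B_powr_integrable[OF assms(2)] by simp
  finally show ?thesis .
qed

lemma energy_integrable:
  assumes "u \<in> V"
  shows "integrable M (\<lambda>z. penergy p (a z + B u z) - penergy p (a z))"
proof (rule Bochner_Integration.integrable_bound)
  note [measurable] = B_measurable[OF assms]
  show "integrable M (\<lambda>z. (2 powr (p - 1) + 1) * (norm (a z) powr (p - 1) * norm (B u z) + (norm (B u z) powr p + norm (B u z) powr p)))"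
    using cross[OF assms] B_powr_integrable[OF assms] by simp
  show "(\<lambda>z. penergy p (a z + B u z) - penergy p (a z)) \<in> borel_measurable M" by measurable
  show "AE z in M. norm (penergy p (a z + B u z) - penergy p (a z))
    \<le> norm ((2 powr (p - 1) + 1) * (norm (a z) powr (p - 1) * norm (B u z) + (norm (B u z) powr p + norm (B u z) powr p)))"
    unfolding real_norm_def by (rule AE_I2) (rule order_trans[OF penergy_increment_le[OF p] abs_ge_self])
qed

lemma pairing_scale:
  assumes "u \<in> V" "v \<in> V"
  shows "pairing u (\<lambda>x. \<tau> * v x) = \<tau> * pairing u v"
proof -
  note [measurable] = B_measurable[OF assms(1)] B_measurable[OF assms(2)] B_measurable[OF V_scale[OF assms(2), of \<tau>]]
  have "pairing u (\<lambda>x. \<tau> * v x) = (LINT z|M. \<tau> * (pflux p (a z + B u z) \<bullet> B v z))"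
    unfolding pairing_def
  proof (rule integral_cong_AE)
    show "AE z in M. pflux p (a z + B u z) \<bullet> B (\<lambda>x. \<tau> * v x) z = \<tau> * (pflux p (a z + B u z) \<bullet> B v z)"
      using lin_scale[OF assms(2), of \<tau>] by eventually_elim simp
  qed measurable
  then show ?thesis by (simp add: pairing_def)
qed

lemma subgradient:
  assumes u: "u \<in> V" and v: "v \<in> V"
  shows "energy u + pairing u (\<lambda>x. v x - u x) \<le> energy v"
proof -
  have "energy u + pairing u (\<lambda>x. v x - u x)
    = (LINT z|M. (penergy p (a z + B u z) - penergy p (a z)) + pflux p (a z + B u z) \<bullet> B (\<lambda>x. v x - u x) z)"
    unfolding energy_def pairing_def
    by (rule Bochner_Integration.integral_add[symmetric]) (intro energy_integrable flux_integrable V_diff u v)+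
  also have "\<dots> \<le> energy v" unfolding energy_def
  proof (rule integral_mono_AE)
    show "AE z in M. (penergy p (a z + B u z) - penergy p (a z)) + pflux p (a z + B u z) \<bullet> B (\<lambda>x. v x - u x) z
      \<le> penergy p (a z + B v z) - penergy p (a z)"
      using lin_diff[OF v u]
    proof eventually_elim
      case (elim z)
      then show ?case using penergy_subgradient[OF p, of "a z + B u z" "a z + B v z"] by simp
    qed
  qed (intro Bochner_Integration.integrable_add energy_integrable flux_integrable V_diff u v)+
  finally show ?thesis .
qed

text \<open>Dominated convergence: the fluxes along the segment from \<open>u\<close> to \<open>u + v\<close> have a common integrable bound.\<close>

lemma hemicontinuous:
  assumes u: "u \<in> V" and v: "v \<in> V"
  shows "(\<lambda>n. pairing (\<lambda>x. u x + (1 / real (Suc n)) * v x) v) \<longlonglongrightarrow> pairing u v"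
proof -
  let ?D = "\<lambda>z. 2 powr (p - 1) * (norm (a z) powr (p - 1) * norm (B v z)
        + (2 powr p * (norm (B u z) powr p + norm (B v z) powr p) + norm (B v z) powr p))"
  let ?h = "\<lambda>n z. B u z + (1 / real (Suc n)) *\<^sub>R B v z"
  note [measurable] = B_measurable[OF u] B_measurable[OF v]
  have Vn: "(\<lambda>x. u x + (1 / real (Suc n)) * v x) \<in> V" for n using V[OF u v, of 1 "1 / real (Suc n)"] by simp
  have eq: "pairing (\<lambda>x. u x + (1 / real (Suc n)) * v x) v = (LINT z|M. pflux p (a z + ?h n z) \<bullet> B v z)" for n
    unfolding pairing_def
  proof (rule integral_cong_AE)
    note [measurable] = B_measurable[OF Vn[of n]]
    show "(\<lambda>z. pflux p (a z + B (\<lambda>x. u x + (1 / real (Suc n)) * v x) z) \<bullet> B v z) \<in> borel_measurable M" by measurable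
    show "(\<lambda>z. pflux p (a z + ?h n z) \<bullet> B v z) \<in> borel_measurable M" by measurable
    show "AE z in M. pflux p (a z + B (\<lambda>x. u x + (1 / real (Suc n)) * v x) z) \<bullet> B v z = pflux p (a z + ?h n z) \<bullet> B v z"
      using lin[OF u v, of 1 "1 / real (Suc n)"] by eventually_elim simp
  qed
  have "(\<lambda>n. LINT z|M. pflux p (a z + ?h n z) \<bullet> B v z) \<longlonglongrightarrow> pairing u v"
    unfolding pairing_def
  proof (rule integral_dominated_convergence)
    show "(\<lambda>z. pflux p (a z + B u z) \<bullet> B v z) \<in> borel_measurable M" by measurable
    show "(\<lambda>z. pflux p (a z + ?h n z) \<bullet> B v z) \<in> borel_measurable M" for n by measurable
    show "integrable M (\<lambda>z. ?D z)"
      using cross[OF v] B_powr_integrable[OF u] B_powr_integrable[OF v] by simp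
    show "AE z in M. (\<lambda>n. pflux p (a z + ?h n z) \<bullet> B v z) \<longlonglongrightarrow> pflux p (a z + B u z) \<bullet> B v z"
    proof (rule AE_I2)
      fix z
      have "(\<lambda>n. a z + (B u z + (1 / real (Suc n)) *\<^sub>R B v z)) \<longlonglongrightarrow> a z + (B u z + 0 *\<^sub>R B v z)"
        using LIMSEQ_inverse_real_of_nat by (intro tendsto_intros) (simp add: inverse_eq_divide)
      then show "(\<lambda>n. pflux p (a z + ?h n z) \<bullet> B v z) \<longlonglongrightarrow> pflux p (a z + B u z) \<bullet> B v z"
        by (intro tendsto_inner pflux_tendsto[OF p] tendsto_const) simp
    qed
    show "AE z in M. norm (pflux p (a z + ?h n z) \<bullet> B v z) \<le> ?D z" for n
    proof (rule AE_I2)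
      fix z
      have "norm ((1 / real (Suc n)) *\<^sub>R B v z) powr p \<le> norm (B v z) powr p"
        using p by (intro powr_mono2) (auto simp: divide_le_eq mult_le_cancel_left1)
      then have "norm (?h n z) powr p \<le> 2 powr p * (norm (B u z) powr p + norm (B v z) powr p)"
        using norm_add_powr_le[of p "B u z" "(1 / real (Suc n)) *\<^sub>R B v z"] p
        by (intro order_trans[OF norm_add_powr_le] mult_left_mono add_left_mono) auto
      then have "2 powr (p - 1) * (norm (a z) powr (p - 1) * norm (B v z) + (norm (?h n z) powr p + norm (B v z) powr p))
        \<le> ?D z"
        by (intro mult_left_mono add_left_mono add_right_mono) auto
      then show "norm (pflux p (a z + ?h n z) \<bullet> B v z) \<le> ?D z"
        using inner_pflux_le[OF p, of "a z" "?h n z" "B v z"] unfolding real_norm_def by (rule order_trans[rotated])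
    qed
  qed
  then show ?thesis by (simp only: eq)
qed

lemma midpoint_gap:
  assumes u: "u \<in> V" and v: "v \<in> V"
  defines "G \<equiv> \<lambda>z. (penergy p (a z + B u z) + penergy p (a z + B v z)) / 2 - penergy p ((1/2) *\<^sub>R ((a z + B u z) + (a z + B v z)))"
  shows "integrable M G" "(energy u + energy v) / 2 - energy (\<lambda>x. (1/2) * (u x + v x)) = integral\<^sup>L M G"
    "0 \<le> (energy u + energy v) / 2 - energy (\<lambda>x. (1/2) * (u x + v x))"
proof -
  let ?m = "\<lambda>x. (1/2) * (u x + v x)"
  let ?D = "\<lambda>w z. penergy p (a z + B w z) - penergy p (a z)"
  have half: "(\<lambda>x. (1/2) * u x + (1/2) * v x) = ?m" by (simp add: fun_eq_iff add_divide_distrib)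
  have m: "?m \<in> V" using V[OF u v, of "1/2" "1/2"] by (simp only: half)
  note [measurable] = B_measurable[OF u] B_measurable[OF v] B_measurable[OF m]
  have i: "integrable M (\<lambda>z. (?D u z + ?D v z) / 2 - ?D ?m z)"
    by (intro Bochner_Integration.integrable_diff integrable_divide Bochner_Integration.integrable_add energy_integrable u v m)
  have Gm: "G \<in> borel_measurable M" unfolding G_def by measurable
  have eq: "AE z in M. (?D u z + ?D v z) / 2 - ?D ?m z = G z"
  proof -
    have "AE z in M. B ?m z = (1/2) *\<^sub>R B u z + (1/2) *\<^sub>R B v z"
      using lin[OF u v, of "1/2" "1/2"] by (simp only: half)
    then show ?thesis
    proof eventually_elim
      case (elim z)
      have "(1/2) *\<^sub>R ((a z + B u z) + (a z + B v z)) = (1/2) *\<^sub>R (a z + a z) + ((1/2) *\<^sub>R B u z + (1/2) *\<^sub>R B v z)"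
        by (simp add: scaleR_add_right)
      also have "\<dots> = a z + B ?m z" unfolding elim by (simp flip: scaleR_2)
      finally show ?case unfolding G_def by (simp add: field_simps)
    qed
  qed
  show G: "integrable M G" by (rule integrable_cong_AE_imp[OF i Gm]) (use eq in \<open>eventually_elim, simp\<close>)
  have "(energy u + energy v) / 2 - energy ?m = (LINT z|M. (?D u z + ?D v z) / 2 - ?D ?m z)"
    using energy_integrable[OF u] energy_integrable[OF v] energy_integrable[OF m]
    unfolding energy_def by (simp only: Bochner_Integration.integral_diff Bochner_Integration.integral_add integral_divide_zero
      integrable_divide Bochner_Integration.integrable_add)
  also have "\<dots> = integral\<^sup>L M G"
    by (rule integral_cong_AE[OF borel_measurable_integrable[OF i] Gm eq])
  finally show E: "(energy u + energy v) / 2 - energy ?m = integral\<^sup>L M G" .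
  show "0 \<le> (energy u + energy v) / 2 - energy ?m"
    unfolding E unfolding G_def by (rule Bochner_Integration.integral_nonneg) (rule penergy_midpoint_le[OF p])
qed

text \<open>Integrates the pointwise inequality between \<open>a + B u\<close> and \<open>a + B v\<close>; the powers of \<open>a + B u\<close> are split by
  \<open>|x + y|\<^sup>p \<le> 2\<^sup>p (|x|\<^sup>p + |y|\<^sup>p)\<close>, which explains the integral of \<open>|a|\<^sup>p\<close> on the right.\<close>

lemma uniformly_convex:
  assumes ap: "a \<in> Lpm p M" and e: "0 < \<epsilon>"
  shows "\<exists>C\<ge>0. \<forall>u\<in>V. \<forall>v\<in>V. (LINT z|M. norm (B (\<lambda>x. u x - v x) z) powr p)
    \<le> \<epsilon> * ((LINT z|M. norm (B u z) powr p) + (LINT z|M. norm (B v z) powr p) + 2 * (LINT z|M. norm (a z) powr p))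
      + C * ((energy u + energy v) / 2 - energy (\<lambda>x. (1/2) * (u x + v x)))"
proof -
  have e': "0 < \<epsilon> / 2 powr p" using e by simp
  obtain C where C: "0 \<le> C" "\<And>x y :: 'e. norm (x - y) powr p \<le> \<epsilon> / 2 powr p * (norm x powr p + norm y powr p)
      + C * ((penergy p x + penergy p y) / 2 - penergy p ((1/2) *\<^sub>R (x + y)))"
    using penergy_uniformly_convex[OF p e', where 'b = 'e] by blast
  have "(LINT z|M. norm (B (\<lambda>x. u x - v x) z) powr p)
    \<le> \<epsilon> * ((LINT z|M. norm (B u z) powr p) + (LINT z|M. norm (B v z) powr p) + 2 * (LINT z|M. norm (a z) powr p))
      + C * ((energy u + energy v) / 2 - energy (\<lambda>x. (1/2) * (u x + v x)))" if u: "u \<in> V" and v: "v \<in> V" for u v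
  proof -
    define G where "G = (\<lambda>z. (penergy p (a z + B u z) + penergy p (a z + B v z)) / 2 - penergy p ((1/2) *\<^sub>R ((a z + B u z) + (a z + B v z))))"
    note G = midpoint_gap[OF u v, folded G_def]
    have p0: "0 \<le> p" using p by simp
    have L: "(\<lambda>z. a z + B w z) \<in> Lpm p M" if "w \<in> V" for w by (rule Lpm_add[OF p0 ap B[OF that]])
    note Lu = LpmD(2)[OF L[OF u]] and Lv = LpmD(2)[OF L[OF v]]
    have I: "(LINT z|M. norm (a z + B w z) powr p) \<le> 2 powr p * ((LINT z|M. norm (a z) powr p) + (LINT z|M. norm (B w z) powr p))"
      if "w \<in> V" for w by (rule Lpm_integral_add_le[OF p0 ap B[OF that]])
    have "(LINT z|M. norm (B (\<lambda>x. u x - v x) z) powr p)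
      \<le> (LINT z|M. \<epsilon> / 2 powr p * (norm (a z + B u z) powr p + norm (a z + B v z) powr p) + C * G z)"
    proof (rule integral_mono_AE)
      show "AE z in M. norm (B (\<lambda>x. u x - v x) z) powr p
        \<le> \<epsilon> / 2 powr p * (norm (a z + B u z) powr p + norm (a z + B v z) powr p) + C * G z"
        using lin_diff[OF u v]
      proof eventually_elim
        case (elim z)
        then show ?case using C(2)[of "a z + B u z" "a z + B v z"] unfolding G_def by simp
      qed
    qed (use B_powr_integrable[OF V_diff[OF u v]] Lu Lv G(1) in auto)
    also have "\<dots> = \<epsilon> / 2 powr p * ((LINT z|M. norm (a z + B u z) powr p) + (LINT z|M. norm (a z + B v z) powr p)) + C * integral\<^sup>L M G"
      using Lu Lv G(1) by simp
    also have "\<dots> \<le> \<epsilon> / 2 powr p * (2 powr p * ((LINT z|M. norm (a z) powr p) + (LINT z|M. norm (B u z) powr p))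
      + 2 powr p * ((LINT z|M. norm (a z) powr p) + (LINT z|M. norm (B v z) powr p))) + C * integral\<^sup>L M G"
      using e' by (intro add_right_mono mult_left_mono add_mono I u v) auto
    also have "\<dots> = \<epsilon> * ((LINT z|M. norm (B u z) powr p) + (LINT z|M. norm (B v z) powr p) + 2 * (LINT z|M. norm (a z) powr p)) + C * integral\<^sup>L M G"
      by (simp add: field_simps)
    finally show ?thesis unfolding G(2) .
  qed
  then show ?thesis using C(1) by blast
qed

end

section \<open>Restriction and change of representatives\<close>

lemma Lpm_lebesgue_on_mono:
  fixes f :: "'a::euclidean_space \<Rightarrow> 'b::euclidean_space"
  assumes f: "f \<in> Lpm r (lebesgue_on T)" and S: "S \<subseteq> T" "S \<in> sets lebesgue" "T \<in> sets lebesgue"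
  shows "f \<in> Lpm r (lebesgue_on S)"
proof (rule LpmI)
  show "f \<in> borel_measurable (lebesgue_on S)"
    using LpmD(1)[OF f] S(1) by (rule measurable_restrict_mono)
  have "integrable lebesgue (\<lambda>x. indicator S x *\<^sub>R (indicator T x *\<^sub>R norm (f x) powr r))"
    using LpmD(2)[OF f] unfolding integrable_lebesgue_on_iff[OF S(3)] by (rule integrable_mult_indicator[OF S(2)])
  moreover have "(\<lambda>x. indicator S x *\<^sub>R (indicator T x *\<^sub>R norm (f x) powr r)) = (\<lambda>x. indicator S x *\<^sub>R norm (f x) powr r)"
    using S(1) by (auto simp: indicator_def fun_eq_iff)
  ultimately show "integrable (lebesgue_on S) (\<lambda>x. norm (f x) powr r)"
    unfolding integrable_lebesgue_on_iff[OF S(2)] by (simp only:)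
qed

lemma is_weak_gradient_mono:
  assumes U: "open U" "open U'" "U \<subseteq> U'" and u: "is_weak_gradient U' u G"
  shows "is_weak_gradient U u G"
proof -
  note u = u[unfolded is_weak_gradient_iff[OF U(2)]]
  have "u \<in> Lp_loc 1 U" "G \<in> Lp_loc 1 U" using u U(3) unfolding Lp_loc_def by blast+
  moreover have "test_functions U \<subseteq> test_functions U'" using U(3) unfolding test_functions_def by blast
  ultimately show ?thesis using u unfolding is_weak_gradient_iff[OF U(1)] by blast
qed

lemma W1p_mono:
  assumes p: "1 < p" and U: "open U" "open U'" "U \<subseteq> U'" and u: "u \<in> W1p p U'"
  shows "u \<in> W1p p U"
proof -
  note u = u[unfolded W1p_iff[OF p U(2)]]
  show ?thesis
    by (rule W1pI[OF p, of _ _ "weak_grad U' u"])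
      (rule Lpm_lebesgue_on_mono[OF _ U(3)] is_weak_gradient_mono[OF U]; use u U sets_lebesgue_open in blast)+
qed

lemma W1p_add:
  assumes p: "1 < p" and U: "open U" and u: "u \<in> W1p p U" and v: "v \<in> W1p p U"
  shows "(\<lambda>x. u x + v x) \<in> W1p p U"
proof -
  note u = u[unfolded W1p_iff[OF p U]] and v = v[unfolded W1p_iff[OF p U]]
  have p0: "0 \<le> p" using p by simp
  show ?thesis
    by (rule W1pI[OF p Lpm_add[OF p0] weak_gradient_add[OF U, of u "weak_grad U u" v "weak_grad U v"] Lpm_add[OF p0]])
      (use u v in blast)+
qed

lemma weak_grad_cong:
  assumes U: "open U" and eq: "\<And>x. x \<in> U \<Longrightarrow> u x = v x"
  shows "weak_grad U u = weak_grad U v"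
proof -
  have "is_weak_gradient U u = is_weak_gradient U v"
  proof (intro ext iffI)
    fix G
    show "is_weak_gradient U v G" if "is_weak_gradient U u G" by (rule weak_gradient_cong[OF U that]) (simp_all add: eq)
    show "is_weak_gradient U u G" if "is_weak_gradient U v G" by (rule weak_gradient_cong[OF U that]) (simp_all add: eq)
  qed
  then show ?thesis unfolding weak_grad_def by simp
qed

text \<open>Membership depends on the values in \<open>U\<close> only: two functions that agree there have the same weak gradients,
  hence the same chosen one.\<close>

lemma W1p_0_cong:
  assumes p: "1 < p" and U: "open U" and u: "u \<in> W1p_0 p U" and eq: "\<And>x. x \<in> U \<Longrightarrow> u x = v x"
  shows "v \<in> W1p_0 p U"
proof -
  obtain \<phi> where uW: "u \<in> W1p p U" and phi: "\<And>n. \<phi> n \<in> test_functions U"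
    "(\<lambda>n. W1p_norm p U (\<lambda>x. \<phi> n x - u x)) \<longlonglongrightarrow> 0" using u unfolding W1p_0_def by auto
  note uW = uW[unfolded W1p_iff[OF p U]]
  have vL: "v \<in> Lpm p (lebesgue_on U)" by (rule Lpm_AE_cong[OF U conjunct1[OF uW]]) (simp add: eq)
  have "is_weak_gradient U v (weak_grad U u)"
    by (rule weak_gradient_cong[OF U conjunct1[OF conjunct2[OF uW]]]) (simp_all add: eq)
  then have vW: "v \<in> W1p p U" using uW by (intro W1pI[OF p vL]) auto
  have "W1p_norm p U (\<lambda>x. \<phi> n x - u x) = W1p_norm p U (\<lambda>x. \<phi> n x - v x)" for n
  proof -
    have "weak_grad U (\<lambda>x. \<phi> n x - u x) = weak_grad U (\<lambda>x. \<phi> n x - v x)" by (rule weak_grad_cong[OF U]) (simp add: eq)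
    moreover have "(LINT x|lebesgue_on U. \<bar>\<phi> n x - u x\<bar> powr p) = (LINT x|lebesgue_on U. \<bar>\<phi> n x - v x\<bar> powr p)"
      by (rule Bochner_Integration.integral_cong) (auto simp: eq)
    ultimately show ?thesis by (simp add: W1p_norm_def)
  qed
  then show ?thesis using vW phi unfolding W1p_0_def by auto
qed

lemma test_function_in_W0z:
  assumes p: "1 < p" and U: "open U" and phi: "\<phi> \<in> test_functions U"
  shows "\<phi> \<in> W0z p U"
proof -
  obtain K where K: "C1_supported K \<phi>" "K \<subseteq> U" using test_function_C1_supported[OF phi] .
  note L = test_function_Lpm[OF p U phi]
  note wk = L(3)
  have W: "\<phi> \<in> W1p p U" by (rule W1pI[OF p L(1) wk L(2)])
  note [measurable] = LpmD(1)[OF L(2)] LpmD(1)[OF conjunct2[OF conjunct2[OF W[unfolded W1p_iff[OF p U]]]]]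
  have "(LINT x|lebesgue_on U. norm (grad \<phi> x - weak_grad U \<phi> x) powr p) = (LINT x|lebesgue_on U. 0)"
  proof (rule integral_lebesgue_on_AE_cong[OF U])
    show "AE x in lebesgue. x \<in> U \<longrightarrow> norm (grad \<phi> x - weak_grad U \<phi> x) powr p = 0"
      using weak_grad_eq(2)[OF U wk] by eventually_elim simp
  qed measurable
  then have "sobolev_dist p U \<phi> (grad \<phi>) \<phi> (weak_grad U \<phi>) = 0" by (simp add: sobolev_dist_def)
  then have "\<phi> \<in> W1p_0 p U" using phi by (intro W1p_0I[OF p U W] bexI[of _ \<phi>]) auto
  moreover have "\<phi> x = 0" if "x \<notin> U" for x using that K(2) C1_supportedD(4)[OF K(1)] by blast
  ultimately show ?thesis by (simp add: W0z_def)
qed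

lemma W0z_weak_grad_linear:
  assumes p: "1 < p" and U: "open U" and u: "u \<in> W0z p U" and v: "v \<in> W0z p U"
  shows "AE x in lebesgue_on U. weak_grad U (\<lambda>x. a * u x + b * v x) x = a *\<^sub>R weak_grad U u x + b *\<^sub>R weak_grad U v x"
  unfolding AE_lebesgue_on[OF U] using W0z_linear(2)[OF p U u v, of a b]
  by eventually_elim (auto simp: zgrad_def)

lemma grad_energy_scale:
  assumes p: "1 < p" and U: "open U" and w: "w \<in> W0z p U"
  shows "grad_energy p U (\<lambda>x. t * w x) = \<bar>t\<bar> powr p * grad_energy p U w"
proof -
  have tw: "(\<lambda>x. t * w x) \<in> W0z p U" using W0z_linear(1)[OF p U w w, of t 0] by simp
  note [measurable] = LpmD(1)[OF W0zD(5)[OF p U w]] LpmD(1)[OF W0zD(5)[OF p U tw]]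
  have "grad_energy p U (\<lambda>x. t * w x) = (LINT x|lebesgue_on U. \<bar>t\<bar> powr p * norm (weak_grad U w x) powr p)"
    unfolding grad_energy_def
  proof (rule integral_cong_AE)
    show "AE x in lebesgue_on U. norm (weak_grad U (\<lambda>x. t * w x) x) powr p = \<bar>t\<bar> powr p * norm (weak_grad U w x) powr p"
      using W0z_weak_grad_linear[OF p U w w, of t 0] by eventually_elim (simp add: powr_mult)
  qed measurable
  then show ?thesis by (simp add: grad_energy_def)
qed

text \<open>Scale \<open>w\<close> by \<open>1 / (1 + E w)\<close>, which brings it into the unit ball of the energy \<open>E\<close>.\<close>

lemma W0z_integrable_of_unit_bound:
  fixes L :: "('a::euclidean_space \<Rightarrow> real) \<Rightarrow> 'm \<Rightarrow> real"
  assumes p: "1 < p" and U: "open U" and w: "w \<in> W0z p U"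
    and hom: "\<And>t z. L (\<lambda>x. t * w x) z = t * L w z"
    and C: "\<And>w. w \<in> W0z p U \<Longrightarrow> grad_energy p U w \<le> 1 \<Longrightarrow> (NNINT z|M. ennreal \<bar>k z * L w z\<bar>) \<le> ennreal C"
    and m: "(\<lambda>z. k z * L w z) \<in> borel_measurable M"
  shows "integrable M (\<lambda>z. k z * L w z)"
proof -
  define t where "t = 1 / (1 + grad_energy p U w)"
  have E: "0 \<le> grad_energy p U w" by (rule grad_energy_nonneg)
  have t: "0 < t" "t \<le> 1" using E by (simp_all add: t_def)
  have tw: "(\<lambda>x. t * w x) \<in> W0z p U" using W0z_linear(1)[OF p U w w, of t 0] by simp
  have "grad_energy p U (\<lambda>x. t * w x) \<le> t * grad_energy p U w"
  proof -
    have "t powr p \<le> t powr 1" using t p by (intro powr_mono') auto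
    then show ?thesis using t E by (simp add: grad_energy_scale[OF p U w] mult_right_mono)
  qed
  also have "\<dots> \<le> 1" using E by (simp add: t_def)
  finally have "(NNINT z|M. ennreal \<bar>k z * L (\<lambda>x. t * w x) z\<bar>) \<le> ennreal C" by (rule C[OF tw])
  moreover have "(NNINT z|M. ennreal \<bar>k z * L (\<lambda>x. t * w x) z\<bar>) = ennreal t * (NNINT z|M. ennreal \<bar>k z * L w z\<bar>)"
  proof -
    have "ennreal \<bar>k z * L (\<lambda>x. t * w x) z\<bar> = ennreal t * ennreal \<bar>k z * L w z\<bar>" for z
      using t by (simp add: hom abs_mult mult_ac flip: ennreal_mult)
    then show ?thesis using m by (simp add: nn_integral_cmult)
  qed
  ultimately have "ennreal t * (NNINT z|M. ennreal \<bar>k z * L w z\<bar>) \<le> ennreal C" by simp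
  then have "ennreal t * (NNINT z|M. ennreal \<bar>k z * L w z\<bar>) < top"
    by (rule order_le_less_trans) (rule ennreal_less_top)
  then have "(NNINT z|M. ennreal \<bar>k z * L w z\<bar>) < top" using t unfolding ennreal_mult_less_top by auto
  then have "(NNINT z|M. ennreal (norm (k z * L w z))) < \<infinity>" by (simp add: less_top)
  with m show ?thesis by (rule integrableI_bounded)
qed

lemma integral_abs_le_of_nn_bound:
  fixes h :: "'m \<Rightarrow> real"
  assumes "integrable M h" "(NNINT z|M. ennreal \<bar>h z\<bar>) \<le> ennreal C"
  shows "(LINT z|M. \<bar>h z\<bar>) \<le> max 0 C"
proof -
  have "ennreal (LINT z|M. \<bar>h z\<bar>) \<le> ennreal (max 0 C)"
  proof -
    have "ennreal (LINT z|M. \<bar>h z\<bar>) = (NNINT z|M. ennreal \<bar>h z\<bar>)"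
      using assms(1) by (intro nn_integral_eq_integral[symmetric]) simp_all
    also have "\<dots> \<le> ennreal (max 0 C)" by (rule order_trans[OF assms(2)]) (simp add: ennreal_leI)
    finally show ?thesis .
  qed
  then show ?thesis by (subst (asm) ennreal_le_iff) auto
qed

text \<open>A function in \<open>L\<^sup>p\<close> that vanishes outside a bounded set is in \<open>L\<^sup>p\<^sup>-\<^sup>1\<close>.\<close>

lemma tail_space_add:
  fixes g w :: "'a::euclidean_space \<Rightarrow> real"
  assumes p: "1 < p" and U: "open U" "bounded U" and g: "g \<in> tail_space (p - 1) \<alpha>" and w: "w \<in> W0z p U"
  shows "(\<lambda>x. g x + w x) \<in> tail_space (p - 1) \<alpha>"
proof -
  let ?W = "\<lambda>x :: 'a. 1 + norm x powr (real DIM('a) + \<alpha>)"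
  note gm[measurable] = tail_space_measurable[OF g]
  note D = W0zD[OF p U(1) w]
  have wL: "w \<in> Lpm p lebesgue" by (rule W0z_whole_space(1)[OF p U(1) w])
  note wm[measurable] = LpmD(1)[OF wL]
  have Um[measurable]: "U \<in> sets lebesgue" using U(1) by (rule sets_lebesgue_open)
  have Ufin: "emeasure lebesgue U < top"
    using emeasure_bounded_finite[OF U(2)] U(1) by (simp add: less_top)
  have w1: "w \<in> Lpm (p - 1) (lebesgue_on UNIV)"
    unfolding lebesgue_on_UNIV_eq
  proof (rule LpmI[OF wm], rule Bochner_Integration.integrable_bound)
    show "integrable lebesgue (\<lambda>x. indicator U x + norm (w x) powr p)" using LpmD(2)[OF wL] Ufin by auto
    show "AE x in lebesgue. norm (norm (w x) powr (p - 1)) \<le> norm (indicat_real U x + norm (w x) powr p)"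
    proof (rule AE_I2)
      fix x
      show "norm (norm (w x) powr (p - 1)) \<le> norm (indicat_real U x + norm (w x) powr p)"
        using powr_times_le_add_powr[OF p, of "\<bar>w x\<bar>" 1] D(6)[of x] by (cases "x \<in> U") (simp_all add: add.commute)
    qed
  qed measurable
  have loc: "(\<lambda>x. g x + w x) \<in> Lp_on (ennreal (p - 1)) K" if K: "compact K" for K
  proof -
    have p1: "0 < p - 1" using p by simp
    have Km: "K \<in> sets lebesgue" using K by (intro sets_completionI_sets) (simp add: compact_imp_closed borel_closed)
    have "g \<in> Lpm (p - 1) (lebesgue_on K)" using g K unfolding tail_space_def Lp_loc_def by (simp add: Lp_on_eq_Lpm[OF p1])
    moreover have "w \<in> Lpm (p - 1) (lebesgue_on K)" by (rule Lpm_lebesgue_on_mono[OF w1 subset_UNIV Km]) simp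
    ultimately show ?thesis unfolding Lp_on_eq_Lpm[OF p1] using p1 by (intro Lpm_add) auto
  qed
  have "integrable lebesgue (\<lambda>x. \<bar>g x + w x\<bar> powr (p - 1) / ?W x)"
  proof (rule Bochner_Integration.integrable_bound)
    show "integrable lebesgue (\<lambda>x. 2 powr (p - 1) * (\<bar>g x\<bar> powr (p - 1) / ?W x + \<bar>w x\<bar> powr (p - 1)))"
      using g LpmD(2)[OF w1] unfolding lebesgue_on_UNIV_eq tail_space_def by simp
    have [measurable]: "(\<lambda>x :: 'a. ?W x) \<in> borel_measurable lebesgue"
      by (rule measurable_completion) measurable
    show "(\<lambda>x. \<bar>g x + w x\<bar> powr (p - 1) / ?W x) \<in> borel_measurable lebesgue"
      by measurable
    show "AE x in lebesgue. norm (\<bar>g x + w x\<bar> powr (p - 1) / ?W x)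
      \<le> norm (2 powr (p - 1) * (\<bar>g x\<bar> powr (p - 1) / ?W x + \<bar>w x\<bar> powr (p - 1)))"
    proof (rule AE_I2)
      fix x :: 'a
      define W where "W = ?W x"
      have W: "1 \<le> W" by (simp add: W_def)
      have "\<bar>g x + w x\<bar> powr (p - 1) / W \<le> 2 powr (p - 1) * (\<bar>g x\<bar> powr (p - 1) + \<bar>w x\<bar> powr (p - 1)) / W"
        using norm_add_powr_le[of "p - 1" "g x" "w x"] p W by (intro divide_right_mono) auto
      also have "\<dots> = 2 powr (p - 1) * (\<bar>g x\<bar> powr (p - 1) / W + \<bar>w x\<bar> powr (p - 1) / W)"
        by (simp only: distrib_left add_divide_distrib times_divide_eq_right)
      also have "\<dots> \<le> 2 powr (p - 1) * (\<bar>g x\<bar> powr (p - 1) / W + \<bar>w x\<bar> powr (p - 1))"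
        using W by (intro mult_left_mono add_left_mono) (auto simp: divide_le_eq mult_le_cancel_left1)
      finally have "\<bar>g x + w x\<bar> powr (p - 1) / W \<le> 2 powr (p - 1) * (\<bar>g x\<bar> powr (p - 1) / W + \<bar>w x\<bar> powr (p - 1))" .
      moreover have "0 \<le> \<bar>g x + w x\<bar> powr (p - 1) / W" using W by simp
      ultimately have "\<bar>\<bar>g x + w x\<bar> powr (p - 1) / W\<bar> \<le> \<bar>2 powr (p - 1) * (\<bar>g x\<bar> powr (p - 1) / W + \<bar>w x\<bar> powr (p - 1))\<bar>"
        by linarith
      then show "norm (\<bar>g x + w x\<bar> powr (p - 1) / ?W x)
        \<le> norm (2 powr (p - 1) * (\<bar>g x\<bar> powr (p - 1) / ?W x + \<bar>w x\<bar> powr (p - 1)))"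
        unfolding W_def[symmetric] real_norm_def .
    qed
  qed
  moreover have "(\<lambda>x. g x + w x) \<in> Lp_loc (ennreal (p - 1)) UNIV"
    unfolding Lp_loc_def by (intro CollectI allI impI loc) (erule conjunct1)
  ultimately show ?thesis unfolding tail_space_def by blast
qed

section \<open>The mixed problem\<close>

definition increment :: "('a \<Rightarrow> real) \<Rightarrow> 'a \<times> 'a \<Rightarrow> real" where
  "increment u z = u (fst z) - u (snd z)"

lemma increment_measurable:
  assumes u: "u \<in> borel_measurable lebesgue"
  shows "increment u \<in> borel_measurable (frac_measure s p)"
proof -
  note [measurable] = measurable_frac_fst_snd[OF u, of s p]
  show ?thesis unfolding increment_def by measurable
qed

text \<open>The hypotheses on the datum and on the right-hand side in the form in which the variational argument uses them:
  both act as bounded functionals on the unit ball of the gradient energy.\<close>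

locale mixed_problem =
  fixes p s A :: real and U :: "'a::euclidean_space set" and f g :: "'a \<Rightarrow> real"
  assumes p: "1 < p" and s: "0 < s" "s < 1" and A: "0 < A" and U: "open U" "bounded U"
    and gW: "g \<in> W1p p U" and gT: "g \<in> tail_space (p - 1) (s * p)"
    and cross_bnd: "\<exists>C. \<forall>w\<in>W0z p U. grad_energy p U w \<le> 1 \<longrightarrow>
      (NNINT z|frac_measure s p. ennreal (\<bar>increment g z\<bar> powr (p - 1) * \<bar>increment w z\<bar>)) \<le> ennreal C"
    and fm[measurable]: "f \<in> borel_measurable (lebesgue_on U)"
    and dual_bnd: "\<exists>C. \<forall>w\<in>W0z p U. grad_energy p U w \<le> 1 \<longrightarrow>
      (NNINT x|lebesgue_on U. ennreal \<bar>f x * w x\<bar>) \<le> ennreal C"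
begin

abbreviation "V \<equiv> W0z p U"

lemma V_measurable: "w \<in> V \<Longrightarrow> w \<in> borel_measurable lebesgue"
  by (rule LpmD(1)[OF W0z_whole_space(1)[OF p U(1)]])

lemma g_grad: "is_weak_gradient U g (weak_grad U g)" "weak_grad U g \<in> Lpm p (lebesgue_on U)"
  using gW unfolding W1p_iff[OF p U(1)] by auto

sublocale loc: convex_energy p "lebesgue_on U" "weak_grad U g" V "weak_grad U"
proof
  show "1 < p" by (rule p)
  show "weak_grad U g \<in> borel_measurable (lebesgue_on U)" by (rule LpmD(1)[OF g_grad(2)])
  show "(\<lambda>x. \<sigma> * u x + \<tau> * v x) \<in> V" if "u \<in> V" "v \<in> V" for u v \<sigma> \<tau>
    by (rule W0z_linear(1)[OF p U(1) that])
  show "weak_grad U u \<in> Lpm p (lebesgue_on U)" if "u \<in> V" for u by (rule W0zD(5)[OF p U(1) that])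
  show "integrable (lebesgue_on U) (\<lambda>z. norm (weak_grad U g z) powr (p - 1) * norm (weak_grad U u z))" if u: "u \<in> V" for u
  proof (rule Bochner_Integration.integrable_bound)
    note L = W0zD(5)[OF p U(1) u]
    note [measurable] = LpmD(1)[OF g_grad(2)] LpmD(1)[OF L]
    show "integrable (lebesgue_on U) (\<lambda>z. norm (weak_grad U g z) powr p + norm (weak_grad U u z) powr p)"
      by (intro Bochner_Integration.integrable_add LpmD(2) g_grad(2) L)
    show "(\<lambda>z. norm (weak_grad U g z) powr (p - 1) * norm (weak_grad U u z)) \<in> borel_measurable (lebesgue_on U)" by measurable
    show "AE z in lebesgue_on U. norm (norm (weak_grad U g z) powr (p - 1) * norm (weak_grad U u z))
      \<le> norm (norm (weak_grad U g z) powr p + norm (weak_grad U u z) powr p)"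
      using powr_times_le_add_powr[OF p norm_ge_zero norm_ge_zero] by (intro AE_I2) simp
  qed
  show "AE z in lebesgue_on U. weak_grad U (\<lambda>x. \<sigma> * u x + \<tau> * v x) z = \<sigma> *\<^sub>R weak_grad U u z + \<tau> *\<^sub>R weak_grad U v z"
    if "u \<in> V" "v \<in> V" for u v \<sigma> \<tau> by (rule W0z_weak_grad_linear[OF p U(1) that])
qed

sublocale nonloc: convex_energy p "frac_measure s p" "increment g" V increment
proof
  show "1 < p" by (rule p)
  show gi: "increment g \<in> borel_measurable (frac_measure s p)" by (rule increment_measurable[OF tail_space_measurable[OF gT]])
  show "(\<lambda>x. \<sigma> * u x + \<tau> * v x) \<in> V" if "u \<in> V" "v \<in> V" for u v \<sigma> \<tau>
    by (rule W0z_linear(1)[OF p U(1) that])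
  have im: "increment u \<in> borel_measurable (frac_measure s p)" if "u \<in> V" for u
    by (rule increment_measurable[OF V_measurable[OF that]])
  show "increment u \<in> Lpm p (frac_measure s p)" if u: "u \<in> V" for u
  proof (rule LpmI[OF im[OF u]], rule integrableI_bounded)
    note [measurable] = im[OF u]
    show "(\<lambda>z. norm (increment u z) powr p) \<in> borel_measurable (frac_measure s p)" by measurable
    obtain C where "(NNINT z|frac_measure s p. ennreal (\<bar>u (fst z) - u (snd z)\<bar> powr p)) \<le> ennreal (C * grad_energy p U u)"
      using W0z_fractional_bound[OF p s U] u by blast
    then show "(NNINT z|frac_measure s p. ennreal (norm (norm (increment u z) powr p))) < \<infinity>"
      by (simp add: increment_def order_le_less_trans[OF _ ennreal_less_top])
  qed
  show "integrable (frac_measure s p) (\<lambda>z. norm (increment g z) powr (p - 1) * norm (increment u z))" if u: "u \<in> V" for u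
  proof -
    note [measurable] = gi im[OF u]
    obtain C where C: "\<And>w. w \<in> V \<Longrightarrow> grad_energy p U w \<le> 1 \<Longrightarrow>
      (NNINT z|frac_measure s p. ennreal (\<bar>increment g z\<bar> powr (p - 1) * \<bar>increment w z\<bar>)) \<le> ennreal C"
      using cross_bnd by blast
    have "integrable (frac_measure s p) (\<lambda>z. norm (increment g z) powr (p - 1) * increment u z)"
    proof (rule W0z_integrable_of_unit_bound[OF p U(1) u, where C = C])
      show "increment (\<lambda>x. t * u x) z = t * increment u z" for t z by (simp add: increment_def right_diff_distrib)
      show "(NNINT z|frac_measure s p. ennreal \<bar>norm (increment g z) powr (p - 1) * increment w z\<bar>) \<le> ennreal C"
        if "w \<in> V" "grad_energy p U w \<le> 1" for w using C[OF that] by (simp add: abs_mult)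
      show "(\<lambda>z. norm (increment g z) powr (p - 1) * increment u z) \<in> borel_measurable (frac_measure s p)" by measurable
    qed
    then have "integrable (frac_measure s p) (\<lambda>z. norm (norm (increment g z) powr (p - 1) * increment u z))" by (rule integrable_norm)
    then show ?thesis by (simp add: abs_mult)
  qed
  show "AE z in frac_measure s p. increment (\<lambda>x. \<sigma> * u x + \<tau> * v x) z = \<sigma> *\<^sub>R increment u z + \<tau> *\<^sub>R increment v z"
    for u v :: "'a \<Rightarrow> real" and \<sigma> \<tau> by (rule AE_I2) (simp add: increment_def algebra_simps)
qed

lemma source_integrable:
  assumes w: "w \<in> V"
  shows "integrable (lebesgue_on U) (\<lambda>x. f x * w x)"
proof -
  note [measurable] = LpmD(1)[OF W0zD(3)[OF p U(1) w]]
  obtain C where C: "\<And>w. w \<in> V \<Longrightarrow> grad_energy p U w \<le> 1 \<Longrightarrow>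
      (NNINT x|lebesgue_on U. ennreal \<bar>f x * w x\<bar>) \<le> ennreal C"
    using dual_bnd by blast
  show ?thesis by (rule W0z_integrable_of_unit_bound[OF p U(1) w _ C]) simp_all
qed

definition total_energy :: "('a \<Rightarrow> real) \<Rightarrow> real" where
  "total_energy w = loc.energy w + A * nonloc.energy w - (LINT x|lebesgue_on U. f x * w x)"

definition first_variation :: "('a \<Rightarrow> real) \<Rightarrow> ('a \<Rightarrow> real) \<Rightarrow> real" where
  "first_variation w \<phi> = loc.pairing w \<phi> + A * nonloc.pairing w \<phi> - (LINT x|lebesgue_on U. f x * \<phi> x)"

lemma weak_gradient_datum_plus:
  assumes w: "w \<in> V" and eq: "\<And>x. x \<in> U \<Longrightarrow> v x = g x + w x"
  shows "AE x in lebesgue_on U. weak_grad U v x = weak_grad U g x + weak_grad U w x"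
proof -
  have "is_weak_gradient U v (\<lambda>x. weak_grad U g x + weak_grad U w x)"
    by (rule weak_gradient_cong[OF U(1) weak_gradient_add[OF U(1) g_grad(1) W0zD(4)[OF p U(1) w]]]) (simp_all add: eq)
  from weak_grad_eq(2)[OF U(1) this] show ?thesis unfolding AE_lebesgue_on[OF U(1)] .
qed

text \<open>The weak formulation is the Euler-Lagrange equation of the total energy. Off \<open>U\<close> the function \<open>v\<close> is
  determined almost everywhere, and pairs that meet a null set form a null set of the fractional measure.\<close>

lemma weak_solution_iff:
  assumes v: "v \<in> W1p_g s p g U" and w: "w \<in> V"
    and eqU: "\<And>x. x \<in> U \<Longrightarrow> v x = g x + w x" and eq: "AE x in lebesgue. v x = g x + w x"
  shows "weak_solution A s p U f g v \<longleftrightarrow> (\<forall>\<phi>\<in>V. first_variation w \<phi> = 0)"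
proof -
  have vW: "v \<in> W1p p U" "v \<in> tail_space (p - 1) (s * p)" using v by (auto simp: W1p_g_def)
  have vg: "weak_grad U v \<in> Lpm p (lebesgue_on U)" using vW(1) unfolding W1p_iff[OF p U(1)] by simp
  note [measurable] = LpmD(1)[OF vg] increment_measurable[OF tail_space_measurable[OF vW(2)]] loc.B_measurable[OF w] nonloc.B_measurable[OF w]
  have dv: "AE x in lebesgue_on U. weak_grad U v x = weak_grad U g x + weak_grad U w x"
    by (rule weak_gradient_datum_plus[OF w]) (rule eqU)
  have l: "integrable (lebesgue_on U) (\<lambda>x. norm (weak_grad U v x) powr (p - 2) * (weak_grad U v x \<bullet> weak_grad U \<phi> x))"
    "(LINT x|lebesgue_on U. norm (weak_grad U v x) powr (p - 2) * (weak_grad U v x \<bullet> weak_grad U \<phi> x)) = loc.pairing w \<phi>"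
    if phi: "\<phi> \<in> V" for \<phi>
  proof -
    note [measurable] = loc.B_measurable[OF phi]
    have e: "AE x in lebesgue_on U. norm (weak_grad U v x) powr (p - 2) * (weak_grad U v x \<bullet> weak_grad U \<phi> x)
      = pflux p (weak_grad U g x + weak_grad U w x) \<bullet> weak_grad U \<phi> x"
      using dv by eventually_elim (simp add: pflux_def)
    have m: "(\<lambda>x. norm (weak_grad U v x) powr (p - 2) * (weak_grad U v x \<bullet> weak_grad U \<phi> x)) \<in> borel_measurable (lebesgue_on U)"
      by measurable
    show "integrable (lebesgue_on U) (\<lambda>x. norm (weak_grad U v x) powr (p - 2) * (weak_grad U v x \<bullet> weak_grad U \<phi> x))"
      by (rule integrable_cong_AE_imp[OF loc.flux_integrable[OF w phi] m]) (use e in \<open>eventually_elim, simp\<close>)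
    show "(LINT x|lebesgue_on U. norm (weak_grad U v x) powr (p - 2) * (weak_grad U v x \<bullet> weak_grad U \<phi> x)) = loc.pairing w \<phi>"
      unfolding loc.pairing_def
      by (rule integral_cong_AE[OF m borel_measurable_integrable[OF loc.flux_integrable[OF w phi]] e])
  qed
  have n: "integrable (frac_measure s p) (\<lambda>(x, y). J p (v x - v y) * (\<phi> x - \<phi> y))"
    "(LINT (x, y)|frac_measure s p. J p (v x - v y) * (\<phi> x - \<phi> y)) = nonloc.pairing w \<phi>"
    if phi: "\<phi> \<in> V" for \<phi>
  proof -
    note [measurable] = nonloc.B_measurable[OF phi]
    have r: "(\<lambda>(x, y). J p (v x - v y) * (\<phi> x - \<phi> y)) = (\<lambda>z. pflux p (increment v z) \<bullet> increment \<phi> z)"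
      by (auto simp: fun_eq_iff J_def pflux_def increment_def)
    have e: "AE z in frac_measure s p. pflux p (increment v z) \<bullet> increment \<phi> z
      = pflux p (increment g z + increment w z) \<bullet> increment \<phi> z"
      using AE_frac_measure[OF eq, of s p]
    proof eventually_elim
      case (elim z)
      then have "increment v z = increment g z + increment w z" by (simp add: increment_def)
      then show ?case by simp
    qed
    have e': "AE z in frac_measure s p. pflux p (increment g z + increment w z) \<bullet> increment \<phi> z
      = pflux p (increment v z) \<bullet> increment \<phi> z"
      using e by eventually_elim (rule sym)
    have m: "(\<lambda>z. pflux p (increment v z) \<bullet> increment \<phi> z) \<in> borel_measurable (frac_measure s p)" by measurable
    show "integrable (frac_measure s p) (\<lambda>(x, y). J p (v x - v y) * (\<phi> x - \<phi> y))"
      unfolding r by (rule integrable_cong_AE_imp[OF nonloc.flux_integrable[OF w phi] m e'])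
    show "(LINT (x, y)|frac_measure s p. J p (v x - v y) * (\<phi> x - \<phi> y)) = nonloc.pairing w \<phi>"
      unfolding r nonloc.pairing_def
      by (rule integral_cong_AE[OF m borel_measurable_integrable[OF nonloc.flux_integrable[OF w phi]] e])
  qed
  have "weak_solution A s p U f g v \<longleftrightarrow> (\<forall>\<phi>\<in>V. loc.pairing w \<phi> + A * nonloc.pairing w \<phi> = (LINT x|lebesgue_on U. f x * \<phi> x))"
    unfolding weak_solution_def W0z_def[of p U] using v l n source_integrable unfolding W0z_def[of p U] by auto
  then show ?thesis by (simp add: first_variation_def)
qed

lemma datum_plus_in_class:
  assumes w: "w \<in> V"
  shows "(\<lambda>x. g x + w x) \<in> W1p_g s p g U"
  unfolding W1p_g_def using W1p_add[OF p U(1) gW W0zD(2)[OF p U(1) w]] tail_space_add[OF p U gT w] W0zD(1,6)[OF p U(1) w] by simp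

text \<open>The midpoint gap of the total energy is the sum of three gaps. That of the nonlocal term is nonnegative and that
  of the linear term is zero, so the total gap bounds the local one, which controls the energy of the difference.\<close>

lemma critical_point:
  "\<exists>w\<in>V. (\<forall>\<phi>\<in>V. first_variation w \<phi> = 0) \<and>
    (\<forall>w'\<in>V. (\<forall>\<phi>\<in>V. first_variation w' \<phi> = 0) \<longrightarrow> grad_energy p U (\<lambda>x. w' x - w x) = 0)"
proof (rule convex_functional_critical_point[OF p, where F = total_energy])
  let ?G = "LINT x|lebesgue_on U. norm (weak_grad U g x) powr p" and ?mid = "\<lambda>u v x. (1/2) * (u x + v x) :: real"
  let ?M = "lebesgue_on U" and ?N = "frac_measure s p :: ('a \<times> 'a) measure"
  let ?f = "\<lambda>w. LINT x|lebesgue_on U. f x * w x"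
  obtain Cp where Cp: "0 \<le> Cp" "\<And>w. w \<in> V \<Longrightarrow> (LINT x|?M. \<bar>w x\<bar> powr p) \<le> Cp * grad_energy p U w"
    using W0z_poincare[OF p U] by blast
  show "(\<lambda>_. 0) \<in> V"
    by (rule test_function_in_W0z[OF p U(1)]) (simp add: test_functions_def Ck_const)
  show "(\<lambda>x. u x + v x) \<in> V" if "u \<in> V" "v \<in> V" for u v
    using W0z_linear(1)[OF p U(1) that, of 1 1] by simp
  show "(\<lambda>x. t * u x) \<in> V" if "u \<in> V" for t u by (rule loc.V_scale[OF that])
  show "0 \<le> grad_energy p U u" for u by (rule grad_energy_nonneg)
  show "grad_energy p U (\<lambda>x. t * u x) = \<bar>t\<bar> powr p * grad_energy p U u" if "u \<in> V" for t u
    by (rule grad_energy_scale[OF p U(1) that])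
  have f_lin: "?f (\<lambda>x. \<sigma> * u x + \<tau> * v x) = \<sigma> * ?f u + \<tau> * ?f v" if "u \<in> V" "v \<in> V" for u v \<sigma> \<tau>
  proof -
    have "?f (\<lambda>x. \<sigma> * u x + \<tau> * v x) = (LINT x|?M. \<sigma> * (f x * u x) + \<tau> * (f x * v x))"
      by (rule Bochner_Integration.integral_cong) (simp_all add: algebra_simps)
    then show ?thesis using source_integrable that by simp
  qed
  show "total_energy u + first_variation u (\<lambda>x. v x - u x) \<le> total_energy v" if uv: "u \<in> V" "v \<in> V" for u v
  proof -
    have "?f (\<lambda>x. v x - u x) = ?f v - ?f u" using f_lin[OF uv(2,1), of 1 "-1"] by simp
    moreover have "A * (nonloc.energy u + nonloc.pairing u (\<lambda>x. v x - u x)) \<le> A * nonloc.energy v"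
      using A by (intro mult_left_mono nonloc.subgradient uv) auto
    ultimately show ?thesis using loc.subgradient[OF uv]
      unfolding total_energy_def first_variation_def distrib_left by linarith
  qed
  show "first_variation u (\<lambda>x. t * v x) = t * first_variation u v" if uv: "u \<in> V" "v \<in> V" for t u v
  proof -
    have "?f (\<lambda>x. t * v x) = t * ?f v" using f_lin[OF uv(2,2), of t 0] by simp
    then show ?thesis
      unfolding first_variation_def loc.pairing_scale[OF uv] nonloc.pairing_scale[OF uv] by (simp add: algebra_simps)
  qed
  show "\<exists>C. \<forall>v\<in>V. grad_energy p U v \<le> 1 \<longrightarrow> \<bar>first_variation u v\<bar> \<le> C" if u: "u \<in> V" for u
  proof -
    obtain Cf where Cf: "0 \<le> Cf" "\<And>w. w \<in> V \<Longrightarrow>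
        (NNINT z|?N. ennreal (\<bar>w (fst z) - w (snd z)\<bar> powr p)) \<le> ennreal (Cf * grad_energy p U w)"
      using W0z_fractional_bound[OF p s U] by blast
    obtain Cc where Cc: "\<And>w. w \<in> V \<Longrightarrow> grad_energy p U w \<le> 1 \<Longrightarrow>
      (NNINT z|?N. ennreal (\<bar>increment g z\<bar> powr (p - 1) * \<bar>increment w z\<bar>)) \<le> ennreal Cc"
      using cross_bnd by blast
    obtain Cd where Cd: "\<And>w. w \<in> V \<Longrightarrow> grad_energy p U w \<le> 1 \<Longrightarrow>
      (NNINT x|?M. ennreal \<bar>f x * w x\<bar>) \<le> ennreal Cd"
      using dual_bnd by blast
    define a1 where "a1 = ?G"
    define u1 where "u1 = (LINT x|?M. norm (weak_grad U u x) powr p)"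
    define u2 where "u2 = (LINT z|?N. norm (increment u z) powr p)"
    have "\<bar>first_variation u v\<bar> \<le> 2 powr (p - 1) * ((a1 + 1) + (u1 + 1)) + A * (2 powr (p - 1) * (max 0 Cc + (u2 + max 0 Cf))) + max 0 Cd"
      if v: "v \<in> V" and E: "grad_energy p U v \<le> 1" for v
    proof -
      have v1: "(LINT x|?M. norm (weak_grad U v x) powr p) \<le> 1" using E by (simp add: grad_energy_def)
      have c1: "(LINT x|?M. norm (weak_grad U g x) powr (p - 1) * norm (weak_grad U v x)) \<le> a1 + 1"
      proof -
        have "(LINT x|?M. norm (weak_grad U g x) powr (p - 1) * norm (weak_grad U v x))
          \<le> (LINT x|?M. norm (weak_grad U g x) powr p + norm (weak_grad U v x) powr p)"
          using LpmD(2)[OF g_grad(2)] loc.B_powr_integrable[OF v] loc.cross[OF v]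
          by (intro integral_mono powr_times_le_add_powr p) simp_all
        also have "\<dots> = a1 + (LINT x|?M. norm (weak_grad U v x) powr p)"
          unfolding a1_def by (rule Bochner_Integration.integral_add[OF LpmD(2)[OF g_grad(2)] loc.B_powr_integrable[OF v]])
        finally show ?thesis using v1 by linarith
      qed
      have "\<bar>loc.pairing u v\<bar> \<le> 2 powr (p - 1) * ((a1 + 1) + (u1 + 1))"
        using loc.pairing_bound[OF u v] unfolding u1_def
        by (rule order_trans) (intro mult_left_mono add_mono c1 v1 order_refl; simp)
      moreover have "\<bar>A * nonloc.pairing u v\<bar> \<le> A * (2 powr (p - 1) * (max 0 Cc + (u2 + max 0 Cf)))"
      proof -
        have c2: "(LINT z|?N. norm (increment g z) powr (p - 1) * norm (increment v z)) \<le> max 0 Cc"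
          using integral_abs_le_of_nn_bound[OF nonloc.cross[OF v], of Cc] Cc[OF v E] by (simp add: abs_mult)
        have "(NNINT z|?N. ennreal \<bar>norm (increment v z) powr p\<bar>) \<le> ennreal Cf"
        proof -
          have "Cf * grad_energy p U v \<le> Cf" using Cf(1) E by (intro mult_left_le) auto
          then have "ennreal (Cf * grad_energy p U v) \<le> ennreal Cf" by (rule ennreal_leI)
          then show ?thesis using Cf(2)[OF v] by (simp add: increment_def)
        qed
        from integral_abs_le_of_nn_bound[OF nonloc.B_powr_integrable[OF v] this]
        have v2: "(LINT z|?N. norm (increment v z) powr p) \<le> max 0 Cf" by simp
        have "\<bar>nonloc.pairing u v\<bar> \<le> 2 powr (p - 1) * (max 0 Cc + (u2 + max 0 Cf))"
          using nonloc.pairing_bound[OF u v] unfolding u2_def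
          by (rule order_trans) (intro mult_left_mono add_mono c2 v2 order_refl; simp)
        then show ?thesis using A by (simp add: abs_mult mult_left_mono)
      qed
      moreover have "\<bar>?f v\<bar> \<le> max 0 Cd"
        using integral_abs_bound[of ?M "\<lambda>x. f x * v x"] integral_abs_le_of_nn_bound[OF source_integrable[OF v] Cd[OF v E]] by linarith
      ultimately show ?thesis unfolding first_variation_def by linarith
    qed
    then show ?thesis by blast
  qed
  show "0 \<le> 2 * ?G" by simp
  show "\<exists>C\<ge>0. \<forall>u\<in>V. \<forall>v\<in>V. grad_energy p U (\<lambda>x. u x - v x)
      \<le> \<epsilon> * (grad_energy p U u + grad_energy p U v + 2 * ?G)
        + C * ((total_energy u + total_energy v) / 2 - total_energy (?mid u v))" if e: "0 < \<epsilon>" for \<epsilon>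
  proof -
    obtain C where C: "0 \<le> C" "\<And>u v. u \<in> V \<Longrightarrow> v \<in> V \<Longrightarrow> grad_energy p U (\<lambda>x. u x - v x)
      \<le> \<epsilon> * (grad_energy p U u + grad_energy p U v + 2 * ?G)
        + C * ((loc.energy u + loc.energy v) / 2 - loc.energy (?mid u v))"
      using loc.uniformly_convex[OF g_grad(2) e] unfolding grad_energy_def by blast
    have "(loc.energy u + loc.energy v) / 2 - loc.energy (?mid u v)
      \<le> (total_energy u + total_energy v) / 2 - total_energy (?mid u v)" if uv: "u \<in> V" "v \<in> V" for u v
    proof -
      have "?f (?mid u v) = ?f (\<lambda>x. (1/2) * u x + (1/2) * v x)"
        by (simp only: distrib_left)
      also have "\<dots> = (1/2) * ?f u + (1/2) * ?f v" by (rule f_lin[OF uv])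
      finally have F: "?f (?mid u v) = (1/2) * ?f u + (1/2) * ?f v" .
      have "0 \<le> A * ((nonloc.energy u + nonloc.energy v) / 2 - nonloc.energy (?mid u v))"
        using nonloc.midpoint_gap(3)[OF uv] A by simp
      then show ?thesis unfolding total_energy_def F by (simp add: field_simps)
    qed
    then have "C * ((loc.energy u + loc.energy v) / 2 - loc.energy (?mid u v))
      \<le> C * ((total_energy u + total_energy v) / 2 - total_energy (?mid u v))" if "u \<in> V" "v \<in> V" for u v
      using C(1) that by (intro mult_left_mono)
    then show ?thesis using C by (intro exI[of _ C] conjI ballI) (auto intro: order_trans[OF C(2)] add_left_mono)
  qed
  show "\<exists>w\<in>V. (\<lambda>n. grad_energy p U (\<lambda>x. u n x - w x)) \<longlonglongrightarrow> 0"
    if u: "\<And>n. u n \<in> V" and c: "\<And>\<epsilon>. 0 < \<epsilon> \<Longrightarrow> \<exists>n0. \<forall>m\<ge>n0. \<forall>n\<ge>n0. grad_energy p U (\<lambda>x. u n x - u m x) < \<epsilon>" for u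
  proof -
    have gd: "(LINT x|?M. norm (weak_grad U v x - weak_grad U w x) powr p) = grad_energy p U (\<lambda>x. v x - w x)"
      if vw: "v \<in> V" "w \<in> V" for v w
      unfolding grad_energy_def
    proof (rule integral_cong_AE)
      note [measurable] = loc.B_measurable[OF vw(1)] loc.B_measurable[OF vw(2)] loc.B_measurable[OF loc.V_diff[OF vw]]
      show "(\<lambda>x. norm (weak_grad U v x - weak_grad U w x) powr p) \<in> borel_measurable ?M"
        "(\<lambda>x. norm (weak_grad U (\<lambda>x. v x - w x) x) powr p) \<in> borel_measurable ?M" by measurable
      show "AE x in ?M. norm (weak_grad U v x - weak_grad U w x) powr p = norm (weak_grad U (\<lambda>x. v x - w x) x) powr p"
        using loc.lin_diff[OF vw] by eventually_elim simp
    qed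
    have sd: "sobolev_dist p U v (weak_grad U v) w (weak_grad U w) \<le> (Cp + 1) * grad_energy p U (\<lambda>x. v x - w x)"
      if vw: "v \<in> V" "w \<in> V" for v w
      using Cp(2)[OF loc.V_diff[OF vw]] unfolding sobolev_dist_def gd[OF vw] by (simp add: distrib_right)
    have "\<exists>n0. \<forall>m\<ge>n0. \<forall>n\<ge>n0. sobolev_dist p U (u n) (weak_grad U (u n)) (u m) (weak_grad U (u m)) < \<epsilon>" if e: "0 < \<epsilon>" for \<epsilon>
    proof -
      obtain n0 where n0: "\<And>m n. n0 \<le> m \<Longrightarrow> n0 \<le> n \<Longrightarrow> grad_energy p U (\<lambda>x. u n x - u m x) < \<epsilon> / (Cp + 1)"
        using c[of "\<epsilon> / (Cp + 1)"] e Cp(1) by auto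
      have "sobolev_dist p U (u n) (weak_grad U (u n)) (u m) (weak_grad U (u m)) < \<epsilon>" if "n0 \<le> m" "n0 \<le> n" for m n
      proof -
        have "(Cp + 1) * grad_energy p U (\<lambda>x. u n x - u m x) < \<epsilon>" using n0[OF that] Cp(1) by (simp add: field_simps)
        then show ?thesis using sd[OF u[of n] u[of m]] by linarith
      qed
      then show ?thesis by blast
    qed
    then obtain w where w: "w \<in> V" "(\<lambda>n. sobolev_dist p U (u n) (weak_grad U (u n)) w (weak_grad U w)) \<longlonglongrightarrow> 0"
      using W0z_complete[OF p U(1), of u] u by blast
    have "(\<lambda>n. grad_energy p U (\<lambda>x. u n x - w x)) \<longlonglongrightarrow> 0"
    proof (rule real_tendsto_sandwich[OF _ _ tendsto_const w(2)])
      show "\<forall>\<^sub>F n in sequentially. 0 \<le> grad_energy p U (\<lambda>x. u n x - w x)" by (simp add: grad_energy_nonneg)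
      show "\<forall>\<^sub>F n in sequentially. grad_energy p U (\<lambda>x. u n x - w x) \<le> sobolev_dist p U (u n) (weak_grad U (u n)) w (weak_grad U w)"
        using gd[OF u w(1)] by (simp add: sobolev_dist_def)
    qed
    then show ?thesis using w(1) by blast
  qed
  show "(\<lambda>n. first_variation (\<lambda>x. u x + (1 / real (Suc n)) * v x) v) \<longlonglongrightarrow> first_variation u v" if "u \<in> V" "v \<in> V" for u v
    unfolding first_variation_def by (intro tendsto_intros loc.hemicontinuous nonloc.hemicontinuous that)
qed

text \<open>Every weak solution is \<open>g + w'\<close> with \<open>w'\<close> critical, so \<open>w' - w\<close> has zero energy, and Poincare's inequality applies.\<close>

lemma unique_weak_solution:
  "\<exists>u. weak_solution A s p U f g u \<and> (\<forall>v. weak_solution A s p U f g v \<longrightarrow> (AE x in lebesgue. v x = u x))"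
proof -
  obtain w where w: "w \<in> V" "\<forall>\<phi>\<in>V. first_variation w \<phi> = 0"
    "\<And>w'. w' \<in> V \<Longrightarrow> \<forall>\<phi>\<in>V. first_variation w' \<phi> = 0 \<Longrightarrow> grad_energy p U (\<lambda>x. w' x - w x) = 0"
    using critical_point by blast
  have "weak_solution A s p U f g (\<lambda>x. g x + w x)"
    using weak_solution_iff[OF datum_plus_in_class[OF w(1)] w(1)] w(2) by simp
  moreover have "AE x in lebesgue. v x = g x + w x" if v: "weak_solution A s p U f g v" for v
  proof -
    have vg: "v \<in> W1p_g s p g U" using v by (simp add: weak_solution_def)
    \<comment> \<open>\<open>v - g\<close> vanishes off \<open>U\<close> only almost everywhere\<close>
    define w' where "w' x = indicator U x * (v x - g x)" for x
    have "w' \<in> W1p_0 p U"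
      by (rule W1p_0_cong[OF p U(1), of "\<lambda>x. v x - g x"]) (use vg in \<open>auto simp: W1p_g_def w'_def\<close>)
    then have w'V: "w' \<in> V" by (simp add: W0z_def w'_def)
    have eqU: "v x = g x + w' x" if "x \<in> U" for x using that by (simp add: w'_def)
    have eq: "AE x in lebesgue. v x = g x + w' x"
    proof -
      have "AE x in lebesgue. x \<notin> U \<longrightarrow> v x = g x" using vg by (simp add: W1p_g_def)
      then show ?thesis by eventually_elim (auto simp: w'_def indicator_def)
    qed
    have "\<forall>\<phi>\<in>V. first_variation w' \<phi> = 0" using weak_solution_iff[OF vg w'V eqU eq] v by blast
    then have E: "grad_energy p U (\<lambda>x. w' x - w x) = 0" by (rule w(3)[OF w'V])
    have d: "(\<lambda>x. w' x - w x) \<in> V" by (rule loc.V_diff[OF w'V w(1)])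
    obtain C where C: "\<And>w. w \<in> V \<Longrightarrow> (LINT x|lebesgue_on U. \<bar>w x\<bar> powr p) \<le> C * grad_energy p U w"
      using W0z_poincare[OF p U] by blast
    have "(LINT x|lebesgue_on U. \<bar>w' x - w x\<bar> powr p) \<le> 0" using C[OF d] unfolding E by simp
    moreover have "0 \<le> (LINT x|lebesgue_on U. \<bar>w' x - w x\<bar> powr p)" by (rule Bochner_Integration.integral_nonneg) simp
    ultimately have z: "(LINT x|lebesgue_on U. \<bar>w' x - w x\<bar> powr p) = 0" by (rule antisym)
    have i: "integrable (lebesgue_on U) (\<lambda>x. \<bar>w' x - w x\<bar> powr p)"
      using LpmD(2)[OF W0zD(3)[OF p U(1) d]] unfolding real_norm_def .
    have "AE x in lebesgue_on U. \<bar>w' x - w x\<bar> powr p = 0"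
      using integral_nonneg_eq_0_iff_AE[OF i] z by simp
    then have "AE x in lebesgue. x \<in> U \<longrightarrow> \<bar>w' x - w x\<bar> powr p = 0" unfolding AE_lebesgue_on[OF U(1)] .
    then show ?thesis using eq
    proof eventually_elim
      case (elim x)
      have "w' x = w x"
      proof (cases "x \<in> U")
        case True
        then show ?thesis using elim(1) by simp
      next
        case False
        then show ?thesis using W0zD(6)[OF p U(1) w(1) False] by (simp add: w'_def)
      qed
      then show ?case using elim(2) by simp
    qed
  qed
  ultimately show ?thesis by blast
qed

end

theorem theorem1p1:
  fixes \<Omega> \<Omega>' :: "'a::euclidean_space set"
    and s p A :: real and q :: ennreal
    and f g :: "'a \<Rightarrow> real"
  assumes "1 < p" and "0 < s" and "s < 1" and "0 < A"
    and "open \<Omega>" and "bounded \<Omega>" and "open \<Omega>'" and "bounded \<Omega>'"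
    and "compactly_contained \<Omega> \<Omega>'"
    and "p \<noteq> real DIM('a) \<Longrightarrow> q \<ge> ennreal (p_star_conj (real DIM('a)) p)"
    and "p = real DIM('a) \<Longrightarrow> q > 1"
    and "f \<in> Lp_on q \<Omega>"
    and "g \<in> W1p p \<Omega>' \<inter> tail_space (p - 1) (s * p)"
  shows "\<exists>u. weak_solution A s p \<Omega> f g u \<and>
    (\<forall>v. weak_solution A s p \<Omega> f g v \<longrightarrow> (AE x in lebesgue. v x = u x))"
proof -
  have sub: "\<Omega> \<subseteq> \<Omega>'" using assms(9) closure_subset[of \<Omega>] by (auto simp: compactly_contained_def)
  have g: "g \<in> W1p p \<Omega>'" "g \<in> tail_space (p - 1) (s * p)" using assms(13) by auto
  have fm: "f \<in> borel_measurable (lebesgue_on \<Omega>)" using assms(12) by (simp add: Lp_on_def)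
  obtain C where C: "\<And>\<phi>. \<phi> \<in> test_functions \<Omega> \<Longrightarrow> (LINT x|lborel. norm (grad \<phi> x) powr p) \<le> 1 \<Longrightarrow>
      (NNINT x|lebesgue_on \<Omega>. ennreal \<bar>f x * \<phi> x\<bar>) \<le> ennreal C"
    using sobolev_dual_bound[OF assms(1,5,6,10,11,12)] by blast
  interpret mixed_problem p s A \<Omega> f g
  proof
    show "g \<in> W1p p \<Omega>" by (rule W1p_mono[OF assms(1,5,7) sub g(1)])
    show "\<exists>C. \<forall>w\<in>W0z p \<Omega>. grad_energy p \<Omega> w \<le> 1 \<longrightarrow>
      (NNINT z|frac_measure s p. ennreal (\<bar>increment g z\<bar> powr (p - 1) * \<bar>increment w z\<bar>)) \<le> ennreal C"
      unfolding increment_def by (rule datum_cross_term_bound[OF assms(1,2,3,5,6,7,9) g])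
    show "\<exists>C. \<forall>w\<in>W0z p \<Omega>. grad_energy p \<Omega> w \<le> 1 \<longrightarrow>
      (NNINT x|lebesgue_on \<Omega>. ennreal \<bar>f x * w x\<bar>) \<le> ennreal C"
      unfolding grad_energy_def by (rule W0z_dual_bound[OF assms(1,5,6) fm C])
  qed (use assms g fm in blast)+
  show ?thesis by (rule unique_weak_solution)
qed

end
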